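(* It is consistent (relative to ZFC) that $\mathfrak a^+(\aleph_1)<\mathfrak c$.
   Context: $\mathfrak c=2^{\aleph_0}$. Almost disjoint (ad) = finite intersection. For $\mathcal X\subseteq[S]^{\aleph_0}$ with $S=\bigcup\mathcal X$, $\mathcal F\subseteq\mathcal X$ is mad in $\mathcal X$ if it is pairwise ad and no $X\in\mathcal X$ is ad to all of its members; $\mathfrak a(\mathcal X)=\min\{|\mathcal F|:|\mathcal F|\ge\aleph_0,\ \mathcal F\text{ mad in }\mathcal X\}$. For an ad family $\mathcal F$ on $\omega$, $\mathcal F^\perp=\{Y\in[\omega]^{\aleph_0}:|X\cap Y|<\aleph_0\ \forall X\in\mathcal F\}$, $\mathfrak a^+(\mathcal F)=\mathfrak a(\mathcal F^\perp)$, and $\mathfrak a^+(\aleph_1)=\sup\{\mathfrak a^+(\mathcal F):\mathcal F\text{ ad on }\omega,\ |\mathcal F|\le\aleph_1\}$. *)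

theory Defs
  imports Main
begin

section \<open>First-order logic over the language of set theory\<close>

datatype fm =
    Mem nat nat
  | Eq nat nat
  | Neg fm
  | Imp fm fm
  | All nat fm

definition Conj :: "fm \<Rightarrow> fm \<Rightarrow> fm" where
  "Conj \<phi> \<psi> = Neg (Imp \<phi> (Neg \<psi>))"

definition Disj :: "fm \<Rightarrow> fm \<Rightarrow> fm" where
  "Disj \<phi> \<psi> = Imp (Neg \<phi>) \<psi>"

definition Iff :: "fm \<Rightarrow> fm \<Rightarrow> fm" where
  "Iff \<phi> \<psi> = Conj (Imp \<phi> \<psi>) (Imp \<psi> \<phi>)"

definition Ex :: "nat \<Rightarrow> fm \<Rightarrow> fm" where
  "Ex x \<phi> = Neg (All x (Neg \<phi>))"

fun fv :: "fm \<Rightarrow> nat set" where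
  "fv (Mem x y) = {x, y}"
| "fv (Eq x y) = {x, y}"
| "fv (Neg \<phi>) = fv \<phi>"
| "fv (Imp \<phi> \<psi>) = fv \<phi> \<union> fv \<psi>"
| "fv (All x \<phi>) = fv \<phi> - {x}"

text \<open>\<open>subst x y \<phi>\<close> replaces the free occurrences of \<open>x\<close> in \<open>\<phi>\<close> by \<open>y\<close>; it may capture \<open>y\<close>
  unless \<open>free_for x y \<phi>\<close> holds.\<close>

fun subst :: "nat \<Rightarrow> nat \<Rightarrow> fm \<Rightarrow> fm" where
  "subst x y (Mem u v) = Mem (if u = x then y else u) (if v = x then y else v)"
| "subst x y (Eq u v) = Eq (if u = x then y else u) (if v = x then y else v)"
| "subst x y (Neg \<phi>) = Neg (subst x y \<phi>)"
| "subst x y (Imp \<phi> \<psi>) = Imp (subst x y \<phi>) (subst x y \<psi>)"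
| "subst x y (All z \<phi>) = (if z = x then All z \<phi> else All z (subst x y \<phi>))"

fun free_for :: "nat \<Rightarrow> nat \<Rightarrow> fm \<Rightarrow> bool" where
  "free_for x y (Mem u v) \<longleftrightarrow> True"
| "free_for x y (Eq u v) \<longleftrightarrow> True"
| "free_for x y (Neg \<phi>) \<longleftrightarrow> free_for x y \<phi>"
| "free_for x y (Imp \<phi> \<psi>) \<longleftrightarrow> free_for x y \<phi> \<and> free_for x y \<psi>"
| "free_for x y (All z \<phi>) \<longleftrightarrow> x \<notin> fv (All z \<phi>) \<or> (z \<noteq> y \<and> free_for x y \<phi>)"

text \<open>The usual Hilbert calculus with equality, with modus ponens and generalization as rules.
  Generalization is unrestricted, so an open formula in \<open>T\<close> acts as its universal closure.\<close>

inductive derives :: "fm set \<Rightarrow> fm \<Rightarrow> bool" (infix "\<turnstile>" 50) for T where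
  ax: "\<phi> \<in> T \<Longrightarrow> T \<turnstile> \<phi>"
| P1: "T \<turnstile> Imp \<phi> (Imp \<psi> \<phi>)"
| P2: "T \<turnstile> Imp (Imp \<phi> (Imp \<psi> \<chi>)) (Imp (Imp \<phi> \<psi>) (Imp \<phi> \<chi>))"
| P3: "T \<turnstile> Imp (Imp (Neg \<psi>) (Neg \<phi>)) (Imp \<phi> \<psi>)"
| Q1: "free_for x y \<phi> \<Longrightarrow> T \<turnstile> Imp (All x \<phi>) (subst x y \<phi>)"
| Q2: "x \<notin> fv \<phi> \<Longrightarrow> T \<turnstile> Imp (All x (Imp \<phi> \<psi>)) (Imp \<phi> (All x \<psi>))"
| E1: "T \<turnstile> Eq x x"
| E2: "T \<turnstile> Imp (Eq x y) (Imp (Eq x z) (Eq y z))"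
| E3: "T \<turnstile> Imp (Eq x y) (Imp (Mem x z) (Mem y z))"
| E4: "T \<turnstile> Imp (Eq x y) (Imp (Mem z x) (Mem z y))"
| MP: "T \<turnstile> Imp \<phi> \<psi> \<Longrightarrow> T \<turnstile> \<phi> \<Longrightarrow> T \<turnstile> \<psi>"
| Gen: "T \<turnstile> \<phi> \<Longrightarrow> T \<turnstile> All x \<phi>"

definition consistent :: "fm set \<Rightarrow> bool" where
  "consistent T \<longleftrightarrow> \<not> (\<exists>\<phi>. T \<turnstile> \<phi> \<and> T \<turnstile> Neg \<phi>)"


section \<open>Notation for writing concrete formulas\<close>

text \<open>To write formulas with HOL binders, we use functions that, given a number \<open>n\<close> such that all
  variables in scope are below \<open>n\<close>, return a formula. A quantifier binds the variable \<open>n\<close> and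
  passes \<open>Suc n\<close> to its body, so no capture can occur; a sentence is obtained by starting at \<open>0\<close>.\<close>

type_synonym form = "nat \<Rightarrow> fm"

definition mem_form :: "nat \<Rightarrow> nat \<Rightarrow> form" (infix "\<^bold>\<in>" 50) where
  "(x \<^bold>\<in> y) = (\<lambda>n. Mem x y)"

definition eq_form :: "nat \<Rightarrow> nat \<Rightarrow> form" (infix "\<^bold>=" 50) where
  "(x \<^bold>= y) = (\<lambda>n. Eq x y)"

definition neg_form :: "form \<Rightarrow> form" ("\<^bold>\<not> _" [40] 40) where
  "(\<^bold>\<not> p) = (\<lambda>n. Neg (p n))"

definition conj_form :: "form \<Rightarrow> form \<Rightarrow> form" (infixr "\<^bold>\<and>" 35) where
  "(p \<^bold>\<and> q) = (\<lambda>n. Conj (p n) (q n))"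

definition disj_form :: "form \<Rightarrow> form \<Rightarrow> form" (infixr "\<^bold>\<or>" 30) where
  "(p \<^bold>\<or> q) = (\<lambda>n. Disj (p n) (q n))"

definition imp_form :: "form \<Rightarrow> form \<Rightarrow> form" (infixr "\<^bold>\<longrightarrow>" 25) where
  "(p \<^bold>\<longrightarrow> q) = (\<lambda>n. Imp (p n) (q n))"

definition iff_form :: "form \<Rightarrow> form \<Rightarrow> form" (infixr "\<^bold>\<longleftrightarrow>" 25) where
  "(p \<^bold>\<longleftrightarrow> q) = (\<lambda>n. Iff (p n) (q n))"

definition all_form :: "(nat \<Rightarrow> form) \<Rightarrow> form" (binder "\<^bold>\<forall>" 10) where
  "(\<^bold>\<forall>x. p x) = (\<lambda>n. All n (p n (Suc n)))"

definition ex_form :: "(nat \<Rightarrow> form) \<Rightarrow> form" (binder "\<^bold>\<exists>" 10) where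
  "(\<^bold>\<exists>x. p x) = (\<lambda>n. Ex n (p n (Suc n)))"

definition ball_form :: "nat \<Rightarrow> (nat \<Rightarrow> form) \<Rightarrow> form" where
  "ball_form a p = (\<^bold>\<forall>x. x \<^bold>\<in> a \<^bold>\<longrightarrow> p x)"

definition bex_form :: "nat \<Rightarrow> (nat \<Rightarrow> form) \<Rightarrow> form" where
  "bex_form a p = (\<^bold>\<exists>x. x \<^bold>\<in> a \<^bold>\<and> p x)"

definition bex1_form :: "nat \<Rightarrow> (nat \<Rightarrow> form) \<Rightarrow> form" where
  "bex1_form a p = (\<^bold>\<exists>y. \<^bold>\<forall>x. (x \<^bold>\<in> a \<^bold>\<and> p x) \<^bold>\<longleftrightarrow> x \<^bold>= y)"

definition subset_form :: "nat \<Rightarrow> nat \<Rightarrow> form" (infix "\<^bold>\<subseteq>" 50) where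
  "(x \<^bold>\<subseteq> y) = ball_form x (\<lambda>z. z \<^bold>\<in> y)"

definition sentence :: "form \<Rightarrow> fm" where
  "sentence p = p 0"


section \<open>The axioms of ZFC\<close>

definition is_empty :: "nat \<Rightarrow> form" where
  "is_empty x = (\<^bold>\<forall>z. \<^bold>\<not> z \<^bold>\<in> x)"

definition is_succ :: "nat \<Rightarrow> nat \<Rightarrow> form" where
  "is_succ x s = (\<^bold>\<forall>z. z \<^bold>\<in> s \<^bold>\<longleftrightarrow> z \<^bold>\<in> x \<^bold>\<or> z \<^bold>= x)"

definition is_inductive :: "nat \<Rightarrow> form" where
  "is_inductive x = (bex_form x is_empty \<^bold>\<and> ball_form x (\<lambda>y. bex_form x (is_succ y)))"

definition extensionality_ax :: fm where
  "extensionality_ax = sentence (\<^bold>\<forall>x. \<^bold>\<forall>y. (\<^bold>\<forall>z. z \<^bold>\<in> x \<^bold>\<longleftrightarrow> z \<^bold>\<in> y) \<^bold>\<longrightarrow> x \<^bold>= y)"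

definition foundation_ax :: fm where
  "foundation_ax = sentence (\<^bold>\<forall>x. (\<^bold>\<exists>y. y \<^bold>\<in> x) \<^bold>\<longrightarrow> bex_form x (\<lambda>y. ball_form x (\<lambda>z. \<^bold>\<not> z \<^bold>\<in> y)))"

definition pairing_ax :: fm where
  "pairing_ax = sentence (\<^bold>\<forall>x. \<^bold>\<forall>y. \<^bold>\<exists>z. x \<^bold>\<in> z \<^bold>\<and> y \<^bold>\<in> z)"

definition union_ax :: fm where
  "union_ax = sentence (\<^bold>\<forall>a. \<^bold>\<exists>u. ball_form a (\<lambda>y. y \<^bold>\<subseteq> u))"

definition power_ax :: fm where
  "power_ax = sentence (\<^bold>\<forall>a. \<^bold>\<exists>p. \<^bold>\<forall>x. x \<^bold>\<subseteq> a \<^bold>\<longrightarrow> x \<^bold>\<in> p)"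

definition infinity_ax :: fm where
  "infinity_ax = sentence (\<^bold>\<exists>x. is_inductive x)"

text \<open>Every family of pairwise disjoint nonempty sets has a transversal.\<close>

definition choice_ax :: fm where
  "choice_ax = sentence (\<^bold>\<forall>a.
     ball_form a (\<lambda>x. \<^bold>\<exists>z. z \<^bold>\<in> x) \<^bold>\<and>
     ball_form a (\<lambda>x. ball_form a (\<lambda>y. \<^bold>\<not> x \<^bold>= y \<^bold>\<longrightarrow> \<^bold>\<not> (\<^bold>\<exists>z. z \<^bold>\<in> x \<^bold>\<and> z \<^bold>\<in> y)))
     \<^bold>\<longrightarrow> (\<^bold>\<exists>c. ball_form a (\<lambda>x. bex1_form x (\<lambda>z. z \<^bold>\<in> c))))"

text \<open>The schemas range over arbitrary formulas \<open>\<phi>\<close> and choices of distinct variables; the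
  remaining free variables of \<open>\<phi>\<close> are parameters, universally closed by generalization.\<close>

definition separation_axs :: "fm set" where
  "separation_axs = {All a (Ex b (All x (Iff (Mem x b) (Conj (Mem x a) \<phi>)))) | a b x \<phi>.
     distinct [a, b, x] \<and> b \<notin> fv \<phi>}"

definition replacement_axs :: "fm set" where
  "replacement_axs = {All a (Imp
       (All x (Imp (Mem x a) (Ex z (All y (Iff \<phi> (Eq y z))))))
       (Ex b (All x (Imp (Mem x a) (Ex y (Conj (Mem y b) \<phi>)))))) | a b x y z \<phi>.
     distinct [a, b, x, y, z] \<and> b \<notin> fv \<phi> \<and> z \<notin> fv \<phi>}"

definition ZFC :: "fm set" where
  "ZFC = {extensionality_ax, foundation_ax, pairing_ax, union_ax, power_ax, infinity_ax, choice_ax}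
     \<union> separation_axs \<union> replacement_axs"


section \<open>Ordinals and cardinals\<close>

text \<open>The least \<open>x\<close> with \<open>p x\<close>, with respect to inclusion, which is the usual order on ordinals.\<close>

definition is_least :: "(nat \<Rightarrow> form) \<Rightarrow> nat \<Rightarrow> form" where
  "is_least p x = (p x \<^bold>\<and> (\<^bold>\<forall>y. p y \<^bold>\<longrightarrow> x \<^bold>\<subseteq> y))"

definition is_omega :: "nat \<Rightarrow> form" where
  "is_omega w = is_least is_inductive w"

definition is_trans :: "nat \<Rightarrow> form" where
  "is_trans x = ball_form x (\<lambda>y. y \<^bold>\<subseteq> x)"

text \<open>By Foundation, the transitive sets of transitive sets are the von Neumann ordinals.\<close>

definition is_ordinal :: "nat \<Rightarrow> form" where
  "is_ordinal x = (is_trans x \<^bold>\<and> ball_form x is_trans)"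

definition is_upair :: "nat \<Rightarrow> nat \<Rightarrow> nat \<Rightarrow> form" where
  "is_upair x y p = (\<^bold>\<forall>z. z \<^bold>\<in> p \<^bold>\<longleftrightarrow> z \<^bold>= x \<^bold>\<or> z \<^bold>= y)"

text \<open>Kuratowski pairs.\<close>

definition is_pair :: "nat \<Rightarrow> nat \<Rightarrow> nat \<Rightarrow> form" where
  "is_pair x y p = (\<^bold>\<exists>s. \<^bold>\<exists>t. is_upair x x s \<^bold>\<and> is_upair x y t \<^bold>\<and> is_upair s t p)"

definition pair_in :: "nat \<Rightarrow> nat \<Rightarrow> nat \<Rightarrow> form" where
  "pair_in x y f = bex_form f (is_pair x y)"

definition is_bijection :: "nat \<Rightarrow> nat \<Rightarrow> nat \<Rightarrow> form" where
  "is_bijection f a b =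
     (ball_form f (\<lambda>p. bex_form a (\<lambda>x. bex_form b (\<lambda>y. is_pair x y p))) \<^bold>\<and>
      ball_form a (\<lambda>x. bex1_form b (\<lambda>y. pair_in x y f)) \<^bold>\<and>
      ball_form b (\<lambda>y. bex1_form a (\<lambda>x. pair_in x y f)))"

definition equipotent :: "nat \<Rightarrow> nat \<Rightarrow> form" where
  "equipotent a b = (\<^bold>\<exists>f. is_bijection f a b)"

definition is_card_of :: "nat \<Rightarrow> nat \<Rightarrow> form" where
  "is_card_of a \<kappa> = is_least (\<lambda>\<alpha>. is_ordinal \<alpha> \<^bold>\<and> equipotent a \<alpha>) \<kappa>"

definition is_cardinal :: "nat \<Rightarrow> form" where
  "is_cardinal \<kappa> = is_card_of \<kappa> \<kappa>"

definition is_aleph1 :: "nat \<Rightarrow> nat \<Rightarrow> form" where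
  "is_aleph1 w \<kappa> = is_least (\<lambda>\<mu>. is_cardinal \<mu> \<^bold>\<and> w \<^bold>\<in> \<mu>) \<kappa>"

definition is_continuum :: "nat \<Rightarrow> nat \<Rightarrow> form" where
  "is_continuum w \<kappa> = (\<^bold>\<exists>p. (\<^bold>\<forall>x. x \<^bold>\<in> p \<^bold>\<longleftrightarrow> x \<^bold>\<subseteq> w) \<^bold>\<and> is_card_of p \<kappa>)"

definition is_cardinal_sup :: "(nat \<Rightarrow> form) \<Rightarrow> nat \<Rightarrow> form" where
  "is_cardinal_sup p \<kappa> = is_least (\<lambda>\<nu>. is_cardinal \<nu> \<^bold>\<and> (\<^bold>\<forall>\<mu>. p \<mu> \<^bold>\<longrightarrow> \<mu> \<^bold>\<subseteq> \<nu>)) \<kappa>"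


section \<open>Almost disjoint families\<close>

text \<open>From here on, the argument \<open>w\<close> always stands for \<open>\<omega>\<close>.\<close>

definition is_inter :: "nat \<Rightarrow> nat \<Rightarrow> nat \<Rightarrow> form" where
  "is_inter x y z = (\<^bold>\<forall>u. u \<^bold>\<in> z \<^bold>\<longleftrightarrow> u \<^bold>\<in> x \<^bold>\<and> u \<^bold>\<in> y)"

definition is_finite :: "nat \<Rightarrow> nat \<Rightarrow> form" where
  "is_finite w x = bex_form w (equipotent x)"

definition almost_disjoint :: "nat \<Rightarrow> nat \<Rightarrow> nat \<Rightarrow> form" where
  "almost_disjoint w x y = (\<^bold>\<exists>z. is_inter x y z \<^bold>\<and> is_finite w z)"

definition pairwise_ad :: "nat \<Rightarrow> nat \<Rightarrow> form" where
  "pairwise_ad w F = ball_form F (\<lambda>x. ball_form F (\<lambda>y. \<^bold>\<not> x \<^bold>= y \<^bold>\<longrightarrow> almost_disjoint w x y))"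

text \<open>\<open>x \<in> [s]\<^bsup>\<aleph>\<^sub>0\<^esup>\<close>\<close>

definition countable_subset :: "nat \<Rightarrow> nat \<Rightarrow> nat \<Rightarrow> form" where
  "countable_subset w x s = (x \<^bold>\<subseteq> s \<^bold>\<and> is_card_of x w)"

definition mad_in :: "nat \<Rightarrow> nat \<Rightarrow> nat \<Rightarrow> form" where
  "mad_in w F X = (F \<^bold>\<subseteq> X \<^bold>\<and> pairwise_ad w F \<^bold>\<and>
     \<^bold>\<not> bex_form X (\<lambda>x. ball_form F (\<lambda>y. almost_disjoint w x y)))"

text \<open>\<open>\<kappa> = \<aa>(X)\<close>; no \<open>\<kappa>\<close> satisfies this if there is no infinite mad family in \<open>X\<close>.\<close>

definition is_a :: "nat \<Rightarrow> nat \<Rightarrow> nat \<Rightarrow> form" where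
  "is_a w X \<kappa> = is_least (\<lambda>\<mu>. \<^bold>\<exists>F. mad_in w F X \<^bold>\<and> is_card_of F \<mu> \<^bold>\<and> w \<^bold>\<subseteq> \<mu>) \<kappa>"

definition ad_family_on_omega :: "nat \<Rightarrow> nat \<Rightarrow> form" where
  "ad_family_on_omega w F = (ball_form F (\<lambda>x. countable_subset w x w) \<^bold>\<and> pairwise_ad w F)"

definition is_perp :: "nat \<Rightarrow> nat \<Rightarrow> nat \<Rightarrow> form" where
  "is_perp w F X = (\<^bold>\<forall>y. y \<^bold>\<in> X \<^bold>\<longleftrightarrow>
     countable_subset w y w \<^bold>\<and> ball_form F (\<lambda>x. almost_disjoint w x y))"

definition is_a_plus :: "nat \<Rightarrow> nat \<Rightarrow> nat \<Rightarrow> form" where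
  "is_a_plus w F \<kappa> = (\<^bold>\<exists>X. is_perp w F X \<^bold>\<and> is_a w X \<kappa>)"

text \<open>\<open>\<kappa> = \<aa>\<^sup>+(\<lambda>)\<close>. The supremum is over those \<open>F\<close> for which \<open>\<aa>\<^sup>+(F)\<close> exists; this
  excludes just the maximal \<open>F\<close>, for which \<open>F\<^sup>\<bottom>\<close> is empty.\<close>

definition is_a_plus_card :: "nat \<Rightarrow> nat \<Rightarrow> nat \<Rightarrow> form" where
  "is_a_plus_card w l \<kappa> = is_cardinal_sup
     (\<lambda>\<mu>. \<^bold>\<exists>F. ad_family_on_omega w F \<^bold>\<and> (\<^bold>\<exists>\<nu>. is_card_of F \<nu> \<^bold>\<and> \<nu> \<^bold>\<subseteq> l) \<^bold>\<and> is_a_plus w F \<mu>) \<kappa>"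

definition a_plus_aleph1_less_continuum :: fm where
  "a_plus_aleph1_less_continuum = sentence (\<^bold>\<exists>w. \<^bold>\<exists>l. \<^bold>\<exists>\<kappa>. \<^bold>\<exists>c.
     is_omega w \<^bold>\<and> is_aleph1 w l \<^bold>\<and> is_a_plus_card w l \<kappa> \<^bold>\<and> is_continuum w c \<^bold>\<and> \<kappa> \<^bold>\<in> c)"

end

theory Submission
  imports Defs "HOL-Library.Countable_Set" "HOL-Library.Infinite_Set"
begin

text \<open>By completeness and soundness, it suffices to extend a countable model of ZFC to a model of ZFC
  in which the statement holds. Over such a model, force with finite conditions that add sets
  \<open>X i \<subseteq> \<omega>\<close> indexed by pairs \<open>i = (\<tau>, K)\<close>, where \<open>\<tau> < \<lambda>\<close> and \<open>K\<close> is a set of names, of rank below a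
  regular \<open>\<theta> > \<aleph>\<^sub>1\<close>, of sets that \<open>X i\<close> is promised to avoid almost everywhere. Every set of conditions has
  a countable predense subset, so that cardinals are preserved, \<open>\<lambda> > \<theta>\<close> reals are added, and names of reals and
  of families of at most \<open>\<aleph>\<^sub>1\<close> reals may be assumed to have rank below \<open>\<theta>\<close>. Given such a family \<open>F\<close>
  that is not mad, let \<open>X\<^sub>b\<close> for \<open>b < \<theta>\<close> be the set with index \<open>(0, K\<^sub>b)\<close>, where \<open>K\<^sub>b\<close> names the members of
  \<open>F\<close> and all \<open>X\<^sub>c\<close> with \<open>c < b\<close>. These sets are almost disjoint from each other and from \<open>F\<close>. If \<open>Y\<close> has a name of
  rank below \<open>b\<close>, is almost disjoint from \<open>F\<close> and meets no \<open>X\<^sub>c\<close> with \<open>c < b\<close> infinitely often, then by genericity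
  it meets \<open>X\<^sub>b\<close> infinitely often. Hence \<open>\<aa>\<^sup>+(F) \<le> \<theta> < \<lambda> \<le> \<cc>\<close>.

  The extension is the quotient of the set of names by forced equality with respect to a generic
  filter, again represented on the natural numbers.\<close>

text \<open>A member of the family has to anticipate sets that arise only from earlier members,
  which would ordinarily call for an iteration of length \<theta>. Here names occur inside the
  conditions, and the rank of a constraint takes the role of the stage. What replaces the factoring
  of an iteration is that a witness for a constraint of stage \<open>g\<close> mentions only indices
  of stage \<open>g\<close>. So \<open>n\<close> can be put into a set \<open>X i0\<close> of higher
  stage while keeping all information of stage \<open>g\<close> from a condition \<open>r\<close> in
  the filter, even if \<open>r\<close> itself says \<open>n \<notin> X i0\<close>. The other
  obstacle is that the countable model need not be well-founded: its finite sets may be infinite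
  from outside. Finiteness arguments therefore are inductions inside the ground model or inside the
  extension, and names cannot be evaluated by an external recursion. Sizes are compared by
  surjections, with \<open>Om\<close> in place of \<omega> because it absorbs pairs and finite
  subsets. Cardinals are controlled through one fact: a function of the extension on a ground model
  set has at most \<open>Om\<close> many candidate values at each point.\<close>

instance fm :: countable by countable_datatype

section \<open>Satisfaction, soundness and completeness\<close>

text \<open>Equality is interpreted by an arbitrary relation \<open>R\<close>, so that term models need no quotient.\<close>

fun satR :: "('a \<Rightarrow> 'a \<Rightarrow> bool) \<Rightarrow> ('a \<Rightarrow> 'a \<Rightarrow> bool) \<Rightarrow> fm \<Rightarrow> (nat \<Rightarrow> 'a) \<Rightarrow> bool" where
  "satR E R (Mem x y) e \<longleftrightarrow> E (e x) (e y)"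
| "satR E R (Eq x y) e \<longleftrightarrow> R (e x) (e y)"
| "satR E R (Neg \<phi>) e \<longleftrightarrow> \<not> satR E R \<phi> e"
| "satR E R (Imp \<phi> \<psi>) e \<longleftrightarrow> (satR E R \<phi> e \<longrightarrow> satR E R \<psi> e)"
| "satR E R (All x \<phi>) e \<longleftrightarrow> (\<forall>v. satR E R \<phi> (e(x := v)))"

abbreviation sat :: "('a \<Rightarrow> 'a \<Rightarrow> bool) \<Rightarrow> fm \<Rightarrow> (nat \<Rightarrow> 'a) \<Rightarrow> bool" where
  "sat E \<equiv> satR E (=)"

text \<open>Truth under all environments matches the unrestricted generalization rule: an open axiom
  holds as its universal closure.\<close>

definition models :: "('a \<Rightarrow> 'a \<Rightarrow> bool) \<Rightarrow> fm set \<Rightarrow> bool" where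
  "models E T \<longleftrightarrow> (\<forall>\<phi>\<in>T. \<forall>e. sat E \<phi> e)"

lemma satR_cong: "(\<forall>x\<in>fv \<phi>. e x = e' x) \<Longrightarrow> satR E R \<phi> e \<longleftrightarrow> satR E R \<phi> e'"
proof (induction \<phi> arbitrary: e e')
  case (All x \<phi>)
  have "satR E R \<phi> (e(x := v)) \<longleftrightarrow> satR E R \<phi> (e'(x := v))" for v
    using All.prems by (intro All.IH) auto
  then show ?case by simp
next
  case (Imp \<phi> \<psi>)
  show ?case using Imp.IH(1)[of e e'] Imp.IH(2)[of e e'] Imp.prems by simp
next
  case (Neg \<phi>)
  show ?case using Neg.IH[of e e'] Neg.prems by simp
qed auto

lemma satR_fresh: "x \<notin> fv \<phi> \<Longrightarrow> satR E R \<phi> (e(x := v)) \<longleftrightarrow> satR E R \<phi> e"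
  by (rule satR_cong) auto

lemma subst_fresh: "x \<notin> fv \<phi> \<Longrightarrow> subst x y \<phi> = \<phi>"
  by (induction \<phi>) auto

lemma satR_subst: "free_for x y \<phi> \<Longrightarrow> satR E R (subst x y \<phi>) e \<longleftrightarrow> satR E R \<phi> (e(x := e y))"
proof (induction \<phi> arbitrary: e)
  case (All z \<phi>)
  show ?case
  proof (cases "x \<in> fv (All z \<phi>)")
    case False
    then have "subst x y (All z \<phi>) = All z \<phi>" by (rule subst_fresh)
    then show ?thesis by (simp only: satR_fresh[OF False])
  next
    case True
    then have "z \<noteq> x" "z \<noteq> y" "free_for x y \<phi>" using All.prems by auto
    then have "satR E R (subst x y \<phi>) (e(z := v)) \<longleftrightarrow> satR E R \<phi> (e(x := e y, z := v))" for v
      using All.IH[of "e(z := v)"] by (metis fun_upd_other fun_upd_twist)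
    then show ?thesis using \<open>z \<noteq> x\<close> by (simp only: subst.simps satR.simps if_False)
  qed
qed auto

lemma soundness: "T \<turnstile> \<phi> \<Longrightarrow> models E T \<Longrightarrow> sat E \<phi> e"
proof (induction arbitrary: e rule: derives.induct)
  case Q1
  then show ?case by (simp add: satR_subst)
next
  case Q2
  then show ?case by (simp add: satR_fresh)
qed (auto simp: models_def)

lemma models_consistent: "models E T \<Longrightarrow> consistent T"
  using soundness[of T _ E] unfolding consistent_def by (metis satR.simps(3))

section \<open>Derivations from hypotheses\<close>

inductive prv :: "fm set \<Rightarrow> fm set \<Rightarrow> fm \<Rightarrow> bool" for T \<Gamma> where
  hyp: "\<phi> \<in> \<Gamma> \<Longrightarrow> prv T \<Gamma> \<phi>"
| der: "T \<turnstile> \<phi> \<Longrightarrow> prv T \<Gamma> \<phi>"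
| detach: "prv T \<Gamma> (Imp \<phi> \<psi>) \<Longrightarrow> prv T \<Gamma> \<phi> \<Longrightarrow> prv T \<Gamma> \<psi>"

lemma prv_mono: "prv T \<Gamma> \<phi> \<Longrightarrow> \<Gamma> \<subseteq> \<Delta> \<Longrightarrow> prv T \<Delta> \<phi>"
  by (induction rule: prv.induct) (auto intro: prv.intros)

lemma Imp_refl: "T \<turnstile> Imp \<phi> \<phi>"
  by (rule derives.MP[OF derives.MP[OF derives.P2[where \<psi> = "Imp \<phi> \<phi>"] derives.P1] derives.P1])

lemma prv_imp: "T \<turnstile> Imp \<phi> \<psi> \<Longrightarrow> prv T \<Gamma> \<phi> \<Longrightarrow> prv T \<Gamma> \<psi>"
  by (rule prv.detach[OF prv.der])

lemma prv_imp2: "T \<turnstile> Imp \<phi> (Imp \<psi> \<chi>) \<Longrightarrow> prv T \<Gamma> \<phi> \<Longrightarrow> prv T \<Gamma> \<psi> \<Longrightarrow> prv T \<Gamma> \<chi>"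
  by (rule prv.detach[OF prv_imp])

text \<open>No side condition on variables arises, because generalization acts only inside
  \<open>T \<turnstile> \<phi>\<close> and never on the hypotheses.\<close>

lemma deduction: "prv T (insert \<psi> \<Gamma>) \<phi> \<Longrightarrow> prv T \<Gamma> (Imp \<psi> \<phi>)"
proof (induction rule: prv.induct)
  case (hyp \<phi>)
  then show ?case using prv_imp[OF derives.P1 prv.hyp] prv.der[OF Imp_refl] by blast
next
  case (der \<phi>)
  then show ?case by (intro prv_imp[OF derives.P1] prv.der)
next
  case (detach \<phi> \<chi>)
  show ?case by (rule prv_imp2[OF derives.P2 detach.IH])
qed

lemma prv_empty: "prv T {} \<phi> \<Longrightarrow> T \<turnstile> \<phi>"
  by (induction rule: prv.induct) (auto intro: derives.MP)

lemma prv_finite: "prv T \<Gamma> \<phi> \<Longrightarrow> \<exists>\<Delta>. finite \<Delta> \<and> \<Delta> \<subseteq> \<Gamma> \<and> prv T \<Delta> \<phi>"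
proof (induction rule: prv.induct)
  case (hyp \<phi>)
  then show ?case by (intro exI[of _ "{\<phi>}"]) (auto intro: prv.hyp)
next
  case (der \<phi>)
  then show ?case by (intro exI[of _ "{}"]) (auto intro: prv.der)
next
  case (detach \<phi> \<psi>)
  then obtain \<Delta> \<Delta>' where "finite \<Delta>" "\<Delta> \<subseteq> \<Gamma>" "prv T \<Delta> (Imp \<phi> \<psi>)" "finite \<Delta>'" "\<Delta>' \<subseteq> \<Gamma>" "prv T \<Delta>' \<phi>" by blast
  then show ?case
    by (intro exI[of _ "\<Delta> \<union> \<Delta>'"]) (auto intro: prv.detach[OF prv_mono prv_mono])
qed

lemma subst_same: "subst x x \<phi> = \<phi>" "free_for x x \<phi>"
  by (induction \<phi>) auto

lemma All_elim: "T \<turnstile> Imp (All x \<phi>) \<phi>"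
  using derives.Q1[of x x \<phi> T] by (simp add: subst_same)

lemma All_Imp: "T \<turnstile> Imp (All x (Imp \<phi> \<psi>)) (Imp (All x \<phi>) (All x \<psi>))"
proof -
  let ?A = "All x (Imp \<phi> \<psi>)" and ?B = "All x \<phi>"
  have "prv T {?A, ?B} \<psi>" 
    by (rule prv.detach[OF prv_imp[OF All_elim prv.hyp] prv_imp[OF All_elim prv.hyp]]) auto
  then have "prv T {} (Imp ?A (Imp ?B \<psi>))" by (intro deduction) (simp add: insert_commute)
  then have "T \<turnstile> All x (Imp ?A (Imp ?B \<psi>))" by (intro derives.Gen prv_empty)
  then have 1: "T \<turnstile> Imp ?A (All x (Imp ?B \<psi>))" by (rule derives.MP[OF derives.Q2, rotated]) simp
  have 2: "T \<turnstile> Imp (All x (Imp ?B \<psi>)) (Imp ?B (All x \<psi>))" by (rule derives.Q2) simp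
  have "prv T {?A} (Imp ?B (All x \<psi>))" by (rule prv_imp[OF 2 prv_imp[OF 1 prv.hyp]]) simp
  then show ?thesis by (rule prv_empty[OF deduction])
qed

text \<open>Generalization remains admissible over variables that are not free in the hypotheses;
  \<open>All_Imp\<close> carries it through \<open>detach\<close>.\<close>

lemma prv_gen: "prv T \<Gamma> \<phi> \<Longrightarrow> \<forall>\<gamma>\<in>\<Gamma>. x \<notin> fv \<gamma> \<Longrightarrow> prv T \<Gamma> (All x \<phi>)"
proof (induction rule: prv.induct)
  case (hyp \<phi>)
  have "T \<turnstile> Imp \<phi> (All x \<phi>)"
    using hyp by (intro derives.MP[OF derives.Q2 derives.Gen[OF Imp_refl]]) auto
  then show ?case using prv_imp[OF _ prv.hyp] hyp by blast
next
  case (der \<phi>)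
  then show ?case by (intro prv.der derives.Gen)
next
  case (detach \<phi> \<psi>)
  then show ?case by (auto intro: prv_imp2[OF All_Imp])
qed

definition con :: "fm set \<Rightarrow> fm set \<Rightarrow> bool" where
  "con T \<Gamma> \<longleftrightarrow> \<not> (\<exists>\<phi>. prv T \<Gamma> \<phi> \<and> prv T \<Gamma> (Neg \<phi>))"

lemma con_mono: "con T \<Delta> \<Longrightarrow> \<Gamma> \<subseteq> \<Delta> \<Longrightarrow> con T \<Gamma>"
  unfolding con_def using prv_mono by blast

lemma prv_explode: "\<not> con T \<Gamma> \<Longrightarrow> prv T \<Gamma> \<phi>"
proof -
  assume "\<not> con T \<Gamma>"
  then obtain \<psi> where \<psi>: "prv T \<Gamma> \<psi>" "prv T \<Gamma> (Neg \<psi>)" by (auto simp: con_def)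
  show ?thesis by (rule prv.detach[OF prv_imp[OF derives.P3 prv_imp[OF derives.P1 \<psi>(2)]] \<psi>(1)])
qed

lemma Neg_Imp: "T \<turnstile> Imp (Neg \<phi>) (Imp \<phi> \<psi>)"
proof -
  have "prv T {\<phi>, Neg \<phi>} \<phi>" "prv T {\<phi>, Neg \<phi>} (Neg \<phi>)" by (auto intro: prv.hyp)
  then have "prv T {\<phi>, Neg \<phi>} \<psi>" by (intro prv_explode) (auto simp only: con_def)
  then show ?thesis by (intro prv_empty deduction)
qed

lemma con_insert: "\<not> con T (insert \<phi> \<Gamma>) \<Longrightarrow> prv T \<Gamma> (Neg \<phi>)"
proof -
  assume "\<not> con T (insert \<phi> \<Gamma>)"
  then have *: "prv T \<Gamma> (Imp \<phi> \<psi>)" for \<psi> by (intro deduction prv_explode)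
  \<comment> \<open>Among the axioms, only the contraposition \<open>P3\<close> treats negation, so
    double negation elimination is derived first, with \<open>Neg (Imp \<phi> \<phi>)\<close> as the
    absurd formula.\<close>
  have dn: "prv T {Neg (Neg \<chi>)} \<chi>" for \<chi>
  proof -
    have "prv T {Neg (Neg \<chi>)} (Imp (Neg \<chi>) (Neg (Imp \<phi> \<phi>)))"
      by (rule prv_imp[OF Neg_Imp prv.hyp]) simp
    then show ?thesis by (rule prv_imp2[OF derives.P3 _ prv.der[OF Imp_refl]])
  qed
  have "prv T (insert (Neg (Neg \<phi>)) \<Gamma>) (Neg (Imp \<phi> \<phi>))"
    by (rule prv.detach[OF prv_mono[OF *] prv_mono[OF dn]]) auto
  then have "prv T \<Gamma> (Imp (Neg (Neg \<phi>)) (Neg (Imp \<phi> \<phi>)))" by (rule deduction)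
  then show ?thesis by (rule prv_imp2[OF derives.P3 _ prv.der[OF Imp_refl]])
qed

lemma con_Neg: "\<not> con T (insert (Neg \<phi>) \<Gamma>) \<Longrightarrow> prv T \<Gamma> \<phi>"
  by (rule prv_imp2[OF derives.P3 prv_imp[OF Neg_Imp con_insert] prv.der[OF Imp_refl]])

section \<open>Fresh variables and the Henkin sequence\<close>

fun vars :: "fm \<Rightarrow> nat set" where
  "vars (Mem x y) = {x, y}"
| "vars (Eq x y) = {x, y}"
| "vars (Neg \<phi>) = vars \<phi>"
| "vars (Imp \<phi> \<psi>) = vars \<phi> \<union> vars \<psi>"
| "vars (All x \<phi>) = insert x (vars \<phi>)"

lemma finite_vars: "finite (vars \<phi>)" by (induction \<phi>) auto
lemma fv_vars: "fv \<phi> \<subseteq> vars \<phi>" by (induction \<phi>) auto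
lemma free_for_fresh: "y \<notin> vars \<phi> \<Longrightarrow> free_for x y \<phi>" by (induction \<phi>) auto
lemma free_for_back: "y \<notin> vars \<phi> \<Longrightarrow> free_for y x (subst x y \<phi>) \<and> subst y x (subst x y \<phi>) = \<phi>"
proof (induction \<phi>)
  case (All z \<phi>)
  have "y \<notin> fv \<phi>" using All.prems fv_vars[of \<phi>] by auto
  then show ?case using All by (cases "z = x") (simp_all add: subst_fresh)
qed auto
lemma fv_subst: "fv (subst x y \<phi>) \<subseteq> insert y (fv \<phi> - {x})" by (induction \<phi>) auto
lemma size_subst [simp]: "size (subst x y \<phi>) = size \<phi>" by (induction \<phi>) auto

text \<open>A generalization over a fresh witness variable has to be turned back into one over the
  original variable; freshness makes the renaming reversible.\<close>

lemma All_rename: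
  assumes "y \<notin> vars \<phi>" shows "T \<turnstile> Imp (All y (subst x y \<phi>)) (All x \<phi>)"
proof (cases "x = y")
  case True
  then show ?thesis by (simp add: subst_same Imp_refl)
next
  case False
  have "T \<turnstile> Imp (All y (subst x y \<phi>)) \<phi>"
    using derives.Q1[of y x "subst x y \<phi>" T] free_for_back[OF assms, of x] by simp
  then have "T \<turnstile> All x (Imp (All y (subst x y \<phi>)) \<phi>)" by (rule derives.Gen)
  moreover have "x \<notin> fv (All y (subst x y \<phi>))" using fv_subst[of x y \<phi>] False by auto
  ultimately show ?thesis by (meson derives.MP derives.Q2)
qed

text \<open>Variables serve as Henkin constants; the witness at step \<open>n\<close> is chosen \<open>\<ge> n\<close>, so that every
  variable is provably equal to arbitrarily large ones, which avoids capture in the truth lemma.\<close>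

definition fresh :: "nat \<Rightarrow> fm set \<Rightarrow> nat" where
  "fresh n \<Gamma> = (SOME y. n \<le> y \<and> (\<forall>\<gamma>\<in>\<Gamma>. y \<notin> vars \<gamma>))"

definition hstep :: "fm set \<Rightarrow> nat \<Rightarrow> fm set \<Rightarrow> fm set" where
  "hstep T n \<Gamma> = (let \<phi> = from_nat n; \<Delta> = insert \<phi> \<Gamma> in
     if con T \<Delta> then \<Delta> \<union> {Neg (subst x (fresh n \<Delta>) \<psi>) | x \<psi>. \<phi> = Neg (All x \<psi>)} else \<Gamma>)"

primrec hseq :: "fm set \<Rightarrow> nat \<Rightarrow> fm set" where
  "hseq T 0 = {}"
| "hseq T (Suc n) = hstep T n (hseq T n)"

lemma fresh:
  assumes "finite \<Gamma>" shows "n \<le> fresh n \<Gamma> \<and> (\<forall>\<gamma>\<in>\<Gamma>. fresh n \<Gamma> \<notin> vars \<gamma>)"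
proof -
  have "finite (\<Union>(vars ` \<Gamma>) \<union> {..<n})" using assms by (auto simp: finite_vars)
  then obtain y where "y \<notin> \<Union>(vars ` \<Gamma>) \<union> {..<n}" using ex_new_if_finite infinite_UNIV_nat by blast
  then have "n \<le> y \<and> (\<forall>\<gamma>\<in>\<Gamma>. y \<notin> vars \<gamma>)" by auto
  then show ?thesis unfolding fresh_def by (rule someI)
qed

lemma finite_hseq: "finite (hseq T n)"
proof (induction n)
  case (Suc n)
  \<comment> \<open>The comprehension has at most one element, since \<phi> determines
    \<open>x\<close> and \<psi>; the case expression names it.\<close>
  have "finite {Neg (subst x y \<psi>) | x \<psi>. \<phi> = Neg (All x \<psi>)}" for y \<phi>
    by (rule finite_subset[of _ "{case \<phi> of Neg (All x \<psi>) \<Rightarrow> Neg (subst x y \<psi>) | _ \<Rightarrow> \<phi>}"]) auto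
  then show ?case using Suc by (simp add: hstep_def Let_def)
qed simp

text \<open>A fresh counterexample is harmless: if it led to inconsistency, the instance at the
  fresh variable would be provable, hence generalizable, and the universal formula would contradict
  its negation.\<close>

lemma con_hseq: "consistent T \<Longrightarrow> con T (hseq T n)"
proof (induction n)
  case 0
  then show ?case by (auto simp: con_def consistent_def dest: prv_empty)
next
  case (Suc n)
  define \<phi> where "\<phi> = (from_nat n :: fm)"
  define \<Delta> where "\<Delta> = insert \<phi> (hseq T n)"
  have fin: "finite \<Delta>" by (simp add: \<Delta>_def finite_hseq)
  have hs: "hseq T (Suc n) =
      (if con T \<Delta> then \<Delta> \<union> {Neg (subst x (fresh n \<Delta>) \<psi>) | x \<psi>. \<phi> = Neg (All x \<psi>)} else hseq T n)"
    by (simp only: hseq.simps hstep_def Let_def \<phi>_def \<Delta>_def)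
  show ?case
  proof (cases "con T \<Delta> \<and> (\<exists>x \<psi>. \<phi> = Neg (All x \<psi>))")
    case False
    then have "hseq T (Suc n) = (if con T \<Delta> then \<Delta> else hseq T n)"
      unfolding hs by auto
    then show ?thesis using Suc by auto
  next
    case True
    then obtain x \<psi> where c: "con T \<Delta>" and \<phi>: "\<phi> = Neg (All x \<psi>)" by auto
    define y where "y = fresh n \<Delta>"
    have eq: "hseq T (Suc n) = insert (Neg (subst x y \<psi>)) \<Delta>"
      using c unfolding hs \<phi> y_def by auto
    have y: "\<forall>\<gamma>\<in>\<Delta>. y \<notin> vars \<gamma>" using fresh[OF fin] by (simp add: y_def)
    then have "y \<notin> vars \<psi>" by (auto simp: \<Delta>_def \<phi>)
    show ?thesis
    proof (rule ccontr)
      assume "\<not> con T (hseq T (Suc n))"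
      then have "prv T \<Delta> (subst x y \<psi>)" unfolding eq by (rule con_Neg)
      then have "prv T \<Delta> (All y (subst x y \<psi>))" using y fv_vars by (intro prv_gen) auto
      then have "prv T \<Delta> (All x \<psi>)" by (rule prv_imp[OF All_rename[OF \<open>y \<notin> vars \<psi>\<close>]])
      moreover have "prv T \<Delta> (Neg (All x \<psi>))" by (intro prv.hyp) (simp add: \<Delta>_def \<phi>)
      ultimately show False using c by (auto simp: con_def)
    qed
  qed
qed

lemma hseq_mono: "n \<le> m \<Longrightarrow> hseq T n \<subseteq> hseq T m"
  by (rule lift_Suc_mono_le) (auto simp: hstep_def Let_def)

section \<open>The maximal consistent set and its term model\<close>

locale henkin =
  fixes T :: "fm set" assumes consT: "consistent T"
begin

definition H :: "fm set" where "H = (\<Union>n. hseq T n)"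

lemma prv_H: assumes "prv T H \<phi>" obtains n where "prv T (hseq T n) \<phi>"
proof -
  obtain \<Delta> where \<Delta>: "finite \<Delta>" "\<Delta> \<subseteq> H" "prv T \<Delta> \<phi>" using prv_finite[OF assms] by blast
  have "\<exists>n. \<Delta> \<subseteq> hseq T n" using \<Delta>(1,2)
  proof (induction \<Delta> rule: finite_induct)
    case (insert \<gamma> \<Delta>)
    then obtain n m where "\<Delta> \<subseteq> hseq T n" "\<gamma> \<in> hseq T m" by (auto simp: H_def)
    then have "insert \<gamma> \<Delta> \<subseteq> hseq T (max n m)"
      using hseq_mono[of n "max n m" T] hseq_mono[of m "max n m" T] by auto
    then show ?case ..
  qed simp
  then show thesis using \<Delta>(3) prv_mono that by blast
qed

lemma con_H: "con T H"
proof (rule ccontr)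
  assume "\<not> con T H"
  then have "prv T H (Neg (Imp \<phi> \<phi>))" for \<phi> by (rule prv_explode)
  then obtain n \<phi> where "prv T (hseq T n) (Neg (Imp \<phi> \<phi>))" using prv_H by metis
  moreover have "prv T (hseq T n) (Imp \<phi> \<phi>)" by (intro prv.der Imp_refl)
  ultimately show False using con_hseq[OF consT, of n] by (auto simp: con_def)
qed

lemma H_closed: assumes "prv T H \<phi>" shows "\<phi> \<in> H"
proof -
  have "con T (insert \<phi> H)"
    using con_H assms prv.detach[OF deduction assms] by (auto simp: con_def)
  then have "con T (insert \<phi> (hseq T (to_nat \<phi>)))"
    by (rule con_mono) (auto simp: H_def)
  then have "\<phi> \<in> hseq T (Suc (to_nat \<phi>))" by (simp add: hstep_def Let_def)
  then show ?thesis unfolding H_def by blast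
qed

lemma H_thm: "T \<turnstile> \<phi> \<Longrightarrow> \<phi> \<in> H" by (rule H_closed[OF prv.der])
lemma H_mp: "Imp \<phi> \<psi> \<in> H \<Longrightarrow> \<phi> \<in> H \<Longrightarrow> \<psi> \<in> H"
  by (rule H_closed[OF prv.detach[OF prv.hyp prv.hyp]])

lemma H_Neg: "Neg \<phi> \<in> H \<longleftrightarrow> \<phi> \<notin> H"
proof
  assume "Neg \<phi> \<in> H" then show "\<phi> \<notin> H" using con_H by (auto simp: con_def intro: prv.hyp)
next
  assume "\<phi> \<notin> H"
  have "\<not> con T (insert \<phi> (hseq T (to_nat \<phi>)))"
  proof
    assume "con T (insert \<phi> (hseq T (to_nat \<phi>)))"
    then have "\<phi> \<in> hseq T (Suc (to_nat \<phi>))" by (simp add: hstep_def Let_def)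
    then show False using \<open>\<phi> \<notin> H\<close> unfolding H_def by blast
  qed
  then have "prv T (hseq T (to_nat \<phi>)) (Neg \<phi>)" by (rule con_insert)
  then show "Neg \<phi> \<in> H" by (intro H_closed) (auto simp: H_def elim!: prv_mono)
qed

lemma H_Imp: "Imp \<phi> \<psi> \<in> H \<longleftrightarrow> (\<phi> \<in> H \<longrightarrow> \<psi> \<in> H)"
  using H_mp[of \<phi> \<psi>] H_Neg[of \<phi>] H_mp[OF H_thm[OF Neg_Imp[of T \<phi> \<psi>]]] H_mp[OF H_thm[OF derives.P1[of T \<psi> \<phi>]]] by blast

lemma H_witness:
  assumes "Neg (All x \<psi>) \<in> H"
  shows "\<exists>y. Neg (subst x y \<psi>) \<in> H \<and> y \<notin> vars \<psi> \<and> to_nat (Neg (All x \<psi>)) \<le> y"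
proof -
  define n where "n = to_nat (Neg (All x \<psi>))"
  define \<Delta> where "\<Delta> = insert (Neg (All x \<psi>)) (hseq T n)"
  have "con T \<Delta>"
    using con_H by (rule con_mono) (use assms in \<open>auto simp: \<Delta>_def H_def\<close>)
  then have "Neg (subst x (fresh n \<Delta>) \<psi>) \<in> hseq T (Suc n)"
    by (auto simp: hstep_def Let_def n_def \<Delta>_def)
  then have "Neg (subst x (fresh n \<Delta>) \<psi>) \<in> H" unfolding H_def by blast
  moreover have "n \<le> fresh n \<Delta> \<and> (\<forall>\<gamma>\<in>\<Delta>. fresh n \<Delta> \<notin> vars \<gamma>)"
    by (rule fresh) (simp add: \<Delta>_def finite_hseq)
  ultimately show ?thesis by (intro exI[of _ "fresh n \<Delta>"]) (auto simp: \<Delta>_def n_def)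
qed

definition R where "R x y \<longleftrightarrow> Eq x y \<in> H"
definition M where "M x y \<longleftrightarrow> Mem x y \<in> H"

lemma R_refl: "R x x" unfolding R_def by (intro H_thm derives.E1)
lemma R_euclid: "R x y \<Longrightarrow> R x z \<Longrightarrow> R y z"
  unfolding R_def using H_thm[OF derives.E2[of T x y z]] by (simp add: H_Imp)
lemma R_sym: "R x y \<Longrightarrow> R y x" using R_refl R_euclid by blast
lemma R_trans: "R x y \<Longrightarrow> R y z \<Longrightarrow> R x z" using R_sym R_euclid by blast
lemma M_cong: "R x y \<Longrightarrow> R u v \<Longrightarrow> M x u \<longleftrightarrow> M y v"
proof -
  have *: "M x u \<Longrightarrow> R x y \<Longrightarrow> R u v \<Longrightarrow> M y v" for x y u v
    using H_thm[OF derives.E3[of T x y u]] H_thm[OF derives.E4[of T u v y]]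
    by (simp add: H_Imp M_def R_def)
  show "R x y \<Longrightarrow> R u v \<Longrightarrow> M x u \<longleftrightarrow> M y v" using * R_sym by blast
qed

lemma equivp_R: "equivp R" by (intro equivpI reflpI sympI transpI R_refl) (auto intro: R_sym R_trans)

text \<open>Each formula saying that something equals \<open>y\<close> has a witness at least as
  large as the code of the formula. Varying the bound variable gives infinitely many such formulas,
  so the codes, and with them the witnesses, are unbounded.\<close>

lemma R_fresh: "\<exists>z. R z y \<and> k \<le> z"
proof -
  have "infinite (range (\<lambda>z. to_nat (Neg (All (Suc (y + z)) (Neg (Eq (Suc (y + z)) y))))))"
    by (rule range_inj_infinite) (auto intro!: injI)
  then obtain m where "m \<in> range (\<lambda>z. to_nat (Neg (All (Suc (y + z)) (Neg (Eq (Suc (y + z)) y)))))" "k \<le> m"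
    unfolding infinite_nat_iff_unbounded_le by blast
  then obtain z where z: "k \<le> to_nat (Neg (All (Suc (y + z)) (Neg (Eq (Suc (y + z)) y))))" by auto
  let ?z = "Suc (y + z)"
  have "All ?z (Neg (Eq ?z y)) \<notin> H"
  proof
    assume "All ?z (Neg (Eq ?z y)) \<in> H"
    moreover have "T \<turnstile> Imp (All ?z (Neg (Eq ?z y))) (Neg (Eq y y))"
      using derives.Q1[of ?z y "Neg (Eq ?z y)" T] by simp
    ultimately have "Neg (Eq y y) \<in> H" using H_thm H_mp by blast
    then show False using R_refl[of y] H_Neg by (simp add: R_def)
  qed
  then have "Neg (All ?z (Neg (Eq ?z y))) \<in> H" by (simp add: H_Neg)
  from H_witness[OF this] obtain x where "Neg (subst ?z x (Neg (Eq ?z y))) \<in> H" "k \<le> x"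
    using z by auto
  then show ?thesis by (intro exI[of _ x]) (simp add: H_Neg R_def)
qed

lemma satR_R: "(\<forall>x. R (e x) (e' x)) \<Longrightarrow> satR M R \<phi> e \<longleftrightarrow> satR M R \<phi> e'"
proof (induction \<phi> arbitrary: e e')
  case (Mem x y)
  then show ?case using M_cong by simp
next
  case (Eq x y)
  then show ?case using R_sym R_trans by (metis satR.simps(2))
next
  case (All x \<phi>)
  have "satR M R \<phi> (e(x := v)) \<longleftrightarrow> satR M R \<phi> (e'(x := v))" for v
    using All.prems R_refl by (intro All.IH) auto
  then show ?case by simp
next
  case (Neg \<phi>)
  show ?case using Neg.IH[OF Neg.prems] by simp
next
  case (Imp \<phi> \<psi>)
  show ?case using Imp.IH[OF Imp.prems] by simp
qed

text \<open>Induction on size, since the instance \<open>subst x y \<psi>\<close> is not a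
  subformula of \<open>All x \<psi>\<close>.\<close>

lemma truth: "satR M R \<phi> id \<longleftrightarrow> \<phi> \<in> H"
proof (induction \<phi> rule: measure_induct_rule[of size])
  case (less \<phi>)
  show ?case
  proof (cases \<phi>)
    case (All x \<psi>)
    show ?thesis
    proof
      assume s: "satR M R \<phi> id"
      show "\<phi> \<in> H"
      proof (rule ccontr)
        assume "\<phi> \<notin> H"
        then have "Neg (All x \<psi>) \<in> H" by (simp add: H_Neg All)
        from H_witness[OF this] obtain y where y: "Neg (subst x y \<psi>) \<in> H" "y \<notin> vars \<psi>" by blast
        have "satR M R (subst x y \<psi>) id"
          using s y(2) by (simp add: All satR_subst free_for_fresh)
        then have "subst x y \<psi> \<in> H" using less[of "subst x y \<psi>"] All by simp
        then show False using y by (simp add: H_Neg)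
      qed
    next
      assume h: "\<phi> \<in> H"
      have "satR M R \<psi> (id(x := v))" for v
      proof -
        \<comment> \<open>The value \<open>v\<close> might be captured in \<psi>; it is exchanged
          for an \<open>R\<close>-equal variable beyond all variables of \<psi>.\<close>
        obtain k where "\<forall>i\<in>vars \<psi>. i < k" using finite_vars[of \<psi>] finite_nat_set_iff_bounded by auto
        then obtain z where z: "R z v" "z \<notin> vars \<psi>" using R_fresh[of v k] by (meson leD)
        have "T \<turnstile> Imp (All x \<psi>) (subst x z \<psi>)" by (intro derives.Q1 free_for_fresh z)
        then have "subst x z \<psi> \<in> H" using h H_thm H_mp All by blast
        then have "satR M R (subst x z \<psi>) id" using less[of "subst x z \<psi>"] All by (simp add: id_def)
        then have "satR M R \<psi> (id(x := z))" using z by (simp add: satR_subst free_for_fresh)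
        then show ?thesis using z R_refl by (subst satR_R[of _ "id(x := z)"]) (auto intro: R_sym)
      qed
      then show "satR M R \<phi> id" by (simp add: All)
    qed
  qed (use less H_Neg H_Imp in \<open>auto simp: M_def R_def\<close>)
qed

text \<open>The truth lemma concerns the environment \<open>id\<close> only; quantifying over the
  free variables of \<phi> transfers it to every environment.\<close>

lemma satR_T: assumes "\<phi> \<in> T" shows "satR M R \<phi> e"
proof -
  obtain xs where xs: "set xs = fv \<phi>"
    using finite_list[OF finite_subset[OF fv_vars[of \<phi>] finite_vars]] by blast
  have *: "satR M R (foldr All ys \<phi>) e' \<Longrightarrow> satR M R \<phi> (\<lambda>x. if x \<in> set ys then e x else e' x)" for ys e'
  proof (induction ys arbitrary: e')
    case (Cons y ys)
    have "satR M R (foldr All ys \<phi>) (e'(y := e y))" using Cons.prems by simp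
    from Cons.IH[OF this] show ?case by (rule satR_cong[THEN iffD1, rotated]) auto
  qed simp
  have "T \<turnstile> foldr All ys \<phi>" for ys
    by (induction ys) (simp_all add: derives.Gen derives.ax assms)
  then have "satR M R (foldr All xs \<phi>) id" using truth H_thm by blast
  from *[OF this] show ?thesis by (rule satR_cong[THEN iffD1, rotated]) (simp add: xs)
qed

end

text \<open>Needed twice, for the term model and for the generic extension: equality becomes
  identity, and the universe becomes \<open>nat\<close>, so that all sets of the model are
  enumerated by the natural numbers.\<close>

lemma quotient_nat:
  fixes R :: "nat \<Rightarrow> nat \<Rightarrow> bool"
  assumes R: "equivp R" and E: "\<And>x y u v. R x y \<Longrightarrow> R u v \<Longrightarrow> E x u \<longleftrightarrow> E y v"
    and inf: "infinite (range (\<lambda>x. {y. R x y}))"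
  obtains h :: "nat \<Rightarrow> nat" and E' where
    "surj h" "\<And>x y. h x = h y \<longleftrightarrow> R x y" "\<And>x y. E' (h x) (h y) \<longleftrightarrow> E x y"
proof -
  let ?c = "\<lambda>x. {y. R x y}"
  have c: "?c x = ?c y \<longleftrightarrow> R x y" for x y
  proof -
    have "?c x = ?c y \<longleftrightarrow> R x = R y" by (auto simp: set_eq_iff fun_eq_iff)
    also have "\<dots> \<longleftrightarrow> R x y" by (rule R[unfolded equivp_def, rule_format, symmetric])
    finally show ?thesis .
  qed
  obtain b where b: "bij_betw b (range ?c) (UNIV :: nat set)"
    by (rule countableE_infinite[OF countable_image[OF countableI_type] inf])
  define h where "h = (\<lambda>x. b (?c x))"
  have s: "surj h"
  proof (rule surjI)
    show "h (SOME x. b (?c x) = n) = n" for n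
    proof -
      have "n \<in> b ` range ?c" using b by (simp add: bij_betw_def)
      then have "\<exists>x. b (?c x) = n" by auto
      then show ?thesis unfolding h_def by (rule someI_ex)
    qed
  qed
  have h: "h x = h y \<longleftrightarrow> R x y" for x y
  proof -
    have "?c x \<in> range ?c" "?c y \<in> range ?c" by blast+
    from inj_on_eq_iff[OF bij_betw_imp_inj_on[OF b] this] show ?thesis by (simp only: h_def c)
  qed
  define E' where "E' = (\<lambda>a b. E (inv h a) (inv h b))"
  have "R (inv h (h x)) x" for x using h s by (metis surj_f_inv_f)
  then have "E' (h x) (h y) \<longleftrightarrow> E x y" for x y unfolding E'_def using E by blast
  then show thesis using that s h by blast
qed

lemma satR_quotient:
  assumes "surj h" "\<And>x y. h x = h y \<longleftrightarrow> R x y" "\<And>x y. E' (h x) (h y) \<longleftrightarrow> E x y"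
  shows "satR E R \<phi> e \<longleftrightarrow> sat E' \<phi> (h \<circ> e)"
proof (induction \<phi> arbitrary: e)
  case (All x \<phi>)
  have "(\<forall>v. sat E' \<phi> ((h \<circ> e)(x := v))) \<longleftrightarrow> (\<forall>v. sat E' \<phi> ((h \<circ> e)(x := h v)))"
    using assms(1) by (metis surj_def)
  moreover have "(h \<circ> e)(x := h v) = h \<circ> e(x := v)" for v by auto
  ultimately show ?case using All.IH by (simp only: satR.simps)
qed (auto simp: assms)

section \<open>Sets and definable classes in a model of ZFC\<close>

lemma satR_fm:
  "satR E R (Ex x \<phi>) e \<longleftrightarrow> (\<exists>v. satR E R \<phi> (e(x := v)))"
  "satR E R (Conj \<phi> \<psi>) e \<longleftrightarrow> satR E R \<phi> e \<and> satR E R \<psi> e"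
  "satR E R (Disj \<phi> \<psi>) e \<longleftrightarrow> satR E R \<phi> e \<or> satR E R \<psi> e"
  "satR E R (Iff \<phi> \<psi>) e \<longleftrightarrow> (satR E R \<phi> e \<longleftrightarrow> satR E R \<psi> e)"
  by (auto simp: Ex_def Conj_def Disj_def Iff_def)

lemma satR_form:
  "satR E R ((x \<^bold>\<in> y) n) e \<longleftrightarrow> E (e x) (e y)"
  "satR E R ((x \<^bold>= y) n) e \<longleftrightarrow> R (e x) (e y)"
  "satR E R ((\<^bold>\<not> p) n) e \<longleftrightarrow> \<not> satR E R (p n) e"
  "satR E R ((p \<^bold>\<and> q) n) e \<longleftrightarrow> satR E R (p n) e \<and> satR E R (q n) e"
  "satR E R ((p \<^bold>\<or> q) n) e \<longleftrightarrow> satR E R (p n) e \<or> satR E R (q n) e"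
  "satR E R ((p \<^bold>\<longrightarrow> q) n) e \<longleftrightarrow> (satR E R (p n) e \<longrightarrow> satR E R (q n) e)"
  "satR E R ((p \<^bold>\<longleftrightarrow> q) n) e \<longleftrightarrow> (satR E R (p n) e \<longleftrightarrow> satR E R (q n) e)"
  "satR E R (all_form P n) e \<longleftrightarrow> (\<forall>v. satR E R (P n (Suc n)) (e(n := v)))"
  "satR E R (ex_form P n) e \<longleftrightarrow> (\<exists>v. satR E R (P n (Suc n)) (e(n := v)))"
  by (simp_all add: mem_form_def eq_form_def neg_form_def conj_form_def disj_form_def imp_form_def
      iff_form_def all_form_def ex_form_def satR_fm)

lemmas satR_sentence = sentence_def ball_form_def bex_form_def bex1_form_def subset_form_def satR_form satR_fm

text \<open>A model of ZFC is infinite, since a finite one would have a universal set.\<close>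

theorem ZFC_countable_model:
  assumes "consistent ZFC"
  obtains E :: "nat \<Rightarrow> nat \<Rightarrow> bool" where "models E ZFC"
proof -
  interpret henkin ZFC using assms by unfold_locales
  have pair: "\<exists>z. M x z \<and> M y z" for x y
    using satR_T[of pairing_ax] by (simp add: ZFC_def pairing_ax_def satR_sentence)
  have union: "\<exists>u. \<forall>y. M y a \<longrightarrow> (\<forall>z. M z y \<longrightarrow> M z u)" for a
    using satR_T[of union_ax] by (simp add: ZFC_def union_ax_def satR_sentence)
  have "All 0 (Ex 1 (All 2 (Iff (Mem 2 1) (Conj (Mem 2 0) (Neg (Mem 2 2)))))) \<in> separation_axs"
    unfolding separation_axs_def
    by (intro CollectI exI[of _ 0] exI[of _ "1::nat"] exI[of _ "2::nat"] exI[of _ "Neg (Mem 2 2)"]) auto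
  then have russell: "\<exists>b. \<forall>x. M x b \<longleftrightarrow> M x a \<and> \<not> M x x" for a
    using satR_T[of "All 0 (Ex 1 (All 2 (Iff (Mem 2 1) (Conj (Mem 2 0) (Neg (Mem 2 2))))))"]
    by (force simp add: ZFC_def satR_sentence)
  have inf: "infinite (range (\<lambda>x. {y. R x y}))"
  proof
    assume "finite (range (\<lambda>x. {y. R x y}))"
    then obtain F where F: "finite F" "range (\<lambda>x. {y. R x y}) = (\<lambda>x. {y. R x y}) ` F"
      by (rule finite_subset_image[THEN exE, OF _ subset_refl]) blast
    have "\<exists>a. \<forall>x\<in>F. M x a" using F(1)
    proof (induction F rule: finite_induct)
      case (insert x F)
      then obtain a where a: "\<forall>x\<in>F. M x a" by blast
      obtain s where "M x s" using pair by blast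
      obtain z where "M a z" "M s z" using pair by blast
      obtain u where "\<forall>y. M y z \<longrightarrow> (\<forall>v. M v y \<longrightarrow> M v u)" using union by blast
      then show ?case using a \<open>M x s\<close> \<open>M a z\<close> \<open>M s z\<close> by (intro exI[of _ u]) auto
    qed simp
    then obtain a where a: "\<forall>x\<in>F. M x a" ..
    have all: "M x a" for x
    proof -
      have "{y. R x y} \<in> (\<lambda>x. {y. R x y}) ` F" using F(2) by blast
      then obtain z where "z \<in> F" "{y. R x y} = {y. R z y}" by auto
      then show ?thesis using a M_cong[of z x a a] R_refl by blast
    qed
    then show False using russell[of a] by blast
  qed
  obtain h :: "nat \<Rightarrow> nat" and E' where
    h: "surj h" "\<And>x y. h x = h y \<longleftrightarrow> R x y" "\<And>x y. E' (h x) (h y) \<longleftrightarrow> M x y"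
    using quotient_nat[where E = M, OF equivp_R M_cong inf] by blast
  have "sat E' \<phi> e" if "\<phi> \<in> ZFC" for \<phi> e
  proof -
    have "h \<circ> (inv h \<circ> e) = e" using h(1) by (simp add: fun_eq_iff surj_f_inv_f)
    then show ?thesis using satR_quotient[where h = h and R = R and E = M and E' = E', OF h, of \<phi> "inv h \<circ> e"] satR_T[OF that] by simp
  qed
  then show thesis using that unfolding models_def by blast
qed

text \<open>Bound variables are renamed too, so an injective \<open>f\<close> never captures and no
  side condition is needed.\<close>

fun ren :: "(nat \<Rightarrow> nat) \<Rightarrow> fm \<Rightarrow> fm" where
  "ren f (Mem x y) = Mem (f x) (f y)"
| "ren f (Eq x y) = Eq (f x) (f y)"
| "ren f (Neg \<phi>) = Neg (ren f \<phi>)"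
| "ren f (Imp \<phi> \<psi>) = Imp (ren f \<phi>) (ren f \<psi>)"
| "ren f (All x \<phi>) = All (f x) (ren f \<phi>)"

lemma sat_ren: "inj f \<Longrightarrow> sat E (ren f \<phi>) e \<longleftrightarrow> sat E \<phi> (e \<circ> f)"
proof (induction \<phi> arbitrary: e)
  case (All x \<phi>)
  have "e(f x := v) \<circ> f = (e \<circ> f)(x := v)" for v using All.prems by (auto simp: fun_eq_iff inj_eq)
  then show ?case using All by (simp only: ren.simps satR.simps)
qed auto

locale zfc =
  fixes E :: "'a \<Rightarrow> 'a \<Rightarrow> bool"
  assumes models: "models E ZFC"
begin

definition el :: "'a \<Rightarrow> 'a set" where "el x = {y. E y x}"

lemma sat_ZFC: "\<phi> \<in> ZFC \<Longrightarrow> sat E \<phi> e" using models by (simp add: models_def)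

lemma ext: "el x = el y \<Longrightarrow> x = y"
  using sat_ZFC[of extensionality_ax] by (auto simp: ZFC_def extensionality_ax_def satR_sentence el_def set_eq_iff)

lemma foundation: "el x \<noteq> {} \<Longrightarrow> \<exists>y\<in>el x. el y \<inter> el x = {}"
  using sat_ZFC[of foundation_ax] by (fastforce simp: ZFC_def foundation_ax_def satR_sentence el_def set_eq_iff)

lemma pairing0: "\<exists>z. x \<in> el z \<and> y \<in> el z"
  using sat_ZFC[of pairing_ax] by (simp add: ZFC_def pairing_ax_def satR_sentence el_def)

lemma union0: "\<exists>u. \<forall>y\<in>el a. el y \<subseteq> el u"
  using sat_ZFC[of union_ax] by (simp add: ZFC_def union_ax_def satR_sentence el_def subset_iff)

lemma power0: "\<exists>p. \<forall>x. el x \<subseteq> el a \<longrightarrow> x \<in> el p"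
  using sat_ZFC[of power_ax] by (simp add: ZFC_def power_ax_def satR_sentence el_def subset_iff)

lemma infinity0: "\<exists>x. (\<exists>z\<in>el x. el z = {}) \<and> (\<forall>y\<in>el x. \<exists>s\<in>el x. el s = insert y (el y))"
proof -
  have "sat E infinity_ax undefined" by (rule sat_ZFC) (simp add: ZFC_def)
  then obtain x where x: "\<exists>z. E z x \<and> (\<forall>u. \<not> E u z)" "\<forall>y. E y x \<longrightarrow> (\<exists>s. E s x \<and> (\<forall>u. E u s \<longleftrightarrow> E u y \<or> u = y))"
    by (auto simp: infinity_ax_def is_inductive_def is_empty_def is_succ_def satR_sentence)
  show ?thesis
    using x by (intro exI[of _ x]) (fastforce simp: el_def set_eq_iff)
qed

lemma choice0:
  assumes "\<forall>x\<in>el a. el x \<noteq> {}" "\<forall>x\<in>el a. \<forall>y\<in>el a. x \<noteq> y \<longrightarrow> el x \<inter> el y = {}"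
  shows "\<exists>c. \<forall>x\<in>el a. \<exists>!z. z \<in> el x \<and> z \<in> el c"
proof -
  have "sat E choice_ax undefined" by (rule sat_ZFC) (simp add: ZFC_def)
  then have *: "\<forall>a. (\<forall>x. E x a \<longrightarrow> (\<exists>z. E z x)) \<and> (\<forall>x. E x a \<longrightarrow> (\<forall>y. E y a \<longrightarrow> x \<noteq> y \<longrightarrow> \<not> (\<exists>z. E z x \<and> E z y)))
      \<longrightarrow> (\<exists>c. \<forall>x. E x a \<longrightarrow> (\<exists>y. \<forall>z. (E z x \<and> E z c) \<longleftrightarrow> z = y))"
    unfolding choice_ax_def satR_sentence
    by (simp only: satR.simps fun_upd_apply simp_thms nat.inject nat.distinct if_True if_False)
  have "\<forall>x. E x a \<longrightarrow> (\<exists>z. E z x)" using assms(1) by (auto simp: el_def)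
  moreover have "\<forall>x. E x a \<longrightarrow> (\<forall>y. E y a \<longrightarrow> x \<noteq> y \<longrightarrow> \<not> (\<exists>z. E z x \<and> E z y))"
    using assms(2) unfolding el_def by blast
  ultimately have "\<exists>c. \<forall>x. E x a \<longrightarrow> (\<exists>y. \<forall>z. (E z x \<and> E z c) \<longleftrightarrow> z = y)"
    by (rule spec[OF *, THEN mp, OF conjI])
  then obtain c where c: "\<And>x. E x a \<Longrightarrow> \<exists>y. \<forall>z. (E z x \<and> E z c) \<longleftrightarrow> z = y" by blast
  have "\<exists>!z. z \<in> el x \<and> z \<in> el c" if x: "x \<in> el a" for x
  proof -
    obtain y where "\<forall>z. (E z x \<and> E z c) \<longleftrightarrow> z = y" using c[of x] x by (auto simp: el_def)
    then show ?thesis by (intro ex1I[of _ y]) (auto simp: el_def)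
  qed
  then show ?thesis by blast
qed

text \<open>\<open>D P\<close> holds if \<open>P\<close> is first-order definable with parameters; an environment \<open>e\<close> sits in the even
  variables and the parameters in the odd ones. Quantifiers bind in de Bruijn style.\<close>

definition code :: "(nat \<Rightarrow> 'a) \<Rightarrow> (nat \<Rightarrow> 'a) \<Rightarrow> nat \<Rightarrow> 'a" where
  "code e c i = (if even i then e (i div 2) else c (i div 2))"

lemma code_simps [simp]: "code e c (2 * k) = e k" "code e c (Suc (2 * k)) = c k"
  by (simp_all add: code_def)

definition D :: "((nat \<Rightarrow> 'a) \<Rightarrow> bool) \<Rightarrow> bool" where
  "D P \<longleftrightarrow> (\<exists>\<phi> c. \<forall>e. P e \<longleftrightarrow> sat E \<phi> (code e c))"

definition DF :: "((nat \<Rightarrow> 'a) \<Rightarrow> 'a) \<Rightarrow> bool" where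
  "DF f \<longleftrightarrow> D (\<lambda>e. e 0 = f (\<lambda>i. e (Suc i)))"

text \<open>These rules decompose HOL expressions down to membership and equality. An
  \<open>intro dfn\<close> thus replaces writing down the formula for an instance of separation or
  replacement.\<close>

named_theorems dfn

lemma D_ren:
  assumes "D P" "inj f" shows "D (\<lambda>e. P (\<lambda>i. e (f i)))"
proof -
  obtain \<phi> c where \<phi>: "\<And>e. P e \<longleftrightarrow> sat E \<phi> (code e c)" using assms(1) by (auto simp: D_def)
  define g where "g i = (if even i then 2 * f (i div 2) else i)" for i
  have g: "inj g"
  proof (rule injI)
    fix x y assume "g x = g y"
    then show "x = y" unfolding g_def
      by (cases "even x"; cases "even y"; simp add: inj_eq[OF assms(2)]; presburger)
  qed
  have "code e c \<circ> g = code (\<lambda>i. e (f i)) c" for e by (auto simp: fun_eq_iff code_def g_def)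
  then have "P (\<lambda>i. e (f i)) \<longleftrightarrow> sat E (ren g \<phi>) (code e c)" for e
    using \<phi> sat_ren[OF g] by metis
  then show ?thesis unfolding D_def by blast
qed

lemma D_not [dfn]: assumes "D P" shows "D (\<lambda>e. \<not> P e)"
proof -
  obtain \<phi> c where "\<And>e. P e \<longleftrightarrow> sat E \<phi> (code e c)" using assms by (auto simp: D_def)
  then have "(\<not> P e) \<longleftrightarrow> sat E (Neg \<phi>) (code e c)" for e by simp
  then show ?thesis unfolding D_def by blast
qed

lemma D_imp [dfn]: assumes "D P" "D Q" shows "D (\<lambda>e. P e \<longrightarrow> Q e)"
proof -
  obtain \<phi> c where \<phi>: "\<And>e. P e \<longleftrightarrow> sat E \<phi> (code e c)" using assms by (auto simp: D_def)
  obtain \<psi> d where \<psi>: "\<And>e. Q e \<longleftrightarrow> sat E \<psi> (code e d)" using assms by (auto simp: D_def)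
  \<comment> \<open>Both formulas keep the environment in the even variables; the parameters of the
    first move to the variables 1 modulo 4, those of the second to the variables 3 modulo 4.\<close>
  define g h where "g i = (if even i then i else 2 * i - 1)" and "h i = (if even i then i else 2 * i + 1)" for i :: nat
  have g: "inj g"
  proof (rule injI)
    fix x y assume "g x = g y"
    then show "x = y" unfolding g_def
      by (cases "even x"; cases "even y"; simp; presburger)
  qed
  have h: "inj h"
  proof (rule injI)
    fix x y assume "h x = h y"
    then show "x = y" unfolding h_def
      by (cases "even x"; cases "even y"; simp; presburger)
  qed
  define b where "b = code c d"
  have gh: "g (2 * k) = 2 * k" "g (Suc (2 * k)) = Suc (2 * (2 * k))"
    "h (2 * k) = 2 * k" "h (Suc (2 * k)) = Suc (2 * Suc (2 * k))" for k by (auto simp: g_def h_def)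
  have "code e b (g i) = code e c i \<and> code e b (h i) = code e d i" for e i
  proof -
    consider k where "i = 2 * k" | k where "i = Suc (2 * k)" by (metis evenE oddE Suc_eq_plus1)
    then show ?thesis by cases (simp_all only: gh code_simps b_def)
  qed
  then have "code e b \<circ> g = code e c" "code e b \<circ> h = code e d" for e by auto
  then have "(P e \<longrightarrow> Q e) \<longleftrightarrow> sat E (Imp (ren g \<phi>) (ren h \<psi>)) (code e b)" for e
    by (simp add: \<phi> \<psi> sat_ren g h)
  then show ?thesis unfolding D_def by blast
qed

lemma D_all [dfn]: assumes "D (\<lambda>e. Q (e 0) (\<lambda>i. e (Suc i)))" shows "D (\<lambda>e. \<forall>x. Q x e)"
proof -
  obtain \<phi> c where \<phi>: "\<And>e. Q (e 0) (\<lambda>i. e (Suc i)) \<longleftrightarrow> sat E \<phi> (code e c)" using assms by (auto simp: D_def)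
  \<comment> \<open>The quantified slot 0 becomes variable 1, which is vacated by moving all
    parameters up by one position, while the rest of the environment moves down.\<close>
  define g where "g i = (if i = 0 then 1 else if even i then i - 2 else i + 2)" for i :: nat
  have g: "inj g" unfolding inj_def g_def by presburger
  define b where "b i = c (i - 1)" for i
  have "(code e b)(1 := v) \<circ> g = code (case_nat v e) c" for e v
  proof
    fix i :: nat
    consider "i = 0" | j where "i = Suc (Suc (2 * j))" | j where "i = Suc (2 * j)" 
      by (metis evenE oddE Suc_eq_plus1 mult_Suc_right add_2_eq_Suc not0_implies_Suc mult_zero_right)
    then show "((code e b)(1 := v) \<circ> g) i = code (case_nat v e) c i"
      by cases (auto simp: code_def g_def b_def)
  qed
  then have "Q v e \<longleftrightarrow> sat E (ren g \<phi>) ((code e b)(1 := v))" for v e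
    using \<phi>[of "case_nat v e"] by (simp add: sat_ren g)
  then have "(\<forall>x. Q x e) \<longleftrightarrow> sat E (All 1 (ren g \<phi>)) (code e b)" for e by simp
  then show ?thesis unfolding D_def by blast
qed

lemma D_and [dfn]: "D P \<Longrightarrow> D Q \<Longrightarrow> D (\<lambda>e. P e \<and> Q e)"
  using D_not[OF D_imp[OF _ D_not]] by simp
lemma D_or [dfn]: "D P \<Longrightarrow> D Q \<Longrightarrow> D (\<lambda>e. P e \<or> Q e)"
  using D_imp[OF D_not, of P Q] by (simp add: disj_imp)
lemma D_iff [dfn]: "D P \<Longrightarrow> D Q \<Longrightarrow> D (\<lambda>e. P e \<longleftrightarrow> Q e)"
  unfolding iff_conv_conj_imp by (intro D_and D_imp)
lemma D_ex [dfn]: "D (\<lambda>e. Q (e 0) (\<lambda>i. e (Suc i))) \<Longrightarrow> D (\<lambda>e. \<exists>x. Q x e)"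
  using D_not[OF D_all[OF D_not, of Q]] by simp

lemma D_mem0: "D (\<lambda>e. e i \<in> el (e j))"
  unfolding D_def el_def by (rule exI[of _ "Mem (2 * i) (2 * j)"]) (simp add: code_def)
lemma D_eq0: "D (\<lambda>e. e i = e j)"
  unfolding D_def el_def by (rule exI[of _ "Eq (2 * i) (2 * j)"]) (simp add: code_def)

lemma DF_var [dfn]: "DF (\<lambda>e. e i)" unfolding DF_def by (rule D_eq0)
lemma DF_const [dfn]: "DF (\<lambda>e. c)"
  unfolding DF_def D_def by (intro exI[of _ "Eq 0 1"] exI[of _ "\<lambda>_. c"]) (simp add: code_def)
lemma D_const [dfn]: "D (\<lambda>e. b)"
  using D_eq0[of 0 0] D_not[OF D_eq0[of 0 0]] by (cases b) simp_all

lemma D_weak: "D (\<lambda>e. Q (e 0) (\<lambda>i. e (Suc i))) \<Longrightarrow> D (\<lambda>e. Q (e 0) (\<lambda>i. e (Suc (Suc i))))"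
  using D_ren[of "\<lambda>e. Q (e 0) (\<lambda>i. e (Suc i))" "\<lambda>i. if i = 0 then 0 else Suc i"] by (simp add: inj_def)
lemma DF_weak: "DF f \<Longrightarrow> DF (\<lambda>e. f (\<lambda>i. e (Suc i)))"
  unfolding DF_def by (rule D_weak)

text \<open>The language has no terms, so a definable function is substituted through an existential
  quantifier over its value.\<close>

lemma D_subst: "DF s \<Longrightarrow> D (\<lambda>e. Q (e 0) (\<lambda>i. e (Suc i))) \<Longrightarrow> D (\<lambda>e. Q (s e) e)"
proof -
  assume "DF s" "D (\<lambda>e. Q (e 0) (\<lambda>i. e (Suc i)))"
  then have "D (\<lambda>e. \<exists>x. x = s e \<and> Q x e)" unfolding DF_def by (intro D_ex D_and)
  then show ?thesis by simp
qed

lemma lift1: "DF s \<Longrightarrow> D (\<lambda>e. Q (e 0)) \<Longrightarrow> D (\<lambda>e. Q (s e))"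
  by (rule D_subst)
text \<open>Since \<open>D_subst\<close> fills variable 0 only, the arguments are first reversed and
  then substituted from the last to the first; the other lifting lemmas do the same.\<close>

lemma lift2:
  assumes "DF s" "DF t" "D (\<lambda>e. Q (e 0) (e (Suc 0)))"
  shows "D (\<lambda>e. Q (s e) (t e))"
proof -
  have "D (\<lambda>e. Q (e (Suc 0)) (e 0))"
    using D_ren[OF assms(3), of "\<lambda>i. if i = 0 then 1 else if i = 1 then 0 else i"] by (simp add: inj_def)
  then have "D (\<lambda>e. Q (e 0) (t (\<lambda>i. e (Suc i))))" by (rule D_subst[OF DF_weak[OF assms(2)]])
  then show ?thesis by (rule D_subst[OF assms(1)])
qed
lemma lift3:
  assumes "DF s" "DF t" "DF u" "D (\<lambda>e. Q (e 0) (e (Suc 0)) (e (Suc (Suc 0))))"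
  shows "D (\<lambda>e. Q (s e) (t e) (u e))"
proof -
  have "D (\<lambda>e. Q (e (Suc (Suc 0))) (e (Suc 0)) (e 0))"
    using D_ren[OF assms(4), of "\<lambda>i. if i = 0 then 2 else if i = 2 then 0 else i"] 
    by (simp add: inj_def numeral_2_eq_2)
  then have "D (\<lambda>e. Q (e (Suc 0)) (e 0) (u (\<lambda>i. e (Suc (Suc i)))))"
    by (rule D_subst[OF DF_weak[OF DF_weak[OF assms(3)]]])
  then have "D (\<lambda>e. Q (e 0) (t (\<lambda>i. e (Suc i))) (u (\<lambda>i. e (Suc i))))"
    by (rule D_subst[OF DF_weak[OF assms(2)]])
  then show ?thesis by (rule D_subst[OF assms(1)])
qed
lemma lift4:
  assumes "DF s" "DF t" "DF u" "DF v" "D (\<lambda>e. Q (e 0) (e (Suc 0)) (e (Suc (Suc 0))) (e (Suc (Suc (Suc 0)))))"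
  shows "D (\<lambda>e. Q (s e) (t e) (u e) (v e))"
proof -
  have i: "inj (\<lambda>i::nat. if i \<le> 3 then 3 - i else i)" by (intro injI) (auto split: if_splits)
  have "D (\<lambda>e. Q (e (Suc (Suc (Suc 0)))) (e (Suc (Suc 0))) (e (Suc 0)) (e 0))"
    using D_ren[OF assms(5) i] by (simp add: numeral_3_eq_3)
  then have "D (\<lambda>e. Q (e (Suc (Suc 0))) (e (Suc 0)) (e 0) (v (\<lambda>i. e (Suc (Suc (Suc i))))))"
    by (rule D_subst[OF DF_weak[OF DF_weak[OF DF_weak[OF assms(4)]]]])
  then have "D (\<lambda>e. Q (e (Suc 0)) (e 0) (u (\<lambda>i. e (Suc (Suc i)))) (v (\<lambda>i. e (Suc (Suc i)))))"
    by (rule D_subst[OF DF_weak[OF DF_weak[OF assms(3)]]])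
  then have "D (\<lambda>e. Q (e 0) (t (\<lambda>i. e (Suc i))) (u (\<lambda>i. e (Suc i))) (v (\<lambda>i. e (Suc i))))"
    by (rule D_subst[OF DF_weak[OF assms(2)]])
  then show ?thesis by (rule D_subst[OF assms(1)])
qed
lemma liftF3: "DF s \<Longrightarrow> DF t \<Longrightarrow> DF u \<Longrightarrow> DF (\<lambda>e. f (e 0) (e (Suc 0)) (e (Suc (Suc 0)))) \<Longrightarrow> DF (\<lambda>e. f (s e) (t e) (u e))"
  unfolding DF_def[of "\<lambda>e. f (s e) (t e) (u e)"]
  by (rule lift4[OF DF_var DF_weak DF_weak DF_weak]) (simp_all add: DF_def)
lemma liftF1: "DF s \<Longrightarrow> DF (\<lambda>e. f (e 0)) \<Longrightarrow> DF (\<lambda>e. f (s e))"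
  unfolding DF_def[of "\<lambda>e. f (s e)"] by (rule lift2[OF DF_var DF_weak]) (simp_all add: DF_def)
lemma liftF2: "DF s \<Longrightarrow> DF t \<Longrightarrow> DF (\<lambda>e. f (e 0) (e (Suc 0))) \<Longrightarrow> DF (\<lambda>e. f (s e) (t e))"
  unfolding DF_def[of "\<lambda>e. f (s e) (t e)"] by (rule lift3[OF DF_var DF_weak DF_weak]) (simp_all add: DF_def)

lemma D_mem [dfn]: "DF s \<Longrightarrow> DF t \<Longrightarrow> D (\<lambda>e. s e \<in> el (t e))"
  by (rule lift2[where Q = "\<lambda>x y. x \<in> el y", OF _ _ D_mem0])
lemma D_eq [dfn]: "DF s \<Longrightarrow> DF t \<Longrightarrow> D (\<lambda>e. s e = t e)"
  by (rule lift2[where Q = "\<lambda>x y. x = y", OF _ _ D_eq0])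

lemma D_ball [dfn]: "D (\<lambda>e. \<forall>x. x \<in> A e \<longrightarrow> P x e) \<Longrightarrow> D (\<lambda>e. \<forall>x\<in>A e. P x e)" by (simp add: Ball_def)
lemma D_bex [dfn]: "D (\<lambda>e. \<exists>x. x \<in> A e \<and> P x e) \<Longrightarrow> D (\<lambda>e. \<exists>x\<in>A e. P x e)" by (simp add: Bex_def)
lemma D_Collect [dfn]: "D (\<lambda>e. P (s e) e) \<Longrightarrow> D (\<lambda>e. s e \<in> {x. P x e})" by simp
lemma D_insert [dfn]: "D (\<lambda>e. s e = a e) \<Longrightarrow> D (\<lambda>e. s e \<in> A e) \<Longrightarrow> D (\<lambda>e. s e \<in> insert (a e) (A e))"
  by (simp add: D_or)
lemma D_empty [dfn]: "D (\<lambda>e. s e \<in> {})" by (simp add: D_const)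
lemma D_Un [dfn]: "D (\<lambda>e. s e \<in> A e) \<Longrightarrow> D (\<lambda>e. s e \<in> B e) \<Longrightarrow> D (\<lambda>e. s e \<in> A e \<union> B e)" by (simp add: D_or)
lemma D_Int [dfn]: "D (\<lambda>e. s e \<in> A e) \<Longrightarrow> D (\<lambda>e. s e \<in> B e) \<Longrightarrow> D (\<lambda>e. s e \<in> A e \<inter> B e)" by (simp add: D_and)
lemma D_Diff [dfn]: "D (\<lambda>e. s e \<in> A e) \<Longrightarrow> D (\<lambda>e. s e \<in> B e) \<Longrightarrow> D (\<lambda>e. s e \<in> A e - B e)" by (simp add: D_and D_not)
lemma D_image [dfn]: "D (\<lambda>e. \<exists>x. x \<in> A e \<and> s e = f e x) \<Longrightarrow> D (\<lambda>e. s e \<in> f e ` A e)"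
  by (simp add: image_iff Bex_def)
lemma D_UN [dfn]: "D (\<lambda>e. \<exists>x. x \<in> A e \<and> s e \<in> B e x) \<Longrightarrow> D (\<lambda>e. s e \<in> \<Union>(B e ` A e))"
  by (simp add: Bex_def)
lemma D_sub [dfn]: "D (\<lambda>e. \<forall>x. x \<in> A e \<longrightarrow> x \<in> B e) \<Longrightarrow> D (\<lambda>e. A e \<subseteq> B e)" by (simp add: subset_iff)
lemma D_seteq [dfn]: "D (\<lambda>e. \<forall>x. x \<in> A e \<longleftrightarrow> x \<in> B e) \<Longrightarrow> D (\<lambda>e. A e = (B e :: 'a set))" by (simp add: set_eq_iff)
lemma D_if [dfn]: "D P \<Longrightarrow> D Q \<Longrightarrow> D R \<Longrightarrow> D (\<lambda>e. if P e then Q e else R e)"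
  unfolding if_bool_eq_conj by (intro dfn)
lemma D_ex1 [dfn]:
  assumes "D (\<lambda>e. Q (e 0) (\<lambda>i. e (Suc i)))" shows "D (\<lambda>e. \<exists>!x. Q x e)"
  unfolding Ex1_def by (intro dfn assms D_weak[OF assms])
lemma DF_if [dfn]:
  assumes "D P" "DF s" "DF t" shows "DF (\<lambda>e. if P e then s e else t e)"
proof -
  have "D (\<lambda>e. P (\<lambda>i. e (Suc i)))" using D_ren[OF assms(1), of Suc] by simp
  then have "D (\<lambda>e. if P (\<lambda>i. e (Suc i)) then e 0 = s (\<lambda>i. e (Suc i)) else e 0 = t (\<lambda>i. e (Suc i)))"
    using assms(2,3) unfolding DF_def by (intro D_if)
  moreover have "(\<lambda>e::nat\<Rightarrow>'a. if P (\<lambda>i. e (Suc i)) then e 0 = s (\<lambda>i. e (Suc i)) else e 0 = t (\<lambda>i. e (Suc i)))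
    = (\<lambda>e. e 0 = (if P (\<lambda>i. e (Suc i)) then s (\<lambda>i. e (Suc i)) else t (\<lambda>i. e (Suc i))))" by auto
  ultimately show ?thesis unfolding DF_def by simp
qed

text \<open>\<open>mk A\<close> and \<open>The1 P\<close> are the empty set if \<open>A\<close> is a proper class or \<open>P\<close> has no unique witness.\<close>

definition small :: "'a set \<Rightarrow> bool" where "small A \<longleftrightarrow> (\<exists>b. el b = A)"
definition emp :: 'a where "emp = (SOME x. el x = {})"
definition mk :: "'a set \<Rightarrow> 'a" where "mk A = (if small A then THE b. el b = A else emp)"
definition The1 :: "('a \<Rightarrow> bool) \<Rightarrow> 'a" where "The1 P = (if \<exists>!x. P x then THE x. P x else emp)"

lemma el_mk: "small A \<Longrightarrow> el (mk A) = A"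
proof -
  assume s: "small A"
  then obtain b where b: "el b = A" by (auto simp: small_def)
  then have "(THE b. el b = A) = b" using ext by (intro the_equality) auto
  then show ?thesis using s b by (simp add: mk_def)
qed
lemma mk_el [simp]: "mk (el x) = x"
  by (rule ext, rule el_mk) (auto simp: small_def)
lemma small_el [simp]: "small (el x)" by (auto simp: small_def)
lemma mk_eq: "el x = A \<Longrightarrow> mk A = x" by auto
lemma mk_D: "a = mk A \<longleftrightarrow> el a = A \<or> (\<not> small A \<and> a = emp)"
proof (cases "small A")
  case True
  then show ?thesis using el_mk[OF True] mk_eq[of a A] by auto
next
  case False
  then show ?thesis by (auto simp: mk_def small_def)
qed
lemma The1_eq: "P a \<Longrightarrow> (\<And>x. P x \<Longrightarrow> x = a) \<Longrightarrow> The1 P = a"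
proof -
  assume a: "P a" "\<And>x. P x \<Longrightarrow> x = a"
  then have ex: "\<exists>!x. P x" by blast
  show ?thesis unfolding The1_def by (simp add: ex the1_equality[OF ex a(1)])
qed

lemma D_small [dfn]:
  assumes "D (\<lambda>e. e 0 \<in> A (\<lambda>i. e (Suc i)))" shows "D (\<lambda>e. small (A e))"
  unfolding small_def by (intro dfn D_weak[of "\<lambda>x e. x \<in> A e", OF assms])
lemma DF_mk [dfn]:
  assumes "D (\<lambda>e. e 0 \<in> A (\<lambda>i. e (Suc i)))" shows "DF (\<lambda>e. mk (A e))"
  unfolding DF_def mk_D by (intro dfn D_weak[of "\<lambda>x e. x \<in> A e", OF assms])
lemma DF_The1 [dfn]:
  assumes "D (\<lambda>e. P (e 0) (\<lambda>i. e (Suc i)))" shows "DF (\<lambda>e. The1 (\<lambda>x. P x e))"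
proof -
  have "a = The1 Q \<longleftrightarrow> (if \<exists>!x. Q x then Q a else a = emp)" for a Q
    unfolding The1_def by (cases "\<exists>!x. Q x") (simp_all, metis the1_equality theI')
  then show ?thesis
    unfolding DF_def by (simp only:) (intro dfn assms D_weak[OF assms])
qed

lemma separation:
  assumes "small A" "B \<subseteq> A" "D (\<lambda>e. e 0 \<in> B)"
  shows "small B"
proof -
  obtain a where a: "el a = A" using assms(1) by (auto simp: small_def)
  obtain \<phi> c where \<phi>: "\<And>e. e 0 \<in> B \<longleftrightarrow> sat E \<phi> (code e c)" using assms(3) by (auto simp: D_def)
  obtain k where k: "\<forall>i\<in>vars \<phi>. i < k" using finite_vars[of \<phi>] finite_nat_set_iff_bounded by auto
  let ?ax = "All (Suc k) (Ex (Suc (Suc k)) (All 0 (Iff (Mem 0 (Suc (Suc k))) (Conj (Mem 0 (Suc k)) \<phi>))))"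
  have k': "i < k" if "i \<in> fv \<phi>" for i using that fv_vars[of \<phi>] k by auto
  then have "Suc (Suc k) \<notin> fv \<phi>" by fastforce
  then have "?ax \<in> separation_axs"
    unfolding separation_axs_def
    by (intro CollectI exI[of _ "Suc k"] exI[of _ "Suc (Suc k)"] exI[of _ 0] exI[of _ \<phi>]) auto
  then have "sat E ?ax (code undefined c)" by (intro sat_ZFC) (simp add: ZFC_def)
  then obtain b where b: "\<And>x. x \<in> el b \<longleftrightarrow> x \<in> el a \<and> sat E \<phi> ((code undefined c)(Suc k := a, Suc (Suc k) := b, 0 := x))"
    by (auto simp: satR_sentence el_def)
  have "sat E \<phi> ((code undefined c)(Suc k := a, Suc (Suc k) := b, 0 := x)) \<longleftrightarrow> x \<in> B" for x
  proof -
    have "x \<in> B \<longleftrightarrow> sat E \<phi> (code (undefined(0 := x)) c)" using \<phi>[of "undefined(0 := x)"] by simp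
    also have "\<dots> \<longleftrightarrow> sat E \<phi> ((code undefined c)(Suc k := a, Suc (Suc k) := b, 0 := x))"
      using k' by (intro satR_cong) (auto simp: code_def dest!: k' elim!: evenE)
    finally show ?thesis by simp
  qed
  then have "el b = B" using b a assms(2) by auto
  then show ?thesis by (auto simp: small_def)
qed

lemma replacement:
  assumes "D (\<lambda>e. Q (e 0) (e (Suc 0)))" "\<forall>x\<in>el a. \<exists>!y. Q x y"
  shows "\<exists>b. \<forall>x\<in>el a. \<exists>y\<in>el b. Q x y"
proof -
  obtain \<phi> c where \<phi>: "\<And>e. Q (e 0) (e (Suc 0)) \<longleftrightarrow> sat E \<phi> (code e c)" using assms(1) by (auto simp: D_def)
  obtain k where k: "\<forall>i\<in>vars \<phi>. i < k" using finite_vars[of \<phi>] finite_nat_set_iff_bounded by auto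
  \<comment> \<open>Variables 0 and 2 are the places where \<open>code\<close> keeps
    \<open>e 0\<close> and \<open>e (Suc 0)\<close>; the others lie beyond all variables of
    \<phi>.\<close>
  let ?ax = "All (k+3) (Imp (All 0 (Imp (Mem 0 (k+3)) (Ex (k+4) (All 2 (Iff \<phi> (Eq 2 (k+4)))))))
       (Ex (k+5) (All 0 (Imp (Mem 0 (k+3)) (Ex 2 (Conj (Mem 2 (k+5)) \<phi>))))))"
  have k': "i < k" if "i \<in> fv \<phi>" for i using that fv_vars[of \<phi>] k by auto
  then have "k+4 \<notin> fv \<phi>" "k+5 \<notin> fv \<phi>" by fastforce+
  then have "?ax \<in> replacement_axs"
    unfolding replacement_axs_def
    by (intro CollectI exI[of _ "k+3"] exI[of _ "k+5"] exI[of _ 0] exI[of _ "2::nat"] exI[of _ "k+4"] exI[of _ \<phi>]) auto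
  then have s: "sat E ?ax (code undefined c)" by (intro sat_ZFC) (simp add: ZFC_def)
  have eq: "sat E \<phi> ((code undefined c)(k+3 := a, 0 := x, k+4 := z, 2 := y)) \<longleftrightarrow> Q x y"
       "sat E \<phi> ((code undefined c)(k+3 := a, k+5 := z, 0 := x, 2 := y)) \<longleftrightarrow> Q x y" for x y z
  proof -
    have *: "Q x y \<longleftrightarrow> sat E \<phi> (code (undefined(0 := x, Suc 0 := y)) c)"
      using \<phi>[of "undefined(0 := x, Suc 0 := y)"] by simp
    show "sat E \<phi> ((code undefined c)(k+3 := a, 0 := x, k+4 := z, 2 := y)) \<longleftrightarrow> Q x y"
      unfolding * using k' by (intro satR_cong) (auto simp: code_def dest!: k' elim!: evenE)
    show "sat E \<phi> ((code undefined c)(k+3 := a, k+5 := z, 0 := x, 2 := y)) \<longleftrightarrow> Q x y"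
      unfolding * using k' by (intro satR_cong) (auto simp: code_def dest!: k' elim!: evenE)
  qed
  have "\<forall>x. E x a \<longrightarrow> (\<exists>z. \<forall>y. Q x y \<longleftrightarrow> y = z)" using assms(2) by (auto simp: el_def Ex1_def) blast
  then have "\<exists>b. \<forall>x. E x a \<longrightarrow> (\<exists>y. E y b \<and> Q x y)"
    using spec[OF s[unfolded satR.simps(5)], of a] by (simp add: satR_sentence eq)
  then show ?thesis by (auto simp: el_def)
qed

end

context zfc begin

subsection \<open>Basic constructions\<close>

lemma small_pair [simp]: "small {x, y}"
proof -
  obtain z where "x \<in> el z" "y \<in> el z" using pairing0 by blast
  then show ?thesis by (intro separation[OF small_el[of z]] dfn) auto
qed

lemma small_empty [simp]: "small {}"
  by (rule separation[OF small_el]) (simp, intro dfn)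

lemma el_emp [simp]: "el emp = {}"
  using small_empty unfolding emp_def small_def by (rule someI_ex)

lemma small_Union: "small (\<Union>(el ` el a))"
proof -
  obtain u where "\<forall>y\<in>el a. el y \<subseteq> el u" using union0 by blast
  then show ?thesis by (intro separation[OF small_el[of u]] dfn) auto
qed

lemma small_pow [simp]: "small {x. el x \<subseteq> el a}"
proof -
  obtain p where "\<forall>x. el x \<subseteq> el a \<longrightarrow> x \<in> el p" using power0 by blast
  then show ?thesis by (intro separation[OF small_el[of p]] dfn) auto
qed

lemma small_Un [simp]: "small A \<Longrightarrow> small B \<Longrightarrow> small (A \<union> B)"
  using small_Union[of "mk {mk A, mk B}"] by (simp add: el_mk)

lemma small_insert [simp]: "small A \<Longrightarrow> small (insert x A)"
  using small_Un[OF small_pair[of x x], of A] by simp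

lemma small_UN:
  assumes "small A" "\<And>x. x \<in> A \<Longrightarrow> small (B x)" "D (\<lambda>e. e 0 \<in> B (e (Suc 0)))"
  shows "small (\<Union>x\<in>A. B x)"
proof -
  obtain a where a: "A = el a" using assms(1) by (auto simp: small_def)
  have "D (\<lambda>e. e (Suc 0) = mk (B (e 0)))" by (intro dfn assms)
  from replacement[OF this, of a] obtain b where "\<forall>x\<in>el a. mk (B x) \<in> el b" by auto
  have "B x \<subseteq> \<Union>(el ` el b)" if "x \<in> A" for x
    using \<open>\<forall>x\<in>el a. mk (B x) \<in> el b\<close> that assms(2)[OF that] a el_mk by blast
  then have "(\<Union>x\<in>A. B x) \<subseteq> \<Union>(el ` el b)" by blast
  then show ?thesis
    by (rule separation[OF small_Union]) (unfold a, intro dfn lift2[OF DF_var DF_var assms(3)])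
qed

lemma small_image: 
  assumes "small A" "DF (\<lambda>e. f (e 0))" shows "small (f ` A)"
proof -
  have "small (\<Union>x\<in>A. {f x})" by (rule small_UN[OF assms(1)]) (simp, intro dfn liftF1[OF DF_var assms(2)])
  then show ?thesis by (simp add: UNION_singleton_eq_range)
qed

definition upr where "upr x y = mk {x, y}"
definition pr where "pr x y = upr (upr x x) (upr x y)"
definition fs where "fs p = The1 (\<lambda>x. \<exists>y. p = pr x y)"
definition sn where "sn p = The1 (\<lambda>y. \<exists>x. p = pr x y)"
definition app where "app f x = The1 (\<lambda>y. pr x y \<in> el f)"
definition lam where "lam A f = mk ((\<lambda>x. pr x (f x)) ` A)"
definition PR where "PR A B = {p. \<exists>x y. p = pr x y \<and> x \<in> A \<and> y \<in> B}"
definition sc where "sc x = mk (insert x (el x))"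
definition un where "un a b = mk (el a \<union> el b)"
definition sg where "sg a = mk {a}"

lemma el_upr [simp]: "el (upr x y) = {x, y}" by (simp add: upr_def el_mk)
lemma el_sc [simp]: "el (sc x) = insert x (el x)" by (simp add: sc_def el_mk)
lemma el_un [simp]: "el (un x y) = el x \<union> el y" by (simp add: un_def el_mk)
lemma el_sg [simp]: "el (sg x) = {x}" using small_insert[OF small_empty, of x] by (simp add: sg_def el_mk)

lemma upr_eq: "upr x y = upr u v \<longleftrightarrow> (x = u \<and> y = v) \<or> (x = v \<and> y = u)"
proof -
  have "upr x y = upr u v \<longleftrightarrow> {x, y} = {u, v}" by (rule iffI) (metis el_upr, metis el_upr ext)
  then show ?thesis by (simp only: doubleton_eq_iff)
qed
lemma pr_eq [simp]: "pr x y = pr u v \<longleftrightarrow> x = u \<and> y = v"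
  unfolding pr_def by (auto simp: upr_eq)
lemma fs_pr [simp]: "fs (pr x y) = x" unfolding fs_def by (rule The1_eq) auto
lemma sn_pr [simp]: "sn (pr x y) = y" unfolding sn_def by (rule The1_eq) auto
lemma pr_in_PR [simp]: "pr x y \<in> PR A B \<longleftrightarrow> x \<in> A \<and> y \<in> B" by (auto simp: PR_def)

lemma DF_upr [dfn]: "DF s \<Longrightarrow> DF t \<Longrightarrow> DF (\<lambda>e. upr (s e) (t e))"
  by (rule liftF2; (assumption | (unfold upr_def, intro dfn)))
lemma DF_pr [dfn]: "DF s \<Longrightarrow> DF t \<Longrightarrow> DF (\<lambda>e. pr (s e) (t e))"
  by (rule liftF2; (assumption | (unfold pr_def, intro dfn)))
lemma DF_fs [dfn]: "DF s \<Longrightarrow> DF (\<lambda>e. fs (s e))"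
  by (rule liftF1; (assumption | (unfold fs_def, intro dfn)))
lemma DF_sn [dfn]: "DF s \<Longrightarrow> DF (\<lambda>e. sn (s e))"
  by (rule liftF1; (assumption | (unfold sn_def, intro dfn)))
lemma DF_app [dfn]: "DF s \<Longrightarrow> DF t \<Longrightarrow> DF (\<lambda>e. app (s e) (t e))"
  by (rule liftF2; (assumption | (unfold app_def, intro dfn)))
lemma DF_sc [dfn]: "DF s \<Longrightarrow> DF (\<lambda>e. sc (s e))"
  by (rule liftF1; (assumption | (unfold sc_def, intro dfn)))
lemma DF_sg [dfn]: "DF s \<Longrightarrow> DF (\<lambda>e. sg (s e))"
  by (rule liftF1; (assumption | (unfold sg_def, intro dfn)))
lemma DF_un [dfn]: "DF s \<Longrightarrow> DF t \<Longrightarrow> DF (\<lambda>e. un (s e) (t e))"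
  by (rule liftF2; (assumption | (unfold un_def, intro dfn)))
lemma D_PR [dfn]: "D (\<lambda>e. \<exists>x y. s e = pr x y \<and> x \<in> A e \<and> y \<in> B e) \<Longrightarrow> D (\<lambda>e. s e \<in> PR (A e) (B e))"
  by (simp add: PR_def)
lemma DF_lam [dfn]:
  "D (\<lambda>e. \<exists>x. x \<in> A (\<lambda>i. e (Suc i)) \<and> e 0 = pr x (f (\<lambda>i. e (Suc i)) x)) \<Longrightarrow> DF (\<lambda>e. lam (A e) (f e))"
  unfolding lam_def by (intro DF_mk D_image)

lemma small_PR [simp]: "small A \<Longrightarrow> small B \<Longrightarrow> small (PR A B)"
proof -
  assume s: "small A" "small B"
  then obtain a b where ab: "A = el a" "B = el b" by (auto simp: small_def)
  have "small (\<Union>x\<in>A. (\<lambda>y. pr x y) ` B)"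
    by (rule small_UN[OF s(1) small_image[OF s(2)]]) (unfold ab; intro dfn)+
  moreover have "PR A B = (\<Union>x\<in>A. (\<lambda>y. pr x y) ` B)" by (auto simp: PR_def)
  ultimately show ?thesis by simp
qed

lemma app_lam:
  assumes "small A" "DF (\<lambda>e. f (e 0))" "x \<in> A" shows "app (lam A f) x = f x"
proof -
  have "el (lam A f) = (\<lambda>x. pr x (f x)) ` A"
    unfolding lam_def by (rule el_mk[OF small_image[OF assms(1)]]) (intro dfn liftF1[OF DF_var assms(2)])
  then show ?thesis unfolding app_def using assms(3) by (intro The1_eq) auto
qed

lemma lam_cong: "(\<And>x. x \<in> A \<Longrightarrow> f x = g x) \<Longrightarrow> lam A f = lam A g"
  unfolding lam_def by (metis (mono_tags, lifting) image_cong)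

subsection \<open>Ordinals\<close>

definition trans where "trans x \<longleftrightarrow> (\<forall>y\<in>el x. el y \<subseteq> el x)"
definition Ord where "Ord x \<longleftrightarrow> trans x \<and> (\<forall>y\<in>el x. trans y)"

lemma D_trans [dfn]: "DF s \<Longrightarrow> D (\<lambda>e. trans (s e))"
  by (rule lift1; (assumption | (unfold trans_def, intro dfn)))
lemma D_Ord [dfn]: "DF s \<Longrightarrow> D (\<lambda>e. Ord (s e))"
  by (rule lift1; (assumption | (unfold Ord_def, intro dfn)))

lemma mem_irrefl [simp]: "x \<notin> el x"
  using foundation[of "sg x"] by auto
lemma mem_asym: "x \<in> el y \<Longrightarrow> y \<notin> el x"
  using foundation[of "upr x y"] by auto

lemma minimal:
  assumes "small A" "D (\<lambda>e. P (e 0))" "x \<in> A" "P x"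
  obtains y where "y \<in> A" "P y" "\<And>z. z \<in> el y \<Longrightarrow> z \<in> A \<Longrightarrow> \<not> P z"
proof -
  obtain a where a: "A = el a" using assms(1) by (auto simp: small_def)
  have "small {y \<in> A. P y}" by (rule separation[OF assms(1)]) (auto simp: a intro!: dfn assms(2))
  then have e: "el (mk {y \<in> A. P y}) = {y \<in> A. P y}" by (rule el_mk)
  then obtain y where "y \<in> {y \<in> A. P y}" "el y \<inter> {y \<in> A. P y} = {}"
    using foundation[of "mk {y \<in> A. P y}"] assms(3,4) by auto
  then show thesis using that[of y] by blast
qed

lemma Ord_mem: "Ord a \<Longrightarrow> b \<in> el a \<Longrightarrow> Ord b" unfolding Ord_def trans_def by blast
lemma Ord_trans: "Ord a \<Longrightarrow> b \<in> el a \<Longrightarrow> c \<in> el b \<Longrightarrow> c \<in> el a" unfolding Ord_def trans_def by blast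
lemma Ord_sc [simp]: "Ord a \<Longrightarrow> Ord (sc a)" unfolding Ord_def trans_def by auto
lemma Ord_emp [simp]: "Ord emp" unfolding Ord_def trans_def by auto

lemma Ord_induct:
  assumes "D (\<lambda>e. P (e 0))" "\<And>a. Ord a \<Longrightarrow> (\<And>b. b \<in> el a \<Longrightarrow> P b) \<Longrightarrow> P a" "Ord a"
  shows "P a"
proof (rule ccontr)
  assume "\<not> P a"
  then obtain b where b: "b \<in> el (sc a)" "\<not> P b" "\<And>z. z \<in> el b \<Longrightarrow> z \<in> el (sc a) \<Longrightarrow> \<not> \<not> P z"
    using minimal[of "el (sc a)" "\<lambda>x. \<not> P x" a] D_not[OF assms(1)] by auto
  have "Ord b" using b(1) assms(3) Ord_mem by auto
  moreover have "P c" if "c \<in> el b" for c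
    using b(3)[OF that] that b(1) Ord_trans[OF Ord_sc[OF assms(3)]] by blast
  ultimately show False using assms(2) b(2) by blast
qed

lemma Ord_linear: assumes "Ord a" "Ord b" shows "a \<in> el b \<or> a = b \<or> b \<in> el a"
proof -
  have "\<forall>b. Ord b \<longrightarrow> a \<in> el b \<or> a = b \<or> b \<in> el a"
  proof (rule Ord_induct[OF _ _ assms(1)])
    show "D (\<lambda>e. \<forall>b. Ord b \<longrightarrow> e 0 \<in> el b \<or> e 0 = b \<or> b \<in> el (e 0))" by (intro dfn)
    fix a assume a: "Ord a" and IH: "\<And>x. x \<in> el a \<Longrightarrow> \<forall>b. Ord b \<longrightarrow> x \<in> el b \<or> x = b \<or> b \<in> el x"
    show "\<forall>b. Ord b \<longrightarrow> a \<in> el b \<or> a = b \<or> b \<in> el a"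
    proof (intro allI impI)
      fix b assume "Ord b"
      then show "a \<in> el b \<or> a = b \<or> b \<in> el a"
      proof (rule Ord_induct[rotated 2])
        show "D (\<lambda>e. a \<in> el (e 0) \<or> a = e 0 \<or> e 0 \<in> el a)" by (intro dfn)
        fix b assume b: "Ord b" and IH2: "\<And>y. y \<in> el b \<Longrightarrow> a \<in> el y \<or> a = y \<or> y \<in> el a"
        show "a \<in> el b \<or> a = b \<or> b \<in> el a"
        proof (rule ccontr)
          assume n: "\<not> ?thesis"
          have "el a = el b"
          proof (intro equalityI subsetI)
            fix x assume "x \<in> el a"
            then show "x \<in> el b" using IH b n Ord_trans[OF a] by blast
          next
            fix y assume "y \<in> el b"
            then show "y \<in> el a" using IH2 n Ord_trans[OF b] by blast
          qed
          then show False using n ext by blast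
        qed
      qed
    qed
  qed
  then show ?thesis using assms(2) by blast
qed

lemma Ord_sub: "Ord a \<Longrightarrow> Ord b \<Longrightarrow> el a \<subseteq> el b \<longleftrightarrow> a \<in> el b \<or> a = b"
  using Ord_linear[of a b] Ord_trans[of b a] mem_irrefl by blast

lemma Ord_not_mem: "Ord a \<Longrightarrow> Ord b \<Longrightarrow> a \<notin> el b \<longleftrightarrow> el b \<subseteq> el a"
  using Ord_linear[of a b] Ord_trans mem_asym by (metis Ord_sub)

lemma Ord_UN:
  assumes "small A" "\<And>a. a \<in> A \<Longrightarrow> Ord a"
  shows "Ord (mk (\<Union>(el ` A)))" "el (mk (\<Union>(el ` A))) = \<Union>(el ` A)"
proof -
  obtain a where a: "A = el a" using assms(1) by (auto simp: small_def)
  show *: "el (mk (\<Union>(el ` A))) = \<Union>(el ` A)" unfolding a by (rule el_mk[OF small_Union])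
  show "Ord (mk (\<Union>(el ` A)))"
    unfolding Ord_def trans_def * using assms(2) by (fastforce simp: Ord_def trans_def)
qed

lemma Ord_least:
  assumes "D (\<lambda>e. P (e 0))" "Ord a" "P a"
  obtains b where "Ord b" "P b" "\<And>c. Ord c \<Longrightarrow> P c \<Longrightarrow> el b \<subseteq> el c"
proof -
  obtain b where b: "b \<in> el (sc a)" "P b" "\<And>z. z \<in> el b \<Longrightarrow> z \<in> el (sc a) \<Longrightarrow> \<not> P z"
    using minimal[of "el (sc a)" P a] assms by auto
  have o: "Ord b" using b(1) assms(2) Ord_mem by auto
  moreover have "el b \<subseteq> el c" if "Ord c" "P c" for c
  proof (rule ccontr)
    assume "\<not> ?thesis"
    then have "c \<in> el b" using Ord_not_mem that(1) o by blast
    moreover then have "c \<in> el (sc a)" using Ord_trans[OF Ord_sc[OF assms(2)] b(1)] by blast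
    ultimately show False using b(3) that(2) by blast
  qed
  ultimately show thesis using that b(2) by blast
qed

text \<open>The Burali-Forti argument.\<close>

lemma no_universal_Ord: "small A \<Longrightarrow> \<exists>a. Ord a \<and> a \<notin> A"
proof (rule ccontr)
  assume A: "small A" and "\<not> (\<exists>a. Ord a \<and> a \<notin> A)"
  then have a: "\<And>a. Ord a \<Longrightarrow> a \<in> A" by blast
  have "small {a. Ord a}" by (rule separation[OF A]) (use a in auto, intro dfn)
  then have e: "el (mk {a. Ord a}) = {a. Ord a}" by (rule el_mk)
  have "el a \<subseteq> {a. Ord a}" if "Ord a" for a using Ord_mem that by blast
  then have "Ord (mk {a. Ord a})" unfolding Ord_def[of "mk _"] trans_def e Ball_def mem_Collect_eq
    using Ord_trans Ord_mem by blast
  then show False using e mem_irrefl by blast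
qed

definition ind where "ind I \<longleftrightarrow> emp \<in> el I \<and> (\<forall>y\<in>el I. sc y \<in> el I)"
definition om where "om = mk {x. \<forall>I. ind I \<longrightarrow> x \<in> el I}"

lemma D_ind [dfn]: "DF s \<Longrightarrow> D (\<lambda>e. ind (s e))"
  by (rule lift1; (assumption | (unfold ind_def, intro dfn)))

lemma ex_ind: "\<exists>I. ind I"
proof -
  obtain x where x: "\<exists>z\<in>el x. el z = {}" "\<forall>y\<in>el x. \<exists>s\<in>el x. el s = insert y (el y)" using infinity0 by blast
  have "emp \<in> el x" using x(1) ext[of emp] by auto
  moreover have "sc y \<in> el x" if y: "y \<in> el x" for y
  proof -
    obtain s where "s \<in> el x" "el s = el (sc y)" using x(2) y by auto
    then show ?thesis using ext by metis
  qed
  ultimately show ?thesis unfolding ind_def by blast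
qed

lemma el_om: "el om = {x. \<forall>I. ind I \<longrightarrow> x \<in> el I}"
proof -
  obtain I where "ind I" using ex_ind ..
  then show ?thesis unfolding om_def by (intro el_mk separation[OF small_el[of I]] dfn) auto
qed

lemma emp_om [simp]: "emp \<in> el om" and sc_om [simp]: "n \<in> el om \<Longrightarrow> sc n \<in> el om"
  by (auto simp: el_om ind_def)

lemma om_induct:
  assumes "D (\<lambda>e. P (e 0))" "P emp" "\<And>n. n \<in> el om \<Longrightarrow> P n \<Longrightarrow> P (sc n)" "n \<in> el om"
  shows "P n"
proof -
  have "small {n \<in> el om. P n}" by (rule separation[OF small_el[of om]]) (auto intro!: dfn assms(1))
  then have e: "el (mk {n \<in> el om. P n}) = {n \<in> el om. P n}" by (rule el_mk)
  then have "ind (mk {n \<in> el om. P n})" unfolding ind_def e using assms(2,3) by auto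
  then show ?thesis using assms(4) e by (auto simp: el_om)
qed

lemma om_Ord [simp]: "n \<in> el om \<Longrightarrow> Ord n"
  by (rule om_induct[of Ord]; (assumption | intro dfn | simp))
lemma om_trans: "n \<in> el om \<Longrightarrow> el n \<subseteq> el om"
  by (rule om_induct[of "\<lambda>n. el n \<subseteq> el om"]; (assumption | intro dfn | auto))
lemma Ord_om [simp]: "Ord om"
  unfolding Ord_def using om_trans om_Ord by (auto simp: trans_def Ord_def)
lemma om_cases: "n \<in> el om \<Longrightarrow> n = emp \<or> (\<exists>m\<in>el om. n = sc m)"
  by (rule om_induct[of "\<lambda>n. n = emp \<or> (\<exists>m\<in>el om. n = sc m)"]; (assumption | intro dfn | auto))

subsection \<open>Recursion\<close>

text \<open>An attempt is a partial solution of the recursion on a transitive set \<open>t\<close>.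
  The step function sees the earlier values as one set, a graph built by \<open>lam\<close>, so that
  it is a function on the model.\<close>

definition att where "att G p t f \<longleftrightarrow> trans t \<and> (\<forall>y\<in>el t. app f y = G p y (lam (el y) (\<lambda>z. app f z)))"
definition val where "val G p y = The1 (\<lambda>v. \<exists>t f. att G p t f \<and> y \<in> el t \<and> v = app f y)"
definition Rec where "Rec G p x = G p x (lam (el x) (\<lambda>y. val G p y))"

definition DF3 where "DF3 G \<longleftrightarrow> DF (\<lambda>e. G (e 0) (e (Suc 0)) (e (Suc (Suc 0))))"

lemma DF3: "DF3 G \<Longrightarrow> DF s \<Longrightarrow> DF t \<Longrightarrow> DF u \<Longrightarrow> DF (\<lambda>e. G (s e) (t e) (u e))"
  unfolding DF3_def by (rule liftF3)

lemma D_att: assumes G: "DF3 G" and "DF s" "DF t" "DF u" shows "D (\<lambda>e. att G (s e) (t e) (u e))"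
  by (rule lift3[OF assms(2-4)]) (unfold att_def, intro dfn DF3[OF G])
lemma DF_val: assumes G: "DF3 G" and "DF s" "DF t" shows "DF (\<lambda>e. val G (s e) (t e))"
  by (rule liftF2[OF assms(2,3)]) (unfold val_def, intro dfn D_att[OF G])
lemma DF_Rec: assumes G: "DF3 G" and "DF s" "DF t" shows "DF (\<lambda>e. Rec G (s e) (t e))"
  by (rule liftF2[OF assms(2,3)]) (unfold Rec_def, intro dfn DF3[OF G] DF_val[OF G])

lemma att_unique:
  assumes G: "DF3 G" and a: "att G p t f" "att G p t' f'" "y \<in> el t" "y \<in> el t'"
  shows "app f y = app f' y"
proof (rule ccontr)
  assume n: "app f y \<noteq> app f' y"
  have "D (\<lambda>e. e 0 \<in> el t' \<and> app f (e 0) \<noteq> app f' (e 0))" by (intro dfn)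
  from minimal[OF small_el[of t] this a(3)] n a(4)
  obtain x where x: "x \<in> el t" "x \<in> el t'" "app f x \<noteq> app f' x"
    "\<And>z. z \<in> el x \<Longrightarrow> z \<in> el t \<Longrightarrow> z \<in> el t' \<Longrightarrow> app f z = app f' z" by metis
  have "lam (el x) (\<lambda>z. app f z) = lam (el x) (\<lambda>z. app f' z)"
    using x a by (intro lam_cong x(4)) (auto simp: att_def trans_def)
  then show False using x(1-3) a(1,2) by (simp add: att_def)
qed

lemma val_att:
  assumes G: "DF3 G" and a: "att G p t f" "y \<in> el t"
  shows "val G p y = app f y" "Rec G p y = app f y"
proof -
  have v: "val G p z = app f z" if "z \<in> el t" for z
    unfolding val_def using a(1) that att_unique[OF G] by (intro The1_eq) blast+
  show "val G p y = app f y" by (rule v[OF a(2)])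
  have "lam (el y) (\<lambda>z. val G p z) = lam (el y) (\<lambda>z. app f z)"
    using a by (intro lam_cong v) (auto simp: att_def trans_def)
  then show "Rec G p y = app f y" using a by (simp add: Rec_def att_def)
qed

text \<open>\<open>Rec\<close> uses only values below its argument. It therefore supplies the
  correct value at a minimal point without an attempt, and together with the points that have
  attempts this yields an attempt there after all.\<close>

lemma Rec_eq:
  assumes G: "DF3 G" and T: "trans T" "x \<in> el T"
  shows "Rec G p x = G p x (lam (el x) (\<lambda>y. Rec G p y))"
proof -
  have "\<exists>t f. att G p t f \<and> y \<in> el t" if "y \<in> el T" for y
  proof (rule ccontr)
    assume n: "\<not> ?thesis"
    let ?OK = "\<lambda>y. \<exists>t f. att G p t f \<and> y \<in> el t"
    have "D (\<lambda>e. \<not> ?OK (e 0))" by (intro dfn D_att[OF G])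
    from minimal[OF small_el[of T] this that] n
    obtain x where x: "x \<in> el T" "\<not> ?OK x" "\<And>z. z \<in> el x \<Longrightarrow> z \<in> el T \<Longrightarrow> ?OK z" by metis
    define t where "t = mk (insert x {y \<in> el T. ?OK y})"
    have "small {y \<in> el T. ?OK y}" by (rule separation[OF small_el[of T]]) (auto intro!: dfn D_att[OF G])
    then have t: "el t = insert x {y \<in> el T. ?OK y}" unfolding t_def by (intro el_mk small_insert)
    have in_t: "z \<in> el T \<and> ?OK z" if "y \<in> el t" "z \<in> el y" for y z
    proof -
      have "z \<in> el T" using that t T x(1) by (auto simp: trans_def)
      moreover have "?OK z" using that x(3)[OF _ calculation] by (auto simp: t att_def trans_def)
      ultimately show ?thesis ..
    qed
    have f: "app (lam (el t) (\<lambda>y. Rec G p y)) y = Rec G p y" if "y \<in> el t" for y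
      by (rule app_lam[OF small_el _ that]) (intro DF_Rec[OF G] dfn)
    have "att G p t (lam (el t) (\<lambda>y. Rec G p y))"
      unfolding att_def
    proof (intro conjI ballI)
      show "trans t" unfolding trans_def using in_t t by blast
      fix y assume y: "y \<in> el t"
      have "val G p z = app (lam (el t) (\<lambda>y. Rec G p y)) z" if "z \<in> el y" for z
      proof -
        have "?OK z" "z \<in> el t" using in_t[OF y that] t by auto
        then show ?thesis using val_att[OF G] f by metis
      qed
      then show "app (lam (el t) (\<lambda>y. Rec G p y)) y = G p y (lam (el y) (\<lambda>z. app (lam (el t) (\<lambda>y. Rec G p y)) z))"
        unfolding f[OF y] by (subst Rec_def) (metis lam_cong)
    qed
    then show False using x(2) t by blast
  qed
  then have "val G p y = Rec G p y" if "y \<in> el x" for y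
    using T that val_att[OF G] unfolding trans_def by (metis subsetD)
  then show ?thesis by (subst Rec_def) (metis lam_cong)
qed

lemma Ord_trans_cover: "Ord a \<Longrightarrow> trans (sc a) \<and> a \<in> el (sc a)"
  using Ord_sc[of a] by (auto simp: Ord_def)

lemma Rec_Ord: "DF3 G \<Longrightarrow> Ord a \<Longrightarrow> Rec G p a = G p a (lam (el a) (\<lambda>y. Rec G p y))"
  using Rec_eq Ord_trans_cover by blast

lemma app_lam_Rec: "DF3 G \<Longrightarrow> y \<in> el x \<Longrightarrow> app (lam (el x) (\<lambda>y. Rec G p y)) y = Rec G p y"
  by (rule app_lam) (auto intro: DF_Rec DF_const DF_var)

end

context zfc begin

subsection \<open>The cumulative hierarchy over a base set\<close>

definition Vstep where "Vstep B a f = mk (el B \<union> {x. \<exists>b\<in>el a. el x \<subseteq> el (app f b)})"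
definition V where "V B a = Rec Vstep B a"

lemma DF3_Vstep: "DF3 Vstep" unfolding DF3_def Vstep_def by (intro dfn)
lemma DF_V [dfn]: "DF s \<Longrightarrow> DF t \<Longrightarrow> DF (\<lambda>e. V (s e) (t e))"
  unfolding V_def by (rule DF_Rec[OF DF3_Vstep])

lemma el_V: assumes "Ord a" shows "el (V B a) = el B \<union> {x. \<exists>b\<in>el a. el x \<subseteq> el (V B b)}"
proof -
  have "V B a = mk (el B \<union> {x. \<exists>b\<in>el a. el x \<subseteq> el (V B b)})"
    unfolding V_def by (subst Rec_Ord[OF DF3_Vstep assms], subst Vstep_def) (simp add: app_lam_Rec[OF DF3_Vstep] cong: bex_cong)
  moreover have "small (\<Union>b\<in>el a. {x. el x \<subseteq> el (V B b)})"
    by (rule small_UN[OF small_el small_pow]) (intro dfn)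
  then have "small (el B \<union> (\<Union>b\<in>el a. {x. el x \<subseteq> el (V B b)}))" by (rule small_Un[OF small_el])
  moreover have "(\<Union>b\<in>el a. {x. el x \<subseteq> el (V B b)}) = {x. \<exists>b\<in>el a. el x \<subseteq> el (V B b)}" by blast
  ultimately show ?thesis using el_mk by metis
qed

lemma V_mono: "Ord b \<Longrightarrow> Ord a \<Longrightarrow> el a \<subseteq> el b \<Longrightarrow> el (V B a) \<subseteq> el (V B b)"
  by (auto simp: el_V)
lemma V_mono1: "Ord b \<Longrightarrow> a \<in> el b \<Longrightarrow> el (V B a) \<subseteq> el (V B b)"
  using V_mono[of b a] Ord_mem Ord_trans by blast
lemma V_intro: "Ord a \<Longrightarrow> b \<in> el a \<Longrightarrow> el x \<subseteq> el (V B b) \<Longrightarrow> x \<in> el (V B a)"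
  by (auto simp: el_V)
lemma V_base: "Ord a \<Longrightarrow> x \<in> el B \<Longrightarrow> x \<in> el (V B a)"
  by (auto simp: el_V)

lemma trans_V: assumes "trans B" "Ord a" shows "trans (V B a)"
  unfolding trans_def
proof
  fix y assume "y \<in> el (V B a)"
  then consider "y \<in> el B" | b where "b \<in> el a" "el y \<subseteq> el (V B b)" using el_V[OF assms(2)] by auto
  then show "el y \<subseteq> el (V B a)"
    using assms V_base[OF assms(2)] V_mono1[OF assms(2)] unfolding trans_def by cases blast+
qed

definition lim where "lim a \<longleftrightarrow> Ord a \<and> emp \<in> el a \<and> (\<forall>b\<in>el a. sc b \<in> el a)"

lemma lim_om: "lim om" by (simp add: lim_def)

lemma V_lim_stage:
  assumes "lim a" "x \<in> el (V B a)" obtains b where "b \<in> el a" "x \<in> el (V B b)"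
proof -
  have o: "Ord a" using assms(1) by (simp add: lim_def)
  consider "x \<in> el B" | b where "b \<in> el a" "el x \<subseteq> el (V B b)" using el_V[OF o] assms(2) by auto
  then show thesis
  proof cases
    case 1
    then show thesis using that[of emp] assms(1) V_base by (simp add: lim_def)
  next
    case 2
    then have "x \<in> el (V B (sc b))" using V_intro[of "sc b" b] Ord_mem[OF o] by auto
    then show thesis using that 2 assms(1) by (auto simp: lim_def)
  qed
qed

lemma lim_max: assumes "lim a" "b \<in> el a" "c \<in> el a" obtains d where "d \<in> el a" "el b \<subseteq> el d" "el c \<subseteq> el d"
proof -
  have "Ord b" "Ord c" using assms Ord_mem by (auto simp: lim_def)
  then have "el b \<subseteq> el c \<or> el c \<subseteq> el b" using Ord_linear Ord_sub by blast
  then show thesis using that assms(2,3) by blast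
qed

lemma V_lim_upr:
  assumes "lim a" "x \<in> el (V B a)" "y \<in> el (V B a)" shows "upr x y \<in> el (V B a)"
proof -
  obtain b c where bc: "b \<in> el a" "x \<in> el (V B b)" "c \<in> el a" "y \<in> el (V B c)"
    using V_lim_stage assms by metis
  then obtain d where d: "d \<in> el a" "el b \<subseteq> el d" "el c \<subseteq> el d" using lim_max assms(1) by metis
  have o: "Ord a" "Ord b" "Ord c" "Ord d" using assms(1) bc d Ord_mem by (auto simp: lim_def)
  have "el (upr x y) \<subseteq> el (V B d)" using bc V_mono[OF o(4) o(2) d(2)] V_mono[OF o(4) o(3) d(3)] by auto
  then show ?thesis by (rule V_intro[OF o(1) d(1)])
qed

lemma V_lim_pr: "lim a \<Longrightarrow> x \<in> el (V B a) \<Longrightarrow> y \<in> el (V B a) \<Longrightarrow> pr x y \<in> el (V B a)"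
  unfolding pr_def by (intro V_lim_upr)

lemma trans_pr: "trans t \<Longrightarrow> pr x y \<in> el t \<Longrightarrow> x \<in> el t \<and> y \<in> el t"
proof -
  assume t: "trans t" "pr x y \<in> el t"
  then have "upr x y \<in> el t" by (auto simp: trans_def pr_def)
  then have "el (upr x y) \<subseteq> el t" using t(1) by (simp only: trans_def)
  then show ?thesis by simp
qed

definition Tstep where "Tstep x n f = mk (el x \<union> \<Union>(el ` (\<Union>m\<in>el n. el (app f m))))"
definition tn where "tn x n = Rec Tstep x n"

lemma DF3_Tstep: "DF3 Tstep" unfolding DF3_def Tstep_def by (intro dfn)
lemma DF_tn [dfn]: "DF s \<Longrightarrow> DF t \<Longrightarrow> DF (\<lambda>e. tn (s e) (t e))"
  unfolding tn_def by (rule DF_Rec[OF DF3_Tstep])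

lemma el_tn: assumes "Ord n" shows "el (tn x n) = el x \<union> \<Union>(el ` (\<Union>m\<in>el n. el (tn x m)))"
proof -
  have "(\<Union>m\<in>el n. el (app (lam (el n) (\<lambda>y. Rec Tstep x y)) m)) = (\<Union>m\<in>el n. el (tn x m))"
    unfolding tn_def by (intro SUP_cong refl) (simp add: app_lam_Rec[OF DF3_Tstep])
  then have "tn x n = mk (el x \<union> \<Union>(el ` (\<Union>m\<in>el n. el (tn x m))))"
    unfolding tn_def by (subst Rec_Ord[OF DF3_Tstep assms], subst Tstep_def) simp
  moreover have "small (\<Union>m\<in>el n. el (tn x m))" by (rule small_UN) (simp_all, intro dfn)
  then have "small (\<Union>(el ` (\<Union>m\<in>el n. el (tn x m))))" using small_Union[of "mk (\<Union>m\<in>el n. el (tn x m))"] el_mk by simp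
  ultimately show ?thesis using el_mk by simp
qed

text \<open>Closing \<open>{x}\<close> under elements in \<omega> steps. Minimal counterexamples
  inside such a set turn foundation into induction over the whole universe.\<close>

lemma cover: "\<exists>t. trans t \<and> x \<in> el t"
proof -
  define t where "t = mk (\<Union>n\<in>el om. el (tn (sg x) n))"
  have t: "el t = (\<Union>n\<in>el om. el (tn (sg x) n))"
    unfolding t_def by (rule el_mk, rule small_UN) (simp_all, intro dfn)
  have "x \<in> el (tn (sg x) emp)" by (simp add: el_tn)
  then have "x \<in> el t" unfolding t using emp_om by blast
  moreover have "trans t"
    unfolding trans_def
  proof (intro ballI subsetI)
    fix y z assume "y \<in> el t" "z \<in> el y"
    then obtain n where n: "n \<in> el om" "y \<in> el (tn (sg x) n)" using t by auto
    then have "z \<in> el (tn (sg x) (sc n))" using \<open>z \<in> el y\<close> by (subst el_tn) auto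
    then show "z \<in> el t" unfolding t using n(1) sc_om by blast
  qed
  ultimately show ?thesis by blast
qed

lemma eps_induct:
  assumes P: "D (\<lambda>e. P (e 0))" "\<And>x. (\<And>y. y \<in> el x \<Longrightarrow> P y) \<Longrightarrow> P x" shows "P x"
proof (rule ccontr)
  assume n: "\<not> P x"
  obtain t where t: "trans t" "x \<in> el t" using cover by blast
  obtain y where y: "y \<in> el t" "\<not> P y" "\<And>z. z \<in> el y \<Longrightarrow> z \<in> el t \<Longrightarrow> \<not> \<not> P z"
    using minimal[OF small_el D_not[OF P(1)] t(2) n] by auto
  then have "P z" if "z \<in> el y" for z using that t(1) by (auto simp: trans_def)
  then show False using P(2) y(2) by blast
qed

definition rk where "rk x = The1 (\<lambda>a. Ord a \<and> x \<in> el (V emp a) \<and> (\<forall>b\<in>el a. x \<notin> el (V emp b)))"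

lemma DF_rk [dfn]: "DF s \<Longrightarrow> DF (\<lambda>e. rk (s e))"
  by (rule liftF1; (assumption | (unfold rk_def, intro dfn)))

lemma least_stage:
  assumes Q: "D (\<lambda>e. Q (e 0))" and "Ord a" "Q a"
  shows "Ord (The1 (\<lambda>a. Ord a \<and> Q a \<and> (\<forall>b\<in>el a. \<not> Q b)))" "Q (The1 (\<lambda>a. Ord a \<and> Q a \<and> (\<forall>b\<in>el a. \<not> Q b)))"
proof -
  obtain b where b: "Ord b" "Q b" "\<And>c. Ord c \<Longrightarrow> Q c \<Longrightarrow> el b \<subseteq> el c" using Ord_least[OF assms] by blast
  have "The1 (\<lambda>a. Ord a \<and> Q a \<and> (\<forall>b\<in>el a. \<not> Q b)) = b"
  proof (rule The1_eq)
    show "Ord b \<and> Q b \<and> (\<forall>c\<in>el b. \<not> Q c)" using b Ord_mem mem_irrefl by blast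
    show "c = b" if "Ord c \<and> Q c \<and> (\<forall>b\<in>el c. \<not> Q b)" for c
      using that b Ord_linear[of b c] mem_irrefl by blast
  qed
  then show "Ord (The1 (\<lambda>a. Ord a \<and> Q a \<and> (\<forall>b\<in>el a. \<not> Q b)))" "Q (The1 (\<lambda>a. Ord a \<and> Q a \<and> (\<forall>b\<in>el a. \<not> Q b)))"
    using b by auto
qed

lemma rk: assumes "Ord a" "x \<in> el (V emp a)" shows "Ord (rk x)" "x \<in> el (V emp (rk x))"
proof -
  have d: "D (\<lambda>e. x \<in> el (V emp (e 0)))" by (intro dfn)
  show "Ord (rk x)" "x \<in> el (V emp (rk x))" unfolding rk_def
    using least_stage[of "\<lambda>a. x \<in> el (V emp a)" a, OF d assms] by blast+
qed

lemma Ord_Union_image: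
  assumes "DF (\<lambda>e. f (e 0))" "\<And>x. x \<in> el A \<Longrightarrow> Ord (f x)"
  obtains b where "Ord b" "\<And>x. x \<in> el A \<Longrightarrow> el (f x) \<subseteq> el b"
proof -
  have "small (f ` el A)" by (rule small_image[OF small_el assms(1)])
  note * = Ord_UN[OF this]
  show thesis using that[of "mk (\<Union>(el ` f ` el A))"] * assms(2) by blast
qed

lemma all_V: "\<exists>a. Ord a \<and> x \<in> el (V emp a)"
proof (rule eps_induct[where x = x])
  show "D (\<lambda>e. \<exists>a. Ord a \<and> e 0 \<in> el (V emp a))" by (intro dfn)
  fix x assume IH: "\<And>y. y \<in> el x \<Longrightarrow> \<exists>a. Ord a \<and> y \<in> el (V emp a)"
  have r: "Ord (rk y)" "y \<in> el (V emp (rk y))" if "y \<in> el x" for y using IH[OF that] rk by blast+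
  obtain b where b: "Ord b" "\<And>y. y \<in> el x \<Longrightarrow> el (rk y) \<subseteq> el b"
    using Ord_Union_image[where f = rk and A = x, OF DF_rk[OF DF_var] r(1)] by blast
  have "el x \<subseteq> el (V emp b)" using r b V_mono[OF b(1)] by blast
  then have "x \<in> el (V emp (sc b))" by (rule V_intro[OF Ord_sc[OF b(1)], rotated]) simp
  then show "\<exists>a. Ord a \<and> x \<in> el (V emp a)" using b Ord_sc by blast
qed

lemma trans_V0: "Ord a \<Longrightarrow> trans (V emp a)" by (rule trans_V) (simp add: trans_def)

text \<open>The names inside a name lie several membership steps below it, as they are hidden in
  pairs; the induction therefore runs over the stages of \<open>V\<close>.\<close>

lemma name_induct:
  assumes P: "D (\<lambda>e. P (e 0))" "\<And>x. (\<And>u p. pr u p \<in> el x \<Longrightarrow> P u) \<Longrightarrow> P x" shows "P x"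
proof -
  have "\<forall>x\<in>el (V emp a). P x" if "Ord a" for a
  proof (rule Ord_induct[OF _ _ that])
    show "D (\<lambda>e. \<forall>x\<in>el (V emp (e 0)). P x)" by (intro dfn lift1[OF DF_var P(1)])
    fix a assume a: "Ord a" and IH: "\<And>b. b \<in> el a \<Longrightarrow> \<forall>x\<in>el (V emp b). P x"
    show "\<forall>x\<in>el (V emp a). P x"
    proof
      fix x assume "x \<in> el (V emp a)"
      then obtain b where b: "b \<in> el a" "el x \<subseteq> el (V emp b)" using el_V[OF a] by auto
      show "P x"
      proof (rule P(2))
        fix u p assume "pr u p \<in> el x"
        then show "P u" using b IH trans_pr[OF trans_V0] Ord_mem[OF a] by blast
      qed
    qed
  qed
  then show ?thesis using all_V by blast
qed

text \<open>Scott's trick: the least stage containing a witness is unique, so replacement applies to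
  stages even where witnesses are not unique.\<close>

lemma collection:
  assumes Q: "D (\<lambda>e. Q (e 0) (e (Suc 0)))"
  obtains b where "\<And>x. x \<in> el a \<Longrightarrow> (\<exists>y. Q x y) \<Longrightarrow> (\<exists>y\<in>el b. Q x y)"
proof -
  define f where "f x = The1 (\<lambda>a. Ord a \<and> (\<exists>y\<in>el (V emp a). Q x y) \<and> (\<forall>b\<in>el a. \<not> (\<exists>y\<in>el (V emp b). Q x y)))" for x
  have DFf: "DF (\<lambda>e. f (e 0))" unfolding f_def by (intro dfn lift2[OF _ _ Q])
  have dQ: "D (\<lambda>e. \<exists>y\<in>el (V emp (e 0)). Q x y)" for x by (intro dfn lift2[OF _ _ Q])
  have f: "Ord (f x)" "\<exists>y\<in>el (V emp (f x)). Q x y" if "\<exists>y. Q x y" for x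
    using least_stage[OF dQ[of x]] that all_V unfolding f_def by blast+
  have "Ord (f x)" for x
  proof (cases "\<exists>y. Q x y")
    case False
    then have "f x = emp" unfolding f_def The1_def by auto
    then show ?thesis by simp
  qed (rule f)
  then obtain b where b: "Ord b" "\<And>x. x \<in> el a \<Longrightarrow> el (f x) \<subseteq> el b"
    using Ord_Union_image[OF DFf] by blast
  show thesis
  proof (rule that[of "V emp b"])
    fix x assume "x \<in> el a" "\<exists>y. Q x y"
    then show "\<exists>y\<in>el (V emp b). Q x y" using f[of x] V_mono[OF b(1) _ b(2)] by blast
  qed
qed

subsection \<open>Choice and well-orderings\<close>

text \<open>The axiom speaks about disjoint families only, so each subset \<open>x\<close> of
  \<open>a\<close> is replaced by the product of \<open>{x}\<close> and \<open>x\<close>.\<close>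

lemma choice_function:
  obtains f where "DF (\<lambda>e. f (e 0))" "\<And>x. el x \<subseteq> el a \<Longrightarrow> x \<noteq> emp \<Longrightarrow> f x \<in> el x"
proof -
  define S where "S = {x. el x \<subseteq> el a} - {emp}"
  have sS: "small S" by (rule separation[OF small_pow[of a]]) (auto simp: S_def, intro dfn)
  define T where "T x = mk (PR {x} (el x))" for x
  have T: "el (T x) = PR {x} (el x)" for x using small_insert[OF small_empty] by (simp add: T_def el_mk)
  have sT: "small (T ` S)" by (rule small_image[OF sS]) (unfold T_def, intro dfn)
  define A where "A = mk (T ` S)"
  have A: "el A = T ` S" unfolding A_def by (rule el_mk[OF sT])
  have "\<exists>c. \<forall>x\<in>el A. \<exists>!z. z \<in> el x \<and> z \<in> el c"
  proof (rule choice0)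
    show "\<forall>x\<in>el A. el x \<noteq> {}"
    proof
      fix x assume "x \<in> el A"
      then obtain y where y: "y \<in> S" "x = T y" using A by auto
      then have "el y \<noteq> {}" using ext[of y emp] by (auto simp: S_def)
      then show "el x \<noteq> {}" using y T by (auto simp: PR_def)
    qed
    show "\<forall>x\<in>el A. \<forall>y\<in>el A. x \<noteq> y \<longrightarrow> el x \<inter> el y = {}" by (auto simp: A T PR_def)
  qed
  then obtain c where "\<forall>x\<in>el A. \<exists>!z. z \<in> el x \<and> z \<in> el c" by (rule exE)
  then have c: "\<exists>!z. z \<in> el (T x) \<and> z \<in> el c" if "x \<in> S" for x using that A by blast
  define f where "f x = The1 (\<lambda>y. y \<in> el x \<and> pr x y \<in> el c)" for x
  have "f x \<in> el x" if "el x \<subseteq> el a" "x \<noteq> emp" for x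
  proof -
    have "x \<in> S" using that by (simp add: S_def)
    then obtain z where z: "z \<in> el (T x)" "z \<in> el c" "\<And>w. w \<in> el (T x) \<Longrightarrow> w \<in> el c \<Longrightarrow> w = z" using c by blast
    from z(1) obtain y where y: "z = pr x y" "y \<in> el x" by (auto simp: T PR_def)
    have "f x = y" unfolding f_def
    proof (rule The1_eq)
      show "y \<in> el x \<and> pr x y \<in> el c" using y z(2) by auto
      fix w assume w: "w \<in> el x \<and> pr x w \<in> el c"
      have "pr x w = z" by (rule z(3)) (use w T in auto)
      then show "w = y" using y by simp
    qed
    then show ?thesis using y by simp
  qed
  moreover have "DF (\<lambda>e. f (e 0))" unfolding f_def by (intro dfn)
  ultimately show thesis using that by blast
qed

lemma AC:
  assumes Q: "D (\<lambda>e. Q (e 0) (e (Suc 0)))" and "\<And>x. x \<in> el a \<Longrightarrow> \<exists>y. Q x y"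
  obtains f where "\<And>x. x \<in> el a \<Longrightarrow> Q x (app f x)"
proof -
  obtain b where b: "\<And>x. x \<in> el a \<Longrightarrow> \<exists>y\<in>el b. Q x y" using collection[OF Q, of a] assms(2) by metis
  obtain ch where ch: "DF (\<lambda>e. ch (e 0))" "\<And>x. el x \<subseteq> el b \<Longrightarrow> x \<noteq> emp \<Longrightarrow> ch x \<in> el x"
    using choice_function by blast
  define g where "g x = mk {y \<in> el b. Q x y}" for x
  have g: "el (g x) = {y \<in> el b. Q x y}" for x
    unfolding g_def by (rule el_mk, rule separation[OF small_el[of b]]) (auto intro!: dfn lift2[OF _ _ Q])
  have DFg: "DF (\<lambda>e. g (e 0))" unfolding g_def by (intro dfn lift2[OF _ _ Q])
  show thesis
  proof (rule that[of "lam (el a) (\<lambda>x. ch (g x))"])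
    fix x assume x: "x \<in> el a"
    have "app (lam (el a) (\<lambda>x. ch (g x))) x = ch (g x)"
      by (rule app_lam[OF small_el _ x]) (intro liftF1[OF _ ch(1)] DFg)
    moreover have "g x \<noteq> emp" using b[OF x] g[of x] el_emp by auto
    then have "ch (g x) \<in> el (g x)" using g by (intro ch(2)) auto
    ultimately show "Q x (app (lam (el a) (\<lambda>x. ch (g x))) x)" using g by auto
  qed
qed

lemma D_bij [dfn]: "D (\<lambda>e. (\<forall>x\<in>A e. \<forall>y\<in>A e. f e x = f e y \<longrightarrow> x = y) \<and> f e ` A e = B e) \<Longrightarrow> D (\<lambda>e. bij_betw (f e) (A e) (B e))"
  by (simp add: bij_betw_def inj_on_def)

text \<open>Zermelo's recursion: \<open>H\<close> picks an element not yet taken, and returns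
  \<open>a\<close> itself, which is no element of \<open>a\<close>, when none is left. If it never
  stopped, the ordinals would be an image of a set.\<close>

theorem well_ordering: obtains \<alpha> g where "Ord \<alpha>" "bij_betw (app g) (el \<alpha>) (el a)"
proof -
  obtain ch where ch: "DF (\<lambda>e. ch (e 0))" "\<And>x. el x \<subseteq> el a \<Longrightarrow> x \<noteq> emp \<Longrightarrow> ch x \<in> el x"
    using choice_function by blast
  define rest where "rest S = mk (el a - S)" for S
  define G where "G p x f = (if el a \<subseteq> (\<lambda>z. app f z) ` el x then a else ch (mk (el a - (\<lambda>z. app f z) ` el x)))" for p x f :: 'a
  have G: "DF3 G" unfolding DF3_def G_def by (intro dfn liftF1[OF _ ch(1)])
  define H where "H x = Rec G emp x" for x
  have DFH: "DF (\<lambda>e. H (e 0))" unfolding H_def by (intro DF_Rec[OF G] dfn)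
  have H: "H x = (if el a \<subseteq> H ` el x then a else ch (mk (el a - H ` el x)))" if "Ord x" for x
  proof -
    have "(\<lambda>z. app (lam (el x) (\<lambda>y. Rec G emp y)) z) ` el x = H ` el x"
      unfolding H_def by (intro image_cong refl) (simp add: app_lam_Rec[OF G])
    then show ?thesis unfolding H_def by (subst Rec_Ord[OF G that], subst G_def) simp
  qed
  have H2: "H x \<in> el a - H ` el x" if "Ord x" "H x \<noteq> a" for x
  proof -
    have n: "\<not> el a \<subseteq> H ` el x" using that H by auto
    have e: "el (mk (el a - H ` el x)) = el a - H ` el x"
      by (rule el_mk, rule separation[OF small_el[of a]]) (auto intro!: dfn liftF1[OF _ DFH])
    have "mk (el a - H ` el x) \<noteq> emp"
      using n e el_emp by (metis Diff_eq_empty_iff)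
    then have "ch (mk (el a - H ` el x)) \<in> el a - H ` el x" using ch(2)[of "mk (el a - H ` el x)"] e by auto
    then show ?thesis using H[OF that(1)] n by simp
  qed
  have "\<exists>x. Ord x \<and> H x = a"
  proof (rule ccontr)
    assume n: "\<not> ?thesis"
    define g where "g y = The1 (\<lambda>x. Ord x \<and> H x = y)" for y
    have "g (H x) = x" if "Ord x" for x
      unfolding g_def
    proof (rule The1_eq)
      fix z assume z: "Ord z \<and> H z = H x"
      have "z \<notin> el x" "x \<notin> el z" using H2[of x] H2[of z] n z that by (auto simp: image_iff)
      then show "z = x" using Ord_linear[of x z] z that by blast
    qed (use that in simp)
    then have "x \<in> g ` el a" if "Ord x" for x using H2[of x] n that by (metis DiffD1 imageI)
    moreover have "small (g ` el a)"
      by (rule small_image[OF small_el]) (unfold g_def, intro dfn liftF1[OF _ DFH])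
    ultimately show False using no_universal_Ord by blast
  qed
  then obtain x where x: "Ord x" "H x = a" by blast
  have dH: "D (\<lambda>e. H (e 0) = a)" by (intro dfn DFH)
  obtain \<alpha> where \<alpha>: "Ord \<alpha>" "H \<alpha> = a" "\<And>c. Ord c \<Longrightarrow> H c = a \<Longrightarrow> el \<alpha> \<subseteq> el c"
    using Ord_least[OF dH x] by blast
  have ne: "H x \<noteq> a" if "x \<in> el \<alpha>" for x using \<alpha>(3)[of x] Ord_mem[OF \<alpha>(1) that] that mem_irrefl by blast
  have in_a: "H x \<in> el a - H ` el x" if "x \<in> el \<alpha>" for x using H2 ne that Ord_mem[OF \<alpha>(1)] by blast
  have sub: "el a \<subseteq> H ` el \<alpha>"
  proof (rule ccontr)
    assume n: "\<not> el a \<subseteq> H ` el \<alpha>"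
    have e: "el (mk (el a - H ` el \<alpha>)) = el a - H ` el \<alpha>"
      by (rule el_mk, rule separation[OF small_el[of a]]) (auto intro!: dfn liftF1[OF _ DFH])
    then have "mk (el a - H ` el \<alpha>) \<noteq> emp" using n el_emp by (metis Diff_eq_empty_iff)
    then have "ch (mk (el a - H ` el \<alpha>)) \<in> el a" using ch(2)[of "mk (el a - H ` el \<alpha>)"] e by auto
    then show False using H[OF \<alpha>(1)] \<alpha>(2) n mem_irrefl by simp
  qed
  have "bij_betw H (el \<alpha>) (el a)"
    unfolding bij_betw_def
  proof (intro conjI inj_onI equalityI sub)
    fix x y assume xy: "x \<in> el \<alpha>" "y \<in> el \<alpha>" "H x = H y"
    then have "x \<notin> el y" "y \<notin> el x" using in_a by (metis DiffD2 imageI)+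
    then show "x = y" using Ord_linear[of x y] Ord_mem[OF \<alpha>(1)] xy by blast
  qed (use in_a in auto)
  moreover have "app (lam (el \<alpha>) H) x = H x" if "x \<in> el \<alpha>" for x by (rule app_lam[OF small_el DFH that])
  ultimately have "bij_betw (app (lam (el \<alpha>) H)) (el \<alpha>) (el a)" using bij_betw_cong by (metis (no_types, lifting))
  then show thesis using that \<alpha>(1) by blast
qed

text \<open>Coverings are what images and functions of the extension naturally provide. Inclusion
  instead of equality lets the empty set be covered and allows stray values.\<close>

definition sj where "sj q a \<longleftrightarrow> (\<exists>f. el a \<subseteq> (\<lambda>x. app f x) ` el q)"

lemma D_sj [dfn]: "DF s \<Longrightarrow> DF t \<Longrightarrow> D (\<lambda>e. sj (s e) (t e))"
  by (rule lift2; (assumption | (unfold sj_def, intro dfn)))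

lemma sjI: assumes "DF (\<lambda>e. f (e 0))" "el a \<subseteq> f ` el q" shows "sj q a"
  unfolding sj_def
proof
  have "app (lam (el q) f) x = f x" if "x \<in> el q" for x by (rule app_lam[OF small_el assms(1) that])
  then show "el a \<subseteq> (\<lambda>x. app (lam (el q) f) x) ` el q" using assms(2) by auto
qed

lemma sj_trans: assumes "sj q a" "sj a b" shows "sj q b"
proof -
  obtain f g where "el a \<subseteq> (\<lambda>x. app f x) ` el q" "el b \<subseteq> (\<lambda>x. app g x) ` el a" using assms by (auto simp: sj_def)
  then have "el b \<subseteq> (\<lambda>x. app g (app f x)) ` el q" by blast
  then show ?thesis by (rule sjI[rotated]) (intro dfn)
qed

lemma sj_sub: "el a \<subseteq> el q \<Longrightarrow> sj q a"
  by (rule sjI[of "\<lambda>x. x"]) (auto intro: dfn)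

lemma sj_exact:
  assumes "sj q a" "emp \<in> el a" obtains f where "(\<lambda>x. app f x) ` el q = el a"
proof -
  obtain f where f: "el a \<subseteq> (\<lambda>x. app f x) ` el q" using assms(1) by (auto simp: sj_def)
  let ?g = "\<lambda>x. if app f x \<in> el a then app f x else emp"
  have "app (lam (el q) ?g) x = ?g x" if "x \<in> el q" for x
    by (rule app_lam[OF small_el _ that]) (intro dfn)
  then have "(\<lambda>x. app (lam (el q) ?g) x) ` el q = ?g ` el q" by (intro image_cong refl)
  moreover have "?g ` el q = el a" using f assms(2) by auto
  ultimately show thesis using that by simp
qed

text \<open>A map of \<open>q\<close> onto an ordinal pulls membership back to a relation on
  \<open>q\<close>, and this relation determines the ordinal. If \<open>q\<close> covered all
  ordinals, they would be an image of the set of relations on \<open>q\<close>.\<close>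

theorem hartogs: "\<exists>\<alpha>. Ord \<alpha> \<and> \<not> sj q \<alpha>"
proof (rule ccontr)
  assume "\<not> ?thesis"
  then have s: "\<And>\<alpha>. Ord \<alpha> \<Longrightarrow> sj q \<alpha>" by blast
  define W where "W r a f \<longleftrightarrow> (\<lambda>x. app f x) ` el q = el a \<and>
    (\<forall>x\<in>el q. \<forall>y\<in>el q. pr x y \<in> el r \<longleftrightarrow> app f x \<in> el (app f y))" for r a f
  have DW: "DF s \<Longrightarrow> DF t \<Longrightarrow> DF u \<Longrightarrow> D (\<lambda>e. W (s e) (t e) (u e))" for s t u
    by (rule lift3; (assumption | (unfold W_def, intro dfn)))
  \<comment> \<open>Equal pulled-back relations force equal maps: by induction on the value, each
    value is the set of the values at its predecessors in the relation.\<close>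
  have sub: "app f' x = app f x"
    if "W r a f" "W r a' f'" "Ord a" "Ord a'" "x \<in> el q" for r a a' f f' x
  proof -
    have "\<forall>x\<in>el q. app f x = b \<longrightarrow> app f' x = b" if "Ord b" for b
    proof (rule Ord_induct[OF _ _ that])
      show "D (\<lambda>e. \<forall>x\<in>el q. app f x = e 0 \<longrightarrow> app f' x = e 0)" by (intro dfn)
      fix b assume "Ord b" and IH: "\<And>c. c \<in> el b \<Longrightarrow> \<forall>x\<in>el q. app f x = c \<longrightarrow> app f' x = c"
      show "\<forall>x\<in>el q. app f x = b \<longrightarrow> app f' x = b"
      proof (intro ballI impI ext equalityI subsetI)
        fix x c assume x: "x \<in> el q" "app f x = b" and c: "c \<in> el (app f' x)"
        have "app f' x \<in> el a'" using \<open>W r a' f'\<close> x(1) by (auto simp: W_def)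
        then have "c \<in> (\<lambda>x. app f' x) ` el q" using Ord_trans[OF \<open>Ord a'\<close> _ c] \<open>W r a' f'\<close> by (simp add: W_def)
        then obtain y where y: "y \<in> el q" "c = app f' y" by auto
        then have "app f y \<in> el b" using c x \<open>W r a f\<close> \<open>W r a' f'\<close> by (auto simp: W_def)
        then show "c \<in> el b" using IH y by metis
      next
        fix x c assume x: "x \<in> el q" "app f x = b" and c: "c \<in> el b"
        have "b \<in> el a" using \<open>W r a f\<close> x by (auto simp: W_def)
        then have "c \<in> (\<lambda>x. app f x) ` el q" using Ord_trans[OF \<open>Ord a\<close> _ c] \<open>W r a f\<close> by (simp add: W_def)
        then obtain y where y: "y \<in> el q" "c = app f y" by auto
        then have "app f' y \<in> el (app f' x)" using c x \<open>W r a f\<close> \<open>W r a' f'\<close> by (auto simp: W_def)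
        then show "c \<in> el (app f' x)" using IH[OF c] y by metis
      qed
    qed
    moreover have "Ord (app f x)" using \<open>W r a f\<close> \<open>Ord a\<close> \<open>x \<in> el q\<close> Ord_mem[of a "app f x"] by (auto simp: W_def)
    ultimately show ?thesis using \<open>x \<in> el q\<close> by blast
  qed
  define F where "F r = The1 (\<lambda>a. Ord a \<and> (\<exists>f. W r a f))" for r
  have sp: "small {r. el r \<subseteq> PR (el q) (el q)}" using small_pow[of "mk (PR (el q) (el q))"] by (simp add: el_mk)
  have "small (insert emp (F ` {r. el r \<subseteq> PR (el q) (el q)}))"
    by (intro small_insert small_image[OF sp]) (unfold F_def, intro dfn DW)
  moreover have "a \<in> insert emp (F ` {r. el r \<subseteq> PR (el q) (el q)})" if a: "Ord a" for a
  proof (cases "a = emp")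
    case False
    then have "emp \<in> el a" using Ord_linear[OF a Ord_emp] by auto
    then obtain f where f: "(\<lambda>x. app f x) ` el q = el a" using sj_exact[OF s[OF a]] by blast
    define r where "r = mk {p \<in> PR (el q) (el q). app f (fs p) \<in> el (app f (sn p))}"
    have r: "el r = {p \<in> PR (el q) (el q). app f (fs p) \<in> el (app f (sn p))}"
      unfolding r_def by (rule el_mk, rule separation[OF small_PR[of "el q" "el q"]]) (auto intro!: dfn)
    have W: "W r a f" unfolding W_def r using f by simp
    have "F r = a"
      unfolding F_def
    proof (rule The1_eq)
      show "Ord a \<and> (\<exists>f. W r a f)" using W a by blast
      fix a' assume "Ord a' \<and> (\<exists>f. W r a' f)"
      then obtain f' where f': "Ord a'" "W r a' f'" by blast
      have "(\<lambda>x. app f' x) ` el q = (\<lambda>x. app f x) ` el q"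
        using sub[OF W f'(2) a f'(1)] by (intro image_cong refl)
      then show "a' = a" using f' W by (intro ext) (auto simp: W_def)
    qed
    then show ?thesis using r by blast
  qed simp
  ultimately show False using no_universal_Ord by blast
qed

subsection \<open>Finite sets\<close>

text \<open>Kuratowski finiteness: induction by adjoining one element is immediate, and no counting
  function has to be carried along.\<close>

definition fin where
  "fin x \<longleftrightarrow> (\<forall>K. emp \<in> el K \<longrightarrow> (\<forall>y\<in>el K. \<forall>a\<in>el x. un y (sg a) \<in> el K) \<longrightarrow> x \<in> el K)"

lemma D_fin [dfn]: "DF s \<Longrightarrow> D (\<lambda>e. fin (s e))"
  by (rule lift1; (assumption | (unfold fin_def, intro dfn)))

lemma fin_emp [simp]: "fin emp" by (simp add: fin_def)
lemma fin_insert: "fin x \<Longrightarrow> fin (un x (sg a))" unfolding fin_def by simp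

lemma fin_induct:
  assumes P: "D (\<lambda>e. P (e 0))" and "fin x" "P emp"
    "\<And>y a. fin y \<Longrightarrow> el y \<subseteq> el x \<Longrightarrow> P y \<Longrightarrow> a \<in> el x \<Longrightarrow> P (un y (sg a))"
  shows "P x"
proof -
  define K where "K = mk {y. el y \<subseteq> el x \<and> fin y \<and> P y}"
  have K: "el K = {y. el y \<subseteq> el x \<and> fin y \<and> P y}"
    unfolding K_def by (rule el_mk, rule separation[OF small_pow[of x]]) (auto intro!: dfn P)
  have "x \<in> el K"
    using assms(2)[unfolded fin_def, rule_format, of K] assms(3,4) fin_insert by (auto simp: K)
  then show ?thesis by (simp add: K)
qed

lemma un_sg: "el y = insert a (el x) \<Longrightarrow> y = un x (sg a)" by (rule ext) simp

lemma fin_sub: assumes "fin x" "el y \<subseteq> el x" shows "fin y"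
proof -
  have "\<forall>y. el y \<subseteq> el x \<longrightarrow> fin y"
  proof (rule fin_induct[OF _ assms(1)])
    show "D (\<lambda>e. \<forall>y. el y \<subseteq> el (e 0) \<longrightarrow> fin y)" by (intro dfn)
    show "\<forall>y. el y \<subseteq> el emp \<longrightarrow> fin y" using ext[of _ emp] fin_emp by (metis el_emp subset_empty)
    fix z a assume IH: "\<forall>y. el y \<subseteq> el z \<longrightarrow> fin y"
    show "\<forall>y. el y \<subseteq> el (un z (sg a)) \<longrightarrow> fin y"
    proof (intro allI impI)
      fix y assume y: "el y \<subseteq> el (un z (sg a))"
      define w where "w = mk (el y - {a})"
      have w: "el w = el y - {a}"
        unfolding w_def by (rule el_mk, rule separation[OF small_el[of y]]) (auto intro!: dfn)
      then have "fin w" using IH y by auto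
      moreover have "y = w \<or> y = un w (sg a)"
      proof (cases "a \<in> el y")
        case True
        then have "y = un w (sg a)" using w by (intro un_sg) auto
        then show ?thesis ..
      next
        case False
        then have "el y = el w" using w by auto
        then show ?thesis using ext by blast
      qed
      ultimately show "fin y" using fin_insert by auto
    qed
  qed
  then show ?thesis using assms(2) by blast
qed

lemma fin_image: assumes f: "DF (\<lambda>e. f (e 0))" and "fin x" shows "fin (mk (f ` el x))"
proof -
  have s: "small (f ` el x)" for x by (rule small_image[OF small_el f])
  show ?thesis
  proof (rule fin_induct[OF _ assms(2)])
    show "D (\<lambda>e. fin (mk (f ` el (e 0))))" by (intro dfn liftF1[OF _ f])
    have "mk (f ` el emp) = emp" by (rule mk_eq) simp
    then show "fin (mk (f ` el emp))" by simp
    fix y a assume "fin (mk (f ` el y))"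
    moreover have "mk (f ` el (un y (sg a))) = un (mk (f ` el y)) (sg (f a))"
      using s[of y] by (intro mk_eq) (auto simp: el_mk)
    ultimately show "fin (mk (f ` el (un y (sg a))))" using fin_insert by simp
  qed
qed

lemma fin_un: assumes "fin x" "fin y" shows "fin (un x y)"
proof -
  have "fin (un x z)" if "fin z" for z
  proof (rule fin_induct[OF _ that])
    show "D (\<lambda>e. fin (un x (e 0)))" by (intro dfn)
    have "un x emp = x" by (rule ext) simp
    then show "fin (un x emp)" using assms by simp
    fix w a assume "fin (un x w)"
    moreover have "un x (un w (sg a)) = un (un x w) (sg a)" by (rule ext) auto
    ultimately show "fin (un x (un w (sg a)))" using fin_insert by simp
  qed
  then show ?thesis using assms by blast
qed

lemma om_sc_bound: "m \<in> el om \<Longrightarrow> n \<in> el om \<Longrightarrow> \<exists>k\<in>el om. el m \<subseteq> el k \<and> n \<in> el k"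
proof -
  assume "m \<in> el om" "n \<in> el om"
  then obtain k where "k \<in> el om" "el m \<subseteq> el k" "el (sc n) \<subseteq> el k" using lim_max[OF lim_om, of m "sc n"] sc_om by metis
  then show ?thesis by auto
qed

lemma fin_bound:
  assumes f: "DF (\<lambda>e. f (e 0))" and "fin x" shows "\<exists>m\<in>el om. \<forall>y\<in>el x. f y \<in> el om \<longrightarrow> f y \<in> el m"
proof (rule fin_induct[OF _ assms(2)])
  show "D (\<lambda>e. \<exists>m\<in>el om. \<forall>y\<in>el (e 0). f y \<in> el om \<longrightarrow> f y \<in> el m)" by (intro dfn liftF1[OF _ f])
  show "\<exists>m\<in>el om. \<forall>y\<in>el emp. f y \<in> el om \<longrightarrow> f y \<in> el m" by (intro bexI[of _ emp]) auto
  fix y a assume "\<exists>m\<in>el om. \<forall>y\<in>el y. f y \<in> el om \<longrightarrow> f y \<in> el m"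
  then obtain m where m: "m \<in> el om" "\<forall>y\<in>el y. f y \<in> el om \<longrightarrow> f y \<in> el m" by blast
  show "\<exists>m\<in>el om. \<forall>y\<in>el (un y (sg a)). f y \<in> el om \<longrightarrow> f y \<in> el m"
  proof (cases "f a \<in> el om")
    case True
    then obtain k where "k \<in> el om" "el m \<subseteq> el k" "f a \<in> el k" using om_sc_bound m(1) by blast
    then show ?thesis using m by auto
  next
    case False
    then show ?thesis using m by auto
  qed
qed

lemma fin_enum: assumes "fin x" shows "\<exists>n\<in>el om. sj n x"
proof (rule fin_induct[OF _ assms])
  show "D (\<lambda>e. \<exists>n\<in>el om. sj n (e 0))" by (intro dfn)
  have "sj emp emp" by (rule sj_sub) simp
  then show "\<exists>n\<in>el om. sj n emp" using emp_om by blast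
  fix y a assume "\<exists>n\<in>el om. sj n y"
  then obtain n f where n: "n \<in> el om" "el y \<subseteq> (\<lambda>x. app f x) ` el n" by (auto simp: sj_def)
  have "sj (sc n) (un y (sg a))"
  proof (rule sjI[of "\<lambda>k. if k = n then a else app f k"])
    show "DF (\<lambda>e. if e 0 = n then a else app f (e 0))" by (intro dfn)
    have "app f k \<in> (\<lambda>k. if k = n then a else app f k) ` el (sc n)" if "k \<in> el n" for k
      using that mem_irrefl by (intro image_eqI[of _ _ k]) auto
    then show "el (un y (sg a)) \<subseteq> (\<lambda>k. if k = n then a else app f k) ` el (sc n)" using n(2) by auto
  qed
  then show "\<exists>n\<in>el om. sj n (un y (sg a))" using n(1) sc_om by blast
qed

lemma V_lim_fin:
  assumes "lim a" "fin x" "el x \<subseteq> el (V B a)" shows "x \<in> el (V B a)"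
proof -
  have o: "Ord a" using assms(1) by (simp add: lim_def)
  have "el x \<subseteq> el (V B a) \<longrightarrow> (\<exists>b\<in>el a. el x \<subseteq> el (V B b))"
  proof (rule fin_induct[OF _ assms(2)])
    show "D (\<lambda>e. el (e 0) \<subseteq> el (V B a) \<longrightarrow> (\<exists>b\<in>el a. el (e 0) \<subseteq> el (V B b)))" by (intro dfn)
    show "el emp \<subseteq> el (V B a) \<longrightarrow> (\<exists>b\<in>el a. el emp \<subseteq> el (V B b))" using assms(1) by (auto simp: lim_def)
    fix y z assume IH: "el y \<subseteq> el (V B a) \<longrightarrow> (\<exists>b\<in>el a. el y \<subseteq> el (V B b))"
    show "el (un y (sg z)) \<subseteq> el (V B a) \<longrightarrow> (\<exists>b\<in>el a. el (un y (sg z)) \<subseteq> el (V B b))"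
    proof
      assume "el (un y (sg z)) \<subseteq> el (V B a)"
      then have yz: "el y \<subseteq> el (V B a)" "z \<in> el (V B a)" by auto
      then obtain b where b: "b \<in> el a" "el y \<subseteq> el (V B b)" using IH by blast
      obtain c where "c \<in> el a" "z \<in> el (V B c)" using V_lim_stage[OF assms(1) yz(2)] by blast
      with b have bc: "b \<in> el a" "el y \<subseteq> el (V B b)" "c \<in> el a" "z \<in> el (V B c)" by blast+
      then obtain d where d: "d \<in> el a" "el b \<subseteq> el d" "el c \<subseteq> el d" using lim_max assms(1) by metis
      have "Ord b" "Ord c" "Ord d" using bc d o Ord_mem by blast+
      have "el y \<subseteq> el (V B d)" "z \<in> el (V B d)"
        using V_mono[of d b B] V_mono[of d c B] bc d \<open>Ord b\<close> \<open>Ord c\<close> \<open>Ord d\<close> by blast+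
      then have "el (un y (sg z)) \<subseteq> el (V B d)" by simp
      then show "\<exists>b\<in>el a. el (un y (sg z)) \<subseteq> el (V B b)" using d by blast
    qed
  qed
  then show ?thesis using assms(3) V_intro[OF o] by blast
qed

end

section \<open>Forcing\<close>

text \<open>Genericity in this form covers dense classes, where the second alternative is
  impossible, and also gives at once that some condition in \<open>G\<close> decides any definable
  class. The truth lemma and the verification of the axioms use it in the latter way.\<close>

locale forcing = zfc E for E :: "nat \<Rightarrow> nat \<Rightarrow> bool" +
  fixes P :: nat and leq :: "nat \<Rightarrow> nat \<Rightarrow> bool" and G :: "nat set"
  assumes D_leq0: "D (\<lambda>e. leq (e 0) (e (Suc 0)))"
    and leq_P: "leq p q \<Longrightarrow> p \<in> el P \<and> q \<in> el P"
    and leq_refl: "p \<in> el P \<Longrightarrow> leq p p"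
    and leq_trans: "leq p q \<Longrightarrow> leq q r \<Longrightarrow> leq p r"
    and G_P: "G \<subseteq> el P" and G_ne: "G \<noteq> {}"
    and G_up: "p \<in> G \<Longrightarrow> leq p q \<Longrightarrow> q \<in> G"
    and G_dir: "p \<in> G \<Longrightarrow> q \<in> G \<Longrightarrow> \<exists>r\<in>G. leq r p \<and> leq r q"
    and G_gen: "D (\<lambda>e. e 0 \<in> Q) \<Longrightarrow> (\<exists>p\<in>G. p \<in> Q) \<or> (\<exists>p\<in>G. \<forall>q. leq q p \<longrightarrow> q \<notin> Q)"
begin

lemma D_leq [dfn]: "DF s \<Longrightarrow> DF t \<Longrightarrow> D (\<lambda>e. leq (s e) (t e))"
  by (rule lift2[OF _ _ D_leq0])

text \<open>Forced equality of names is the greatest bisimulation; as bisimulations may be taken to be sets,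
  no recursion on names is needed to define it.\<close>

definition clause where
  "clause K x y p \<longleftrightarrow>
    (\<forall>u r q. pr u r \<in> el x \<and> leq q p \<and> leq q r \<longrightarrow> (\<exists>q' v s. leq q' q \<and> pr v s \<in> el y \<and> leq q' s \<and> K u v q')) \<and>
    (\<forall>v s q. pr v s \<in> el y \<and> leq q p \<and> leq q s \<longrightarrow> (\<exists>q' u r. leq q' q \<and> pr u r \<in> el x \<and> leq q' r \<and> K u v q'))"

definition bis where
  "bis R \<longleftrightarrow> (\<forall>x y p. pr (pr x y) p \<in> el R \<longrightarrow> clause (\<lambda>u v q. pr (pr u v) q \<in> el R) x y p)"
definition feq where "feq x y p \<longleftrightarrow> p \<in> el P \<and> (\<exists>R. bis R \<and> pr (pr x y) p \<in> el R)"
definition fmem where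
  "fmem x y p \<longleftrightarrow> p \<in> el P \<and> (\<forall>q. leq q p \<longrightarrow> (\<exists>q' v s. leq q' q \<and> pr v s \<in> el y \<and> leq q' s \<and> feq x v q'))"

lemma D_bis [dfn]: "DF s \<Longrightarrow> D (\<lambda>e. bis (s e))"
  by (rule lift1; (assumption | (unfold bis_def clause_def, intro dfn)))
lemma D_feq [dfn]: "DF s \<Longrightarrow> DF t \<Longrightarrow> DF u \<Longrightarrow> D (\<lambda>e. feq (s e) (t e) (u e))"
  by (rule lift3; (assumption | (unfold feq_def, intro dfn)))
lemma D_fmem [dfn]: "DF s \<Longrightarrow> DF t \<Longrightarrow> DF u \<Longrightarrow> D (\<lambda>e. fmem (s e) (t e) (u e))"
  by (rule lift3; (assumption | (unfold fmem_def, intro dfn)))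

lemma clause_mono:
  assumes "clause K x y p"
    and "\<And>u v r s q. pr u r \<in> el x \<Longrightarrow> pr v s \<in> el y \<Longrightarrow> q \<in> el P \<Longrightarrow> K u v q \<Longrightarrow> K' u v q"
  shows "clause K' x y p"
  unfolding clause_def
proof (intro conjI allI impI)
  fix u r q assume "pr u r \<in> el x \<and> leq q p \<and> leq q r"
  moreover then obtain q' v s where "leq q' q \<and> pr v s \<in> el y \<and> leq q' s \<and> K u v q'"
    using assms(1) unfolding clause_def by meson
  ultimately show "\<exists>q' v s. leq q' q \<and> pr v s \<in> el y \<and> leq q' s \<and> K' u v q'" using assms(2) leq_P by blast
next
  fix v s q assume "pr v s \<in> el y \<and> leq q p \<and> leq q s"
  moreover then obtain q' u r where "leq q' q \<and> pr u r \<in> el x \<and> leq q' r \<and> K u v q'"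
    using assms(1) unfolding clause_def by meson
  ultimately show "\<exists>q' u r. leq q' q \<and> pr u r \<in> el x \<and> leq q' r \<and> K' u v q'" using assms(2) leq_P by blast
qed

text \<open>The fixed point property. For the converse direction, \<open>feq\<close> is restricted
  to a transitive set containing both names, to make it a set, and the new triple is added to
  it.\<close>

lemma feq_unfold: assumes "p \<in> el P" shows "feq x y p \<longleftrightarrow> clause feq x y p"
proof
  assume "feq x y p"
  then obtain R where R: "bis R" "pr (pr x y) p \<in> el R" by (auto simp: feq_def)
  then have "clause (\<lambda>u v q. pr (pr u v) q \<in> el R) x y p" by (simp add: bis_def)
  then show "clause feq x y p" by (rule clause_mono) (use R(1) in \<open>auto simp: feq_def\<close>)
next
  assume c: "clause feq x y p"
  obtain t where t: "trans t" "upr x y \<in> el t" using cover by blast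
  then have xy: "x \<in> el t" "y \<in> el t" by (auto simp: trans_def)
  define S where "S = {z \<in> PR (PR (el t) (el t)) (el P). feq (fs (fs z)) (sn (fs z)) (sn z)}"
  have "small S" unfolding S_def by (rule separation[of "PR (PR (el t) (el t)) (el P)"]) (auto intro!: dfn)
  then have R: "el (mk (insert (pr (pr x y) p) S)) = insert (pr (pr x y) p) S" by (intro el_mk small_insert)
  have inS: "pr (pr u v) q \<in> S \<longleftrightarrow> u \<in> el t \<and> v \<in> el t \<and> q \<in> el P \<and> feq u v q" for u v q
    by (auto simp: S_def)
  have "bis (mk (insert (pr (pr x y) p) S))"
    unfolding bis_def R
  proof (intro allI impI)
    fix u v q assume *: "pr (pr u v) q \<in> insert (pr (pr x y) p) S"
    then have uv: "u \<in> el t" "v \<in> el t" using inS xy by auto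
    have "clause feq u v q"
    proof (cases "pr (pr u v) q \<in> S")
      case True
      then obtain R' where R': "bis R'" "pr (pr u v) q \<in> el R'" using inS by (auto simp: feq_def)
      then have "clause (\<lambda>u v q. pr (pr u v) q \<in> el R') u v q" by (simp add: bis_def)
      then show ?thesis by (rule clause_mono) (use R'(1) in \<open>auto simp: feq_def\<close>)
    qed (use * c in simp)
    then show "clause (\<lambda>u v q. pr (pr u v) q \<in> insert (pr (pr x y) p) S) u v q"
    proof (rule clause_mono)
      fix u' v' r s q' assume "pr u' r \<in> el u" "pr v' s \<in> el v" "q' \<in> el P" "feq u' v' q'"
      moreover then have "u' \<in> el t" "v' \<in> el t" using uv t(1) trans_pr[OF t(1)] unfolding trans_def by blast+
      ultimately show "pr (pr u' v') q' \<in> insert (pr (pr x y) p) S" using inS by blast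
    qed
  qed
  then show "feq x y p" unfolding feq_def using assms R by blast
qed

lemma feq_P: "feq x y p \<Longrightarrow> p \<in> el P" by (simp add: feq_def)
lemma fmem_P: "fmem x y p \<Longrightarrow> p \<in> el P" by (simp add: fmem_def)

lemma feq1: "feq x y p \<Longrightarrow> pr u r \<in> el x \<Longrightarrow> leq q p \<Longrightarrow> leq q r \<Longrightarrow> \<exists>q' v s. leq q' q \<and> pr v s \<in> el y \<and> leq q' s \<and> feq u v q'"
  using feq_unfold[OF feq_P] unfolding clause_def by blast
lemma feq2: "feq x y p \<Longrightarrow> pr v s \<in> el y \<Longrightarrow> leq q p \<Longrightarrow> leq q s \<Longrightarrow> \<exists>q' u r. leq q' q \<and> pr u r \<in> el x \<and> leq q' r \<and> feq u v q'"
  using feq_unfold[OF feq_P] unfolding clause_def by blast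
lemma feqI:
  assumes "p \<in> el P"
    "\<And>u r q. pr u r \<in> el x \<Longrightarrow> leq q p \<Longrightarrow> leq q r \<Longrightarrow> \<exists>q' v s. leq q' q \<and> pr v s \<in> el y \<and> leq q' s \<and> feq u v q'"
    "\<And>v s q. pr v s \<in> el y \<Longrightarrow> leq q p \<Longrightarrow> leq q s \<Longrightarrow> \<exists>q' u r. leq q' q \<and> pr u r \<in> el x \<and> leq q' r \<and> feq u v q'"
  shows "feq x y p"
  unfolding feq_unfold[OF assms(1)] clause_def using assms(2,3) by blast

lemma feq_down: "feq x y p \<Longrightarrow> leq q p \<Longrightarrow> feq x y q"
proof -
  assume a: "feq x y p" "leq q p"
  show ?thesis
    by (rule feqI) (use a leq_P leq_trans feq1[OF a(1)] feq2[OF a(1)] in blast)+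
qed
lemma feq_reg:
  assumes "p \<in> el P" "\<And>q. leq q p \<Longrightarrow> \<exists>q'. leq q' q \<and> feq x y q'" shows "feq x y p"
proof (rule feqI[OF assms(1)])
  fix u r q assume a: "pr u r \<in> el x" "leq q p" "leq q r"
  obtain q1 where q1: "leq q1 q" "feq x y q1" using assms(2)[OF a(2)] by blast
  have "leq q1 q1" using leq_refl leq_P q1 by blast
  from feq1[OF q1(2) a(1) this leq_trans[OF q1(1) a(3)]] 
  show "\<exists>q' v s. leq q' q \<and> pr v s \<in> el y \<and> leq q' s \<and> feq u v q'" using leq_trans q1(1) by blast
next
  fix v s q assume a: "pr v s \<in> el y" "leq q p" "leq q s"
  obtain q1 where q1: "leq q1 q" "feq x y q1" using assms(2)[OF a(2)] by blast
  have "leq q1 q1" using leq_refl leq_P q1 by blast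
  from feq2[OF q1(2) a(1) this leq_trans[OF q1(1) a(3)]] 
  show "\<exists>q' u r. leq q' q \<and> pr u r \<in> el x \<and> leq q' r \<and> feq u v q'" using leq_trans q1(1) by blast
qed

lemma feq_refl: assumes "p \<in> el P" shows "feq x x p"
proof -
  have "\<forall>p\<in>el P. feq x x p"
  proof (rule name_induct[where x = x])
    show "D (\<lambda>e. \<forall>p\<in>el P. feq (e 0) (e 0) p)" by (intro dfn)
    fix x assume IH: "\<And>u p. pr u p \<in> el x \<Longrightarrow> \<forall>p\<in>el P. feq u u p"
    show "\<forall>p\<in>el P. feq x x p"
    proof
      fix p assume p: "p \<in> el P"
      show "feq x x p" by (rule feqI[OF p]) (use IH leq_refl leq_P in blast)+
    qed
  qed
  then show ?thesis using assms by blast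
qed

lemma feq_sym: assumes "feq x y p" shows "feq y x p"
proof -
  have "\<forall>y p. feq x y p \<longrightarrow> feq y x p"
  proof (rule name_induct[where x = x])
    show "D (\<lambda>e. \<forall>y p. feq (e 0) y p \<longrightarrow> feq y (e 0) p)" by (intro dfn)
    fix x assume IH: "\<And>u p. pr u p \<in> el x \<Longrightarrow> \<forall>y p. feq u y p \<longrightarrow> feq y u p"
    show "\<forall>y p. feq x y p \<longrightarrow> feq y x p"
    proof (intro allI impI)
      fix y p assume a: "feq x y p"
      show "feq y x p"
        by (rule feqI[OF feq_P[OF a]]) (use IH feq1[OF a] feq2[OF a] in blast)+
    qed
  qed
  then show ?thesis using assms by blast
qed

lemma feq_trans: assumes "feq x y p" "feq y z p" shows "feq x z p"
proof -
  have "\<forall>y z p. feq x y p \<longrightarrow> feq y z p \<longrightarrow> feq x z p"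
  proof (rule name_induct[where x = x])
    show "D (\<lambda>e. \<forall>y z p. feq (e 0) y p \<longrightarrow> feq y z p \<longrightarrow> feq (e 0) z p)" by (intro dfn)
    fix x assume IH: "\<And>u p. pr u p \<in> el x \<Longrightarrow> \<forall>y z p. feq u y p \<longrightarrow> feq y z p \<longrightarrow> feq u z p"
    show "\<forall>y z p. feq x y p \<longrightarrow> feq y z p \<longrightarrow> feq x z p"
    proof (intro allI impI)
      fix y z p assume xy: "feq x y p" and yz: "feq y z p"
      show "feq x z p"
      proof (rule feqI[OF feq_P[OF xy]])
        fix u r q assume u: "pr u r \<in> el x" "leq q p" "leq q r"
        obtain q1 v s where q1: "leq q1 q" "pr v s \<in> el y" "leq q1 s" "feq u v q1" using feq1[OF xy u] by blast
        obtain q2 w k where q2: "leq q2 q1" "pr w k \<in> el z" "leq q2 k" "feq v w q2"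
          using feq1[OF yz q1(2) leq_trans[OF q1(1) u(2)] q1(3)] by blast
        have "feq u w q2" using IH[OF u(1)] feq_down[OF q1(4) q2(1)] q2(4) by blast
        then show "\<exists>q' v s. leq q' q \<and> pr v s \<in> el z \<and> leq q' s \<and> feq u v q'"
          using q2 leq_trans[OF q2(1) q1(1)] by blast
      next
        fix w k q assume w: "pr w k \<in> el z" "leq q p" "leq q k"
        obtain q1 v s where q1: "leq q1 q" "pr v s \<in> el y" "leq q1 s" "feq v w q1" using feq2[OF yz w] by blast
        obtain q2 u r where q2: "leq q2 q1" "pr u r \<in> el x" "leq q2 r" "feq u v q2"
          using feq2[OF xy q1(2) leq_trans[OF q1(1) w(2)] q1(3)] by blast
        have "feq u w q2" using IH[OF q2(2)] feq_down[OF q1(4) q2(1)] q2(4) by blast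
        then show "\<exists>q' u r. leq q' q \<and> pr u r \<in> el x \<and> leq q' r \<and> feq u w q'"
          using q2 leq_trans[OF q2(1) q1(1)] by blast
      qed
    qed
  qed
  then show ?thesis using assms by blast
qed

lemma fmemD: "fmem x y p \<Longrightarrow> leq q p \<Longrightarrow> \<exists>q' v s. leq q' q \<and> pr v s \<in> el y \<and> leq q' s \<and> feq x v q'"
  by (simp add: fmem_def)
lemma fmem_down: "fmem x y p \<Longrightarrow> leq q p \<Longrightarrow> fmem x y q"
  unfolding fmem_def using leq_P leq_trans by blast
lemma fmem_reg:
  assumes "p \<in> el P" "\<And>q. leq q p \<Longrightarrow> \<exists>q'. leq q' q \<and> fmem x y q'" shows "fmem x y p"
  unfolding fmem_def
proof (intro conjI allI impI assms(1))
  fix q assume "leq q p"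
  then obtain q1 where q1: "leq q1 q" "fmem x y q1" using assms(2) by blast
  then have "leq q1 q1" using leq_refl leq_P by blast
  then show "\<exists>q' v s. leq q' q \<and> pr v s \<in> el y \<and> leq q' s \<and> feq x v q'"
    using fmemD[OF q1(2)] q1(1) leq_trans by blast
qed
lemma fmem_cong1: "fmem x y p \<Longrightarrow> feq x x' p \<Longrightarrow> fmem x' y p"
  unfolding fmem_def using feq_sym feq_trans feq_down leq_trans by (metis (no_types, lifting))
lemma fmem_cong2: assumes m: "fmem x y p" and e: "feq y y' p" shows "fmem x y' p"
  unfolding fmem_def
proof (intro conjI allI impI fmem_P[OF m])
  fix q assume q: "leq q p"
  obtain q1 v s where q1: "leq q1 q" "pr v s \<in> el y" "leq q1 s" "feq x v q1" using fmemD[OF m q] by blast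
  obtain q2 w k where q2: "leq q2 q1" "pr w k \<in> el y'" "leq q2 k" "feq v w q2"
    using feq1[OF e q1(2) leq_trans[OF q1(1) q] q1(3)] by blast
  then have "feq x w q2" using feq_trans feq_down q1(4) by blast
  then show "\<exists>q' v s. leq q' q \<and> pr v s \<in> el y' \<and> leq q' s \<and> feq x v q'"
    using q2 leq_trans[OF q2(1) q1(1)] by blast
qed

section \<open>Values of names with respect to the filter\<close>

definition teq where "teq x y \<longleftrightarrow> (\<exists>p\<in>G. feq x y p)"
definition tmem where "tmem x y \<longleftrightarrow> (\<exists>p\<in>G. fmem x y p)"

lemma teq_equivp: "equivp teq"
proof (intro equivpI reflpI sympI transpI)
  show "teq x x" for x unfolding teq_def using feq_refl G_ne G_P by blast
  show "teq x y \<Longrightarrow> teq y x" for x y unfolding teq_def using feq_sym by blast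
  show "teq x z" if xyz: "teq x y" "teq y z" for x y z
  proof -
    obtain p q where "p \<in> G" "feq x y p" "q \<in> G" "feq y z q" using xyz by (auto simp: teq_def)
    moreover obtain r where "r \<in> G" "leq r p" "leq r q" using G_dir calculation by blast
    ultimately show ?thesis unfolding teq_def using feq_trans feq_down by blast
  qed
qed
lemma teq_refl: "teq x x" using teq_equivp equivp_reflp by metis
lemma teq_sym: "teq x y \<Longrightarrow> teq y x" using teq_equivp equivp_symp by metis
lemma tmem_cong: assumes "teq x x'" "teq y y'" "tmem x y" shows "tmem x' y'"
proof -
  obtain p q r where *: "p \<in> G" "feq x x' p" "q \<in> G" "feq y y' q" "r \<in> G" "fmem x y r"
    using assms by (auto simp: teq_def tmem_def)
  obtain k where k: "k \<in> G" "leq k p" "leq k q" using G_dir * by blast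
  obtain l where l: "l \<in> G" "leq l k" "leq l r" using G_dir * k by blast
  have "fmem x y l" "feq x x' l" "feq y y' l" using * k l fmem_down feq_down leq_trans by blast+
  then show ?thesis unfolding tmem_def using l(1) fmem_cong1 fmem_cong2 by blast
qed

text \<open>Below a condition that forces membership, the conditions placing \<open>x\<close> at
  some pair of \<open>y\<close> are dense, so \<open>G\<close> contains one of them.\<close>

lemma tmem_iff: "tmem x y \<longleftrightarrow> (\<exists>v s. pr v s \<in> el y \<and> s \<in> G \<and> teq x v)"
proof
  assume "tmem x y"
  then obtain p where p: "p \<in> G" "fmem x y p" by (auto simp: tmem_def)
  define Q where "Q = {q. \<exists>v s. pr v s \<in> el y \<and> leq q s \<and> feq x v q}"
  have "D (\<lambda>e. e 0 \<in> Q)" unfolding Q_def by (intro dfn)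
  from G_gen[OF this] show "\<exists>v s. pr v s \<in> el y \<and> s \<in> G \<and> teq x v"
  proof
    assume "\<exists>p\<in>G. p \<in> Q" then show ?thesis unfolding Q_def teq_def using G_up by blast
  next
    assume "\<exists>p\<in>G. \<forall>q. leq q p \<longrightarrow> q \<notin> Q"
    then obtain p' where p': "p' \<in> G" "\<forall>q. leq q p' \<longrightarrow> q \<notin> Q" by blast
    obtain r where "r \<in> G" "leq r p" "leq r p'" using G_dir p(1) p'(1) by blast
    then have False using fmemD[OF p(2)] p'(2) leq_trans unfolding Q_def by blast
    then show ?thesis ..
  qed
next
  assume "\<exists>v s. pr v s \<in> el y \<and> s \<in> G \<and> teq x v"
  then obtain v s p where *: "pr v s \<in> el y" "s \<in> G" "p \<in> G" "feq x v p" by (auto simp: teq_def)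
  obtain r where r: "r \<in> G" "leq r s" "leq r p" using G_dir * by blast
  have "fmem x y r" unfolding fmem_def
    using r * G_P leq_refl leq_trans feq_down leq_P by blast
  then show "tmem x y" unfolding tmem_def using r(1) by blast
qed

text \<open>Check names use all conditions at every pair, since the partial order is not assumed to
  have a greatest element.\<close>

definition Cstep where "Cstep A x f = mk {z. \<exists>y\<in>el x. \<exists>p\<in>el A. z = pr (app f y) p}"
definition chk where "chk x = Rec Cstep P x"

lemma DF3_Cstep: "DF3 Cstep" unfolding DF3_def Cstep_def by (intro dfn)
lemma DF_chk [dfn]: "DF s \<Longrightarrow> DF (\<lambda>e. chk (s e))"
  unfolding chk_def by (intro DF_Rec[OF DF3_Cstep] dfn)

lemma el_chk: "el (chk x) = {z. \<exists>y\<in>el x. \<exists>p\<in>el P. z = pr (chk y) p}"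
proof -
  obtain t where t: "trans t" "x \<in> el t" using cover by blast
  have "chk x = mk {z. \<exists>y\<in>el x. \<exists>p\<in>el P. z = pr (chk y) p}"
    unfolding chk_def by (subst Rec_eq[OF DF3_Cstep t], subst Cstep_def) (simp add: app_lam_Rec[OF DF3_Cstep] cong: bex_cong)
  moreover have "small {z. \<exists>y\<in>el x. \<exists>p\<in>el P. z = pr (chk y) p}"
  proof (rule separation[OF small_PR[OF small_image[OF small_el] small_el]])
    show "DF (\<lambda>e. chk (e 0))" by (intro dfn)
    show "{z. \<exists>y\<in>el x. \<exists>p\<in>el P. z = pr (chk y) p} \<subseteq> PR (chk ` el x) (el P)" by (auto simp: PR_def)
  qed (intro dfn)
  ultimately show ?thesis using el_mk by simp
qed

lemma tmem_chk: "tmem z (chk x) \<longleftrightarrow> (\<exists>y\<in>el x. teq z (chk y))"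
  unfolding tmem_iff el_chk using G_P G_ne by auto

lemma feq_chk: "feq (chk x) (chk y) p \<Longrightarrow> x = y"
proof -
  assume "feq (chk x) (chk y) p"
  moreover have "\<forall>y p. feq (chk x) (chk y) p \<longrightarrow> x = y"
  proof (rule eps_induct[where x = x])
    show "D (\<lambda>e. \<forall>y p. feq (chk (e 0)) (chk y) p \<longrightarrow> e 0 = y)" by (intro dfn)
    fix x assume IH: "\<And>u. u \<in> el x \<Longrightarrow> \<forall>y p. feq (chk u) (chk y) p \<longrightarrow> u = y"
    show "\<forall>y p. feq (chk x) (chk y) p \<longrightarrow> x = y"
    proof (intro allI impI ext equalityI subsetI)
      fix y p u assume a: "feq (chk x) (chk y) p"
      have p: "p \<in> el P" "leq p p" using feq_P[OF a] leq_refl by auto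
      { assume u: "u \<in> el x"
        then have "pr (chk u) p \<in> el (chk x)" using p el_chk by auto
        from feq1[OF a this p(2) p(2)] obtain q v s where "pr v s \<in> el (chk y)" "feq (chk u) v q" by blast
        then show "u \<in> el y" using IH[OF u] el_chk by auto }
      { assume u: "u \<in> el y"
        then have "pr (chk u) p \<in> el (chk y)" using p el_chk by auto
        from feq2[OF a this p(2) p(2)] obtain q v s where "pr v s \<in> el (chk x)" "feq v (chk u) q" by blast
        then show "u \<in> el x" using IH el_chk by auto }
    qed
  qed
  ultimately show ?thesis by blast
qed

lemma teq_chk: "teq (chk x) (chk y) \<longleftrightarrow> x = y"
  using feq_chk teq_refl unfolding teq_def by blast

lemma teq_infinite: "infinite (range (\<lambda>x. {y. teq x y}))"
proof -
  have "inj (\<lambda>x. {y. teq (chk x) y})"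
  proof (rule injI)
    fix x y assume "{z. teq (chk x) z} = {z. teq (chk y) z}"
    then have "teq (chk x) (chk y)" using teq_refl by blast
    then show "x = y" by (simp add: teq_chk)
  qed
  then have "infinite (range (\<lambda>x. {y. teq (chk x) y}))" by (rule range_inj_infinite)
  moreover have "range (\<lambda>x. {y. teq (chk x) y}) \<subseteq> range (\<lambda>x. {y. teq x y})" by auto
  ultimately show ?thesis using finite_subset by blast
qed

section \<open>The forcing relation and its definability\<close>

fun fo :: "fm \<Rightarrow> (nat \<Rightarrow> nat) \<Rightarrow> nat \<Rightarrow> bool" where
  "fo (Mem i j) e p \<longleftrightarrow> fmem (e i) (e j) p"
| "fo (Eq i j) e p \<longleftrightarrow> feq (e i) (e j) p"
| "fo (Neg \<phi>) e p \<longleftrightarrow> p \<in> el P \<and> (\<forall>q. leq q p \<longrightarrow> \<not> fo \<phi> e q)"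
| "fo (Imp \<phi> \<psi>) e p \<longleftrightarrow> p \<in> el P \<and> (\<forall>q. leq q p \<longrightarrow> fo \<phi> e q \<longrightarrow> fo \<psi> e q)"
| "fo (All x \<phi>) e p \<longleftrightarrow> (\<forall>v. fo \<phi> (e(x := v)) p)"

lemma fo_down: "fo \<phi> e p \<Longrightarrow> leq q p \<Longrightarrow> fo \<phi> e q"
proof (induction \<phi> arbitrary: e)
  case (Neg \<phi>)
  then show ?case using leq_P leq_trans by (simp; blast)
next
  case (Imp \<phi> \<psi>)
  then show ?case using leq_P leq_trans by (simp; blast)
qed (auto intro: feq_down fmem_down)

text \<open>What is forced densely below \<open>p\<close> is forced by \<open>p\<close>. This makes
  the Kripke clauses for \<open>Neg\<close> and \<open>Imp\<close> adequate for classical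
  logic.\<close>

lemma fo_reg: "p \<in> el P \<Longrightarrow> (\<And>q. leq q p \<Longrightarrow> \<exists>q'. leq q' q \<and> fo \<phi> e q') \<Longrightarrow> fo \<phi> e p"
proof (induction \<phi> arbitrary: e p)
  case (Mem i j)
  then show ?case by (auto intro: fmem_reg)
next
  case (Eq i j)
  then show ?case by (auto intro: feq_reg)
next
  case (Neg \<phi>)
  show ?case
    unfolding fo.simps
  proof (intro conjI allI impI notI Neg.prems(1))
    fix q assume q: "leq q p" "fo \<phi> e q"
    obtain q' where q': "leq q' q" "fo (Neg \<phi>) e q'" using Neg.prems(2)[OF q(1)] by blast
    then show False using fo_down[OF q(2) q'(1)] leq_refl leq_P by (simp; blast)
  qed
next
  case (Imp \<phi> \<psi>)
  show ?case
    unfolding fo.simps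
  proof (intro conjI allI impI Imp.prems(1))
    fix q assume q: "leq q p" "fo \<phi> e q"
    show "fo \<psi> e q"
    proof (rule Imp.IH(2))
      show "q \<in> el P" using leq_P q by blast
      fix r assume r: "leq r q"
      obtain q' where q': "leq q' r" "fo (Imp \<phi> \<psi>) e q'" using Imp.prems(2)[OF leq_trans[OF r q(1)]] by blast
      have "fo \<phi> e q'" using fo_down[OF q(2)] leq_trans[OF q'(1) r] by blast
      then have "fo \<psi> e q'" using q' leq_refl leq_P by (simp; blast)
      then show "\<exists>q'. leq q' r \<and> fo \<psi> e q'" using q'(1) by blast
    qed
  qed
next
  case (All x \<phi>)
  show ?case
    unfolding fo.simps
  proof
    fix v show "fo \<phi> (e(x := v)) p"
    proof (rule All.IH[OF All.prems(1)])
      fix q assume "leq q p"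
      then obtain q' where "leq q' q" "fo (All x \<phi>) e q'" using All.prems(2) by blast
      then show "\<exists>q'. leq q' q \<and> fo \<phi> (e(x := v)) q'" by auto
    qed
  qed
qed

text \<open>Environments are given by definable terms \<open>t i\<close>, so that the induction can
  pass a quantified name on as the new variable 0.\<close>

lemma D_fo: "(\<And>i. DF (t i)) \<Longrightarrow> DF s \<Longrightarrow> D (\<lambda>e. fo \<phi> (\<lambda>i. t i e) (s e))"
proof (induction \<phi> arbitrary: t s)
  case (Neg \<phi>)
  have "D (\<lambda>e. fo \<phi> (\<lambda>i. t i (\<lambda>j. e (Suc j))) (e 0))"
    by (rule Neg.IH[of "\<lambda>i e. t i (\<lambda>j. e (Suc j))"]) (intro DF_weak Neg.prems dfn)+
  then show ?case unfolding fo.simps by (intro dfn Neg.prems DF_weak[OF Neg.prems(2)])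
next
  case (Imp \<phi> \<psi>)
  have "D (\<lambda>e. fo \<phi> (\<lambda>i. t i (\<lambda>j. e (Suc j))) (e 0))" "D (\<lambda>e. fo \<psi> (\<lambda>i. t i (\<lambda>j. e (Suc j))) (e 0))"
    by (rule Imp.IH(1)[of "\<lambda>i e. t i (\<lambda>j. e (Suc j))"] Imp.IH(2)[of "\<lambda>i e. t i (\<lambda>j. e (Suc j))"]; 
      intro DF_weak Imp.prems dfn)+
  then show ?case unfolding fo.simps by (intro dfn Imp.prems DF_weak[OF Imp.prems(2)])
next
  case (All x \<phi>)
  have *: "(\<lambda>i. ((\<lambda>i e. t i (\<lambda>j. e (Suc j)))(x := (\<lambda>e. e 0))) i e) = (\<lambda>i. t i (\<lambda>j. e (Suc j)))(x := e 0)" for e :: "nat \<Rightarrow> nat"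
    by (auto simp: fun_eq_iff)
  have "D (\<lambda>e. fo \<phi> (\<lambda>i. ((\<lambda>i e. t i (\<lambda>j. e (Suc j)))(x := (\<lambda>e. e 0))) i e) (s (\<lambda>j. e (Suc j))))"
  proof (rule All.IH)
    show "DF (((\<lambda>i e. t i (\<lambda>j. e (Suc j)))(x := (\<lambda>e. e 0))) i)" for i
      using DF_weak[OF All.prems(1)] DF_var by (cases "i = x") auto
  qed (intro DF_weak All.prems)
  then have "D (\<lambda>e. fo \<phi> ((\<lambda>i. t i (\<lambda>j. e (Suc j)))(x := e 0)) (s (\<lambda>j. e (Suc j))))" by (simp only: *)
  then show ?case unfolding fo.simps by (intro D_all)
qed (auto intro!: dfn)

lemma D_fo0: "D (\<lambda>e. fo \<phi> a (e 0))"
  by (rule D_fo[of "\<lambda>i e. a i"]) (intro dfn)+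
lemma D_fo1: "D (\<lambda>e. fo \<phi> (a(x := e 0)) (e (Suc 0)))"
proof -
  have "D (\<lambda>e. fo \<phi> (\<lambda>i. (if i = x then (\<lambda>e. e 0) else (\<lambda>e. a i)) e) (e (Suc 0)))"
    by (rule D_fo) (auto intro: dfn)
  moreover have "(\<lambda>i. (if i = x then (\<lambda>e. e 0) else (\<lambda>e. a i)) e) = a(x := e 0)" for e :: "nat \<Rightarrow> nat" by auto
  ultimately show ?thesis by simp
qed
lemma D_fo2: "D (\<lambda>e. fo \<phi> (a(x := e 0, y := e (Suc 0))) (e (Suc (Suc 0))))"
proof -
  have "D (\<lambda>e. fo \<phi> (\<lambda>i. (if i = y then (\<lambda>e. e (Suc 0)) else if i = x then (\<lambda>e. e 0) else (\<lambda>e. a i)) e) (e (Suc (Suc 0))))"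
    by (rule D_fo) (auto intro: dfn)
  moreover have "(\<lambda>i. (if i = y then (\<lambda>e. e (Suc 0)) else if i = x then (\<lambda>e. e 0) else (\<lambda>e. a i)) e) = a(x := e 0, y := e (Suc 0))" for e :: "nat \<Rightarrow> nat" by auto
  ultimately show ?thesis by simp
qed

end

section \<open>The extension is a model of ZFC\<close>

locale extension = forcing +
  fixes h :: "nat \<Rightarrow> nat" and E' :: "nat \<Rightarrow> nat \<Rightarrow> bool"
  assumes surj_h: "surj h" and h_eq: "h x = h y \<longleftrightarrow> teq x y" and h_mem: "E' (h x) (h y) \<longleftrightarrow> tmem x y"
begin

lemma ex_h: obtains a where "z = h a" using surj_h by (metis surj_def)

lemma decide:
  assumes "D (\<lambda>e. e 0 \<in> Q)" "\<And>q. q \<in> G \<Longrightarrow> q \<in> Q \<Longrightarrow> False"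
  obtains p where "p \<in> G" "\<And>q. leq q p \<Longrightarrow> q \<notin> Q"
  using G_gen[OF assms(1)] assms(2) that by blast

lemma truth: "sat E' \<phi> (h \<circ> e) \<longleftrightarrow> (\<exists>p\<in>G. fo \<phi> e p)"
proof (induction \<phi> arbitrary: e)
  case (Mem i j)
  then show ?case by (simp add: h_mem tmem_def)
next
  case (Eq i j)
  then show ?case by (simp add: h_eq teq_def)
next
  case (Neg \<phi>)
  have "(\<exists>p\<in>G. fo (Neg \<phi>) e p) \<longleftrightarrow> \<not> (\<exists>p\<in>G. fo \<phi> e p)"
  proof
    assume "\<exists>p\<in>G. fo (Neg \<phi>) e p"
    then obtain p where p: "p \<in> G" "fo (Neg \<phi>) e p" by blast
    show "\<not> (\<exists>p\<in>G. fo \<phi> e p)"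
    proof
      assume "\<exists>p\<in>G. fo \<phi> e p"
      then obtain q where q: "q \<in> G" "fo \<phi> e q" by blast
      then obtain r where r: "r \<in> G" "leq r p" "leq r q" using G_dir p by blast
      then show False using fo_down[OF q(2)] p(2) by auto
    qed
  next
    assume n: "\<not> (\<exists>p\<in>G. fo \<phi> e p)"
    have dQ: "D (\<lambda>e'. e' 0 \<in> {p. fo \<phi> e p})" by (intro dfn D_fo0)
    from dQ obtain p where "p \<in> G" "\<And>q. leq q p \<Longrightarrow> q \<notin> {p. fo \<phi> e p}" by (rule decide) (use n in auto)
    then show "\<exists>p\<in>G. fo (Neg \<phi>) e p" using G_P by auto
  qed
  then show ?case using Neg by simp
next
  case (Imp \<phi> \<psi>)
  have "(\<exists>p\<in>G. fo (Imp \<phi> \<psi>) e p) \<longleftrightarrow> ((\<exists>p\<in>G. fo \<phi> e p) \<longrightarrow> (\<exists>p\<in>G. fo \<psi> e p))"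
  proof (intro iffI impI)
    assume "\<exists>p\<in>G. fo (Imp \<phi> \<psi>) e p" "\<exists>p\<in>G. fo \<phi> e p"
    then obtain p q where "p \<in> G" "fo (Imp \<phi> \<psi>) e p" "q \<in> G" "fo \<phi> e q" by blast
    moreover then obtain r where "r \<in> G" "leq r p" "leq r q" using G_dir by blast
    ultimately show "\<exists>p\<in>G. fo \<psi> e p" using fo_down[of \<phi> e q r] by auto
  next
    assume i: "(\<exists>p\<in>G. fo \<phi> e p) \<longrightarrow> (\<exists>p\<in>G. fo \<psi> e p)"
    show "\<exists>p\<in>G. fo (Imp \<phi> \<psi>) e p"
    proof (cases "\<exists>p\<in>G. fo \<psi> e p")
      case True
      then show ?thesis using fo_down G_P by (simp; blast)
    next
      case False
      then have n: "\<not> (\<exists>p\<in>G. fo \<phi> e p)" using i by blast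
      have dQ: "D (\<lambda>e'. e' 0 \<in> {p. fo \<phi> e p})" by (intro dfn D_fo0)
      from dQ obtain p where "p \<in> G" "\<And>q. leq q p \<Longrightarrow> q \<notin> {p. fo \<phi> e p}" by (rule decide) (use n in auto)
      then show ?thesis using G_P by (simp; blast)
    qed
  qed
  then show ?case using Imp by simp
next
  case (All x \<phi>)
  have eq: "(h \<circ> e)(x := h v) = h \<circ> e(x := v)" for v by auto
  have "(\<exists>p\<in>G. fo (All x \<phi>) e p) \<longleftrightarrow> (\<forall>v. \<exists>p\<in>G. fo \<phi> (e(x := v)) p)"
  proof
    assume all: "\<forall>v. \<exists>p\<in>G. fo \<phi> (e(x := v)) p"
    \<comment> \<open>Below a condition in \<open>Q\<close>, some instance is nowhere forced. If
      \<open>G\<close> has a condition with no extension in \<open>Q\<close>, that condition forces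
      every instance by regularity.\<close>
    define Q where "Q = {p. \<exists>v. \<forall>q. leq q p \<longrightarrow> \<not> fo \<phi> (e(x := v)) q}"
    have "D (\<lambda>e'. fo \<phi> (e(x := e' (Suc 0))) (e' 0))"
      by (rule lift2[where Q = "\<lambda>v p. fo \<phi> (e(x := v)) p", OF DF_var DF_var D_fo1])
    then have "D (\<lambda>e'. e' 0 \<in> Q)" unfolding Q_def
      by (intro dfn lift2[where Q = "\<lambda>v p. fo \<phi> (e(x := v)) p", OF _ _ D_fo1])
    moreover have False if pp: "p \<in> G" "p \<in> Q" for p
    proof -
      obtain v where v: "\<forall>q. leq q p \<longrightarrow> \<not> fo \<phi> (e(x := v)) q" using pp Q_def by blast
      obtain q where q: "q \<in> G" "fo \<phi> (e(x := v)) q" using all by blast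
      obtain r where "r \<in> G" "leq r p" "leq r q" using G_dir pp(1) q(1) by blast
      then show False using v fo_down q by blast
    qed
    ultimately obtain p where p: "p \<in> G" "\<And>q. leq q p \<Longrightarrow> q \<notin> Q" by (rule decide) blast+
    have "fo \<phi> (e(x := v)) p" for v
      using p G_P by (intro fo_reg) (auto simp: Q_def)
    then show "\<exists>p\<in>G. fo (All x \<phi>) e p" using p by auto
  qed auto
  moreover have "sat E' (All x \<phi>) (h \<circ> e) \<longleftrightarrow> (\<forall>v. sat E' \<phi> ((h \<circ> e)(x := h v)))"
    unfolding satR.simps using ex_h by metis
  ultimately show ?case using All.IH by (simp only: eq)
qed

lemma mem_h: "E' z (h y) \<longleftrightarrow> (\<exists>v s. pr v s \<in> el y \<and> s \<in> G \<and> z = h v)"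
proof -
  obtain a where "z = h a" by (rule ex_h)
  then show ?thesis by (simp add: h_mem h_eq tmem_iff)
qed

lemma mem_chk: "E' z (h (chk x)) \<longleftrightarrow> (\<exists>y\<in>el x. z = h (chk y))"
proof -
  obtain a where "z = h a" by (rule ex_h)
  then show ?thesis by (simp add: h_mem h_eq tmem_chk)
qed

text \<open>The conditions that exhibit a failure of the inclusion form a definable class, which
  \<open>G\<close> avoids; regularity then turns avoidance into forcing.\<close>

lemma forced_subset:
  assumes "\<forall>z. E' z (h x) \<longrightarrow> E' z (h y)"
  shows "\<exists>p\<in>G. \<forall>u r q. pr u r \<in> el x \<longrightarrow> leq q p \<longrightarrow> leq q r \<longrightarrow> fmem u y q"
proof -
  define Q where "Q = {q. \<exists>u r. pr u r \<in> el x \<and> leq q r \<and> (\<forall>q'. leq q' q \<longrightarrow> \<not> fmem u y q')}"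
  have "D (\<lambda>e. e 0 \<in> Q)" unfolding Q_def by (intro dfn)
  moreover have False if q: "q \<in> G" "q \<in> Q" for q
  proof -
    obtain u r where ur: "pr u r \<in> el x" "leq q r" "\<forall>q'. leq q' q \<longrightarrow> \<not> fmem u y q'" using q Q_def by blast
    then have "E' (h u) (h x)" using mem_h G_up q(1) by blast
    then have "tmem u y" using assms h_mem by blast
    then obtain p where "p \<in> G" "fmem u y p" by (auto simp: tmem_def)
    moreover obtain k where "k \<in> G" "leq k p" "leq k q" using G_dir calculation(1) q(1) by blast
    ultimately show False using ur(3) fmem_down by blast
  qed
  ultimately obtain p where p: "p \<in> G" "\<And>q. leq q p \<Longrightarrow> q \<notin> Q" by (rule decide) blast+
  have "fmem u y q" if "pr u r \<in> el x" "leq q p" "leq q r" for u r q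
  proof (rule fmem_reg)
    show "q \<in> el P" using leq_P that by blast
    fix q1 assume q1: "leq q1 q"
    then have "q1 \<notin> Q" "leq q1 r" using p(2) leq_trans that by blast+
    then show "\<exists>q'. leq q' q1 \<and> fmem u y q'" using that(1) Q_def by blast
  qed
  then show ?thesis using p(1) by blast
qed

lemma ext': assumes "\<forall>z. E' z a \<longleftrightarrow> E' z b" shows "a = b"
proof -
  obtain x y where xy: "a = h x" "b = h y" using ex_h by metis
  obtain p where p: "p \<in> G" "\<forall>u r q. pr u r \<in> el x \<longrightarrow> leq q p \<longrightarrow> leq q r \<longrightarrow> fmem u y q"
    using forced_subset[of x y] assms xy by auto
  obtain p' where p': "p' \<in> G" "\<forall>u r q. pr u r \<in> el y \<longrightarrow> leq q p' \<longrightarrow> leq q r \<longrightarrow> fmem u x q"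
    using forced_subset[of y x] assms xy by auto
  obtain k where k: "k \<in> G" "leq k p" "leq k p'" using G_dir[OF p(1) p'(1)] by blast
  have "feq x y k"
  proof (rule feqI)
    show "k \<in> el P" using k G_P by blast
    fix u r q assume "pr u r \<in> el x" "leq q k" "leq q r"
    then have "fmem u y q" "leq q q" using p(2) k leq_trans leq_refl leq_P by blast+
    then show "\<exists>q' v s. leq q' q \<and> pr v s \<in> el y \<and> leq q' s \<and> feq u v q'" using fmemD by blast
  next
    fix v s q assume "pr v s \<in> el y" "leq q k" "leq q s"
    then have "fmem v x q" "leq q q" using p'(2) k leq_trans leq_refl leq_P by blast+
    then show "\<exists>q' u r. leq q' q \<and> pr u r \<in> el x \<and> leq q' r \<and> feq u v q'" using fmemD feq_sym by blast
  qed
  then show ?thesis unfolding xy h_eq teq_def using k(1) by blast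
qed

text \<open>If no minimal element existed, some condition of \<open>G\<close> would have no
  extension forcing one; below it, induction on names shows that no name at all is forced into
  \<open>x\<close>.\<close>

lemma foundation': assumes "E' z a" shows "\<exists>y. E' y a \<and> (\<forall>w. E' w a \<longrightarrow> \<not> E' w y)"
proof (rule ccontr)
  assume n: "\<not> ?thesis"
  obtain x where x: "a = h x" by (rule ex_h)
  obtain u0 where "z = h u0" by (rule ex_h)
  then obtain p0 where p0: "p0 \<in> G" "fmem u0 x p0" using assms x h_mem by (auto simp: tmem_def)
  define Q where "Q = {q. \<exists>u. fmem u x q \<and> (\<forall>w q'. leq q' q \<longrightarrow> fmem w u q' \<longrightarrow> \<not> fmem w x q')}"
  have "D (\<lambda>e. e 0 \<in> Q)" unfolding Q_def by (intro dfn)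
  moreover have False if q: "q \<in> G" "q \<in> Q" for q
  proof -
    obtain u where u: "fmem u x q" "\<forall>w q'. leq q' q \<longrightarrow> fmem w u q' \<longrightarrow> \<not> fmem w x q'" using q Q_def by blast
    have "E' (h u) a" using u q(1) x h_mem tmem_def by blast
    then obtain w where w: "E' w a" "E' w (h u)" using n by blast
    obtain v where v: "w = h v" by (rule ex_h)
    obtain k l where kl: "k \<in> G" "fmem v x k" "l \<in> G" "fmem v u l" using w x v h_mem by (auto simp: tmem_def)
    obtain m where m: "m \<in> G" "leq m k" "leq m l" using G_dir kl by blast
    obtain j where j: "j \<in> G" "leq j m" "leq j q" using G_dir m q by blast
    have "fmem v x j" "fmem v u j" using fmem_down kl m j leq_trans by blast+
    then show False using u(2) j(3) by blast
  qed
  ultimately obtain p where p: "p \<in> G" "\<And>q. leq q p \<Longrightarrow> q \<notin> Q" by (rule decide) blast+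
  obtain k where k: "k \<in> G" "leq k p" "leq k p0" using G_dir p p0 by blast
  have "\<forall>q. leq q k \<longrightarrow> \<not> fmem u x q" for u
  proof (rule name_induct[where x = u])
    show "D (\<lambda>e. \<forall>q. leq q k \<longrightarrow> \<not> fmem (e 0) x q)" by (intro dfn)
    fix u assume IH: "\<And>v s. pr v s \<in> el u \<Longrightarrow> \<forall>q. leq q k \<longrightarrow> \<not> fmem v x q"
    show "\<forall>q. leq q k \<longrightarrow> \<not> fmem u x q"
    proof (intro allI impI notI)
      fix q assume q: "leq q k" "fmem u x q"
      then have "q \<notin> Q" using p(2) k leq_trans by blast
      then obtain w q' where w: "leq q' q" "fmem w u q'" "fmem w x q'" using q Q_def by blast
      then obtain q2 v s where q2: "leq q2 q'" "pr v s \<in> el u" "feq w v q2"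
        using fmemD[OF w(2)] leq_refl leq_P by blast
      then have "fmem v x q2" using fmem_cong1 fmem_down w(3) by blast
      then show False using IH[OF q2(2)] q2(1) w(1) q(1) leq_trans by blast
    qed
  qed
  then show False using fmem_down[OF p0(2) k(3)] leq_refl k(1) G_P by blast
qed

definition dom where "dom a = {u. \<exists>r. pr u r \<in> el a}"

lemma small_dom [simp]: "small (dom a)"
proof -
  obtain t where t: "trans t" "a \<in> el t" using cover by blast
  then have "dom a \<subseteq> el t" using trans_pr[OF t(1)] unfolding dom_def trans_def by blast
  then show ?thesis by (rule separation[OF small_el]) (unfold dom_def, intro dfn)
qed

lemma D_dom [dfn]: "DF t \<Longrightarrow> D (\<lambda>e. \<exists>r. pr (s e) r \<in> el (t e)) \<Longrightarrow> D (\<lambda>e. s e \<in> dom (t e))"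
  unfolding dom_def by simp

lemma mem_hD: "E' z (h a) \<Longrightarrow> \<exists>u\<in>dom a. z = h u"
  unfolding mem_h dom_def by blast

lemma pairing': "\<exists>z. E' a z \<and> E' b z"
proof -
  obtain x y where xy: "a = h x" "b = h y" using ex_h by metis
  obtain p where "p \<in> G" using G_ne by blast
  then have "E' a (h (upr (pr x p) (pr y p))) \<and> E' b (h (upr (pr x p) (pr y p)))"
    unfolding mem_h xy by auto
  then show ?thesis by blast
qed

lemma union': "\<exists>u. \<forall>y. E' y a \<longrightarrow> (\<forall>z. E' z y \<longrightarrow> E' z u)"
proof -
  obtain x where x: "a = h x" by (rule ex_h)
  define U where "U = mk {z. \<exists>y\<in>dom x. z \<in> el y}"
  have "small (\<Union>y\<in>dom x. el y)" by (rule small_UN) (simp_all, intro dfn)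
  moreover have "(\<Union>y\<in>dom x. el y) = {z. \<exists>y\<in>dom x. z \<in> el y}" by blast
  ultimately have U: "el U = {z. \<exists>y\<in>dom x. z \<in> el y}" unfolding U_def using el_mk by simp
  have "E' z (h U)" if yz: "E' y a" "E' z y" for y z
  proof -
    obtain v where v: "v \<in> dom x" "y = h v" using mem_hD yz(1) x by blast
    with yz(2) obtain w k where "pr w k \<in> el v" "k \<in> G" "z = h w" by (auto simp: mem_h)
    then show ?thesis using v(1) U mem_h by blast
  qed
  then show ?thesis by blast
qed

text \<open>Every subset of the value of \<open>y\<close> also has a name contained in the product
  of \<open>dom y\<close> and \<open>P\<close>, and such names form a set.\<close>

lemma power': "\<exists>p. \<forall>x. (\<forall>z. E' z x \<longrightarrow> E' z a) \<longrightarrow> E' x p"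
proof -
  obtain y where y: "a = h y" by (rule ex_h)
  obtain p0 where p0: "p0 \<in> G" using G_ne by blast
  define A where "A = mk (PR (dom y) (el P))"
  have A: "el A = PR (dom y) (el P)" unfolding A_def by (intro el_mk) simp
  define B where "B = mk ((\<lambda>b. pr b p0) ` {b. el b \<subseteq> el A})"
  have B: "el B = (\<lambda>b. pr b p0) ` {b. el b \<subseteq> el A}"
    unfolding B_def by (intro el_mk small_image small_pow dfn)
  have "E' x (h B)" if sub: "\<forall>z. E' z x \<longrightarrow> E' z a" for x
  proof -
    obtain v where v: "x = h v" by (rule ex_h)
    define b where "b = mk {z \<in> el A. fmem (fs z) v (sn z)}"
    have b: "el b = {z \<in> el A. fmem (fs z) v (sn z)}"
      unfolding b_def by (rule el_mk, rule separation[OF small_el[of A]]) (auto intro!: dfn)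
    have "h b = h v"
    proof (rule ext', intro allI iffI)
      fix z assume "E' z (h b)"
      then obtain u p where "pr u p \<in> el b" "p \<in> G" "z = h u" by (auto simp: mem_h)
      then show "E' z (h v)" using b h_mem tmem_def by auto
    next
      fix z assume z: "E' z (h v)"
      then have "E' z (h y)" using sub v y by blast
      then obtain u where u: "u \<in> dom y" "z = h u" using mem_hD by blast
      then obtain p where "p \<in> G" "fmem u v p" using z h_mem tmem_def by blast
      then have "pr u p \<in> el b" using u b A G_P by auto
      then show "E' z (h b)" using \<open>p \<in> G\<close> u mem_h by blast
    qed
    moreover have "pr b p0 \<in> el B" unfolding B using b by blast
    ultimately show ?thesis using p0 v mem_h by metis
  qed
  then show ?thesis by blast
qed

lemma infinity': "\<exists>x. (\<exists>z. E' z x \<and> (\<forall>u. \<not> E' u z)) \<and> (\<forall>y. E' y x \<longrightarrow> (\<exists>s. E' s x \<and> (\<forall>u. E' u s \<longleftrightarrow> E' u y \<or> u = y)))"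
proof (rule exI[of _ "h (chk om)"], intro conjI allI impI)
  show "\<exists>z. E' z (h (chk om)) \<and> (\<forall>u. \<not> E' u z)" using emp_om by (intro exI[of _ "h (chk emp)"]) (auto simp: mem_chk)
  fix y assume "E' y (h (chk om))"
  then obtain n where n: "n \<in> el om" "y = h (chk n)" by (auto simp: mem_chk)
  then show "\<exists>s. E' s (h (chk om)) \<and> (\<forall>u. E' u s \<longleftrightarrow> E' u y \<or> u = y)"
    by (intro exI[of _ "h (chk (sc n))"]) (auto simp: mem_chk)
qed

lemma sep':
  assumes "distinct [a, b, x]" "b \<notin> fv \<phi>"
  shows "\<exists>B. \<forall>X. E' X B \<longleftrightarrow> E' X A \<and> sat E' \<phi> (e(a := A, b := B, x := X))"
proof -
  obtain d where d: "e = h \<circ> d" using ex_h surj_h by (metis (no_types, opaque_lifting) comp_assoc fun.map_id surj_iff comp_id)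
  obtain A' where A': "A = h A'" by (rule ex_h)
  define N where "N = mk {z \<in> PR (dom A') (el P). fmem (fs z) A' (sn z) \<and> fo \<phi> (d(a := A', x := fs z)) (sn z)}"
  have N: "el N = {z \<in> PR (dom A') (el P). fmem (fs z) A' (sn z) \<and> fo \<phi> (d(a := A', x := fs z)) (sn z)}"
    unfolding N_def
  proof (rule el_mk, rule separation[of "PR (dom A') (el P)"])
    have "D (\<lambda>e'. fo \<phi> (d(a := A', x := fs (e' 0))) (sn (e' 0)))"
      by (rule lift2[where Q = "\<lambda>u p. fo \<phi> (d(a := A', x := u)) p", OF _ _ D_fo1]) (intro dfn)+
    then show "D (\<lambda>e'. e' 0 \<in> {z \<in> PR (dom A') (el P). fmem (fs z) A' (sn z) \<and> fo \<phi> (d(a := A', x := fs z)) (sn z)})"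
      by (intro dfn)
  qed auto
  have eq: "sat E' \<phi> (e(a := A, b := B, x := h u)) \<longleftrightarrow> (\<exists>p\<in>G. fo \<phi> (d(a := A', x := u)) p)" for B u
  proof -
    have "sat E' \<phi> (e(a := A, b := B, x := h u)) \<longleftrightarrow> sat E' \<phi> (h \<circ> d(a := A', x := u))"
      using assms by (intro satR_cong) (auto simp: d A')
    then show ?thesis using truth by blast
  qed
  have "E' X (h N) \<longleftrightarrow> E' X A \<and> sat E' \<phi> (e(a := A, b := h N, x := X))" for X
  proof
    assume "E' X (h N)"
    then obtain u p where "pr u p \<in> el N" "p \<in> G" "X = h u" by (auto simp: mem_h)
    then show "E' X A \<and> sat E' \<phi> (e(a := A, b := h N, x := X))" using eq by (auto simp: N A' h_mem tmem_def)
  next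
    assume X: "E' X A \<and> sat E' \<phi> (e(a := A, b := h N, x := X))"
    then obtain u where u: "u \<in> dom A'" "X = h u" using mem_hD A' by blast
    obtain p q where pq: "p \<in> G" "fo \<phi> (d(a := A', x := u)) p" "q \<in> G" "fmem u A' q"
      using X eq u A' h_mem tmem_def by blast
    obtain r where r: "r \<in> G" "leq r p" "leq r q" using G_dir pq by blast
    have "pr u r \<in> el N" using N u r pq fo_down fmem_down G_P by auto
    then show "E' X (h N)" using r u mem_h by blast
  qed
  then show ?thesis by blast
qed

lemma repl':
  assumes "distinct [a, b, x, y, z]" "b \<notin> fv \<phi>" "z \<notin> fv \<phi>"
    and f: "\<forall>X. E' X A \<longrightarrow> (\<exists>Z. \<forall>Y. sat E' \<phi> (e(a := A, x := X, z := Z, y := Y)) \<longleftrightarrow> Y = Z)"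
  shows "\<exists>B. \<forall>X. E' X A \<longrightarrow> (\<exists>Y. E' Y B \<and> sat E' \<phi> (e(a := A, b := B, x := X, y := Y)))"
proof -
  obtain d where d: "e = h \<circ> d" using ex_h surj_h by (metis (no_types, opaque_lifting) comp_assoc fun.map_id surj_iff comp_id)
  obtain A' where A': "A = h A'" by (rule ex_h)
  obtain p0 where p0: "p0 \<in> G" using G_ne by blast
  have eq: "sat E' \<phi> (e(a := A, x := h u, z := Z, y := h w)) \<longleftrightarrow> (\<exists>p\<in>G. fo \<phi> (d(a := A', x := u, y := w)) p)"
    "sat E' \<phi> (e(a := A, b := Z, x := h u, y := h w)) \<longleftrightarrow> (\<exists>p\<in>G. fo \<phi> (d(a := A', x := u, y := w)) p)" for Z u w
  proof -
    have "sat E' \<phi> (e(a := A, x := h u, z := Z, y := h w)) \<longleftrightarrow> sat E' \<phi> (h \<circ> d(a := A', x := u, y := w))"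
      "sat E' \<phi> (e(a := A, b := Z, x := h u, y := h w)) \<longleftrightarrow> sat E' \<phi> (h \<circ> d(a := A', x := u, y := w))"
      using assms by (auto intro!: satR_cong simp: d A')
    then show "sat E' \<phi> (e(a := A, x := h u, z := Z, y := h w)) \<longleftrightarrow> (\<exists>p\<in>G. fo \<phi> (d(a := A', x := u, y := w)) p)"
    "sat E' \<phi> (e(a := A, b := Z, x := h u, y := h w)) \<longleftrightarrow> (\<exists>p\<in>G. fo \<phi> (d(a := A', x := u, y := w)) p)"
      using truth by blast+
  qed
  have dW: "D (\<lambda>e'. fo \<phi> (d(a := A', x := fs (e' 0), y := e' (Suc 0))) (sn (e' 0)))"
    by (rule lift3[where Q = "\<lambda>u w p. fo \<phi> (d(a := A', x := u, y := w)) p", OF _ _ _ D_fo2]) (intro dfn)+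
  \<comment> \<open>Collection in the ground model bounds names for the values, for all pairs of a
    possible argument and a condition at once.\<close>
  obtain W where W: "\<And>zz. zz \<in> el (mk (PR (dom A') (el P))) \<Longrightarrow> (\<exists>w. fo \<phi> (d(a := A', x := fs zz, y := w)) (sn zz)) \<Longrightarrow>
      (\<exists>w\<in>el W. fo \<phi> (d(a := A', x := fs zz, y := w)) (sn zz))"
    by (rule collection[where Q = "\<lambda>zz w. fo \<phi> (d(a := A', x := fs zz, y := w)) (sn zz)" and a = "mk (PR (dom A') (el P))", OF dW]) blast
  define N where "N = mk ((\<lambda>w. pr w p0) ` el W)"
  have N: "el N = (\<lambda>w. pr w p0) ` el W" unfolding N_def by (intro el_mk small_image small_el dfn)
  have "\<exists>Y. E' Y (h N) \<and> sat E' \<phi> (e(a := A, b := h N, x := X, y := Y))" if XA: "E' X A" for X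
  proof -
    obtain u where u: "u \<in> dom A'" "X = h u" using mem_hD A' XA by blast
    obtain Z where "\<forall>Y. sat E' \<phi> (e(a := A, x := X, z := Z, y := Y)) \<longleftrightarrow> Y = Z" using f XA by blast
    then have "sat E' \<phi> (e(a := A, x := X, z := Z, y := Z))" by blast
    moreover obtain w where "Z = h w" by (rule ex_h)
    ultimately obtain p where p: "p \<in> G" "fo \<phi> (d(a := A', x := u, y := w)) p" using u eq by metis
    have "pr u p \<in> el (mk (PR (dom A') (el P)))" using u p G_P by (auto simp: el_mk)
    from W[OF this] p obtain w' where w': "w' \<in> el W" "fo \<phi> (d(a := A', x := u, y := w')) p" by auto
    then have "sat E' \<phi> (e(a := A, b := h N, x := X, y := h w'))" using eq u p by blast
    moreover have "E' (h w') (h N)" using w' p0 mem_h N by blast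
    ultimately show ?thesis by blast
  qed
  then show ?thesis by blast
qed

text \<open>All names of potential elements are well-ordered in the ground model.
  \<open>B u x p\<close> says that \<open>p\<close> forces \<open>u\<close> into \<open>x\<close>
  and excludes all earlier names from \<open>x\<close>; genericity provides such a \<open>u\<close>
  for each \<open>x\<close>, and any two such names have the same position.\<close>

lemma choice':
  assumes ne: "\<forall>x. E' x A \<longrightarrow> (\<exists>z. E' z x)"
    and dj: "\<forall>x. E' x A \<longrightarrow> (\<forall>y. E' y A \<longrightarrow> x \<noteq> y \<longrightarrow> \<not> (\<exists>z. E' z x \<and> E' z y))"
  shows "\<exists>c. \<forall>x. E' x A \<longrightarrow> (\<exists>y. \<forall>z. (E' z x \<and> E' z c) \<longleftrightarrow> z = y)"
proof -
  obtain a where a: "A = h a" by (rule ex_h)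
  define U where "U = mk (\<Union>y\<in>dom a. dom y)"
  have "small (\<Union>y\<in>dom a. dom y)" by (rule small_UN) (simp_all, intro dfn)
  then have U: "el U = (\<Union>y\<in>dom a. dom y)" unfolding U_def by (rule el_mk)
  obtain \<alpha> g where \<alpha>: "Ord \<alpha>" and g: "bij_betw (app g) (el \<alpha>) (el U)" by (rule well_ordering)
  define B where "B u x p \<longleftrightarrow> fmem u x p \<and> (\<forall>b b'. b \<in> el \<alpha> \<longrightarrow> b' \<in> el b \<longrightarrow> app g b = u \<longrightarrow> (\<forall>q. leq q p \<longrightarrow> \<not> fmem (app g b') x q))"
    for u x p
  have DB: "DF s \<Longrightarrow> DF t \<Longrightarrow> DF v \<Longrightarrow> D (\<lambda>e. B (s e) (t e) (v e))" for s t v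
    by (rule lift3; (assumption | (unfold B_def, intro dfn)))
  have B_down: "B u x q" if "B u x p" "leq q p" for u x p q
    using that fmem_down leq_trans unfolding B_def by blast
  define c where "c = mk {z \<in> PR (el U) (el P). \<exists>x s. pr x s \<in> el a \<and> leq (sn z) s \<and> B (fs z) x (sn z)}"
  have c: "el c = {z \<in> PR (el U) (el P). \<exists>x s. pr x s \<in> el a \<and> leq (sn z) s \<and> B (fs z) x (sn z)}"
    unfolding c_def by (rule el_mk, rule separation[of "PR (el U) (el P)"]) (auto intro!: dfn DB)
  have "\<exists>y. \<forall>z. (E' z X \<and> E' z (h c)) \<longleftrightarrow> z = y" if X: "E' X A" for X
  proof -
    obtain x s where x: "pr x s \<in> el a" "s \<in> G" "X = h x" using X a by (auto simp: mem_h)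
    obtain z0 where "E' z0 X" using ne X by blast
    then obtain u0 where u0: "u0 \<in> dom x" "z0 = h u0" using mem_hD x by blast
    have u0U: "u0 \<in> el U" using u0 x U by (auto simp: dom_def)
    obtain p0 where p0: "p0 \<in> G" "fmem u0 x p0" using \<open>E' z0 X\<close> u0 x h_mem tmem_def by blast
    define Q where "Q = {q. \<exists>u\<in>el U. B u x q}"
    have "D (\<lambda>e. e 0 \<in> Q)" unfolding Q_def by (intro dfn DB)
    from G_gen[OF this] have "\<exists>q\<in>G. q \<in> Q"
    proof
      assume "\<exists>p\<in>G. \<forall>q. leq q p \<longrightarrow> q \<notin> Q"
      then obtain p where p: "p \<in> G" "\<forall>q. leq q p \<longrightarrow> q \<notin> Q" by blast
      obtain k where k: "k \<in> G" "leq k p" "leq k p0" using G_dir p p0 by blast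
      obtain b0 where b0: "b0 \<in> el \<alpha>" "app g b0 = u0" using g u0U by (metis bij_betw_imp_surj_on image_iff)
      have dP: "D (\<lambda>e. e 0 \<in> el \<alpha> \<and> (\<exists>q. leq q k \<and> fmem (app g (e 0)) x q))" by (intro dfn)
      have "fmem u0 x k" "leq k k" using fmem_down p0 k leq_refl G_P by blast+
      \<comment> \<open>The least position whose name can still be forced into \<open>x\<close>
        below \<open>k\<close>; a condition that forces it in automatically excludes all earlier
        ones.\<close>
      then obtain b where b: "Ord b" "b \<in> el \<alpha> \<and> (\<exists>q. leq q k \<and> fmem (app g b) x q)"
        "\<And>c. Ord c \<Longrightarrow> c \<in> el \<alpha> \<and> (\<exists>q. leq q k \<and> fmem (app g c) x q) \<Longrightarrow> el b \<subseteq> el c"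
        using Ord_least[OF dP, of b0] b0 Ord_mem[OF \<alpha>] by blast
      obtain q where q: "leq q k" "fmem (app g b) x q" using b(2) by blast
      have "B (app g b) x q"
        unfolding B_def
      proof (intro conjI q(2) allI impI notI)
        fix b1 b' q' assume *: "b1 \<in> el \<alpha>" "b' \<in> el b1" "app g b1 = app g b" "leq q' q" "fmem (app g b') x q'"
        then have "b1 = b" using g b(2) by (metis bij_betw_imp_inj_on inj_onD)
        moreover have "b' \<in> el \<alpha>" using * Ord_trans[OF \<alpha>] by blast
        ultimately have "el b \<subseteq> el b'" using b(3)[of b'] * q Ord_mem[OF \<alpha>] leq_trans by blast
        then show False using * \<open>b1 = b\<close> mem_irrefl by blast
      qed
      moreover have "app g b \<in> el U" using g b(2) by (metis bij_betw_apply)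
      ultimately have "q \<in> Q" unfolding Q_def by blast
      then show ?thesis using p(2) q k leq_trans by blast
    qed blast
    then obtain q u where q: "q \<in> G" "u \<in> el U" "B u x q" unfolding Q_def by blast
    obtain r where r: "r \<in> G" "leq r q" "leq r s" using G_dir q x by blast
    have Br: "B u x r" using B_down q r by blast
    have "pr u r \<in> el c" using c q r Br x G_P by auto
    then have uc: "E' (h u) (h c)" using r mem_h by blast
    have ux: "E' (h u) X" using Br r x h_mem tmem_def B_def by blast
    have "z = h u" if z: "E' z X" "E' z (h c)" for z
    proof -
      obtain v k where v: "pr v k \<in> el c" "k \<in> G" "z = h v" using z(2) by (auto simp: mem_h)
      then obtain y l where y: "pr y l \<in> el a" "leq k l" "B v y k" "v \<in> el U" using c by auto
      have "E' (h y) A" using a mem_h y v G_up by blast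
      moreover have "E' z (h y)" using v y h_mem tmem_def B_def by blast
      ultimately have Xy: "X = h y" using dj X z(1) by blast
      obtain b b' where b: "b \<in> el \<alpha>" "app g b = u" "b' \<in> el \<alpha>" "app g b' = v"
        using g y(4) q(2) by (metis bij_betw_imp_surj_on image_iff)
      have "b \<notin> el b'"
      proof
        assume bb: "b \<in> el b'"
        have "tmem u y" using ux Xy h_mem by blast
        then obtain m where m: "m \<in> G" "fmem u y m" by (auto simp: tmem_def)
        obtain j where "j \<in> G" "leq j m" "leq j k" using G_dir m v by blast
        then show False using y(3) b bb m fmem_down unfolding B_def by blast
      qed
      moreover have "b' \<notin> el b"
      proof
        assume bb: "b' \<in> el b"
        have "tmem v x" using z(1) v x h_mem by blast
        then obtain m where m: "m \<in> G" "fmem v x m" by (auto simp: tmem_def)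
        obtain j where "j \<in> G" "leq j m" "leq j r" using G_dir m r by blast
        then show False using Br b bb m fmem_down unfolding B_def by blast
      qed
      ultimately have "b = b'" using Ord_linear Ord_mem[OF \<alpha>] b by blast
      then show ?thesis using b v by simp
    qed
    then show ?thesis using uc ux by (intro exI[of _ "h u"]) blast
  qed
  then show ?thesis by blast
qed

theorem extension_models: "models E' ZFC"
  unfolding models_def
proof (intro ballI allI)
  fix \<phi> and e :: "nat \<Rightarrow> nat"
  assume "\<phi> \<in> ZFC"
  then consider "\<phi> = extensionality_ax" | "\<phi> = foundation_ax" | "\<phi> = pairing_ax" | "\<phi> = union_ax" | "\<phi> = power_ax"
    | "\<phi> = infinity_ax" | "\<phi> = choice_ax" | "\<phi> \<in> separation_axs" | "\<phi> \<in> replacement_axs"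
    by (auto simp: ZFC_def)
  then show "sat E' \<phi> e"
  proof cases
    case 1
    then show ?thesis using ext' by (simp add: extensionality_ax_def satR_sentence)
  next
    case 2
    then show ?thesis using foundation' by (simp add: foundation_ax_def satR_sentence) blast
  next
    case 3
    then show ?thesis using pairing' by (simp add: pairing_ax_def satR_sentence)
  next
    case 4
    then show ?thesis using union' by (simp add: union_ax_def satR_sentence)
  next
    case 5
    then show ?thesis using power' by (simp add: power_ax_def satR_sentence)
  next
    case 6
    then show ?thesis
      using infinity' by (simp add: infinity_ax_def is_inductive_def is_empty_def is_succ_def satR_sentence)
  next
    case 7
    have "sat E' choice_ax e"
      unfolding choice_ax_def satR_sentence
      by (simp only: satR.simps fun_upd_apply simp_thms nat.inject nat.distinct if_True if_False)
        (intro allI impI, elim conjE, rule choice'; assumption)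
    then show ?thesis using 7 by simp
  next
    case 8
    then obtain a b x \<psi> where "\<phi> = All a (Ex b (All x (Iff (Mem x b) (Conj (Mem x a) \<psi>))))"
      "distinct [a, b, x]" "b \<notin> fv \<psi>" by (auto simp: separation_axs_def)
    then show ?thesis using sep'[of a b x \<psi>] by (simp add: satR_fm)
  next
    case 9
    then obtain a b x y z \<psi> where "\<phi> = All a (Imp
       (All x (Imp (Mem x a) (Ex z (All y (Iff \<psi> (Eq y z))))))
       (Ex b (All x (Imp (Mem x a) (Ex y (Conj (Mem y b) \<psi>))))))"
      "distinct [a, b, x, y, z]" "b \<notin> fv \<psi>" "z \<notin> fv \<psi>" by (auto simp: replacement_axs_def)
    then show ?thesis using repl'[of a b x y z \<psi>] by (simp add: satR_fm eq_commute[of z y])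
  qed
qed

end

section \<open>The partial order\<close>

context zfc begin

definition cp where "cp a b = mk (PR (el a) (el b))"
lemma el_cp [simp]: "el (cp a b) = PR (el a) (el b)" by (simp add: cp_def el_mk)
lemma DF_cp [dfn]: "DF s \<Longrightarrow> DF t \<Longrightarrow> DF (\<lambda>e. cp (s e) (t e))"
  by (rule liftF2; (assumption | (unfold cp_def, intro dfn)))

definition Om where "Om = V emp om"
definition Fin where "Fin x = mk {y. el y \<subseteq> el x \<and> fin y}"

lemma el_Fin: "el (Fin x) = {y. el y \<subseteq> el x \<and> fin y}"
  unfolding Fin_def by (rule el_mk, rule separation[OF small_pow[of x]]) (auto, intro dfn)
lemma DF_Fin [dfn]: "DF s \<Longrightarrow> DF (\<lambda>e. Fin (s e))"
  by (rule liftF1; (assumption | (unfold Fin_def, intro dfn)))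

lemma Om_pr: "x \<in> el Om \<Longrightarrow> y \<in> el Om \<Longrightarrow> pr x y \<in> el Om"
  unfolding Om_def by (rule V_lim_pr[OF lim_om])
lemma Om_fin: "fin x \<Longrightarrow> el x \<subseteq> el Om \<Longrightarrow> x \<in> el Om"
  unfolding Om_def by (rule V_lim_fin[OF lim_om])
lemma trans_Om: "trans Om" unfolding Om_def by (rule trans_V0) simp

lemma om_Om: "el om \<subseteq> el Om"
proof
  fix n assume "n \<in> el om"
  then have "n \<in> el Om \<and> fin n"
  proof (rule om_induct[rotated 3])
    show "D (\<lambda>e. e 0 \<in> el Om \<and> fin (e 0))" by (intro dfn)
    show "emp \<in> el Om \<and> fin emp" using Om_fin[of emp] by simp
    fix n assume n: "n \<in> el Om \<and> fin n"
    have "sc n = un n (sg n)" by (rule ext) simp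
    then have "fin (sc n)" using n fin_insert by metis
    moreover have "el (sc n) \<subseteq> el Om" using n trans_Om by (auto simp: trans_def)
    ultimately show "sc n \<in> el Om \<and> fin (sc n)" using Om_fin by blast
  qed
  then show "n \<in> el Om" ..
qed

lemma sj_image: assumes "sj q a" "DF (\<lambda>e. f (e 0))" "el b \<subseteq> f ` el a" shows "sj q b"
  using sj_trans[OF assms(1) sjI[OF assms(2,3)]] .

lemma sj_cp: assumes "sj q (cp q q)" "sj q a" "sj q b" shows "sj q (cp a b)"
proof -
  obtain f g where fg: "el a \<subseteq> (\<lambda>x. app f x) ` el q" "el b \<subseteq> (\<lambda>x. app g x) ` el q"
    using assms by (auto simp: sj_def)
  show ?thesis
  proof (rule sj_image[OF assms(1), of "\<lambda>x. pr (app f (fs x)) (app g (sn x))"])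
    show "DF (\<lambda>e. pr (app f (fs (e 0))) (app g (sn (e 0))))" by (intro dfn)
    show "el (cp a b) \<subseteq> (\<lambda>x. pr (app f (fs x)) (app g (sn x))) ` el (cp q q)"
    proof
      fix z assume "z \<in> el (cp a b)"
      then obtain x y where z: "z = pr x y" "x \<in> el a" "y \<in> el b" by (auto simp: PR_def)
      then obtain u v where "u \<in> el q" "x = app f u" "v \<in> el q" "y = app g v" using fg by blast
      then show "z \<in> (\<lambda>x. pr (app f (fs x)) (app g (sn x))) ` el (cp q q)"
        using z by (intro image_eqI[of _ _ "pr u v"]) auto
    qed
  qed
qed

lemma sj_Om_Om: "sj Om (cp Om Om)"
  by (rule sj_sub) (use Om_pr in \<open>auto simp: PR_def\<close>)

lemmas sj_Om_cp = sj_cp[OF sj_Om_Om]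

lemma sj_Om_fin: "fin x \<Longrightarrow> sj Om x"
proof -
  assume "fin x"
  then obtain n where n: "n \<in> el om" "sj n x" using fin_enum by blast
  have "el n \<subseteq> el Om" using n(1) om_trans om_Om by blast
  then show ?thesis using sj_trans[OF sj_sub] n(2) by blast
qed

lemma sj_Om_om: "sj Om om" by (rule sj_sub[OF om_Om])

text \<open>A finite subset of \<open>a\<close> is the image of a finite subset of
  \<open>Om\<close>, and the latter is itself an element of \<open>Om\<close>.\<close>

lemma sj_Om_Fin: assumes "sj Om a" shows "sj Om (Fin a)"
proof -
  obtain f where f: "el a \<subseteq> (\<lambda>x. app f x) ` el Om" using assms by (auto simp: sj_def)
  have s: "small ((\<lambda>k. app f k) ` el x)" for x by (intro small_image small_el dfn)
  show ?thesis
  proof (rule sjI[of "\<lambda>x. mk ((\<lambda>k. app f k) ` el x)"])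
    show "DF (\<lambda>e. mk ((\<lambda>k. app f k) ` el (e 0)))" by (intro dfn)
    show "el (Fin a) \<subseteq> (\<lambda>x. mk ((\<lambda>k. app f k) ` el x)) ` el Om"
    proof
      fix y assume "y \<in> el (Fin a)"
      then have y: "fin y" "el y \<subseteq> el a" by (auto simp: el_Fin)
      have "\<exists>x. fin x \<and> el x \<subseteq> el Om \<and> mk ((\<lambda>k. app f k) ` el x) = y"
      proof (rule fin_induct[OF _ y(1)])
        show "D (\<lambda>e. \<exists>x. fin x \<and> el x \<subseteq> el Om \<and> mk ((\<lambda>k. app f k) ` el x) = e 0)" by (intro dfn)
        have "mk ((\<lambda>k. app f k) ` el emp) = emp" by (rule mk_eq) simp
        then show "\<exists>x. fin x \<and> el x \<subseteq> el Om \<and> mk ((\<lambda>k. app f k) ` el x) = emp"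
          by (intro exI[of _ emp]) simp
        fix z b assume IH: "\<exists>x. fin x \<and> el x \<subseteq> el Om \<and> mk ((\<lambda>k. app f k) ` el x) = z" and b: "b \<in> el y"
        then obtain x where x: "fin x" "el x \<subseteq> el Om" "mk ((\<lambda>k. app f k) ` el x) = z" by blast
        obtain k where k: "k \<in> el Om" "b = app f k" using b y(2) f by blast
        have "el z = (\<lambda>k. app f k) ` el x" using x(3) el_mk[OF s] by blast
        then have "mk ((\<lambda>k. app f k) ` el (un x (sg k))) = un z (sg b)"
          using k by (intro mk_eq) auto
        then show "\<exists>x. fin x \<and> el x \<subseteq> el Om \<and> mk ((\<lambda>k. app f k) ` el x) = un z (sg b)"
          using x(1,2) k fin_insert by (intro exI[of _ "un x (sg k)"]) auto
      qed
      then show "y \<in> (\<lambda>x. mk ((\<lambda>k. app f k) ` el x)) ` el Om" using Om_fin by blast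
    qed
  qed
qed

text \<open>Choice selects covering maps for all \<open>B x\<close> at once; a pair from
  \<open>q\<close> then encodes an index together with an argument of its map.\<close>

lemma sj_UN:
  assumes qq: "sj q (cp q q)" and "sj q a" and B: "DF (\<lambda>e. B (e 0))" and "\<And>x. x \<in> el a \<Longrightarrow> sj q (B x)"
    and C: "el C \<subseteq> (\<Union>x\<in>el a. el (B x))"
  shows "sj q C"
proof -
  obtain f where f: "el a \<subseteq> (\<lambda>x. app f x) ` el q" using assms by (auto simp: sj_def)
  have "D (\<lambda>e. el (B (e 0)) \<subseteq> (\<lambda>x. app (e (Suc 0)) x) ` el q)" by (intro dfn liftF1[OF _ B])
  then obtain F where F: "\<And>x. x \<in> el a \<Longrightarrow> el (B x) \<subseteq> (\<lambda>y. app (app F x) y) ` el q"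
    by (rule AC[where Q = "\<lambda>x F. el (B x) \<subseteq> (\<lambda>y. app F y) ` el q" and a = a]) (use assms(4) in \<open>auto simp: sj_def\<close>)
  show ?thesis
  proof (rule sj_image[OF qq, of "\<lambda>z. app (app F (app f (fs z))) (sn z)"])
    show "DF (\<lambda>e. app (app F (app f (fs (e 0)))) (sn (e 0)))" by (intro dfn)
    show "el C \<subseteq> (\<lambda>z. app (app F (app f (fs z))) (sn z)) ` el (cp q q)"
    proof
      fix c assume "c \<in> el C"
      then obtain x where x: "x \<in> el a" "c \<in> el (B x)" using C by blast
      then obtain u v where "u \<in> el q" "x = app f u" "v \<in> el q" "c = app (app F x) v" using f F by blast
      then show "c \<in> (\<lambda>z. app (app F (app f (fs z))) (sn z)) ` el (cp q q)"
        by (intro image_eqI[of _ _ "pr u v"]) auto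
    qed
  qed
qed

lemmas sj_Om_UN = sj_UN[OF sj_Om_Om]

definition t0 where "t0 = emp"
definition t1 where "t1 = sc emp"
definition t2 where "t2 = sc (sc emp)"

lemma tags [simp]: "t0 \<noteq> t1" "t1 \<noteq> t0" "t0 \<noteq> t2" "t2 \<noteq> t0" "t1 \<noteq> t2" "t2 \<noteq> t1"
proof -
  have "el t0 = {}" "el t1 = {emp}" "el t2 = {emp, sc emp}" by (auto simp: t0_def t1_def t2_def)
  moreover have "sc emp \<noteq> emp" using el_sc[of emp] el_emp by (metis insert_not_empty)
  ultimately show "t0 \<noteq> t1" "t1 \<noteq> t0" "t0 \<noteq> t2" "t2 \<noteq> t0" "t1 \<noteq> t2" "t2 \<noteq> t1" by (metis insertI1 insert_iff singletonD empty_iff)+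
qed

lemma tags_om: "t0 \<in> el om" "t1 \<in> el om" "t2 \<in> el om" by (simp_all add: t0_def t1_def t2_def)

end

text \<open>A condition is a finite set of facts about sets \<open>X i \<subseteq> \<omega>\<close>, where the index \<open>i = (\<tau>, K)\<close>
  carries a set \<open>K\<close> of names of constraints: \<open>(t0, i, n)\<close> says \<open>n \<notin> X i\<close>, \<open>(t1, i, n)\<close> says \<open>n \<in> X i\<close>, and
  \<open>(t2, i, k)\<close> with \<open>k \<in> K\<close> promises that elements entering \<open>X i\<close> later lie outside the set named by \<open>k\<close>;
  a pair \<open>(n, d) \<in> k\<close> says that \<open>d\<close> forces \<open>n\<close> to be outside. As \<open>d\<close> has lower rank than \<open>k\<close>, the order
  would naturally be defined by recursion; instead, \<open>leq q p\<close> asks for a set \<open>W\<close> of conditions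
  verified by \<open>q\<close> that is closed under the needed witnesses. The ordinal \<open>th\<close> will be the length of the
  mad family, \<open>w1\<close> has cardinality above \<open>\<omega>\<close> in the extension, and \<open>la\<close> is the number of new reals;
  \<open>Om = V\<^sub>\<omega>\<close> serves as an index set that is closed under pairs.\<close>

locale mad_poset = zfc E for E :: "nat \<Rightarrow> nat \<Rightarrow> bool" +
  fixes th la w1 :: nat
  assumes lim_th: "lim th" and Ord_la: "Ord la" and om_la: "el om \<subseteq> el la"
    and reg_th: "\<alpha> \<in> el th \<Longrightarrow> \<forall>x\<in>el \<alpha>. app f x \<in> el th \<Longrightarrow> \<exists>b\<in>el th. \<forall>x\<in>el \<alpha>. app f x \<in> el b"
    and reg_w1: "\<forall>x\<in>el (cp (cp w1 om) Om). app f x \<in> el th \<Longrightarrow> \<exists>b\<in>el th. \<forall>x\<in>el (cp (cp w1 om) Om). app f x \<in> el b"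
    and om_th: "om \<in> el th"
    and w1: "Ord w1" "\<not> sj (cp om Om) w1" "emp \<in> el w1"
    and la: "\<not> sj (cp th Om) la"
begin

text \<open>With \<open>la\<close> as base set, all ordinals below \<lambda> are available at every
  stage, so the first component of an index costs nothing and a stage measures only the nesting of
  constraints.\<close>

abbreviation U where "U a \<equiv> V la a"

lemma Ord_th: "Ord th" using lim_th by (simp add: lim_def)
lemma trans_la: "trans la" using Ord_la by (simp add: Ord_def)
lemma trans_U: "Ord a \<Longrightarrow> trans (U a)" by (rule trans_V[OF trans_la])
lemma la_U: "Ord a \<Longrightarrow> el la \<subseteq> el (U a)" using V_base by blast

definition isidx where "isidx i \<longleftrightarrow> (\<exists>t K. i = pr t K \<and> t \<in> el la \<and> K \<in> el (U th))"
definition isfact where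
  "isfact z \<longleftrightarrow> (\<exists>i x. isidx i \<and> ((z = pr t0 (pr i x) \<and> x \<in> el om) \<or> (z = pr t1 (pr i x) \<and> x \<in> el om) \<or>
     (z = pr t2 (pr i x) \<and> x \<in> el (sn i))))"
definition cnd where
  "cnd p \<longleftrightarrow> fin p \<and> (\<forall>z\<in>el p. isfact z) \<and> (\<forall>i x. \<not> (pr t0 (pr i x) \<in> el p \<and> pr t1 (pr i x) \<in> el p))"
definition PP where "PP = mk {p \<in> el (U th). cnd p}"
definition ver where
  "ver q W \<longleftrightarrow> (\<forall>w\<in>el W. w \<in> el PP \<and> el w \<subseteq> el q \<and>
     (\<forall>i n k. pr t1 (pr i n) \<in> el q - el w \<and> pr t2 (pr i k) \<in> el w \<longrightarrow> (\<exists>d\<in>el W. pr n d \<in> el k)))"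
definition leq where "leq q p \<longleftrightarrow> q \<in> el PP \<and> p \<in> el PP \<and> (\<exists>W. p \<in> el W \<and> ver q W)"

lemma D_isidx [dfn]: "DF s \<Longrightarrow> D (\<lambda>e. isidx (s e))"
  by (rule lift1; (assumption | (unfold isidx_def, intro dfn)))
lemma D_isfact [dfn]: "DF s \<Longrightarrow> D (\<lambda>e. isfact (s e))"
  by (rule lift1; (assumption | (unfold isfact_def, intro dfn)))
lemma D_cnd [dfn]: "DF s \<Longrightarrow> D (\<lambda>e. cnd (s e))"
  by (rule lift1; (assumption | (unfold cnd_def, intro dfn)))
lemma D_ver [dfn]: "DF s \<Longrightarrow> DF t \<Longrightarrow> D (\<lambda>e. ver (s e) (t e))"
  by (rule lift2; (assumption | (unfold ver_def, intro dfn)))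
lemma D_leq [dfn]: "DF s \<Longrightarrow> DF t \<Longrightarrow> D (\<lambda>e. leq (s e) (t e))"
  by (rule lift2; (assumption | (unfold leq_def, intro dfn)))

lemma isfact_simps [simp]:
  "isfact (pr t0 (pr i x)) \<longleftrightarrow> isidx i \<and> x \<in> el om"
  "isfact (pr t1 (pr i x)) \<longleftrightarrow> isidx i \<and> x \<in> el om"
  "isfact (pr t2 (pr i x)) \<longleftrightarrow> isidx i \<and> x \<in> el (sn i)"
  by (auto simp: isfact_def)

lemma isidx_U: "isidx i \<Longrightarrow> i \<in> el (U th)"
  unfolding isidx_def using V_lim_pr[OF lim_th] la_U[OF Ord_th] by blast

lemma isfact_U: "isfact z \<Longrightarrow> z \<in> el (U th)"
proof -
  assume "isfact z"
  then obtain t i x where z: "z = pr t (pr i x)" "isidx i" "t \<in> el om" "x \<in> el om \<or> x \<in> el (sn i)"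
    using tags_om unfolding isfact_def by blast
  have "el om \<subseteq> el (U th)" using om_la la_U[OF Ord_th] by blast
  moreover have "el (sn i) \<subseteq> el (U th)" using z(2) trans_U[OF Ord_th] by (auto simp: isidx_def trans_def)
  ultimately show ?thesis using z isidx_U V_lim_pr[OF lim_th] by blast
qed

lemma in_PP: "p \<in> el PP \<longleftrightarrow> cnd p"
proof -
  have "el PP = {p \<in> el (U th). cnd p}"
    unfolding PP_def by (rule el_mk, rule separation[OF small_el[of "U th"]]) (auto intro!: dfn)
  moreover have "p \<in> el (U th)" if "cnd p"
    using that isfact_U by (intro V_lim_fin[OF lim_th]) (auto simp: cnd_def)
  ultimately show ?thesis by blast
qed

lemma leq_PP: "leq q p \<Longrightarrow> q \<in> el PP \<and> p \<in> el PP" by (simp add: leq_def)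

lemma leq_refl: "p \<in> el PP \<Longrightarrow> leq p p"
  unfolding leq_def ver_def by (intro conjI exI[of _ "sg p"]) auto

lemma ver_leq: "ver q W \<Longrightarrow> q \<in> el PP \<Longrightarrow> w \<in> el W \<Longrightarrow> leq q w"
  unfolding leq_def ver_def by blast

lemma leq_sub: "leq q p \<Longrightarrow> el p \<subseteq> el q" unfolding leq_def ver_def by blast

lemma leq_promise:
  assumes "leq q p" "pr t1 (pr i n) \<in> el q" "pr t1 (pr i n) \<notin> el p" "pr t2 (pr i k) \<in> el p"
  obtains d where "leq q d" "pr n d \<in> el k"
proof -
  obtain W where W: "p \<in> el W" "ver q W" using assms(1) by (auto simp: leq_def)
  then obtain d where "d \<in> el W" "pr n d \<in> el k" using assms unfolding ver_def by blast
  then show thesis using that ver_leq W leq_PP assms(1) by blast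
qed

text \<open>The verifying set may be described as a class: being definable and contained in
  \<open>PP\<close>, it is a set.\<close>

lemma leqI:
  assumes "q \<in> el PP" "D (\<lambda>e. A (e 0))" "A p"
    and A: "\<And>w. A w \<Longrightarrow> w \<in> el PP \<and> el w \<subseteq> el q"
    "\<And>w i n k. A w \<Longrightarrow> pr t1 (pr i n) \<in> el q \<Longrightarrow> pr t1 (pr i n) \<notin> el w \<Longrightarrow> pr t2 (pr i k) \<in> el w \<Longrightarrow> \<exists>d. A d \<and> pr n d \<in> el k"
  shows "leq q p"
proof -
  have W: "el (mk {w. A w}) = {w. A w}"
    by (rule el_mk, rule separation[OF small_el[of PP]]) (use A(1) in \<open>auto intro!: dfn assms(2)\<close>)
  have "ver q (mk {w. A w})" unfolding ver_def W using A by blast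
  then show ?thesis by (rule ver_leq) (use assms W in auto)
qed

text \<open>Conditions above \<open>r\<close> or above \<open>q\<close> together are closed under
  witnesses: a number present in \<open>q\<close> was justified by \<open>q\<close>, and one that
  enters after \<open>q\<close> meets a promise that is still present in \<open>q\<close>.\<close>

lemma leq_trans: assumes "leq r q" "leq q p" shows "leq r p"
proof (rule leqI[of r "\<lambda>w. leq r w \<or> leq q w"])
  show "D (\<lambda>e. leq r (e 0) \<or> leq q (e 0))" by (intro dfn)
  fix w assume w: "leq r w \<or> leq q w"
  show "w \<in> el PP \<and> el w \<subseteq> el r" using w leq_sub leq_PP assms(1) by blast
  fix i n k assume n: "pr t1 (pr i n) \<in> el r" "pr t1 (pr i n) \<notin> el w" and k: "pr t2 (pr i k) \<in> el w"
  show "\<exists>d. (leq r d \<or> leq q d) \<and> pr n d \<in> el k"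
  proof (cases "leq r w")
    case True
    then show ?thesis using leq_promise n k by metis
  next
    case False
    then have q: "leq q w" using w by blast
    show ?thesis
    proof (cases "pr t1 (pr i n) \<in> el q")
      case True
      then show ?thesis using leq_promise[OF q] n k by metis
    next
      case False
      then show ?thesis using leq_promise[OF assms(1) n(1)] k leq_sub[OF q] by (metis subsetD)
    qed
  qed
qed (use assms leq_PP in auto)

definition idx where "idx p = mk ((\<lambda>z. fs (sn z)) ` el p)"
lemma el_idx: "el (idx p) = (\<lambda>z. fs (sn z)) ` el p"
  unfolding idx_def by (intro el_mk small_image small_el dfn)
lemma DF_idx [dfn]: "DF s \<Longrightarrow> DF (\<lambda>e. idx (s e))"
  by (rule liftF1; (assumption | (unfold idx_def, intro dfn)))
lemma idxI: "pr t (pr i x) \<in> el p \<Longrightarrow> i \<in> el (idx p)"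
  unfolding el_idx by (intro image_eqI[of _ _ "pr t (pr i x)"]) auto
lemma fin_idx: "fin p \<Longrightarrow> fin (idx p)"
  unfolding idx_def by (intro fin_image dfn)

text \<open>Promises are dropped because compatibility depends only on the decided facts about
  common indices.\<close>

definition res where "res p a = mk {z \<in> el p. fs (sn z) \<in> el a \<and> fs z \<noteq> t2}"
lemma el_res: "el (res p a) = {z \<in> el p. fs (sn z) \<in> el a \<and> fs z \<noteq> t2}"
  unfolding res_def by (rule el_mk, rule separation[OF small_el[of p]]) (auto, intro dfn)
lemma DF_res [dfn]: "DF s \<Longrightarrow> DF t \<Longrightarrow> DF (\<lambda>e. res (s e) (t e))"
  by (rule liftF2; (assumption | (unfold res_def, intro dfn)))

text \<open>Facts of \<open>c\<close> about an index of \<open>u\<close> already belong to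
  \<open>u\<close>, so the union puts no new number into a set about which \<open>u\<close> has
  promises; \<open>u\<close> alone serves as verifying set.\<close>

lemma merge:
  assumes u: "u \<in> el PP" and c: "c \<in> el PP" and eq: "res u a = res c a"
    and a: "el (idx u) \<inter> el (idx c) \<subseteq> el a"
  shows "leq (un u c) u"
proof -
  have agree: "pr t (pr i x) \<in> el u \<longleftrightarrow> pr t (pr i x) \<in> el c"
    if "i \<in> el (idx u)" "i \<in> el (idx c)" "t \<noteq> t2" for t i x
  proof -
    have "i \<in> el a" using a that by blast
    then have "pr t (pr i x) \<in> el (res u a) \<longleftrightarrow> pr t (pr i x) \<in> el u"
      "pr t (pr i x) \<in> el (res c a) \<longleftrightarrow> pr t (pr i x) \<in> el c"
      using that by (auto simp: el_res)
    then show ?thesis using eq by simp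
  qed
  have "\<not> (pr t0 (pr i x) \<in> el (un u c) \<and> pr t1 (pr i x) \<in> el (un u c))" for i x
    using u c agree[of i t0 x] agree[of i t1 x] idxI[of _ i x u] idxI[of _ i x c]
    unfolding in_PP cnd_def by auto
  then have uc: "un u c \<in> el PP" using u c fin_un unfolding in_PP cnd_def by auto
  show ?thesis
  proof (rule leqI[of _ "\<lambda>w. w = u"])
    show "D (\<lambda>e. e 0 = u)" by (intro dfn)
    fix w i n k assume "w = u" "pr t1 (pr i n) \<in> el (un u c)" "pr t1 (pr i n) \<notin> el w" "pr t2 (pr i k) \<in> el w"
    then show "\<exists>d. d = u \<and> pr n d \<in> el k" using agree[of i t1 n] idxI[of _ i] by auto
  qed (use uc u in auto)
qed

text \<open>The small predense subset consists of chosen elements with indices in a set \<open>J\<close> closed under a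
  function choosing, for a finite \<open>a \<subseteq> J\<close> and a finite partial assignment, an element of \<open>A\<close> with this
  restriction to \<open>a\<close>.\<close>

definition FJ where "FJ J = cp (Fin J) (Fin (cp (upr t0 t1) (cp J om)))"
lemma DF_FJ [dfn]: "DF s \<Longrightarrow> DF (\<lambda>e. FJ (s e))"
  by (rule liftF1; (assumption | (unfold FJ_def, intro dfn)))

lemma predense_small:
  assumes A: "el A \<subseteq> el PP"
  obtains C where "sj Om C" "el C \<subseteq> el A" "\<And>u. u \<in> el A \<Longrightarrow> \<exists>c\<in>el C. \<exists>r. leq r u \<and> leq r c"
proof -
  define Z where "Z = mk {z \<in> el (cp (Fin (cp la (U th))) (U th)). \<exists>c\<in>el A. res c (fs z) = sn z}"
  have Z: "el Z = {z \<in> el (cp (Fin (cp la (U th))) (U th)). \<exists>c\<in>el A. res c (fs z) = sn z}"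
    unfolding Z_def by (rule el_mk, rule separation[OF small_el[of "cp (Fin (cp la (U th))) (U th)"]]) (auto intro!: dfn)
  have "D (\<lambda>e. e (Suc 0) \<in> el A \<and> res (e (Suc 0)) (fs (e 0)) = sn (e 0))" by (intro dfn)
  then obtain F where F: "\<And>z. z \<in> el Z \<Longrightarrow> app F z \<in> el A \<and> res (app F z) (fs z) = sn z"
    by (rule AC[where Q = "\<lambda>z c. c \<in> el A \<and> res c (fs z) = sn z" and a = Z]) (auto simp: Z)
  define Ph where "Ph J = mk (el J \<union> (\<Union>z\<in>el (FJ J) \<inter> el Z. el (idx (app F z))))" for J
  have sP: "small (\<Union>z\<in>el (FJ J) \<inter> el Z. el (idx (app F z)))" for J
    by (rule small_UN, rule separation[OF small_el[of "FJ J"]]) (auto, intro dfn, intro dfn)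
  have Ph: "el (Ph J) = el J \<union> (\<Union>z\<in>el (FJ J) \<inter> el Z. el (idx (app F z)))" for J
    unfolding Ph_def by (intro el_mk small_Un small_el sP)
  have DPh: "DF s \<Longrightarrow> DF (\<lambda>e. Ph (s e))" for s
    by (rule liftF1; (assumption | (unfold Ph_def, intro dfn)))
  define St where "St p n f = mk (\<Union>m\<in>el n. el (Ph (app f m)))" for p n f :: nat
  have St: "DF3 St" unfolding DF3_def St_def by (intro dfn DPh)
  define J where "J n = Rec St emp n" for n
  have DJ: "DF s \<Longrightarrow> DF (\<lambda>e. J (s e))" for s unfolding J_def by (intro DF_Rec[OF St] dfn)
  have J: "el (J n) = (\<Union>m\<in>el n. el (Ph (J m)))" if "Ord n" for n
  proof -
    have "J n = mk (\<Union>m\<in>el n. el (Ph (J m)))"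
      unfolding J_def by (subst Rec_Ord[OF St that], subst St_def) (simp add: app_lam_Rec[OF St] cong: SUP_cong)
    moreover have "small (\<Union>m\<in>el n. el (Ph (J m)))" by (rule small_UN) (simp_all, intro dfn DPh DJ)
    ultimately show ?thesis using el_mk by simp
  qed
  have fin_PP: "fin p" if "p \<in> el A" for p using that A in_PP cnd_def by blast
  have sj_FJ: "sj Om (FJ K)" if "sj Om K" for K
    unfolding FJ_def
    by (intro sj_Om_cp sj_Om_Fin that sj_Om_om sj_Om_fin) (use fin_insert[OF fin_insert[OF fin_emp]] in \<open>metis el_un el_sg el_emp un_sg sup_bot_left ext el_upr insert_is_Un\<close>)
  have sj_FZ: "sj Om (mk (el (FJ K) \<inter> el Z))" "el (mk (el (FJ K) \<inter> el Z)) = el (FJ K) \<inter> el Z" if "sj Om K" for K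
  proof -
    show e: "el (mk (el (FJ K) \<inter> el Z)) = el (FJ K) \<inter> el Z"
      by (rule el_mk, rule separation[OF small_el[of "FJ K"]]) (auto, intro dfn)
    show "sj Om (mk (el (FJ K) \<inter> el Z))" by (rule sj_image[OF sj_FJ[OF that], of "\<lambda>x. x"]) (auto simp: e intro: dfn)
  qed
  have sj_Ph: "sj Om (Ph K)" if K: "sj Om K" for K
  proof -
    have 1: "sj Om (mk (\<Union>z\<in>el (FJ K) \<inter> el Z. el (idx (app F z))))"
    proof (rule sj_Om_UN[OF sj_FZ(1)[OF K], of "\<lambda>z. idx (app F z)"])
      show "DF (\<lambda>e. idx (app F (e 0)))" by (intro dfn)
      show "sj Om (idx (app F z))" if "z \<in> el (mk (el (FJ K) \<inter> el Z))" for z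
        using that F fin_PP sj_FZ(2)[OF K] by (intro sj_Om_fin fin_idx) auto
    qed (simp add: el_mk sP sj_FZ(2)[OF K])
    have up: "sj Om (upr K K')" for K'
      by (intro sj_Om_fin) (metis fin_insert[OF fin_insert[OF fin_emp]] el_un el_sg el_emp sup_bot_left ext el_upr insert_is_Un)
    show ?thesis
      by (rule sj_Om_UN[OF up[of "mk (\<Union>z\<in>el (FJ K) \<inter> el Z. el (idx (app F z)))"], of "\<lambda>x. x"])
        (use 1 K in \<open>auto simp: Ph el_mk sP intro: dfn\<close>)
  qed
  have sj_J: "n \<in> el om \<longrightarrow> sj Om (J n)" if "Ord n" for n
  proof (rule Ord_induct[OF _ _ that])
    show "D (\<lambda>e. e 0 \<in> el om \<longrightarrow> sj Om (J (e 0)))" by (intro dfn DJ)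
    fix n assume n: "Ord n" and IH: "\<And>m. m \<in> el n \<Longrightarrow> m \<in> el om \<longrightarrow> sj Om (J m)"
    show "n \<in> el om \<longrightarrow> sj Om (J n)"
    proof
      assume no: "n \<in> el om"
      have "sj Om n" using no om_Om trans_Om by (intro sj_sub) (auto simp: trans_def)
      then show "sj Om (J n)"
      proof (rule sj_Om_UN[of _ "\<lambda>m. Ph (J m)"])
        show "DF (\<lambda>e. Ph (J (e 0)))" by (intro DPh DJ dfn)
        show "sj Om (Ph (J m))" if "m \<in> el n" for m using sj_Ph IH that om_trans[OF no] by blast
      qed (simp add: J n)
    qed
  qed
  have J_mono: "el (J m) \<subseteq> el (Ph (J m))" "el (Ph (J m)) \<subseteq> el (J n)" if "Ord n" "m \<in> el n" for m n
    using J[OF that(1)] that(2) Ph by auto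
  have J_mono2: "el (J m) \<subseteq> el (J n)" if "Ord n" "m \<in> el n \<or> m = n" for m n using J_mono that by blast
  have chain: "fin x \<Longrightarrow> el x \<subseteq> (\<Union>n\<in>el om. el (J n)) \<Longrightarrow> \<exists>n\<in>el om. el x \<subseteq> el (J n)" for x
  proof -
    assume x: "fin x" "el x \<subseteq> (\<Union>n\<in>el om. el (J n))"
    have "el x \<subseteq> (\<Union>n\<in>el om. el (J n)) \<longrightarrow> (\<exists>n\<in>el om. el x \<subseteq> el (J n))"
    proof (rule fin_induct[OF _ x(1)])
      show "D (\<lambda>e. el (e 0) \<subseteq> (\<Union>n\<in>el om. el (J n)) \<longrightarrow> (\<exists>n\<in>el om. el (e 0) \<subseteq> el (J n)))" by (intro dfn DJ)
      show "el emp \<subseteq> (\<Union>n\<in>el om. el (J n)) \<longrightarrow> (\<exists>n\<in>el om. el emp \<subseteq> el (J n))" by (intro impI bexI[of _ emp]) auto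
      fix y b assume IH: "el y \<subseteq> (\<Union>n\<in>el om. el (J n)) \<longrightarrow> (\<exists>n\<in>el om. el y \<subseteq> el (J n))"
      show "el (un y (sg b)) \<subseteq> (\<Union>n\<in>el om. el (J n)) \<longrightarrow> (\<exists>n\<in>el om. el (un y (sg b)) \<subseteq> el (J n))"
      proof
        assume "el (un y (sg b)) \<subseteq> (\<Union>n\<in>el om. el (J n))"
        then obtain n m where nm: "n \<in> el om" "el y \<subseteq> el (J n)" "m \<in> el om" "b \<in> el (J m)" using IH by auto
        have "el (J n) \<subseteq> el (J m) \<or> el (J m) \<subseteq> el (J n)"
          using Ord_linear[of n m] J_mono2 nm(1,3) om_Ord by blast
        then show "\<exists>n\<in>el om. el (un y (sg b)) \<subseteq> el (J n)" using nm by auto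
      qed
    qed
    then show ?thesis using x(2) by blast
  qed
  define C where "C = mk ((\<lambda>z. app F z) ` (\<Union>n\<in>el om. el (FJ (J n)) \<inter> el Z))"
  have s1: "small (\<Union>n\<in>el om. el (FJ (J n)) \<inter> el Z)"
    by (rule small_UN, simp, rule separation[OF small_el]) (auto, intro dfn DJ, intro dfn DJ)
  have C: "el C = (\<lambda>z. app F z) ` (\<Union>n\<in>el om. el (FJ (J n)) \<inter> el Z)"
    unfolding C_def by (intro el_mk small_image s1 dfn)
  show thesis
  proof (rule that)
    show "el C \<subseteq> el A" using C F by auto
    have "sj Om (mk (\<Union>n\<in>el om. el (FJ (J n)) \<inter> el Z))"
    proof (rule sj_Om_UN[OF sj_Om_om, of "\<lambda>n. mk (el (FJ (J n)) \<inter> el Z)"])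
      show "DF (\<lambda>e. mk (el (FJ (J (e 0))) \<inter> el Z))" by (intro dfn DJ)
      show "sj Om (mk (el (FJ (J n)) \<inter> el Z))" if "n \<in> el om" for n using sj_J that by (intro sj_FZ) auto
      show "el (mk (\<Union>n\<in>el om. el (FJ (J n)) \<inter> el Z)) \<subseteq> (\<Union>n\<in>el om. el (mk (el (FJ (J n)) \<inter> el Z)))"
        using el_mk[OF s1] sj_FZ(2)[OF sj_J[rule_format]] by auto
    qed
    then show "sj Om C" by (rule sj_image[of _ _ "\<lambda>z. app F z"]) (intro dfn, simp only: C el_mk[OF s1] subset_refl)
    fix u assume u: "u \<in> el A"
    \<comment> \<open>The part of the indices of \<open>u\<close> inside the closed set. The chosen
      element has the same restriction to it and all its indices in the closed set, so its common
      indices with \<open>u\<close> lie in \<open>a\<close> and \<open>merge\<close> applies both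
      ways.\<close>
    define a where "a = mk {i \<in> el (idx u). i \<in> (\<Union>n\<in>el om. el (J n))}"
    have a: "el a = {i \<in> el (idx u). i \<in> (\<Union>n\<in>el om. el (J n))}"
      unfolding a_def by (rule el_mk, rule separation[OF small_el[of "idx u"]]) (auto intro!: dfn DJ)
    have fa: "fin a" by (rule fin_sub[OF fin_idx[OF fin_PP[OF u]]]) (auto simp: a)
    then obtain n where n: "n \<in> el om" "el a \<subseteq> el (J n)" using chain a by blast
    have fu: "isfact z" if "z \<in> el u" for z using that u A by (auto simp: in_PP cnd_def)
    have "z \<in> el (cp (upr t0 t1) (cp (J n) om))" if "z \<in> el (res u a)" for z
      using that fu[of z] n(2) by (auto simp: el_res isfact_def)
    moreover have fr: "fin (res u a)" by (rule fin_sub[OF fin_PP[OF u]]) (auto simp: el_res)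
    ultimately have zF: "pr a (res u a) \<in> el (FJ (J n))" using fa n(2) unfolding FJ_def by (auto simp: el_Fin)
    have "el a \<subseteq> el (cp la (U th))"
    proof
      fix i assume "i \<in> el a"
      then obtain z where "z \<in> el u" "i = fs (sn z)" using a el_idx by auto
      then show "i \<in> el (cp la (U th))" using fu[of z] by (auto simp: isfact_def isidx_def)
    qed
    moreover have "res u a \<in> el (U th)"
      using fu isfact_U by (intro V_lim_fin[OF lim_th fr]) (auto simp: el_res)
    ultimately have zZ: "pr a (res u a) \<in> el Z" using fa u unfolding Z by (auto simp: el_Fin)
    let ?c = "app F (pr a (res u a))"
    have c: "?c \<in> el A" "res ?c a = res u a" using F[OF zZ] by auto
    have "el (idx ?c) \<subseteq> el (Ph (J n))" using Ph zF zZ by blast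
    then have "el (idx ?c) \<subseteq> el (J (sc n))" using J_mono(2)[of "sc n" n] n(1) by auto
    then have "el (idx u) \<inter> el (idx ?c) \<subseteq> el a" using a n(1) sc_om by blast
    then have "leq (un u ?c) u" "leq (un ?c u) ?c" using c u A by (auto intro!: merge[where a = a])
    moreover have "un u ?c = un ?c u" by (rule ext) auto
    moreover have "?c \<in> el C" using C zF zZ n(1) by blast
    ultimately show "\<exists>c\<in>el C. \<exists>r. leq r u \<and> leq r c" by metis
  qed
qed

end

section \<open>Extending conditions, and the stages of names\<close>

context mad_poset begin

lemma fin_sg: "fin (sg z)"
proof -
  have "un emp (sg z) = sg z" by (rule ext) simp
  then show ?thesis using fin_insert[OF fin_emp, of z] by simp
qed

lemma leq_sg:
  assumes "q \<in> el PP" "pr t (pr i n) \<in> el q" "t \<noteq> t2" shows "leq q (sg (pr t (pr i n)))"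
proof (rule leqI[OF assms(1), of "\<lambda>w. w = sg (pr t (pr i n))"])
  show "D (\<lambda>e. e 0 = sg (pr t (pr i n)))" by (intro dfn)
  have "isfact (pr t (pr i n))" using assms in_PP cnd_def by blast
  moreover have "fin (sg (pr t (pr i n)))" by (rule fin_sg)
  ultimately have "sg (pr t (pr i n)) \<in> el PP" unfolding in_PP cnd_def using tags by auto
  then show "\<And>w. w = sg (pr t (pr i n)) \<Longrightarrow> w \<in> el PP \<and> el w \<subseteq> el q" using assms by auto
qed (use assms in auto)

lemma emp_PP: "emp \<in> el PP" by (simp add: in_PP cnd_def)

lemma leq_emp: "q \<in> el PP \<Longrightarrow> leq q emp"
  by (rule leqI[of q "\<lambda>w. w = emp"]) (auto simp: emp_PP intro: dfn)

lemma add_promise: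
  assumes "p \<in> el PP" "isidx i" "k \<in> el (sn i)" shows "leq (un p (sg (pr t2 (pr i k)))) p"
proof (rule leqI[of _ "\<lambda>w. w = p"])
  show "un p (sg (pr t2 (pr i k))) \<in> el PP"
    using assms fin_insert unfolding in_PP cnd_def by auto
  show "D (\<lambda>e. e 0 = p)" by (intro dfn)
qed (use assms in auto)

lemma fresh_bound:
  assumes "p \<in> el PP"
  obtains m where "m \<in> el om" "\<And>n t i. n \<in> el om \<Longrightarrow> n \<notin> el m \<Longrightarrow> pr t (pr i n) \<notin> el p"
proof -
  have "fin p" using assms by (simp add: in_PP cnd_def)
  then obtain m where m: "m \<in> el om" "\<forall>y\<in>el p. sn (sn y) \<in> el om \<longrightarrow> sn (sn y) \<in> el m"
    using fin_bound[of "\<lambda>z. sn (sn z)" p, OF DF_sn[OF DF_sn[OF DF_var]]] by blast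
  have "pr t (pr i n) \<notin> el p" if "n \<in> el om" "n \<notin> el m" for n t i
    using bspec[OF m(2), of "pr t (pr i n)"] that by auto
  then show thesis using that m(1) by blast
qed

text \<open>An index with empty constraint set admits no promises, so both facts can be added
  freely. This makes the \<lambda> reals with such indices distinct.\<close>

lemma split_idx:
  assumes p: "p \<in> el PP" and "a \<in> el la" "b \<in> el la" "a \<noteq> b"
    and n: "n \<in> el om" "\<And>t i. pr t (pr i n) \<notin> el p"
  shows "leq (un p (upr (pr t1 (pr (pr a emp) n)) (pr t0 (pr (pr b emp) n)))) p" (is "leq ?q p")
proof (rule leqI[of _ "\<lambda>w. w = p"])
  have e: "emp \<in> el (U th)" using V_intro[OF Ord_th, of emp emp] lim_th by (auto simp: lim_def)
  then have i: "isidx (pr a emp)" "isidx (pr b emp)" using assms by (auto simp: isidx_def)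
  have "fin ?q"
  proof -
    have "?q = un (un p (sg (pr t1 (pr (pr a emp) n)))) (sg (pr t0 (pr (pr b emp) n)))"
      by (rule ext) auto
    then show ?thesis using p fin_insert by (simp add: in_PP cnd_def)
  qed
  then show "?q \<in> el PP" using p i n assms(4) unfolding in_PP cnd_def by auto
  show "D (\<lambda>e. e 0 = p)" by (intro dfn)
  fix w i k m assume w: "w = p" "pr t1 (pr i k) \<in> el ?q" "pr t1 (pr i k) \<notin> el w" "pr t2 (pr i m) \<in> el w"
  then have "i = pr a emp" by auto
  moreover have "isfact (pr t2 (pr i m))" using w(1,4) p unfolding in_PP cnd_def by blast
  ultimately show "\<exists>d. d = p \<and> pr k d \<in> el m" by simp
qed (use p in auto)

text \<open>The conditions that speak only about sets of stage \<open>g\<close>; they play the part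
  of an initial segment of an iteration.\<close>

definition PL where "PL g p \<longleftrightarrow> (\<forall>i\<in>el (idx p). sn i \<in> el (U g))"
lemma D_PL [dfn]: "DF s \<Longrightarrow> DF t \<Longrightarrow> D (\<lambda>e. PL (s e) (t e))"
  by (rule lift2; (assumption | (unfold PL_def, intro dfn)))

lemma PL_stage: assumes "Ord g" "d \<in> el (U g)" "d \<in> el PP" shows "PL g d"
  unfolding PL_def
proof
  note T = trans_U[OF assms(1)]
  fix i assume "i \<in> el (idx d)"
  then obtain z where z: "z \<in> el d" "i = fs (sn z)" using el_idx by auto
  moreover have "isfact z" using assms(3) z in_PP cnd_def by blast
  ultimately obtain t x where zz: "z = pr t (pr i x)" "isidx i" by (auto simp: isfact_def)
  have "z \<in> el (U g)" using T z(1) assms(2) by (auto simp: trans_def)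
  then have "i \<in> el (U g)" using zz trans_pr[OF T] by blast
  moreover obtain a k where "i = pr a k" using zz(2) by (auto simp: isidx_def)
  ultimately show "sn i \<in> el (U g)" using trans_pr[OF T, of a k] by simp
qed

text \<open>Stages are transitive, so a witness for a constraint of stage \<open>g\<close> has only
  indices of stage \<open>g\<close>. Fulfilling promises never leads out of the low part.\<close>

lemma PL_closed: assumes "Ord g" "k \<in> el (U g)" "pr n d \<in> el k" "d \<in> el PP" shows "PL g d"
proof -
  have "pr n d \<in> el (U g)" using assms trans_U[OF assms(1)] by (auto simp: trans_def)
  then show ?thesis using PL_stage[OF assms(1) _ assms(4)] trans_pr[OF trans_U[OF assms(1)]] by blast
qed

lemma PL_emp: "PL g emp" by (simp add: PL_def el_idx)

text \<open>The new condition adds \<open>n \<in> X i0\<close> to \<open>p\<close> and to the part of \<open>r\<close> below stage \<open>g\<close>; promises that no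
  information below stage \<open>g\<close> fulfills must be of the form \<open>hn i\<close>, and are kept by adding \<open>n \<notin> X i\<close>.\<close>

lemma extend:
  assumes g: "Ord g" and rp: "leq r p" and i0: "isidx i0" "sn i0 \<notin> el (U g)"
    and n: "n \<in> el om" "\<And>t i. pr t (pr i n) \<notin> el p"
    and T: "fin T" "\<And>i. i \<in> el T \<Longrightarrow> isidx i \<and> sn i \<notin> el (U g) \<and> i \<noteq> i0"
    and prom: "\<And>k. pr t2 (pr i0 k) \<in> el p \<Longrightarrow> \<exists>d. pr n d \<in> el k \<and>
      ((PL g d \<and> leq r d) \<or> (\<exists>i\<in>el T. d = sg (pr t0 (pr i n))))"
  obtains q where "leq q p" "pr t1 (pr i0 n) \<in> el q" "\<And>d. PL g d \<Longrightarrow> leq r d \<Longrightarrow> leq q d"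
proof -
  \<comment> \<open>The whole of \<open>r\<close> is unsuitable: it may say that \<open>n\<close> is
    outside \<open>X i0\<close>, or contain further promises about \<open>i0\<close>. Neither
    belongs to the part below stage \<open>g\<close>.\<close>
  define low where "low = mk {z \<in> el r. sn (fs (sn z)) \<in> el (U g)}"
  have low: "el low = {z \<in> el r. sn (fs (sn z)) \<in> el (U g)}"
    unfolding low_def by (rule el_mk, rule separation[OF small_el[of r]]) (auto, intro dfn)
  define Z where "Z = mk ((\<lambda>i. pr t0 (pr i n)) ` el T)"
  have Z: "el Z = (\<lambda>i. pr t0 (pr i n)) ` el T" unfolding Z_def by (intro el_mk small_image small_el dfn)
  have finZ: "fin Z" unfolding Z_def by (intro fin_image T dfn)
  define q where "q = un (un (un low p) (sg (pr t1 (pr i0 n)))) Z"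
  have q: "el q = el low \<union> el p \<union> {pr t1 (pr i0 n)} \<union> el Z" by (auto simp: q_def)
  have pr: "el p \<subseteq> el r" and P: "p \<in> el PP" "r \<in> el PP" using rp leq_sub leq_PP by blast+
  have finlow: "fin low" using P(2) fin_sub[of r low] low by (auto simp: in_PP cnd_def)
  have "cnd q" unfolding cnd_def
  proof (intro conjI ballI allI notI)
    show "fin q" unfolding q_def using P finlow finZ by (intro fin_un fin_insert) (auto simp: in_PP cnd_def)
    show "isfact z" if "z \<in> el q" for z
    proof -
      have "z \<in> el r \<or> z = pr t1 (pr i0 n) \<or> z \<in> el Z" using that pr low unfolding q by blast
      then show ?thesis using P(2) i0(1) n(1) T(2) Z by (auto simp: in_PP cnd_def)
    qed
    fix i x assume "pr t0 (pr i x) \<in> el q \<and> pr t1 (pr i x) \<in> el q"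
    then have "(pr t0 (pr i x) \<in> el low \<union> el p \<or> (i \<in> el T \<and> x = n))"
      "(pr t1 (pr i x) \<in> el low \<union> el p \<or> (i = i0 \<and> x = n))" unfolding q Z by auto
    moreover have "\<not> (pr t0 (pr i x) \<in> el r \<and> pr t1 (pr i x) \<in> el r)" using P(2) by (auto simp: in_PP cnd_def)
    moreover have "i \<in> el T \<Longrightarrow> pr t1 (pr i n) \<notin> el low \<union> el p" using T(2) low n(2) by auto
    moreover have "pr t0 (pr i0 n) \<notin> el low \<union> el p" using i0(2) low n(2) by auto
    moreover have "i0 \<notin> el T" using T(2) by blast
    ultimately show False using pr low by blast
  qed
  then have qP: "q \<in> el PP" by (simp add: in_PP)
  \<comment> \<open>The verifying class: \<open>p\<close> itself, the low conditions above
    \<open>r\<close>, which justify each other, and the single negative facts, which contain no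
    promises.\<close>
  define A where "A w \<longleftrightarrow> w = p \<or> (PL g w \<and> leq r w) \<or> (\<exists>i\<in>el T. w = sg (pr t0 (pr i n)))" for w
  have DA: "D (\<lambda>e. A (e 0))" unfolding A_def by (intro dfn)
  have A1: "w \<in> el PP \<and> el w \<subseteq> el q" if "A w" for w
    using that unfolding A_def
  proof (elim disjE conjE bexE)
    assume w: "PL g w" "leq r w"
    have "z \<in> el low" if "z \<in> el w" for z
    proof -
      have "fs (sn z) \<in> el (idx w)" using that el_idx by auto
      then show ?thesis using w leq_sub that low by (auto simp: PL_def)
    qed
    then show ?thesis using w leq_PP q by blast
  next
    fix i assume i: "i \<in> el T" "w = sg (pr t0 (pr i n))"
    then have "pr t0 (pr i n) \<in> el q" using q Z by blast
    then have "leq q w" using leq_sg[OF qP] i by simp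
    then show ?thesis using leq_PP leq_sub by blast
  qed (use P q in auto)
  have A2: "\<exists>d. A d \<and> pr m d \<in> el k"
    if w: "A w" and m: "pr t1 (pr i m) \<in> el q" "pr t1 (pr i m) \<notin> el w" and k: "pr t2 (pr i k) \<in> el w" for w i m k
    using w unfolding A_def[of w]
  proof (elim disjE conjE bexE)
    have kk: "k \<in> el (sn i)" "isidx i"
    proof -
      have "w \<in> el PP" using A1 w by blast
      then have "isfact (pr t2 (pr i k))" using k in_PP cnd_def by blast
      then show "k \<in> el (sn i)" "isidx i" by auto
    qed
    assume wp: "w = p"
    \<comment> \<open>\<open>Z\<close> contributes only negative facts, so a new positive fact
      either comes from the low part of \<open>r\<close> or is the one about
      \<open>i0\<close>.\<close>
    have "pr t1 (pr i m) \<in> el low \<or> (i = i0 \<and> m = n)" using m wp q Z by auto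
    then show ?thesis
    proof (elim disjE conjE)
      assume "pr t1 (pr i m) \<in> el low"
      then have l: "pr t1 (pr i m) \<in> el r" "sn i \<in> el (U g)" using low by auto
      obtain d where d: "leq r d" "pr m d \<in> el k" using leq_promise[OF rp l(1)] m(2) k wp by blast
      have "k \<in> el (U g)" using l(2) kk trans_U[OF g] unfolding trans_def by blast
      then have "PL g d" using PL_closed[OF g _ d(2)] d(1) leq_PP by blast
      then show ?thesis using d unfolding A_def by blast
    next
      assume "i = i0" "m = n"
      then show ?thesis using prom k wp unfolding A_def by blast
    qed
  next
    assume pw: "PL g w" "leq r w"
    have "i \<in> el (idx w)" using k idxI by blast
    then have i: "sn i \<in> el (U g)" using pw by (simp add: PL_def)
    then have "pr t1 (pr i m) \<in> el r" using m i0 low pr unfolding q Z by auto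
    then obtain d where d: "leq r d" "pr m d \<in> el k" using leq_promise[OF pw(2)] m(2) k by blast
    have "isfact (pr t2 (pr i k))" using k pw(2) leq_PP in_PP cnd_def by blast
    then have "k \<in> el (U g)" using i trans_U[OF g] unfolding trans_def by auto
    then have "PL g d" using PL_closed[OF g _ d(2)] d(1) leq_PP by blast
    then show ?thesis using d unfolding A_def by blast
  next
    fix j assume "j \<in> el T" "w = sg (pr t0 (pr j n))"
    then show ?thesis using k by simp
  qed
  have leqA: "leq q w" if "A w" for w by (rule leqI[OF qP DA that A1 A2])
  show thesis
  proof (rule that)
    show "leq q p" by (rule leqA) (simp add: A_def)
    show "pr t1 (pr i0 n) \<in> el q" using q by blast
    show "leq q d" if "PL g d" "leq r d" for d by (rule leqA) (use that in \<open>simp add: A_def\<close>)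
  qed
qed

text \<open>\<open>H\<close> is finite only in the sense of the model, so the decisions are
  collected by an internal induction and not by repeating the choice outside.\<close>

lemma decide_finite:
  assumes S: "D (\<lambda>e. S (e 0) (e (Suc 0)))" and "fin H" "p \<in> el PP"
  shows "\<exists>r. leq r p \<and> (\<forall>k\<in>el H. (\<exists>d. S k d \<and> leq r d) \<or> (\<forall>d r'. S k d \<longrightarrow> leq r' r \<longrightarrow> \<not> leq r' d))"
proof (rule fin_induct[OF _ assms(2)])
  show "D (\<lambda>e. \<exists>r. leq r p \<and> (\<forall>k\<in>el (e 0). (\<exists>d. S k d \<and> leq r d) \<or> (\<forall>d r'. S k d \<longrightarrow> leq r' r \<longrightarrow> \<not> leq r' d)))"
    by (intro dfn lift2[OF _ _ S])
  show "\<exists>r. leq r p \<and> (\<forall>k\<in>el emp. (\<exists>d. S k d \<and> leq r d) \<or> (\<forall>d r'. S k d \<longrightarrow> leq r' r \<longrightarrow> \<not> leq r' d))"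
    using leq_refl assms(3) by auto
  fix y a assume "\<exists>r. leq r p \<and> (\<forall>k\<in>el y. (\<exists>d. S k d \<and> leq r d) \<or> (\<forall>d r'. S k d \<longrightarrow> leq r' r \<longrightarrow> \<not> leq r' d))"
  then obtain r where r: "leq r p" "\<forall>k\<in>el y. (\<exists>d. S k d \<and> leq r d) \<or> (\<forall>d r'. S k d \<longrightarrow> leq r' r \<longrightarrow> \<not> leq r' d)" by blast
  obtain r1 where r1: "leq r1 r" "(\<exists>d. S a d \<and> leq r1 d) \<or> (\<forall>d r'. S a d \<longrightarrow> leq r' r1 \<longrightarrow> \<not> leq r' d)"
  proof (cases "\<exists>d r1. S a d \<and> leq r1 r \<and> leq r1 d")
    case True
    then show ?thesis using that by blast
  next
    case False
    then show ?thesis using that[of r] leq_refl leq_PP r(1) by blast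
  qed
  have "leq r1 p" using r1 r leq_trans by blast
  moreover have "(\<exists>d. S k d \<and> leq r1 d) \<or> (\<forall>d r'. S k d \<longrightarrow> leq r' r1 \<longrightarrow> \<not> leq r' d)" if "k \<in> el y" for k
    using bspec[OF r(2) that] r1(1) leq_trans by blast
  ultimately show "\<exists>r. leq r p \<and> (\<forall>k\<in>el (un y (sg a)). (\<exists>d. S k d \<and> leq r d) \<or> (\<forall>d r'. S k d \<longrightarrow> leq r' r \<longrightarrow> \<not> leq r' d))"
    using r1(2) by (intro exI[of _ r1]) auto
qed

text \<open>The predense subsets for all \<open>y\<close> are enumerated simultaneously and over the
  common index set \<open>Om\<close>, so that the conditions used altogether can be counted.\<close>

lemma predense_choice:
  assumes DS: "DF (\<lambda>e. S (e 0))" and "\<And>y. el (S y) \<subseteq> el PP"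
  obtains F where "\<And>y u. y \<in> el A \<Longrightarrow> u \<in> el (S y) \<Longrightarrow>
    \<exists>x\<in>el Om. app (app F y) x \<in> el (S y) \<and> (\<exists>r. leq r u \<and> leq r (app (app F y) x))"
proof -
  define R where "R y F \<longleftrightarrow> (\<forall>u\<in>el (S y). \<exists>x\<in>el Om. app F x \<in> el (S y) \<and> (\<exists>r. leq r u \<and> leq r (app F x)))" for y F
  have DR: "D (\<lambda>e. R (e 0) (e (Suc 0)))" unfolding R_def by (intro dfn liftF1[OF _ DS])
  have "\<exists>F. R y F" for y
  proof -
    obtain C where C: "sj Om C" "el C \<subseteq> el (S y)" "\<And>u. u \<in> el (S y) \<Longrightarrow> \<exists>c\<in>el C. \<exists>r. leq r u \<and> leq r c"
      using predense_small[OF assms(2)[of y]] by metis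
    obtain f where f: "el C \<subseteq> (\<lambda>x. app f x) ` el Om" using C(1) by (auto simp: sj_def)
    have "R y f" unfolding R_def
    proof
      fix u assume "u \<in> el (S y)"
      then obtain c r where c: "c \<in> el C" "leq r u" "leq r c" using C(3) by blast
      then obtain x where "x \<in> el Om" "c = app f x" using f by blast
      then show "\<exists>x\<in>el Om. app f x \<in> el (S y) \<and> (\<exists>r. leq r u \<and> leq r (app f x))" using c C(2) by blast
    qed
    then show ?thesis by blast
  qed
  then obtain F where F: "\<And>y. y \<in> el A \<Longrightarrow> R y (app F y)" using AC[OF DR, of A] by metis
  then show thesis using that unfolding R_def by blast
qed

lemma lim_sc: "b \<in> el th \<Longrightarrow> sc b \<in> el th" using lim_th by (simp add: lim_def)
lemma Ord_in_th: "b \<in> el th \<Longrightarrow> Ord b" using Ord_mem[OF Ord_th] .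

lemma U_sub: "b \<in> el th \<Longrightarrow> el x \<subseteq> el (U b) \<Longrightarrow> x \<in> el (U (sc b))"
  using Ord_in_th by (intro V_intro[of "sc b" b]) auto

definition stage where "stage x = The1 (\<lambda>b. Ord b \<and> (b \<in> el th \<and> x \<in> el (U b)) \<and> (\<forall>c\<in>el b. \<not> (c \<in> el th \<and> x \<in> el (U c))))"
lemma DF_stage [dfn]: "DF s \<Longrightarrow> DF (\<lambda>e. stage (s e))"
  by (rule liftF1; (assumption | (unfold stage_def, intro dfn)))
lemma stage: assumes "x \<in> el (U th)" shows "stage x \<in> el th" "x \<in> el (U (stage x))"
proof -
  obtain b where b: "b \<in> el th" "x \<in> el (U b)" using V_lim_stage[OF lim_th assms] by blast
  have d: "D (\<lambda>e. e 0 \<in> el th \<and> x \<in> el (U (e 0)))" by (intro dfn)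
  from least_stage[OF d Ord_in_th[OF b(1)]] b
  show "stage x \<in> el th" "x \<in> el (U (stage x))" unfolding stage_def by blast+
qed

lemma stage_image:
  assumes reg: "\<And>f. \<forall>x\<in>el A. app f x \<in> el th \<Longrightarrow> \<exists>b\<in>el th. \<forall>x\<in>el A. app f x \<in> el b"
    and F: "DF (\<lambda>e. F (e 0))" "\<And>x. x \<in> el A \<Longrightarrow> F x \<in> el (U th)"
  obtains b where "b \<in> el th" "\<And>x. x \<in> el A \<Longrightarrow> F x \<in> el (U b)"
proof -
  have DF: "DF (\<lambda>e. stage (F (e 0)))" by (intro dfn F(1))
  have a: "app (lam (el A) (\<lambda>x. stage (F x))) x = stage (F x)" if "x \<in> el A" for x
    by (rule app_lam[OF small_el DF that])
  then obtain b where b: "b \<in> el th" "\<forall>x\<in>el A. stage (F x) \<in> el b"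
    using reg[of "lam (el A) (\<lambda>x. stage (F x))"] stage F(2) by auto
  have "F x \<in> el (U b)" if "x \<in> el A" for x
    using stage(2)[OF F(2)[OF that]] V_mono1[OF Ord_in_th[OF b(1)]] b(2) that by blast
  then show thesis using that b(1) by blast
qed

text \<open>A nice name: for each \<open>y\<close> only \<open>Om\<close> many conditions are kept,
  predense among those below the original ones. Regularity of \<theta> for the product of
  \<open>A\<close> and \<open>Om\<close> then bounds their stages.\<close>

lemma bounded_name:
  assumes reg: "\<And>f. \<forall>x\<in>el (cp A Om). app f x \<in> el th \<Longrightarrow> \<exists>b\<in>el th. \<forall>x\<in>el (cp A Om). app f x \<in> el b"
  obtains N' g where "g \<in> el th"
    "\<And>y d. pr y d \<in> el N' \<Longrightarrow> y \<in> el A \<and> d \<in> el PP \<and> d \<in> el (U g)"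
    "\<And>y d. pr y d \<in> el N' \<Longrightarrow> \<exists>d0. pr y d0 \<in> el N \<and> leq d d0"
    "\<And>y d0 u. y \<in> el A \<Longrightarrow> pr y d0 \<in> el N \<Longrightarrow> leq u d0 \<Longrightarrow> \<exists>d r. pr y d \<in> el N' \<and> leq r u \<and> leq r d"
proof -
  define S where "S y = mk {u \<in> el PP. \<exists>d0. pr y d0 \<in> el N \<and> leq u d0}" for y
  have S: "el (S y) = {u \<in> el PP. \<exists>d0. pr y d0 \<in> el N \<and> leq u d0}" for y
    unfolding S_def by (rule el_mk, rule separation[OF small_el[of PP]]) (auto, intro dfn)
  have DS: "DF s \<Longrightarrow> DF (\<lambda>e. S (s e))" for s
    by (rule liftF1; (assumption | (unfold S_def, intro dfn)))
  obtain F where F: "\<And>y u. y \<in> el A \<Longrightarrow> u \<in> el (S y) \<Longrightarrow> \<exists>x\<in>el Om. app (app F y) x \<in> el (S y) \<and> (\<exists>r. leq r u \<and> leq r (app (app F y) x))"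
    using predense_choice[of S A, OF DS[OF DF_var]] S by blast
  \<comment> \<open>The default \<open>emp\<close> makes every value a condition, so that it has a
    stage.\<close>
  define H where "H z = (if app (app F (fs z)) (sn z) \<in> el PP then app (app F (fs z)) (sn z) else emp)" for z
  have DH: "DF (\<lambda>e. H (e 0))" unfolding H_def by (intro dfn)
  have PPU: "p \<in> el (U th)" if "p \<in> el PP" for p
  proof -
    have "PP = mk {p \<in> el (U th). cnd p}" by (rule PP_def)
    moreover have "small {p \<in> el (U th). cnd p}" by (rule separation[OF small_el[of "U th"]]) (auto intro!: dfn)
    ultimately show ?thesis using that el_mk by auto
  qed
  have HP: "H z \<in> el PP" for z by (simp add: H_def emp_PP)
  obtain g where g: "g \<in> el th" "\<And>z. z \<in> el (cp A Om) \<Longrightarrow> H z \<in> el (U g)"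
    by (rule stage_image[where A = "cp A Om" and F = H]) (use reg DH HP PPU in blast)+
  define N' where "N' = mk {z \<in> PR (el A) (el PP). \<exists>x\<in>el Om. sn z = app (app F (fs z)) x \<and> sn z \<in> el (S (fs z))}"
  have N': "el N' = {z \<in> PR (el A) (el PP). \<exists>x\<in>el Om. sn z = app (app F (fs z)) x \<and> sn z \<in> el (S (fs z))}"
    unfolding N'_def by (rule el_mk, rule separation[OF small_PR[OF small_el[of A] small_el[of PP]]]) (auto, intro dfn DS)
  show thesis
  proof (rule that[OF g(1)])
    fix y d assume yd: "pr y d \<in> el N'"
    then obtain x where x: "y \<in> el A" "d \<in> el PP" "x \<in> el Om" "d = app (app F y) x" "d \<in> el (S y)" by (auto simp: N')
    then have "H (pr y x) = d" by (simp add: H_def)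
    then show "y \<in> el A \<and> d \<in> el PP \<and> d \<in> el (U g)" using g(2)[of "pr y x"] x by simp
    show "\<exists>d0. pr y d0 \<in> el N \<and> leq d d0" using x S by blast
  next
    fix y d0 u assume y: "y \<in> el A" "pr y d0 \<in> el N" "leq u d0"
    then have "u \<in> el (S y)" using S leq_PP by blast
    then obtain x r where x: "x \<in> el Om" "app (app F y) x \<in> el (S y)" "leq r u" "leq r (app (app F y) x)"
      using F[OF y(1)] by blast
    then have "pr y (app (app F y) x) \<in> el N'" unfolding N' using y(1) S by auto
    then show "\<exists>d r. pr y d \<in> el N' \<and> leq r u \<and> leq r d" using x by blast
  qed
qed

text \<open>\<open>xn i\<close> names the generic set \<open>X i\<close>, and \<open>hn i\<close> names its complement as a constraint.\<close>

definition hn where "hn i = lam (el om) (\<lambda>n. sg (pr t0 (pr i n)))"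
definition xn where "xn i = lam (el om) (\<lambda>n. sg (pr t1 (pr i n)))"
text \<open>As every \<open>n\<close> is paired with the trivial condition \<open>emp\<close>, this
  constraint excludes nothing. The additional element \<open>U g\<close> is not a pair and has the
  sole effect of keeping \<open>junk g\<close> out of stage \<open>g\<close>.\<close>

definition junk where "junk g = un (cp om (sg emp)) (sg (U g))"

lemma el_hn: "el (hn i) = (\<lambda>n. pr n (sg (pr t0 (pr i n)))) ` el om"
  unfolding hn_def lam_def by (intro el_mk small_image small_el dfn)
lemma el_xn: "el (xn i) = (\<lambda>n. pr n (sg (pr t1 (pr i n)))) ` el om"
  unfolding xn_def lam_def by (intro el_mk small_image small_el dfn)
lemma el_junk: "el (junk g) = insert (U g) ((\<lambda>n. pr n emp) ` el om)"
  by (auto simp: junk_def PR_def)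
lemma DF_hn [dfn]: "DF s \<Longrightarrow> DF (\<lambda>e. hn (s e))"
  by (rule liftF1; (assumption | (unfold hn_def, intro dfn)))
lemma DF_xn [dfn]: "DF s \<Longrightarrow> DF (\<lambda>e. xn (s e))"
  by (rule liftF1; (assumption | (unfold xn_def, intro dfn)))
lemma DF_junk [dfn]: "DF s \<Longrightarrow> DF (\<lambda>e. junk (s e))"
  by (rule liftF1; (assumption | (unfold junk_def, intro dfn)))

lemma sg_eq [simp]: "sg a = sg b \<longleftrightarrow> a = b" by (metis el_sg singleton_inject)

lemma hn_inj: "hn i = hn j \<longleftrightarrow> i = j"
proof
  assume "hn i = hn j"
  moreover have "pr emp (sg (pr t0 (pr i emp))) \<in> el (hn i)" unfolding el_hn by simp
  ultimately have "pr emp (sg (pr t0 (pr i emp))) \<in> el (hn j)" by simp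
  then show "i = j" unfolding el_hn by auto
qed simp

lemma pr_ne_emp: "pr x y \<noteq> emp" by (metis el_emp el_upr insert_not_empty pr_def)
lemma emp_notin_pr: "emp \<notin> el (pr x y)" unfolding pr_def by (metis el_emp el_upr insert_iff insert_not_empty singletonD)
lemma not_Ord_pr: "\<not> Ord (pr x y)"
  using Ord_linear[of "pr x y" emp] pr_ne_emp emp_notin_pr by auto

lemma U_not_pr: "Ord g \<Longrightarrow> U g \<noteq> pr x y"
proof
  assume g: "Ord g" "U g = pr x y"
  have "emp \<in> el la" using om_la emp_om by blast
  then have "emp \<in> el (U g)" using la_U[OF g(1)] by blast
  then show False using g(2) emp_notin_pr by simp
qed

lemma junk_pr: "Ord g \<Longrightarrow> pr n d \<in> el (junk g) \<longleftrightarrow> n \<in> el om \<and> d = emp"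
  unfolding el_junk using U_not_pr[of g n d] by auto

lemma pr_stage: "b \<in> el th \<Longrightarrow> x \<in> el (U b) \<Longrightarrow> y \<in> el (U b) \<Longrightarrow> pr x y \<in> el (U (sc (sc b)))"
  unfolding pr_def by (intro U_sub lim_sc) (auto intro: U_sub)

lemma U_mono: "b \<in> el th \<Longrightarrow> c \<in> el th \<Longrightarrow> el b \<subseteq> el c \<Longrightarrow> el (U b) \<subseteq> el (U c)"
  using V_mono Ord_in_th by blast

lemma U_sc: "b \<in> el th \<Longrightarrow> el (U b) \<subseteq> el (U (sc b))"
  by (intro U_mono lim_sc) auto

lemma om_U: "b \<in> el th \<Longrightarrow> el om \<subseteq> el (U b)" using om_la la_U Ord_in_th by blast

lemma hn_U: assumes "i \<in> el (U th)" shows "hn i \<in> el (U th)"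
proof -
  obtain b where b: "b \<in> el th" "i \<in> el (U b)" using stage assms by blast
  \<comment> \<open>A pair costs two stages and a singleton one, which accounts for the successors
    here.\<close>
  define c where "c = sc (sc b)"
  define d where "d = sc (sc (sc c))"
  have cd: "c \<in> el th" "d \<in> el th" using b(1) lim_sc by (auto simp: c_def d_def)
  have "pr n (sg (pr t0 (pr i n))) \<in> el (U (sc (sc d)))" if n: "n \<in> el om" for n
  proof -
    have nb: "n \<in> el (U b)" "t0 \<in> el (U c)" "n \<in> el (U d)" using om_U b cd n tags_om by blast+
    have "pr i n \<in> el (U c)" unfolding c_def by (rule pr_stage[OF b nb(1)])
    then have "pr t0 (pr i n) \<in> el (U (sc (sc c)))" by (intro pr_stage cd nb)
    then have "sg (pr t0 (pr i n)) \<in> el (U d)" unfolding d_def by (intro U_sub lim_sc cd) simp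
    then show ?thesis by (intro pr_stage cd nb)
  qed
  then have "hn i \<in> el (U (sc (sc (sc d))))" by (intro U_sub lim_sc cd) (auto simp: el_hn)
  then show ?thesis using V_mono1[OF Ord_th] cd lim_sc by blast
qed

lemma junk_U: assumes "g \<in> el th" shows "junk g \<in> el (U th)"
proof -
  have "emp \<in> el (U g)" using om_U assms emp_om by blast
  then have "pr n emp \<in> el (U (sc (sc g)))" if "n \<in> el om" for n
    using om_U assms that by (intro pr_stage) auto
  moreover have "U g \<in> el (U (sc g))" by (intro U_sub assms) simp
  then have "U g \<in> el (U (sc (sc g)))" using U_sc lim_sc assms by blast
  ultimately have "junk g \<in> el (U (sc (sc (sc g))))" by (intro U_sub lim_sc assms) (auto simp: el_junk)
  then show ?thesis using V_mono1[OF Ord_th] assms lim_sc by blast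
qed

text \<open>The constraint sets of the generic mad family: \<open>C K g b\<close> consists of the names in \<open>K\<close>, two
  dummy constraints that only raise its rank, and the names of all earlier members.\<close>

definition Cst where
  "Cst q b f = mk (el (fs q) \<union> ({junk (sn q), junk b} \<union> (\<lambda>m. hn (pr t0 (app f m))) ` el b))"
definition C where "C K g b = Rec Cst (pr K g) b"
lemma DF3_Cst: "DF3 Cst" unfolding DF3_def Cst_def by (intro dfn)
lemma DF_C [dfn]: "DF s \<Longrightarrow> DF (\<lambda>e. C K g (s e))" unfolding C_def by (intro DF_Rec[OF DF3_Cst] dfn)

lemma el_C: assumes "Ord b"
  shows "el (C K g b) = el K \<union> ({junk g, junk b} \<union> (\<lambda>m. hn (pr t0 (C K g m))) ` el b)"
proof -
  have "C K g b = mk (el K \<union> ({junk g, junk b} \<union> (\<lambda>m. hn (pr t0 (C K g m))) ` el b))"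
    unfolding C_def by (subst Rec_Ord[OF DF3_Cst assms], subst Cst_def) (simp add: app_lam_Rec[OF DF3_Cst] cong: image_cong)
  moreover have "small (el K \<union> ({junk g, junk b} \<union> (\<lambda>m. hn (pr t0 (C K g m))) ` el b))"
    by (intro small_Un small_el small_pair small_image dfn)
  ultimately show ?thesis using el_mk by simp
qed

lemma t0_la: "t0 \<in> el la" using tags_om om_la by blast

text \<open>The stages of the names of the \<open>b\<close> many earlier members are bounded below
  \<theta> by \<open>reg_th\<close>.\<close>

lemma C_U: assumes K: "K \<in> el (U th)" and g: "g \<in> el th" and "b \<in> el th" shows "C K g b \<in> el (U th)"
proof -
  have "b \<in> el th \<longrightarrow> C K g b \<in> el (U th)"
  proof (rule Ord_induct[OF _ _ Ord_in_th[OF assms(3)]])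
    show "D (\<lambda>e. e 0 \<in> el th \<longrightarrow> C K g (e 0) \<in> el (U th))" by (intro dfn)
    fix b assume IH: "\<And>m. m \<in> el b \<Longrightarrow> m \<in> el th \<longrightarrow> C K g m \<in> el (U th)"
    show "b \<in> el th \<longrightarrow> C K g b \<in> el (U th)"
    proof
      assume b: "b \<in> el th"
      have dd: "DF (\<lambda>e. hn (pr t0 (C K g (e 0))))" by (intro dfn)
      have inU: "hn (pr t0 (C K g m)) \<in> el (U th)" if "m \<in> el b" for m
        using IH[OF that] Ord_trans[OF Ord_th b that] t0_la la_U[OF Ord_th] by (intro hn_U V_lim_pr[OF lim_th]) auto
      obtain b1 where b1: "b1 \<in> el th" "\<And>m. m \<in> el b \<Longrightarrow> hn (pr t0 (C K g m)) \<in> el (U b1)"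
        using stage_image[where A = b and F = "\<lambda>m. hn (pr t0 (C K g m))", OF reg_th[OF b] dd inU] by blast
      define s1 s2 s3 where "s1 = stage K" and "s2 = stage (junk g)" and "s3 = stage (junk b)"
      have s: "s1 \<in> el th" "K \<in> el (U s1)" "s2 \<in> el th" "junk g \<in> el (U s2)" "s3 \<in> el th" "junk b \<in> el (U s3)"
        unfolding s1_def s2_def s3_def using stage K junk_U g b by auto
      obtain c1 where c1: "c1 \<in> el th" "el b1 \<subseteq> el c1" "el s1 \<subseteq> el c1" using lim_max[OF lim_th b1(1) s(1)] .
      obtain c2 where c2: "c2 \<in> el th" "el c1 \<subseteq> el c2" "el s2 \<subseteq> el c2" using lim_max[OF lim_th c1(1) s(3)] .
      obtain c where c: "c \<in> el th" "el c2 \<subseteq> el c" "el s3 \<subseteq> el c" using lim_max[OF lim_th c2(1) s(5)] .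
      have sub: "el (U b1) \<subseteq> el (U c)" "el (U s1) \<subseteq> el (U c)" "el (U s2) \<subseteq> el (U c)" "el (U s3) \<subseteq> el (U c)"
        using U_mono[OF b1(1) c(1)] U_mono[OF s(1) c(1)] U_mono[OF s(3) c(1)] U_mono[OF s(5) c(1)]
          subset_trans[OF subset_trans[OF c1(2) c2(2)] c(2)] subset_trans[OF subset_trans[OF c1(3) c2(2)] c(2)]
          subset_trans[OF c2(3) c(2)] c(3) by simp_all
      have "el K \<subseteq> el (U c)" using s(2) sub trans_U[OF Ord_in_th[OF c(1)]] by (auto simp: trans_def)
      then have "el (C K g b) \<subseteq> el (U c)" unfolding el_C[OF Ord_in_th[OF b]] using s b1 sub by auto
      then show "C K g b \<in> el (U th)" using U_sub[OF c(1)] V_mono1[OF Ord_th] lim_sc[OF c(1)] by blast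
    qed
  qed
  then show ?thesis using assms(3) by blast
qed

lemma C_not_low: assumes "Ord b" "g \<in> el th" shows "C K g b \<notin> el (U g)"
proof
  note T = trans_U[OF Ord_in_th[OF assms(2)]]
  assume "C K g b \<in> el (U g)"
  then have "junk g \<in> el (U g)" using T el_C[OF assms(1)] by (auto simp: trans_def)
  then have "U g \<in> el (U g)" using T el_junk by (auto simp: trans_def)
  then show False by simp
qed

text \<open>\<open>r\<close> is the least stage containing all constraints of the index. So these
  are low with respect to \<open>r\<close> while the index is not, and \<open>junk b\<close> pushes
  \<open>r\<close> above \<open>b\<close>.\<close>

lemma C_stage: assumes "b \<in> el th" "g \<in> el th" "K \<in> el (U th)"
  obtains r where "r \<in> el th" "el (C K g b) \<subseteq> el (U r)" "C K g b \<notin> el (U r)" "b \<in> el r"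
proof -
  note ob = Ord_in_th[OF assms(1)]
  obtain r0 where r0: "r0 \<in> el th" "C K g b \<in> el (U r0)" using V_lim_stage[OF lim_th C_U[OF assms(3,2,1)]] .
  have "el (C K g b) \<subseteq> el (U r0)" using r0 trans_U[OF Ord_in_th[OF r0(1)]] by (auto simp: trans_def)
  moreover have d: "D (\<lambda>e. el (C K g b) \<subseteq> el (U (e 0)))" by (intro dfn)
  ultimately obtain r where r: "Ord r" "el (C K g b) \<subseteq> el (U r)" "\<And>c. Ord c \<Longrightarrow> el (C K g b) \<subseteq> el (U c) \<Longrightarrow> el r \<subseteq> el c"
    using Ord_least[OF d Ord_in_th[OF r0(1)]] by blast
  have "el r \<subseteq> el r0" using r(3) r0 Ord_in_th \<open>el (C K g b) \<subseteq> el (U r0)\<close> by blast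
  then have rth: "r \<in> el th" using Ord_sub[OF r(1) Ord_in_th[OF r0(1)]] r0(1) Ord_trans[OF Ord_th] by blast
  \<comment> \<open>Elements of the base set belong to all stages and have to be excluded
    separately: they are ordinals, whereas \<open>junk g\<close> contains a pair.\<close>
  have nla: "C K g b \<notin> el la"
  proof
    assume "C K g b \<in> el la"
    then have "Ord (C K g b)" using Ord_mem Ord_la by blast
    moreover have "junk g \<in> el (C K g b)" using el_C[OF ob] by auto
    ultimately have "Ord (junk g)" using Ord_mem by blast
    moreover have "pr emp emp \<in> el (junk g)" unfolding el_junk by auto
    ultimately show False using Ord_mem not_Ord_pr by blast
  qed
  have nr: "C K g b \<notin> el (U r)"
  proof
    assume "C K g b \<in> el (U r)"
    then obtain r' where r': "r' \<in> el r" "el (C K g b) \<subseteq> el (U r')" using el_V[OF r(1)] nla by auto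
    then have "el r \<subseteq> el r'" using r Ord_mem by blast
    then show False using r' mem_irrefl by blast
  qed
  have "junk b \<in> el (U r)" using r(2) el_C[OF ob] by auto
  then have ub: "U b \<in> el (U r)" using trans_U[OF r(1)] el_junk by (auto simp: trans_def)
  have "b \<in> el r"
  proof (rule ccontr)
    assume "b \<notin> el r"
    then have "el r \<subseteq> el b" using Ord_not_mem[OF ob r(1)] Ord_not_mem ob r(1) by blast
    then have "U b \<in> el (U b)" using U_mono[OF rth assms(1)] ub by blast
    then show False by simp
  qed
  then show thesis using that rth r(2) nr by blast
qed

text \<open>Otherwise the constraint set would occur, through the name \<open>hn\<close> of an
  earlier member, inside one of its own elements, against its rank.\<close>

lemma C_neq: assumes "b \<in> el th" "g \<in> el th" "K \<in> el (U th)" "m \<in> el b" shows "C K g m \<noteq> C K g b"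
proof
  assume eq: "C K g m = C K g b"
  obtain r where r: "r \<in> el th" "el (C K g b) \<subseteq> el (U r)" "C K g b \<notin> el (U r)" using C_stage assms(1-3) by metis
  note T = trans_U[OF Ord_in_th[OF r(1)]]
  have "hn (pr t0 (C K g m)) \<in> el (C K g b)" using el_C[OF Ord_in_th[OF assms(1)], of K g] assms(4) by blast
  then have "hn (pr t0 (C K g b)) \<in> el (C K g b)" using eq by simp
  then have "hn (pr t0 (C K g b)) \<in> el (U r)" using r(2) by blast
  moreover have "pr emp (sg (pr t0 (pr (pr t0 (C K g b)) emp))) \<in> el (hn (pr t0 (C K g b)))" unfolding el_hn by simp
  ultimately have "pr emp (sg (pr t0 (pr (pr t0 (C K g b)) emp))) \<in> el (U r)" using T by (auto simp: trans_def)
  then have "sg (pr t0 (pr (pr t0 (C K g b)) emp)) \<in> el (U r)" using trans_pr[OF T] by blast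
  then have "pr t0 (pr (pr t0 (C K g b)) emp) \<in> el (U r)" using T by (auto simp: trans_def)
  then have "C K g b \<in> el (U r)" using trans_pr[OF T] by blast
  then show False using r(3) by blast
qed

end

section \<open>The generic extension\<close>

context zfc begin

text \<open>Applied inside the extension, where \<open>k\<close> may be a nonstandard natural
  number; the maximum of \<open>k\<close> many bounds therefore needs the induction of the
  model.\<close>

lemma finite_sup:
  assumes "k \<in> el om" "\<forall>l\<in>el k. \<exists>m\<in>el om. \<forall>n\<in>el om. pr l n \<in> el X \<longrightarrow> n \<in> el m"
  shows "\<exists>m\<in>el om. \<forall>l\<in>el k. \<forall>n\<in>el om. pr l n \<in> el X \<longrightarrow> n \<in> el m"
proof -
  have "(\<forall>l\<in>el k. \<exists>m\<in>el om. \<forall>n\<in>el om. pr l n \<in> el X \<longrightarrow> n \<in> el m) \<longrightarrow>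
    (\<exists>m\<in>el om. \<forall>l\<in>el k. \<forall>n\<in>el om. pr l n \<in> el X \<longrightarrow> n \<in> el m)" (is "?P k")
  proof (rule om_induct[OF _ _ _ assms(1)])
    show "D (\<lambda>e. ?P (e 0))" by (intro dfn)
    show "?P emp" by (intro impI bexI[of _ emp]) auto
    fix k assume IH: "?P k"
    show "?P (sc k)"
    proof
      assume a: "\<forall>l\<in>el (sc k). \<exists>m\<in>el om. \<forall>n\<in>el om. pr l n \<in> el X \<longrightarrow> n \<in> el m"
      then obtain m where m: "m \<in> el om" "\<forall>l\<in>el k. \<forall>n\<in>el om. pr l n \<in> el X \<longrightarrow> n \<in> el m" using IH by auto
      obtain m' where m': "m' \<in> el om" "\<forall>n\<in>el om. pr k n \<in> el X \<longrightarrow> n \<in> el m'" using a by auto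
      obtain q where q: "q \<in> el om" "el m \<subseteq> el q" "el m' \<subseteq> el q" using lim_max[OF lim_om m(1) m'(1)] .
      then show "\<exists>m\<in>el om. \<forall>l\<in>el (sc k). \<forall>n\<in>el om. pr l n \<in> el X \<longrightarrow> n \<in> el m" using m m' by (intro bexI[of _ q]) auto
    qed
  qed
  then show ?thesis using assms(2) by blast
qed

text \<open>Finiteness of subsets of \<omega>, stated for arbitrary HOL sets because the values
  \<open>ev Y\<close> are in general no sets of the ground model.\<close>

definition bd where "bd S \<longleftrightarrow> (\<exists>m\<in>el om. \<forall>n\<in>S. n \<in> el om \<longrightarrow> n \<in> el m)"

lemma bd_sub: "bd S \<Longrightarrow> T \<subseteq> S \<Longrightarrow> bd T" unfolding bd_def by blast

lemma not_bd: "\<not> bd S \<Longrightarrow> m \<in> el om \<Longrightarrow> \<exists>n\<in>S. n \<in> el om \<and> n \<notin> el m" unfolding bd_def by blast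

end

locale mad_ext = mad_poset E th la w1 + extension E "mad_poset.PP E th la" "mad_poset.leq E th la" G h E'
  for E th la w1 G h E'
begin

sublocale N: zfc E' using extension_models by unfold_locales

section \<open>Ground model sets in the extension\<close>

definition j where "j x = h (chk x)"
text \<open>Subsets of a ground model set are handled by simplified names, in which the elements
  themselves stand in place of their check names; \<open>set_of\<close> and \<open>name_of\<close>
  translate.\<close>

definition ev where "ev A = {y. \<exists>d\<in>G. pr y d \<in> el A}"

lemma N_el_j [simp]: "N.el (j x) = j ` el x" by (auto simp: N.el_def j_def mem_chk)
lemma j_eq [simp]: "j x = j y \<longleftrightarrow> x = y" by (simp add: j_def h_eq teq_chk)
lemma N_el_h: "N.el (h y) = {z. \<exists>v s. pr v s \<in> el y \<and> s \<in> G \<and> z = h v}" by (auto simp: N.el_def mem_h)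

lemma set_of: obtains X where "N.el X = j ` (el a \<inter> ev A)"
proof -
  define x where "x = mk {z \<in> PR (chk ` el a) (el PP). \<exists>y\<in>el a. \<exists>d\<in>el PP. z = pr (chk y) d \<and> pr y d \<in> el A}"
  have "small (PR (chk ` el a) (el PP))" by (intro small_PR small_image small_el dfn)
  then have x: "el x = {z \<in> PR (chk ` el a) (el PP). \<exists>y\<in>el a. \<exists>d\<in>el PP. z = pr (chk y) d \<and> pr y d \<in> el A}"
    unfolding x_def by (intro el_mk, elim separation) (auto, intro dfn)
  have "N.el (h x) = j ` (el a \<inter> ev A)"
    unfolding N_el_h x ev_def j_def using G_P by (auto simp: image_iff)
  then show thesis by (rule that)
qed

lemma name_of: obtains A where "\<And>y. y \<in> el a \<Longrightarrow> j y \<in> N.el X \<longleftrightarrow> y \<in> ev A"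
proof -
  obtain x where x: "X = h x" by (rule ex_h)
  define A where "A = mk {z \<in> PR (el a) (el PP). fmem (chk (fs z)) x (sn z)}"
  have A: "el A = {z \<in> PR (el a) (el PP). fmem (chk (fs z)) x (sn z)}"
    unfolding A_def by (rule el_mk, rule separation[OF small_PR[OF small_el[of a] small_el[of PP]]]) (auto, intro dfn)
  have "j y \<in> N.el X \<longleftrightarrow> y \<in> ev A" if "y \<in> el a" for y
    using that G_P by (auto simp: N.el_def x j_def h_mem tmem_def ev_def A)
  then show thesis by (rule that)
qed

lemma j_emp: "N.emp = j emp" by (rule N.ext) simp
lemma j_upr: "N.upr (j x) (j y) = j (upr x y)" by (rule N.ext) simp
lemma j_pr: "N.pr (j x) (j y) = j (pr x y)" by (simp add: N.pr_def pr_def j_upr)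
lemma j_sc: "N.sc (j x) = j (sc x)" by (rule N.ext) simp
lemma N_fs: "N.fs (j (pr x y)) = j x" "N.sn (j (pr x y)) = j y" by (simp_all add: j_pr[symmetric])

text \<open>As \<omega> may be nonstandard, agreement is shown by a minimal counterexample inside
  the extension, which would have to be zero or a successor.\<close>

lemma j_om: "N.om = j om"
proof (rule N.ext, intro equalityI)
  have "N.ind (j om)" unfolding N.ind_def by (auto simp: j_emp j_sc)
  then show "N.el N.om \<subseteq> N.el (j om)" unfolding N.el_om by blast
  show "N.el (j om) \<subseteq> N.el N.om"
  proof (rule ccontr)
    assume "\<not> ?thesis"
    then obtain z where z: "z \<in> N.el (j om)" "z \<notin> N.el N.om" by blast
    have "N.D (\<lambda>e. e 0 \<notin> N.el N.om)" by (intro N.dfn)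
    then obtain y where y: "y \<in> N.el (j om)" "y \<notin> N.el N.om" "\<And>z. z \<in> N.el y \<Longrightarrow> z \<in> N.el (j om) \<Longrightarrow> \<not> z \<notin> N.el N.om"
      using N.minimal[OF N.small_el[of "j om"], of "\<lambda>z. z \<notin> N.el N.om"] z by metis
    then obtain n where n: "n \<in> el om" "y = j n" by auto
    then consider "n = emp" | m where "m \<in> el om" "n = sc m" using om_cases by blast
    then show False
    proof cases
      case 1
      then show False using n y(2) N.emp_om j_emp by simp
    next
      case 2
      then have "j m \<in> N.el N.om" using y(3)[of "j m"] n(2) by auto
      then show False using N.sc_om y(2) 2 n j_sc by metis
    qed
  qed
qed

lemma om_j: "n \<in> N.el N.om \<longleftrightarrow> (\<exists>m\<in>el om. n = j m)" by (auto simp: j_om)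

text \<open>The conditions deciding the value at \<open>x\<close> have a predense subset enumerated
  by \<open>Om\<close>. Each of its members decides a single value, so the function
  \<open>F\<close>, which lives in the ground model, lists all candidates.\<close>

lemma covering:
  obtains F where "\<And>x y. x \<in> el a \<Longrightarrow> y \<in> el b \<Longrightarrow> N.app f (j x) = j y \<Longrightarrow> \<exists>w\<in>el Om. y = app F (pr x w)"
proof -
  define X where "X = N.mk {z \<in> N.el (j (cp a b)). N.app f (N.fs z) = N.sn z}"
  have X: "N.el X = {z \<in> N.el (j (cp a b)). N.app f (N.fs z) = N.sn z}"
    unfolding X_def by (rule N.el_mk, rule N.separation[OF N.small_el[of "j (cp a b)"]], blast, intro N.dfn)
  obtain A where A: "\<And>z. z \<in> el (cp a b) \<Longrightarrow> j z \<in> N.el X \<longleftrightarrow> z \<in> ev A" by (rule name_of[of "cp a b" X]) blast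
  have val: "N.app f (j x) = j y \<longleftrightarrow> (\<exists>d\<in>G. pr (pr x y) d \<in> el A)" if "x \<in> el a" "y \<in> el b" for x y
    using A[of "pr x y"] that by (auto simp: X N_fs ev_def)
  \<comment> \<open>Conditions that decide two different values. None is in \<open>G\<close>, so
    below some \<open>p\<close> in \<open>G\<close> there are none at all, and \<open>S\<close> is
    restricted to conditions below this \<open>p\<close>.\<close>
  define Q where "Q = {q. \<exists>x\<in>el a. \<exists>y\<in>el b. \<exists>y'\<in>el b. \<exists>d d'. y \<noteq> y' \<and> pr (pr x y) d \<in> el A \<and> pr (pr x y') d' \<in> el A \<and> leq q d \<and> leq q d'}"
  have "D (\<lambda>e. e 0 \<in> Q)" unfolding Q_def by (intro dfn)
  then obtain p where p: "p \<in> G" "\<And>q. leq q p \<Longrightarrow> q \<notin> Q"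
  proof (rule decide)
    fix q assume "q \<in> G" "q \<in> Q"
    then obtain x y y' d d' where *: "x \<in> el a" "y \<in> el b" "y' \<in> el b" "y \<noteq> y'"
      "pr (pr x y) d \<in> el A" "pr (pr x y') d' \<in> el A" "leq q d" "leq q d'" unfolding Q_def by blast
    then have "d \<in> G" "d' \<in> G" using G_up \<open>q \<in> G\<close> by blast+
    then have "N.app f (j x) = j y" "N.app f (j x) = j y'" using val * by blast+
    then show False using \<open>y \<noteq> y'\<close> by simp
  qed blast
  define S where "S x = mk {r \<in> el PP. leq r p \<and> (\<exists>y\<in>el b. \<exists>d. pr (pr x y) d \<in> el A \<and> leq r d)}" for x
  have S: "el (S x) = {r \<in> el PP. leq r p \<and> (\<exists>y\<in>el b. \<exists>d. pr (pr x y) d \<in> el A \<and> leq r d)}" for x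
    unfolding S_def by (rule el_mk, rule separation[OF small_el[of PP]]) (auto, intro dfn)
  have DS: "DF (\<lambda>e. S (e 0))" unfolding S_def by (intro dfn)
  obtain F where F: "\<And>y u. y \<in> el a \<Longrightarrow> u \<in> el (S y) \<Longrightarrow>
    \<exists>x\<in>el Om. app (app F y) x \<in> el (S y) \<and> (\<exists>r. leq r u \<and> leq r (app (app F y) x))"
    using predense_choice[OF DS, of a] S by blast
  define B where "B z = The1 (\<lambda>y. y \<in> el b \<and> (\<exists>d. pr (pr (fs z) y) d \<in> el A \<and> leq (app (app F (fs z)) (sn z)) d))" for z
  have DB: "DF (\<lambda>e. B (e 0))" unfolding B_def by (intro dfn)
  have "\<exists>w\<in>el Om. y = app (lam (el (cp a Om)) B) (pr x w)" if xy: "x \<in> el a" "y \<in> el b" "N.app f (j x) = j y" for x y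
  proof -
    obtain d where d: "d \<in> G" "pr (pr x y) d \<in> el A" using val xy by blast
    obtain r where r: "r \<in> G" "leq r d" "leq r p" using G_dir[OF d(1) p(1)] by blast
    have "r \<in> el (S x)" using r d xy G_P unfolding S by blast
    then obtain w r' where w: "w \<in> el Om" "app (app F x) w \<in> el (S x)" "leq r' r" "leq r' (app (app F x) w)"
      using F[OF xy(1)] by blast
    then obtain y1 d1 where y1: "y1 \<in> el b" "pr (pr x y1) d1 \<in> el A" "leq (app (app F x) w) d1" "leq (app (app F x) w) p"
      unfolding S by blast
    have uniq: "z = y1" if z: "z \<in> el b" "pr (pr x z) d' \<in> el A" "leq (app (app F x) w) d'" for z d'
      using p(2)[OF y1(4)] y1 z xy(1) unfolding Q_def by blast
    have "r' \<notin> Q" using p(2) r(3) w(3) leq_trans by blast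
    moreover have "leq r' d" "leq r' d1" using leq_trans w(3,4) r(2) y1(3) by blast+
    ultimately have "y = y1" using xy y1(1,2) d(2) unfolding Q_def by blast
    moreover have "B (pr x w) = y1"
      unfolding B_def fs_pr sn_pr by (rule The1_eq) (use y1 uniq in blast)+
    moreover have "app (lam (el (cp a Om)) B) (pr x w) = B (pr x w)"
      by (rule app_lam[OF small_el DB]) (use xy w in simp)
    ultimately show ?thesis using w(1) by metis
  qed
  then show thesis by (rule that)
qed

lemma no_sj: assumes "\<not> sj (cp a Om) b" shows "\<not> N.sj (j a) (j b)"
proof
  assume "N.sj (j a) (j b)"
  then obtain f where f: "N.el (j b) \<subseteq> (\<lambda>x. N.app f x) ` N.el (j a)" by (auto simp: N.sj_def)
  obtain F where F: "\<And>x y. x \<in> el a \<Longrightarrow> y \<in> el b \<Longrightarrow> N.app f (j x) = j y \<Longrightarrow> \<exists>w\<in>el Om. y = app F (pr x w)"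
    by (rule covering[of a b f]) blast
  have "el b \<subseteq> (\<lambda>z. app F z) ` el (cp a Om)"
  proof
    fix y assume y: "y \<in> el b"
    then obtain x where "x \<in> el a" "N.app f (j x) = j y" using f by (auto simp: image_subset_iff)
    then obtain w where "w \<in> el Om" "y = app F (pr x w)" using F y by blast
    then show "y \<in> (\<lambda>z. app F z) ` el (cp a Om)" using \<open>x \<in> el a\<close> by auto
  qed
  then show False using assms unfolding sj_def by blast
qed

text \<open>The bounded name keeps the value: if \<open>G\<close> contains a condition of the old
  name at \<open>y\<close>, then by predensity and genericity it also contains one of the new
  name.\<close>

lemma ev_bounded:
  assumes reg: "\<And>f. \<forall>x\<in>el (cp A Om). app f x \<in> el th \<Longrightarrow> \<exists>b\<in>el th. \<forall>x\<in>el (cp A Om). app f x \<in> el b"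
  obtains M g where "g \<in> el th" "\<And>y d. pr y d \<in> el M \<Longrightarrow> y \<in> el A \<and> d \<in> el PP \<and> d \<in> el (U g)"
    "el A \<inter> ev N = ev M"
proof (rule bounded_name[where N = N and A = A, OF reg])
  fix M g assume g: "g \<in> el th"
    and 1: "\<And>y d. pr y d \<in> el M \<Longrightarrow> y \<in> el A \<and> d \<in> el PP \<and> d \<in> el (U g)"
    and 2: "\<And>y d. pr y d \<in> el M \<Longrightarrow> \<exists>d0. pr y d0 \<in> el N \<and> leq d d0"
    and 3: "\<And>y d0 u. y \<in> el A \<Longrightarrow> pr y d0 \<in> el N \<Longrightarrow> leq u d0 \<Longrightarrow> \<exists>d r. pr y d \<in> el M \<and> leq r u \<and> leq r d"
  have eq: "el A \<inter> ev N = ev M"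
  proof (intro equalityI subsetI)
    fix y assume "y \<in> ev M"
    then show "y \<in> el A \<inter> ev N" using 1 2 G_up unfolding ev_def by blast
  next
    fix y assume "y \<in> el A \<inter> ev N"
    then obtain d0 where d0: "y \<in> el A" "d0 \<in> G" "pr y d0 \<in> el N" by (auto simp: ev_def)
    define Q where "Q = {r. \<exists>d. pr y d \<in> el M \<and> leq r d}"
    have "D (\<lambda>e. e 0 \<in> Q)" unfolding Q_def by (intro dfn)
    from G_gen[OF this] show "y \<in> ev M"
    proof
      assume "\<exists>p\<in>G. p \<in> Q"
      then show ?thesis using G_up unfolding Q_def ev_def by blast
    next
      assume "\<exists>p\<in>G. \<forall>q. leq q p \<longrightarrow> q \<notin> Q"
      then obtain p where p: "p \<in> G" "\<forall>q. leq q p \<longrightarrow> q \<notin> Q" by blast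
      obtain u where u: "u \<in> G" "leq u p" "leq u d0" using G_dir p(1) d0 by blast
      obtain d r where "pr y d \<in> el M" "leq r u" "leq r d" using 3[OF d0(1,3) u(3)] by blast
      then show ?thesis using p(2) leq_trans[OF _ u(2)] unfolding Q_def by blast
    qed
  qed
  show thesis by (rule that[OF g 1 eq])
qed

text \<open>Only membership witnessed by conditions of stage \<open>g\<close> counts, because only
  such witnesses can be carried over by \<open>extend\<close>.\<close>

definition evL where "evL g k = {n. \<exists>d\<in>G. pr n d \<in> el k \<and> PL g d}"

text \<open>A finite union of bounded sets is bounded. Since \<open>H\<close> is finite only
  internally while the sets depend on \<open>G\<close>, the union is formed in the extension and
  \<open>finite_sup\<close> is applied there.\<close>

lemma unb_finite:
  assumes H: "fin H" "\<And>k. k \<in> el H \<Longrightarrow> bd (ev Y - evL g k)" and Y: "\<not> bd (ev Y)" and m: "m \<in> el om"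
  shows "\<exists>n\<in>el om. n \<notin> el m \<and> n \<in> ev Y \<and> (\<forall>k\<in>el H. n \<in> evL g k)"
proof -
  obtain k0 f where k0: "k0 \<in> el om" "el H \<subseteq> (\<lambda>l. app f l) ` el k0"
    using fin_enum[OF H(1)] by (auto simp: sj_def)
  \<comment> \<open>\<open>A\<close> names the successful pairs of a position \<open>l\<close> and a
    number \<open>n\<close>; \<open>A2\<close> discards the positions where the enumeration
    \<open>f\<close> leaves \<open>H\<close>. The remaining failures form the set \<open>X\<close>
    of the extension.\<close>
  define A where "A = mk {z \<in> PR (el (cp k0 om)) (el PP). pr (sn (fs z)) (sn z) \<in> el (app f (fs (fs z))) \<and> PL g (sn z) \<and> app f (fs (fs z)) \<in> el H}"
  define A2 where "A2 = mk {z \<in> PR (el (cp k0 om)) (el PP). app f (fs (fs z)) \<notin> el H}"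
  have A: "el A = {z \<in> PR (el (cp k0 om)) (el PP). pr (sn (fs z)) (sn z) \<in> el (app f (fs (fs z))) \<and> PL g (sn z) \<and> app f (fs (fs z)) \<in> el H}"
    unfolding A_def by (rule el_mk, rule separation[OF small_PR[OF small_el[of "cp k0 om"] small_el[of PP]]]) (auto, intro dfn)
  have A2: "el A2 = {z \<in> PR (el (cp k0 om)) (el PP). app f (fs (fs z)) \<notin> el H}"
    unfolding A2_def by (rule el_mk, rule separation[OF small_PR[OF small_el[of "cp k0 om"] small_el[of PP]]]) (auto, intro dfn)
  have evA: "pr l n \<in> ev A \<longleftrightarrow> n \<in> evL g (app f l) \<and> app f l \<in> el H" if "l \<in> el k0" "n \<in> el om" for l n
    using that G_P unfolding ev_def evL_def A by auto
  have evA2: "pr l n \<in> ev A2 \<longleftrightarrow> app f l \<notin> el H" if "l \<in> el k0" "n \<in> el om" for l n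
    using that G_P G_ne unfolding ev_def A2 by auto
  obtain X1 where X1: "N.el X1 = j ` (el (cp k0 om) \<inter> ev A)" by (rule set_of)
  obtain X2 where X2: "N.el X2 = j ` (el (cp k0 om) \<inter> ev A2)" by (rule set_of)
  obtain Y1 where Y1: "N.el Y1 = j ` (el om \<inter> ev Y)" by (rule set_of)
  define X where "X = N.mk {z \<in> N.el (j (cp k0 om)). N.sn z \<in> N.el Y1 \<and> z \<notin> N.el X1 \<and> z \<notin> N.el X2}"
  have X: "N.el X = {z \<in> N.el (j (cp k0 om)). N.sn z \<in> N.el Y1 \<and> z \<notin> N.el X1 \<and> z \<notin> N.el X2}"
    unfolding X_def by (rule N.el_mk, rule N.separation[OF N.small_el[of "j (cp k0 om)"]], blast, intro N.dfn)
  have inX: "N.pr (j l) (j n) \<in> N.el X \<longleftrightarrow> n \<in> ev Y \<and> app f l \<in> el H \<and> n \<notin> evL g (app f l)"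
    if "l \<in> el k0" "n \<in> el om" for l n
    using that evA[OF that] evA2[OF that] by (auto simp: X j_pr N_fs X1 X2 Y1 image_iff)
  have "\<forall>l\<in>N.el (j k0). \<exists>m\<in>N.el N.om. \<forall>n\<in>N.el N.om. N.pr l n \<in> N.el X \<longrightarrow> n \<in> N.el m"
  proof
    fix l' assume "l' \<in> N.el (j k0)"
    then obtain l where l: "l \<in> el k0" "l' = j l" by auto
    show "\<exists>m\<in>N.el N.om. \<forall>n\<in>N.el N.om. N.pr l' n \<in> N.el X \<longrightarrow> n \<in> N.el m"
    proof (cases "app f l \<in> el H")
      case True
      then obtain m where m: "m \<in> el om" "\<forall>n\<in>ev Y - evL g (app f l). n \<in> el om \<longrightarrow> n \<in> el m"
        using H(2) unfolding bd_def by blast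
      show ?thesis
        by (rule bexI[of _ "j m"]) (use m l inX in \<open>auto simp: om_j\<close>)
    next
      case False
      then show ?thesis using l inX by (intro bexI[of _ "j emp"]) (auto simp: om_j)
    qed
  qed
  moreover have "j k0 \<in> N.el N.om" using k0 om_j by blast
  ultimately have "\<exists>m\<in>N.el N.om. \<forall>l\<in>N.el (j k0). \<forall>n\<in>N.el N.om. N.pr l n \<in> N.el X \<longrightarrow> n \<in> N.el m"
    by (intro N.finite_sup)
  then obtain m' where m': "m' \<in> N.el N.om" "\<forall>l\<in>N.el (j k0). \<forall>n\<in>N.el N.om. N.pr l n \<in> N.el X \<longrightarrow> n \<in> N.el m'" by blast
  then obtain m1 where m1e: "m1 \<in> el om" "m' = j m1" using om_j by blast
  have "n \<in> el m1" if "l \<in> el k0" "n \<in> el om" "N.pr (j l) (j n) \<in> N.el X" for l n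
  proof -
    have "j l \<in> N.el (j k0)" "j n \<in> N.el N.om" using that om_j by auto
    then have "j n \<in> N.el (j m1)" using m'(2) that(3) m1e(2) by blast
    then show ?thesis by auto
  qed
  then have m1: "m1 \<in> el om" "\<forall>l\<in>el k0. \<forall>n\<in>el om. N.pr (j l) (j n) \<in> N.el X \<longrightarrow> n \<in> el m1"
    using m1e by blast+
  obtain m2 where m2: "m2 \<in> el om" "el m \<subseteq> el m2" "el m1 \<subseteq> el m2" using lim_max[OF lim_om m m1(1)] .
  obtain n where n: "n \<in> ev Y" "n \<in> el om" "n \<notin> el m2" using not_bd[OF Y m2(1)] by blast
  have "n \<in> evL g k" if k: "k \<in> el H" for k
  proof -
    obtain l where "l \<in> el k0" "k = app f l" using k0(2) k by blast
    then show ?thesis using m1(2) inX n m2(3) k by blast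
  qed
  then show ?thesis using n m2(2) by blast
qed

text \<open>An infinite set with a name of stage \<open>g\<close> meets \<open>X i0\<close> infinitely often, unless it is almost covered
  by a set that \<open>X i0\<close> has to avoid.\<close>

lemma hit:
  assumes g: "g \<in> el th" and i0: "isidx i0" "sn i0 \<notin> el (U g)"
    and Y: "\<And>n d. pr n d \<in> el Y \<Longrightarrow> PL g d" "\<not> bd (ev Y)"
    and K: "\<And>k. k \<in> el (sn i0) \<Longrightarrow> bd (ev Y - evL g k) \<or> (\<exists>i. isidx i \<and> sn i \<notin> el (U g) \<and> i \<noteq> i0 \<and> k = hn i)"
  shows "\<not> bd (ev Y \<inter> ev (xn i0))"
proof
  assume "bd (ev Y \<inter> ev (xn i0))"
  then obtain m where m: "m \<in> el om" "\<forall>n\<in>ev Y \<inter> ev (xn i0). n \<in> el om \<longrightarrow> n \<in> el m" by (auto simp: bd_def)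
  \<comment> \<open>Conditions that force a common element above the supposed bound. As
    \<open>G\<close> contains none, some \<open>p\<close> in \<open>G\<close> has no such extension;
    the proof constructs one.\<close>
  define Q where "Q = {q \<in> el PP. \<exists>n\<in>el om. n \<notin> el m \<and> pr t1 (pr i0 n) \<in> el q \<and> (\<exists>d. pr n d \<in> el Y \<and> leq q d)}"
  have "D (\<lambda>e. e 0 \<in> Q)" unfolding Q_def by (intro dfn)
  then obtain p where p: "p \<in> G" "\<And>q. leq q p \<Longrightarrow> q \<notin> Q"
  proof (rule decide)
    fix q assume q: "q \<in> G" "q \<in> Q"
    then obtain n d where n: "n \<in> el om" "n \<notin> el m" "pr t1 (pr i0 n) \<in> el q" "pr n d \<in> el Y" "leq q d"
      unfolding Q_def by blast
    have "sg (pr t1 (pr i0 n)) \<in> G" using leq_sg[OF _ n(3)] G_up q(1) G_P by auto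
    then have "n \<in> ev (xn i0)" unfolding ev_def el_xn using n(1) by blast
    moreover have "n \<in> ev Y" unfolding ev_def using n G_up q(1) by blast
    ultimately show False using m n by blast
  qed blast
  have pP: "p \<in> el PP" "fin p" using p(1) G_P in_PP cnd_def by blast+
  obtain mp where mp: "mp \<in> el om" "\<And>n t i. n \<in> el om \<Longrightarrow> n \<notin> el mp \<Longrightarrow> pr t (pr i n) \<notin> el p"
    using fresh_bound[OF pP(1)] by metis
  obtain mm where mm: "mm \<in> el om" "el m \<subseteq> el mm" "el mp \<subseteq> el mm" using lim_max[OF lim_om m(1) mp(1)] .
  define far where "far i \<longleftrightarrow> isidx i \<and> sn i \<notin> el (U g) \<and> i \<noteq> i0" for i
  have Dfar: "DF s \<Longrightarrow> D (\<lambda>e. far (s e))" for s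
    by (rule lift1; (assumption | (unfold far_def, intro dfn)))
  \<comment> \<open>The promises of \<open>p\<close> about \<open>i0\<close> are split: those in
    \<open>H\<close> are to be fulfilled by evidence of stage \<open>g\<close>, while those of the
    form \<open>hn i\<close> with \<open>far i\<close> are kept by new facts that exclude
    \<open>n\<close> from \<open>X i\<close> for \<open>i\<close> in \<open>T\<close>.\<close>
  define H where "H = mk {k \<in> (\<lambda>z. sn (sn z)) ` el p. pr t2 (pr i0 k) \<in> el p \<and> \<not> (\<exists>i. far i \<and> k = hn i)}"
  have sH: "small ((\<lambda>z. sn (sn z)) ` el p)" by (intro small_image small_el dfn)
  have "el H = {k \<in> (\<lambda>z. sn (sn z)) ` el p. pr t2 (pr i0 k) \<in> el p \<and> \<not> (\<exists>i. far i \<and> k = hn i)}"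
    unfolding H_def by (rule el_mk, rule separation[OF sH]) (auto, intro dfn Dfar)
  then have H: "k \<in> el H \<longleftrightarrow> pr t2 (pr i0 k) \<in> el p \<and> \<not> (\<exists>i. far i \<and> k = hn i)" for k
    by (auto simp: image_iff) (metis sn_pr)
  have "fin (mk ((\<lambda>z. sn (sn z)) ` el p))" by (intro fin_image pP dfn)
  then have finH: "fin H" by (rule fin_sub) (auto simp: el_mk[OF sH] H image_iff, metis sn_pr)
  define iv where "iv z = The1 (\<lambda>i. sn (sn z) = hn i)" for z
  have Div: "DF s \<Longrightarrow> DF (\<lambda>e. iv (s e))" for s
    by (rule liftF1; (assumption | (unfold iv_def, intro dfn)))
  have iv: "iv (pr t2 (pr i0 (hn i))) = i" for i unfolding iv_def by (rule The1_eq) (auto simp: hn_inj)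
  define T where "T = mk {i \<in> iv ` el p. far i \<and> pr t2 (pr i0 (hn i)) \<in> el p}"
  have sT: "small (iv ` el p)" by (intro small_image small_el Div dfn)
  have "el T = {i \<in> iv ` el p. far i \<and> pr t2 (pr i0 (hn i)) \<in> el p}"
    unfolding T_def by (rule el_mk, rule separation[OF sT]) (auto, intro dfn Dfar Div)
  then have T: "i \<in> el T \<longleftrightarrow> far i \<and> pr t2 (pr i0 (hn i)) \<in> el p" for i
    using iv[of i] by (auto simp: image_iff) metis
  have "fin (mk (iv ` el p))" by (intro fin_image pP Div dfn)
  then have finT: "fin T" by (rule fin_sub) (auto simp: el_mk[OF sT] T image_iff, metis iv)
  have sn0: "k \<in> el (sn i0)" if "pr t2 (pr i0 k) \<in> el p" for k
  proof -
    have "isfact (pr t2 (pr i0 k))" using that pP(1) in_PP cnd_def by blast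
    then show ?thesis by simp
  qed
  have "\<exists>n\<in>el om. n \<notin> el mm \<and> n \<in> ev Y \<and> (\<forall>k\<in>el H. n \<in> evL g k)"
    by (rule unb_finite[OF finH _ Y(2) mm(1)]) (use K sn0 H far_def in blast)
  then obtain n where n: "n \<in> el om" "n \<notin> el mm" "n \<in> ev Y" "\<And>k. k \<in> el H \<Longrightarrow> n \<in> evL g k" by blast
  obtain dy where dy: "dy \<in> G" "pr n dy \<in> el Y" using n(3) by (auto simp: ev_def)
  define S where "S k d \<longleftrightarrow> pr n d \<in> el k \<and> PL g d" for k d
  have DS: "D (\<lambda>e. S (e 0) (e (Suc 0)))" unfolding S_def by (intro dfn)
  \<comment> \<open>Directedness of \<open>G\<close> gives no common lower bound for witnesses
    indexed by an internally finite set. Genericity gives an \<open>r0\<close> in \<open>G\<close>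
    deciding every \<open>k\<close> in \<open>H\<close>, and since \<open>G\<close> contains a
    witness for each, all decisions are positive.\<close>
  define Q2 where "Q2 = {r. \<forall>k\<in>el H. (\<exists>d. S k d \<and> leq r d) \<or> (\<forall>d r'. S k d \<longrightarrow> leq r' r \<longrightarrow> \<not> leq r' d)}"
  have "D (\<lambda>e. e 0 \<in> Q2)" unfolding Q2_def by (intro dfn lift2[OF _ _ DS])
  from G_gen[OF this] have "\<exists>r\<in>G. r \<in> Q2"
  proof
    assume "\<exists>p\<in>G. \<forall>q. leq q p \<longrightarrow> q \<notin> Q2"
    then obtain p' where p': "p' \<in> G" "\<forall>q. leq q p' \<longrightarrow> q \<notin> Q2" by blast
    then show ?thesis using decide_finite[OF DS finH, of p'] G_P unfolding Q2_def by blast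
  qed
  then obtain r0 where r0: "r0 \<in> G" "r0 \<in> Q2" by blast
  have r0S: "\<exists>d. S k d \<and> leq r0 d" if k: "k \<in> el H" for k
  proof -
    obtain d where d: "d \<in> G" "S k d" using n(4)[OF k] by (auto simp: evL_def S_def)
    obtain r' where "leq r' r0" "leq r' d" using G_dir[OF r0(1) d(1)] by blast
    then show ?thesis using r0(2) k d(2) unfolding Q2_def by blast
  qed
  obtain r1 where r1: "r1 \<in> G" "leq r1 r0" "leq r1 dy" using G_dir[OF r0(1) dy(1)] by blast
  obtain r where r: "r \<in> G" "leq r r1" "leq r p" using G_dir[OF r1(1) p(1)] by blast
  obtain q where q: "leq q p" "pr t1 (pr i0 n) \<in> el q" "\<And>d. PL g d \<Longrightarrow> leq r d \<Longrightarrow> leq q d"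
  proof (rule extend[OF Ord_in_th[OF g] r(3) i0 n(1), of T])
    show "pr t (pr i n) \<notin> el p" for t i using mp(2) n(1,2) mm(3) by blast
    show "fin T" by (rule finT)
    show "isidx i \<and> sn i \<notin> el (U g) \<and> i \<noteq> i0" if "i \<in> el T" for i using that T far_def by blast
    fix k assume k: "pr t2 (pr i0 k) \<in> el p"
    show "\<exists>d. pr n d \<in> el k \<and> ((PL g d \<and> leq r d) \<or> (\<exists>i\<in>el T. d = sg (pr t0 (pr i n))))"
    proof (cases "k \<in> el H")
      case True
      then obtain d where d: "S k d" "leq r0 d" using r0S by blast
      have "leq r d" by (rule leq_trans[OF leq_trans[OF r(2) r1(2)] d(2)])
      then show ?thesis using d(1) unfolding S_def by blast
    next
      case False
      then obtain i where i: "far i" "k = hn i" using H k by blast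
      then have "i \<in> el T" "pr n (sg (pr t0 (pr i n))) \<in> el k" using T k n(1) by (auto simp: el_hn)
      then show ?thesis by blast
    qed
  qed blast
  have "leq q dy" using q(3) Y(1)[OF dy(2)] leq_trans[OF r(2) r1(3)] by blast
  then have "q \<in> Q" unfolding Q_def using q dy(2) n(1,2) mm(2) leq_PP by blast
  then show False using p(2) q(1) by blast
qed

end

section \<open>Cardinals and almost disjointness in a model\<close>

context zfc begin

definition eqp where "eqp a b \<longleftrightarrow> (\<exists>f. bij_betw (\<lambda>x. app f x) (el a) (el b))"

lemma D_eqp [dfn]: "DF s \<Longrightarrow> DF t \<Longrightarrow> D (\<lambda>e. eqp (s e) (t e))"
  by (rule lift2; (assumption | (unfold eqp_def, intro dfn)))

lemma eqpI: assumes "DF (\<lambda>e. f (e 0))" "bij_betw f (el a) (el b)" shows "eqp a b"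
proof -
  have "app (lam (el a) f) x = f x" if "x \<in> el a" for x by (rule app_lam[OF small_el assms(1) that])
  then have "bij_betw (\<lambda>x. app (lam (el a) f) x) (el a) (el b)"
    using assms(2) by (subst bij_betw_cong[of _ _ f]) auto
  then show ?thesis unfolding eqp_def by blast
qed

lemma eqp_refl: "eqp a a"
  by (rule eqpI[of "\<lambda>x. x"]) (auto intro: dfn simp: bij_betw_def)

lemma eqp_sym: assumes "eqp a b" shows "eqp b a"
proof -
  obtain f where f: "bij_betw (\<lambda>x. app f x) (el a) (el b)" using assms by (auto simp: eqp_def)
  define g where "g y = The1 (\<lambda>x. x \<in> el a \<and> app f x = y)" for y
  have g: "g (app f x) = x" if "x \<in> el a" for x
    unfolding g_def
  proof (rule The1_eq)
    show "x' = x" if "x' \<in> el a \<and> app f x' = app f x" for x'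
      using f that \<open>x \<in> el a\<close> unfolding bij_betw_def inj_on_def by blast
  qed (use that in blast)
  show ?thesis
  proof (rule eqpI[of g])
    show "DF (\<lambda>e. g (e 0))" unfolding g_def by (intro dfn)
    have "el b = (\<lambda>x. app f x) ` el a" using f by (simp add: bij_betw_def)
    then show "bij_betw g (el b) (el a)"
      unfolding bij_betw_def inj_on_def by (auto simp: g image_iff)
  qed
qed

lemma eqp_trans: assumes "eqp a b" "eqp b c" shows "eqp a c"
proof -
  obtain f g where "bij_betw (\<lambda>x. app f x) (el a) (el b)" "bij_betw (\<lambda>x. app g x) (el b) (el c)"
    using assms by (auto simp: eqp_def)
  then have "bij_betw ((\<lambda>x. app g x) \<circ> (\<lambda>x. app f x)) (el a) (el c)" by (rule bij_betw_trans)
  then show ?thesis by (intro eqpI[of "\<lambda>x. app g (app f x)"] dfn) (simp add: comp_def)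
qed

lemma eqp_sj: "eqp a b \<Longrightarrow> sj a b" unfolding eqp_def sj_def bij_betw_def by blast

definition card where "card a k \<longleftrightarrow> Ord k \<and> eqp a k \<and> (\<forall>b. Ord b \<and> eqp a b \<longrightarrow> el k \<subseteq> el b)"

lemma D_card [dfn]: "DF s \<Longrightarrow> DF t \<Longrightarrow> D (\<lambda>e. card (s e) (t e))"
  by (rule lift2; (assumption | (unfold card_def, intro dfn)))

lemma card_ex: "\<exists>k. card a k"
proof -
  obtain \<alpha> g where \<alpha>: "Ord \<alpha>" "bij_betw (app g) (el \<alpha>) (el a)" by (rule well_ordering)
  then have "eqp \<alpha> a" by (auto simp: eqp_def)
  then have 1: "eqp a \<alpha>" by (rule eqp_sym)
  have "D (\<lambda>e. eqp a (e 0))" by (intro dfn)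
  from Ord_least[OF this \<alpha>(1) 1] show ?thesis unfolding card_def by metis
qed

lemma card_card: "card a k \<Longrightarrow> card k k"
  unfolding card_def using eqp_refl eqp_trans by blast

lemma card_eqp: "card a k \<Longrightarrow> eqp a b \<Longrightarrow> card b k"
  unfolding card_def using eqp_sym eqp_trans by blast

text \<open>Mostowski collapse.\<close>

definition col where "col p a f = mk ((\<lambda>b. app f b) ` (el a \<inter> el p))"

lemma collapse:
  assumes a: "Ord a" and x: "el x \<subseteq> el a"
  obtains r where "Ord r" "el r \<subseteq> el a" "eqp x r"
proof -
  have D3: "DF3 col" unfolding DF3_def col_def by (intro dfn)
  define c where "c b = Rec col x b" for b
  have Dc: "DF s \<Longrightarrow> DF (\<lambda>e. c (s e))" for s unfolding c_def by (intro DF_Rec[OF D3] dfn)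
  have c: "el (c b) = c ` (el b \<inter> el x)" if "Ord b" for b
  proof -
    have "(\<lambda>y. app (lam (el b) (\<lambda>y. Rec col x y)) y) ` (el b \<inter> el x) = c ` (el b \<inter> el x)"
      unfolding c_def by (intro image_cong refl) (simp add: app_lam_Rec[OF D3])
    then have "c b = mk (c ` (el b \<inter> el x))"
      unfolding c_def by (subst Rec_Ord[OF D3 that], subst col_def) simp
    moreover have "small (c ` (el b \<inter> el x))"
      by (rule small_image[OF separation[OF small_el[of b]]]) (auto, intro dfn, intro Dc dfn)
    ultimately show ?thesis using el_mk by simp
  qed
  have oc: "Ord (c b) \<and> el (c b) \<subseteq> el b" if "Ord b" for b
  proof (rule Ord_induct[OF _ _ that])
    show "D (\<lambda>e. Ord (c (e 0)) \<and> el (c (e 0)) \<subseteq> el (e 0))" by (intro dfn Dc)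
    fix b assume b: "Ord b" and IH: "\<And>d. d \<in> el b \<Longrightarrow> Ord (c d) \<and> el (c d) \<subseteq> el d"
    have "c d \<in> el b" if d: "d \<in> el b" for d
    proof -
      have "c d \<in> el d \<or> c d = d" using IH[OF d] Ord_sub Ord_mem[OF b d] by blast
      then show ?thesis using Ord_trans[OF b d] d by (metis subsetD)
    qed
    then have "el (c b) \<subseteq> el b" using c[OF b] by auto
    moreover have "trans (c b)"
      unfolding trans_def
    proof (intro ballI subsetI)
      fix y z assume "y \<in> el (c b)" "z \<in> el y"
      then obtain d where d: "d \<in> el b" "d \<in> el x" "z \<in> el (c d)" using c[OF b] by auto
      then obtain d' where "d' \<in> el d" "d' \<in> el x" "z = c d'" using c[OF Ord_mem[OF b d(1)]] by auto
      then show "z \<in> el (c b)" using c[OF b] Ord_trans[OF b d(1)] by auto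
    qed
    moreover have "\<forall>y\<in>el (c b). trans y" using c[OF b] IH by (auto simp: Ord_def)
    ultimately show "Ord (c b) \<and> el (c b) \<subseteq> el b" by (simp add: Ord_def)
  qed
  have inj: "c b \<in> el (c d)" if "b \<in> el x" "d \<in> el x" "b \<in> el d" for b d
    using that c[of d] Ord_mem[OF a] x by blast
  have "el a \<inter> el x = el x" using x by blast
  then have img: "el (c a) = c ` el x" using c[OF a] by simp
  have "bij_betw c (el x) (el (c a))"
    unfolding bij_betw_def img
  proof (intro conjI inj_onI refl)
    fix b d assume bd: "b \<in> el x" "d \<in> el x" "c b = c d"
    have "b \<notin> el d" "d \<notin> el b" using inj[OF bd(1,2)] inj[OF bd(2,1)] bd(3) mem_irrefl by metis+
    then show "b = d" using Ord_linear[of b d] Ord_mem[OF a] x bd by blast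
  qed
  then have "eqp x (c a)" by (intro eqpI[of c] Dc dfn)
  then show thesis using that oc[OF a] by blast
qed

lemma fin_om: assumes "n \<in> el om" shows "fin n"
proof (rule om_induct[OF _ _ _ assms])
  show "D (\<lambda>e. fin (e 0))" by (intro dfn)
  fix n assume "fin n"
  moreover have "sc n = un n (sg n)" by (rule ext) simp
  ultimately show "fin (sc n)" using fin_insert by metis
qed simp

text \<open>The literal reading of \<open>is_finite\<close>, in contrast to \<open>fin\<close>. For
  subsets of \<omega>, the next lemmas replace it and the notions built on it by
  \<open>bd\<close>.\<close>

definition afin where "afin x \<longleftrightarrow> (\<exists>n\<in>el om. eqp x n)"
definition ad where "ad x y \<longleftrightarrow> (\<exists>z. el z = el x \<inter> el y \<and> afin z)"
definition csub where "csub x s \<longleftrightarrow> el x \<subseteq> el s \<and> card x om"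

lemma afin_bd: assumes "el z \<subseteq> el om" shows "afin z \<longleftrightarrow> bd (el z)"
proof
  assume "afin z"
  then obtain n where n: "n \<in> el om" "eqp z n" by (auto simp: afin_def)
  then obtain f where f: "bij_betw (\<lambda>x. app f x) (el n) (el z)" using eqp_sym by (metis eqp_def)
  obtain m where "m \<in> el om" "\<forall>y\<in>el n. app f y \<in> el om \<longrightarrow> app f y \<in> el m"
    using fin_bound[of "\<lambda>y. app f y", OF DF_app[OF DF_const DF_var] fin_om[OF n(1)]] by blast
  moreover have "el z = (\<lambda>x. app f x) ` el n" using f by (simp add: bij_betw_def)
  ultimately show "bd (el z)" unfolding bd_def by auto
next
  assume "bd (el z)"
  then obtain m where m: "m \<in> el om" "el z \<subseteq> el m" using assms unfolding bd_def by blast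
  obtain r where r: "Ord r" "el r \<subseteq> el m" "eqp z r" using collapse[OF om_Ord[OF m(1)] m(2)] .
  then have "r \<in> el om" using Ord_sub[of r m] m(1) om_trans by auto
  then show "afin z" using r by (auto simp: afin_def)
qed

lemma ad_bd: assumes "el x \<subseteq> el om \<or> el y \<subseteq> el om" shows "ad x y \<longleftrightarrow> bd (el x \<inter> el y)"
proof -
  have "small (el x \<inter> el y)" by (rule separation[OF small_el[of x]]) (auto, intro dfn)
  then have e: "el (mk (el x \<inter> el y)) = el x \<inter> el y" by (rule el_mk)
  have "z = mk (el x \<inter> el y)" if "el z = el x \<inter> el y" for z using that by (metis mk_el)
  then have "ad x y \<longleftrightarrow> afin (mk (el x \<inter> el y))" unfolding ad_def using e by metis
  then show ?thesis using afin_bd[of "mk (el x \<inter> el y)"] e assms by auto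
qed

lemma csub_bd: "csub x om \<longleftrightarrow> el x \<subseteq> el om \<and> \<not> bd (el x)"
proof (cases "el x \<subseteq> el om")
  case True
  have "card x om \<longleftrightarrow> \<not> afin x"
  proof
    assume c: "card x om"
    show "\<not> afin x"
    proof
      assume "afin x"
      then obtain n where "n \<in> el om" "eqp x n" by (auto simp: afin_def)
      then have "el om \<subseteq> el n" using c om_Ord unfolding card_def by blast
      then show False using \<open>n \<in> el om\<close> mem_irrefl by blast
    qed
  next
    assume n: "\<not> afin x"
    obtain r where r: "Ord r" "el r \<subseteq> el om" "eqp x r" using collapse[OF Ord_om True] .
    then have "r = om" using Ord_sub[of r om] n by (auto simp: afin_def)
    moreover have "el om \<subseteq> el b" if "Ord b" "eqp x b" for b
    proof -
      have "b \<notin> el om" using n that by (auto simp: afin_def)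
      then show ?thesis using Ord_not_mem that(1) by auto
    qed
    ultimately show "card x om" using r by (auto simp: card_def)
  qed
  then show ?thesis using True afin_bd[OF True] by (simp add: csub_def)
qed (simp add: csub_def)

definition pad where "pad F \<longleftrightarrow> (\<forall>x\<in>el F. \<forall>y\<in>el F. x \<noteq> y \<longrightarrow> ad x y)"
definition madin where "madin F X \<longleftrightarrow> el F \<subseteq> el X \<and> pad F \<and> \<not> (\<exists>x\<in>el X. \<forall>y\<in>el F. ad x y)"
definition infmad where "infmad X m \<longleftrightarrow> (\<exists>F. madin F X \<and> card F m \<and> el om \<subseteq> el m)"
definition perp where "perp F X \<longleftrightarrow> (\<forall>y. y \<in> el X \<longleftrightarrow> csub y om \<and> (\<forall>x\<in>el F. ad x y))"
definition aplus where
  "aplus F m \<longleftrightarrow> (\<exists>X. perp F X \<and> infmad X m \<and> (\<forall>k. infmad X k \<longrightarrow> el m \<subseteq> el k))"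
definition apl where
  "apl l m \<longleftrightarrow> (\<exists>F. ((\<forall>x\<in>el F. csub x om) \<and> pad F) \<and> (\<exists>n. card F n \<and> el n \<subseteq> el l) \<and> aplus F m)"
definition aleph1 where
  "aleph1 l \<longleftrightarrow> (card l l \<and> om \<in> el l) \<and> (\<forall>m. card m m \<and> om \<in> el m \<longrightarrow> el l \<subseteq> el m)"

lemma bd_empty: "bd {}" unfolding bd_def using emp_om by blast

text \<open>A family of subsets of \<omega> is coded by one relation \<open>R\<close> with these
  sections, so that a single name suffices for the whole family.\<close>

definition sec where "sec R b = mk {n \<in> el om. pr b n \<in> el R}"
lemma el_sec: "el (sec R b) = {n \<in> el om. pr b n \<in> el R}"
  unfolding sec_def by (rule el_mk, rule separation[OF small_el[of om]]) (blast, intro dfn)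
lemma DF_sec [dfn]: "DF s \<Longrightarrow> DF t \<Longrightarrow> DF (\<lambda>e. sec (s e) (t e))"
  by (rule liftF2; (assumption | (unfold sec_def, intro dfn)))

lemma D_afin [dfn]: "DF s \<Longrightarrow> D (\<lambda>e. afin (s e))"
  by (rule lift1; (assumption | (unfold afin_def, intro dfn)))
lemma D_ad [dfn]: "DF s \<Longrightarrow> DF t \<Longrightarrow> D (\<lambda>e. ad (s e) (t e))"
  by (rule lift2; (assumption | (unfold ad_def, intro dfn)))
lemma D_csub [dfn]: "DF s \<Longrightarrow> DF t \<Longrightarrow> D (\<lambda>e. csub (s e) (t e))"
  by (rule lift2; (assumption | (unfold csub_def, intro dfn)))
lemma D_pad [dfn]: "DF s \<Longrightarrow> D (\<lambda>e. pad (s e))"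
  by (rule lift1; (assumption | (unfold pad_def, intro dfn)))
lemma D_madin [dfn]: "DF s \<Longrightarrow> DF t \<Longrightarrow> D (\<lambda>e. madin (s e) (t e))"
  by (rule lift2; (assumption | (unfold madin_def, intro dfn)))
lemma D_infmad [dfn]: "DF s \<Longrightarrow> DF t \<Longrightarrow> D (\<lambda>e. infmad (s e) (t e))"
  by (rule lift2; (assumption | (unfold infmad_def, intro dfn)))
lemma D_perp [dfn]: "DF s \<Longrightarrow> DF t \<Longrightarrow> D (\<lambda>e. perp (s e) (t e))"
  by (rule lift2; (assumption | (unfold perp_def, intro dfn)))
lemma D_aplus [dfn]: "DF s \<Longrightarrow> DF t \<Longrightarrow> D (\<lambda>e. aplus (s e) (t e))"
  by (rule lift2; (assumption | (unfold aplus_def, intro dfn)))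
lemma D_apl [dfn]: "DF s \<Longrightarrow> DF t \<Longrightarrow> D (\<lambda>e. apl (s e) (t e))"
  by (rule lift2; (assumption | (unfold apl_def, intro dfn)))

lemma inj_sj: assumes s: "DF (\<lambda>e. s (e 0))" and "inj_on s (el a)" "s ` el a \<subseteq> el p" shows "sj p a"
proof (rule sjI)
  show "DF (\<lambda>e. The1 (\<lambda>x. x \<in> el a \<and> s x = e 0))" by (intro dfn liftF1[OF _ s])
  have "The1 (\<lambda>x'. x' \<in> el a \<and> s x' = s x) = x" if "x \<in> el a" for x
    by (rule The1_eq) (use that assms(2) in \<open>auto simp: inj_on_def\<close>)
  then show "el a \<subseteq> (\<lambda>y. The1 (\<lambda>x. x \<in> el a \<and> s x = y)) ` el p"
    using assms(3) by (intro subsetI image_eqI[of _ _ "s x" for x]) auto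
qed

lemma not_sj_om: assumes "n \<in> el om" shows "\<not> sj n om"
proof
  assume "sj n om"
  then obtain f where f: "el om \<subseteq> (\<lambda>x. app f x) ` el n" by (auto simp: sj_def)
  obtain m where m: "m \<in> el om" "\<forall>y\<in>el n. app f y \<in> el om \<longrightarrow> app f y \<in> el m"
    using fin_bound[of "\<lambda>y. app f y", OF DF_app[OF DF_const DF_var] fin_om[OF assms]] by blast
  obtain y where "y \<in> el n" "m = app f y" using f m(1) by blast
  then have "m \<in> el m" using m by auto
  then show False by simp
qed

subsection \<open>The meaning of the formulas\<close>

lemma el_eq: "el x = el y \<longleftrightarrow> x = y" using ext by blast

text \<open>Arguments of a formula lie below the next free variable \<open>n\<close>, so quantifiers
  leave their values unchanged; this is the source of the premises \<open>x < n\<close> in this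
  part.\<close>

lemma upd_lt: "x < n \<Longrightarrow> (e(n := v)) x = e x" for n :: nat by simp

lemmas fm_simps = satR_sentence upd_lt fun_upd_same less_SucI

lemma sat_is_empty: "x < n \<Longrightarrow> sat E (is_empty x n) e \<longleftrightarrow> el (e x) = {}"
  by (simp add: is_empty_def fm_simps el_def del: fun_upd_apply)

lemma sat_is_succ: "x < n \<Longrightarrow> s < n \<Longrightarrow> sat E (is_succ x s n) e \<longleftrightarrow> e s = sc (e x)"
proof -
  assume "x < n" "s < n"
  then have "sat E (is_succ x s n) e \<longleftrightarrow> (\<forall>z. z \<in> el (e s) \<longleftrightarrow> z \<in> el (e x) \<or> z = e x)"
    by (simp add: is_succ_def fm_simps el_def del: fun_upd_apply)
  also have "\<dots> \<longleftrightarrow> el (e s) = el (sc (e x))" by auto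
  finally show ?thesis by (simp only: el_eq)
qed

lemma sat_subset: "x < n \<Longrightarrow> y < n \<Longrightarrow> sat E ((x \<^bold>\<subseteq> y) n) e \<longleftrightarrow> el (e x) \<subseteq> el (e y)"
  by (simp add: fm_simps el_def subset_iff del: fun_upd_apply)

lemma sat_is_inductive: "x < n \<Longrightarrow> sat E (is_inductive x n) e \<longleftrightarrow> ind (e x)"
proof -
  assume x: "x < n"
  have "sat E (is_inductive x n) e \<longleftrightarrow> (\<exists>z\<in>el (e x). el z = {}) \<and> (\<forall>y\<in>el (e x). sc y \<in> el (e x))"
    using x by (simp add: is_inductive_def fm_simps sat_is_empty sat_is_succ el_def[of "e x"] Ball_def Bex_def del: fun_upd_apply)
  moreover have "(\<exists>z\<in>el (e x). el z = {}) \<longleftrightarrow> emp \<in> el (e x)" using ext[of emp] by (metis el_emp)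
  ultimately show ?thesis by (simp add: ind_def)
qed

lemma sat_is_least:
  "x < n \<Longrightarrow> sat E (is_least p x n) e \<longleftrightarrow>
    sat E (p x n) e \<and> (\<forall>v. sat E (p n (Suc n)) (e(n := v)) \<longrightarrow> el (e x) \<subseteq> el v)"
  by (simp add: is_least_def satR_form sat_subset upd_lt less_SucI del: fun_upd_apply) (simp add: fun_upd_same)

lemma sat_is_omega: "w < n \<Longrightarrow> sat E (is_omega w n) e \<longleftrightarrow> e w = om"
proof -
  assume w: "w < n"
  then have "sat E (is_omega w n) e \<longleftrightarrow> ind (e w) \<and> (\<forall>v. ind v \<longrightarrow> el (e w) \<subseteq> el v)"
    by (simp add: is_omega_def sat_is_least sat_is_inductive)
  also have "\<dots> \<longleftrightarrow> el (e w) = el om"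
  proof
    assume "ind (e w) \<and> (\<forall>v. ind v \<longrightarrow> el (e w) \<subseteq> el v)"
    then show "el (e w) = el om" unfolding el_om by blast
  next
    assume a: "el (e w) = el om"
    have "ind om" by (simp add: ind_def)
    then have "ind (e w)" using a by (simp add: ind_def)
    moreover have "el om \<subseteq> el v" if "ind v" for v using that unfolding el_om by blast
    ultimately show "ind (e w) \<and> (\<forall>v. ind v \<longrightarrow> el (e w) \<subseteq> el v)" using a by simp
  qed
  finally show ?thesis by (simp only: el_eq)
qed

lemma sat_is_trans: "x < n \<Longrightarrow> sat E (is_trans x n) e \<longleftrightarrow> trans (e x)"
  by (simp add: is_trans_def ball_form_def satR_form sat_subset upd_lt less_SucI trans_def el_def[of "e x"] del: fun_upd_apply) (simp add: fun_upd_same el_def)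

lemma sat_is_ordinal: "x < n \<Longrightarrow> sat E (is_ordinal x n) e \<longleftrightarrow> Ord (e x)"
  by (simp add: is_ordinal_def ball_form_def satR_form sat_is_trans upd_lt less_SucI Ord_def el_def[of "e x"] del: fun_upd_apply) (simp add: fun_upd_same el_def)

lemma sat_is_upair: "x < n \<Longrightarrow> y < n \<Longrightarrow> p < n \<Longrightarrow> sat E (is_upair x y p n) e \<longleftrightarrow> e p = upr (e x) (e y)"
proof -
  assume "x < n" "y < n" "p < n"
  then have "sat E (is_upair x y p n) e \<longleftrightarrow> (\<forall>z. z \<in> el (e p) \<longleftrightarrow> z = e x \<or> z = e y)"
    by (simp add: is_upair_def fm_simps el_def del: fun_upd_apply)
  also have "\<dots> \<longleftrightarrow> el (e p) = el (upr (e x) (e y))" by auto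
  finally show ?thesis by (simp only: el_eq)
qed

lemma sat_is_pair: "x < n \<Longrightarrow> y < n \<Longrightarrow> p < n \<Longrightarrow> sat E (is_pair x y p n) e \<longleftrightarrow> e p = pr (e x) (e y)"
  by (simp add: is_pair_def satR_form sat_is_upair upd_lt less_SucI pr_def del: fun_upd_apply) (simp add: upd_lt)

lemma sat_pair_in: "x < n \<Longrightarrow> y < n \<Longrightarrow> f < n \<Longrightarrow> sat E (pair_in x y f n) e \<longleftrightarrow> pr (e x) (e y) \<in> el (e f)"
  by (simp add: pair_in_def bex_form_def satR_form sat_is_pair upd_lt less_SucI el_def[of "e f"] del: fun_upd_apply) (simp add: upd_lt)


definition bijf where
  "bijf f a b \<longleftrightarrow> el f \<subseteq> PR (el a) (el b) \<and> (\<forall>x\<in>el a. \<exists>!y. y \<in> el b \<and> pr x y \<in> el f) \<and>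
    (\<forall>y\<in>el b. \<exists>!x. x \<in> el a \<and> pr x y \<in> el f)"

lemma ex1_iff: "(\<exists>y. \<forall>x. P x \<longleftrightarrow> x = y) \<longleftrightarrow> (\<exists>!x. P x)" unfolding Ex1_def by metis

lemma sat_is_bijection:
  assumes "f < n" "a < n" "b < n" shows "sat E (is_bijection f a b n) e \<longleftrightarrow> bijf (e f) (e a) (e b)"
proof -
  have "sat E (is_bijection f a b n) e \<longleftrightarrow>
    (\<forall>p. p \<in> el (e f) \<longrightarrow> (\<exists>x. x \<in> el (e a) \<and> (\<exists>y. y \<in> el (e b) \<and> p = pr x y))) \<and>
    (\<forall>x. x \<in> el (e a) \<longrightarrow> (\<exists>y. \<forall>x'. (x' \<in> el (e b) \<and> pr x x' \<in> el (e f)) \<longleftrightarrow> x' = y)) \<and>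
    (\<forall>x. x \<in> el (e b) \<longrightarrow> (\<exists>y. \<forall>x'. (x' \<in> el (e a) \<and> pr x' x \<in> el (e f)) \<longleftrightarrow> x' = y))"
    using assms
    by (simp add: is_bijection_def fm_simps sat_is_pair sat_pair_in el_def[of "e f"] el_def[of "e a"] el_def[of "e b"] del: fun_upd_apply)
  moreover have "el (e f) \<subseteq> PR (el (e a)) (el (e b)) \<longleftrightarrow>
    (\<forall>p. p \<in> el (e f) \<longrightarrow> (\<exists>x. x \<in> el (e a) \<and> (\<exists>y. y \<in> el (e b) \<and> p = pr x y)))"
    unfolding PR_def subset_iff mem_Collect_eq by metis
  ultimately show ?thesis unfolding ex1_iff bijf_def Ball_def by simp
qed

lemma eqp_bijf: "eqp a b \<longleftrightarrow> (\<exists>f. bijf f a b)"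
proof
  assume "eqp a b"
  then obtain f where f: "bij_betw (\<lambda>x. app f x) (el a) (el b)" by (auto simp: eqp_def)
  have e: "el (lam (el a) (\<lambda>x. app f x)) = (\<lambda>x. pr x (app f x)) ` el a"
    unfolding lam_def by (intro el_mk small_image small_el dfn)
  have in_e: "pr x y \<in> el (lam (el a) (\<lambda>x. app f x)) \<longleftrightarrow> x \<in> el a \<and> y = app f x" for x y
    unfolding e by (auto simp: image_iff)
  have fb: "app f x \<in> el b" if "x \<in> el a" for x using f that by (rule bij_betw_apply)
  have "bijf (lam (el a) (\<lambda>x. app f x)) a b"
    unfolding bijf_def in_e
  proof (intro conjI ballI)
    show "el (lam (el a) (\<lambda>x. app f x)) \<subseteq> PR (el a) (el b)" unfolding e PR_def using fb by blast
    show "\<exists>!y. y \<in> el b \<and> x \<in> el a \<and> y = app f x" if "x \<in> el a" for x using fb that by blast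
    show "\<exists>!x. x \<in> el a \<and> x \<in> el a \<and> y = app f x" if "y \<in> el b" for y
      using f that unfolding bij_betw_def inj_on_def by (metis (no_types, lifting) image_iff)
  qed
  then show "\<exists>f. bijf f a b" by blast
next
  assume "\<exists>f. bijf f a b"
  then obtain f where "bijf f a b" ..
  then have f: "el f \<subseteq> PR (el a) (el b)" "\<forall>x\<in>el a. \<exists>!y. y \<in> el b \<and> pr x y \<in> el f"
    "\<forall>y\<in>el b. \<exists>!x. x \<in> el a \<and> pr x y \<in> el f" by (simp_all add: bijf_def)
  have in_ab: "x \<in> el a \<and> y \<in> el b" if "pr x y \<in> el f" for x y using f(1) that by (auto simp: PR_def)
  have u2: "y = y'" if "pr x y \<in> el f" "pr x y' \<in> el f" for x y y'
    using bspec[OF f(2), of x] in_ab[OF that(1)] in_ab[OF that(2)] that by (metis (no_types, lifting))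
  have u1: "x = x'" if "pr x y \<in> el f" "pr x' y \<in> el f" for x x' y
    using bspec[OF f(3), of y] in_ab[OF that(1)] in_ab[OF that(2)] that by (metis (no_types, lifting))
  have app: "app f x = y" if "pr x y \<in> el f" for x y
    unfolding app_def
  proof (rule The1_eq)
    show "pr x y \<in> el f" by (rule that)
    show "y' = y" if "pr x y' \<in> el f" for y' using u2[OF that \<open>pr x y \<in> el f\<close>] .
  qed
  have app': "pr x (app f x) \<in> el f" if x: "x \<in> el a" for x
  proof -
    obtain y where "pr x y \<in> el f" using bspec[OF f(2) x] by (elim ex1E conjE)
    then show ?thesis using app by simp
  qed
  have "inj_on (\<lambda>x. app f x) (el a)"
  proof (rule inj_onI)
    fix x x' assume *: "x \<in> el a" "x' \<in> el a" "app f x = app f x'"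
    have "pr x' (app f x) \<in> el f" using app'[OF *(2)] *(3) by simp
    then show "x = x'" using u1 app'[OF *(1)] by metis
  qed
  moreover have "(\<lambda>x. app f x) ` el a = el b"
  proof (intro equalityI subsetI)
    fix y assume y: "y \<in> el b"
    obtain x where "x \<in> el a" "pr x y \<in> el f" using bspec[OF f(3) y] by (elim ex1E conjE)
    then show "y \<in> (\<lambda>x. app f x) ` el a" using app by (intro image_eqI[of _ _ x]) auto
  next
    fix y assume "y \<in> (\<lambda>x. app f x) ` el a"
    then show "y \<in> el b" using app' in_ab by (elim imageE) metis
  qed
  ultimately show "eqp a b" unfolding eqp_def bij_betw_def by metis
qed

lemma sat_equipotent: "a < n \<Longrightarrow> b < n \<Longrightarrow> sat E (equipotent a b n) e \<longleftrightarrow> eqp (e a) (e b)"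
  by (simp add: equipotent_def fm_simps sat_is_bijection eqp_bijf del: fun_upd_apply)

lemma sat_is_card_of: "a < n \<Longrightarrow> k < n \<Longrightarrow> sat E (is_card_of a k n) e \<longleftrightarrow> card (e a) (e k)"
  by (simp add: is_card_of_def sat_is_least fm_simps sat_is_ordinal sat_equipotent card_def del: fun_upd_apply)

lemma sat_is_cardinal: "k < n \<Longrightarrow> sat E (is_cardinal k n) e \<longleftrightarrow> card (e k) (e k)"
  by (simp add: is_cardinal_def sat_is_card_of)

lemma sat_is_aleph1:
  "w < n \<Longrightarrow> e w = om \<Longrightarrow> k < n \<Longrightarrow> sat E (is_aleph1 w k n) e \<longleftrightarrow> aleph1 (e k)"
  by (simp add: is_aleph1_def sat_is_least fm_simps sat_is_cardinal aleph1_def el_def[of "e k"] el_def del: fun_upd_apply)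

lemma sat_is_continuum:
  "w < n \<Longrightarrow> e w = om \<Longrightarrow> k < n \<Longrightarrow> sat E (is_continuum w k n) e \<longleftrightarrow>
    (\<exists>p. (\<forall>x. x \<in> el p \<longleftrightarrow> el x \<subseteq> el om) \<and> card p (e k))"
  by (simp add: is_continuum_def satR_form satR_fm sat_subset sat_is_card_of upd_lt less_SucI fun_upd_same del: fun_upd_apply)
    (simp add: el_def)

lemma sat_almost_disjoint:
  assumes "w < n" "e w = om" "x < n" "y < n"
  shows "sat E (almost_disjoint w x y n) e \<longleftrightarrow> ad (e x) (e y)"
proof -
  have "sat E (almost_disjoint w x y n) e \<longleftrightarrow>
    (\<exists>z. (\<forall>u. u \<in> el z \<longleftrightarrow> u \<in> el (e x) \<and> u \<in> el (e y)) \<and> (\<exists>k. k \<in> el om \<and> eqp z k))"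
    using assms
    by (simp add: almost_disjoint_def is_inter_def is_finite_def fm_simps sat_equipotent el_def del: fun_upd_apply)
  also have "\<dots> \<longleftrightarrow> ad (e x) (e y)" unfolding ad_def afin_def by (simp add: set_eq_iff Bex_def)
  finally show ?thesis .
qed

lemma sat_countable_subset:
  "w < n \<Longrightarrow> e w = om \<Longrightarrow> x < n \<Longrightarrow> s < n \<Longrightarrow> sat E (countable_subset w x s n) e \<longleftrightarrow> csub (e x) (e s)"
  by (simp add: countable_subset_def satR_form sat_subset sat_is_card_of csub_def)

lemma sat_pairwise_ad:
  "w < n \<Longrightarrow> e w = om \<Longrightarrow> F < n \<Longrightarrow> sat E (pairwise_ad w F n) e \<longleftrightarrow> pad (e F)"
  by (simp add: pairwise_ad_def fm_simps sat_almost_disjoint pad_def el_def Ball_def del: fun_upd_apply)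

lemma sat_mad_in:
  "w < n \<Longrightarrow> e w = om \<Longrightarrow> F < n \<Longrightarrow> X < n \<Longrightarrow> sat E (mad_in w F X n) e \<longleftrightarrow> madin (e F) (e X)"
  by (simp add: mad_in_def satR_form satR_fm bex_form_def ball_form_def upd_lt less_SucI fun_upd_same
      sat_subset sat_pairwise_ad sat_almost_disjoint madin_def el_def[of "e X"] el_def[of "e F"] Ball_def Bex_def del: fun_upd_apply)

lemma sat_is_perp:
  "w < n \<Longrightarrow> e w = om \<Longrightarrow> F < n \<Longrightarrow> X < n \<Longrightarrow> sat E (is_perp w F X n) e \<longleftrightarrow> perp (e F) (e X)"
  by (simp add: is_perp_def satR_form satR_fm ball_form_def upd_lt less_SucI fun_upd_same
      sat_countable_subset sat_almost_disjoint perp_def el_def[of "e X"] el_def[of "e F"] Ball_def del: fun_upd_apply)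

lemma sat_is_a_plus:
  "w < n \<Longrightarrow> e w = om \<Longrightarrow> F < n \<Longrightarrow> k < n \<Longrightarrow> sat E (is_a_plus w F k n) e \<longleftrightarrow> aplus (e F) (e k)"
  by (simp add: is_a_plus_def is_a_def satR_form(6) satR_form sat_is_least upd_lt less_SucI fun_upd_same
      sat_is_perp sat_mad_in sat_is_card_of sat_subset infmad_def aplus_def del: fun_upd_apply)

lemma sat_is_a_plus_card:
  "w < n \<Longrightarrow> e w = om \<Longrightarrow> l < n \<Longrightarrow> k < n \<Longrightarrow> sat E (is_a_plus_card w l k n) e \<longleftrightarrow>
    (card (e k) (e k) \<and> (\<forall>m. apl (e l) m \<longrightarrow> el m \<subseteq> el (e k))) \<and>
    (\<forall>v. card v v \<and> (\<forall>m. apl (e l) m \<longrightarrow> el m \<subseteq> el v) \<longrightarrow> el (e k) \<subseteq> el v)"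
  by (simp add: is_a_plus_card_def is_cardinal_sup_def ad_family_on_omega_def ball_form_def satR_form satR_fm
      sat_is_least upd_lt less_SucI fun_upd_same sat_is_cardinal sat_is_card_of sat_subset sat_is_a_plus
      sat_pairwise_ad sat_countable_subset apl_def Ball_def el_def[symmetric] del: fun_upd_apply) (simp add: el_def)

theorem sat_statement:
  "sat E a_plus_aleph1_less_continuum e \<longleftrightarrow> (\<exists>l k c. aleph1 l \<and>
    ((card k k \<and> (\<forall>m. apl l m \<longrightarrow> el m \<subseteq> el k)) \<and>
     (\<forall>v. card v v \<and> (\<forall>m. apl l m \<longrightarrow> el m \<subseteq> el v) \<longrightarrow> el k \<subseteq> el v)) \<and>
    (\<exists>p. (\<forall>x. x \<in> el p \<longleftrightarrow> el x \<subseteq> el om) \<and> card p c) \<and> k \<in> el c)"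
  by (simp add: a_plus_aleph1_less_continuum_def sentence_def satR_form satR_fm upd_lt less_SucI fun_upd_same
      sat_is_omega sat_is_aleph1 sat_is_a_plus_card sat_is_continuum el_def cong: conj_cong del: fun_upd_apply)

end

section \<open>The generic mad family\<close>

context mad_ext begin

lemma leq_t1: "p \<in> el PP \<Longrightarrow> pr t1 (pr i n) \<in> el p \<Longrightarrow> leq p (sg (pr t1 (pr i n)))"
  by (rule leq_sg) auto
lemma leq_t0: "p \<in> el PP \<Longrightarrow> pr t0 (pr i n) \<in> el p \<Longrightarrow> leq p (sg (pr t0 (pr i n)))"
  by (rule leq_sg) auto

lemma ev_xn: "n \<in> ev (xn i) \<longleftrightarrow> n \<in> el om \<and> sg (pr t1 (pr i n)) \<in> G"
  unfolding ev_def el_xn by auto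
lemma ev_hn: "n \<in> ev (hn i) \<longleftrightarrow> n \<in> el om \<and> sg (pr t0 (pr i n)) \<in> G"
  unfolding ev_def el_hn by auto

lemma meets:
  assumes "D (\<lambda>e. e 0 \<in> Q)" "\<And>p. p \<in> G \<Longrightarrow> \<exists>q\<in>Q. leq q p" obtains p where "p \<in> G" "p \<in> Q"
  using G_gen[OF assms(1)] assms(2) that by blast

text \<open>Promises can always be added, so some \<open>p\<close> in \<open>G\<close> carries this
  one. A number entering \<open>X i\<close> beyond those mentioned in \<open>p\<close> then needs a
  witness from \<open>k\<close>, and the witness lies above a condition of \<open>G\<close>.\<close>

lemma promise_kept: assumes i: "isidx i" "k \<in> el (sn i)" shows "bd (ev (xn i) - ev k)"
proof -
  define Q where "Q = {q \<in> el PP. pr t2 (pr i k) \<in> el q}"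
  have DQ: "D (\<lambda>e. e 0 \<in> Q)" unfolding Q_def by (intro dfn)
  obtain p where p: "p \<in> G" "p \<in> Q"
  proof (rule meets[OF DQ])
    fix p assume "p \<in> G"
    then have l: "leq (un p (sg (pr t2 (pr i k)))) p" using add_promise i G_P by blast
    then have "un p (sg (pr t2 (pr i k))) \<in> Q" unfolding Q_def using leq_PP by auto
    then show "\<exists>q\<in>Q. leq q p" using l by blast
  qed blast
  have pP: "p \<in> el PP" and pk: "pr t2 (pr i k) \<in> el p" using p(2) by (auto simp: Q_def)
  obtain m where m: "m \<in> el om" "\<And>n t i. n \<in> el om \<Longrightarrow> n \<notin> el m \<Longrightarrow> pr t (pr i n) \<notin> el p"
    using fresh_bound[OF pP] by metis
  have "n \<in> el m" if n: "n \<in> ev (xn i)" "n \<notin> ev k" for n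
  proof (rule ccontr)
    assume nm: "n \<notin> el m"
    have no: "n \<in> el om" "sg (pr t1 (pr i n)) \<in> G" using n(1) ev_xn by auto
    obtain r where r: "r \<in> G" "leq r p" "leq r (sg (pr t1 (pr i n)))" using G_dir[OF p(1) no(2)] by blast
    have "pr t1 (pr i n) \<in> el r" using leq_sub[OF r(3)] by auto
    then obtain d where "leq r d" "pr n d \<in> el k"
      using leq_promise[OF r(2) _ m(2)[OF no(1) nm] pk] by blast
    then show False using n(2) G_up r(1) unfolding ev_def by blast
  qed
  then show ?thesis unfolding bd_def using m(1) by blast
qed

lemma hn_xn: "n \<in> ev (hn i) \<Longrightarrow> n \<in> ev (xn i) \<Longrightarrow> False"
proof -
  assume "n \<in> ev (hn i)" "n \<in> ev (xn i)"
  then have "sg (pr t0 (pr i n)) \<in> G" "sg (pr t1 (pr i n)) \<in> G" using ev_xn ev_hn by auto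
  then obtain r where r: "leq r (sg (pr t0 (pr i n)))" "leq r (sg (pr t1 (pr i n)))" using G_dir by blast
  then have "pr t0 (pr i n) \<in> el r" "pr t1 (pr i n) \<in> el r" using leq_sub[OF r(1)] leq_sub[OF r(2)] by auto
  moreover have "cnd r" using leq_PP[OF r(1)] in_PP by blast
  ultimately show False unfolding cnd_def by blast
qed

lemma hn_or_xn: assumes i: "isidx i" and n: "n \<in> el om" shows "n \<in> ev (hn i) \<or> n \<in> ev (xn i)"
proof -
  define Q where "Q = {q \<in> el PP. pr t0 (pr i n) \<in> el q \<or> pr t1 (pr i n) \<in> el q}"
  have DQ: "D (\<lambda>e. e 0 \<in> Q)" unfolding Q_def by (intro dfn)
  obtain p where p: "p \<in> G" "p \<in> Q"
  proof (rule meets[OF DQ])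
    fix p assume "p \<in> G"
    then have pP: "p \<in> el PP" using G_P by blast
    show "\<exists>q\<in>Q. leq q p"
    proof (cases "p \<in> Q")
      case True
      then show ?thesis using leq_refl pP by blast
    next
      case False
      let ?q = "un p (sg (pr t0 (pr i n)))"
      have "pr t1 (pr i n) \<notin> el p" using False pP by (auto simp: Q_def)
      then have "cnd ?q" using pP i n fin_insert unfolding in_PP cnd_def by auto
      then have qP: "?q \<in> el PP" by (simp add: in_PP)
      have "leq ?q p"
      proof (rule leqI[OF qP, of "\<lambda>w. w = p"])
        show "D (\<lambda>e. e 0 = p)" by (intro dfn)
      qed (use pP in auto)
      moreover have "?q \<in> Q" unfolding Q_def using qP by simp
      ultimately show ?thesis by blast
    qed
  qed blast
  then have pP: "p \<in> el PP" by (simp add: Q_def)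
  from p(2) have "pr t0 (pr i n) \<in> el p \<or> pr t1 (pr i n) \<in> el p" by (simp add: Q_def)
  then have "sg (pr t0 (pr i n)) \<in> G \<or> sg (pr t1 (pr i n)) \<in> G"
    using leq_t0[OF pP] leq_t1[OF pP] G_up[OF p(1)] by blast
  then show ?thesis using n by (auto simp: ev_xn ev_hn)
qed

lemma xn_distinct: assumes "a \<in> el la" "b \<in> el la" "a \<noteq> b" shows "ev (xn (pr a emp)) \<noteq> ev (xn (pr b emp))"
proof -
  define Q where "Q = {q \<in> el PP. \<exists>n\<in>el om. pr t1 (pr (pr a emp) n) \<in> el q \<and> pr t0 (pr (pr b emp) n) \<in> el q}"
  have DQ: "D (\<lambda>e. e 0 \<in> Q)" unfolding Q_def by (intro dfn)
  obtain p where p: "p \<in> G" "p \<in> Q"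
  proof (rule meets[OF DQ])
    fix p assume "p \<in> G"
    then have pP: "p \<in> el PP" using G_P by blast
    obtain m where m: "m \<in> el om" "\<And>n t i. n \<in> el om \<Longrightarrow> n \<notin> el m \<Longrightarrow> pr t (pr i n) \<notin> el p"
      using fresh_bound[OF pP] by metis
    have l: "leq (un p (upr (pr t1 (pr (pr a emp) m)) (pr t0 (pr (pr b emp) m)))) p"
      by (rule split_idx[OF pP assms m(1)]) (rule m(2)[OF m(1) mem_irrefl])
    moreover have "un p (upr (pr t1 (pr (pr a emp) m)) (pr t0 (pr (pr b emp) m))) \<in> Q"
      unfolding Q_def using leq_PP[OF l] m(1) by auto
    ultimately show "\<exists>q\<in>Q. leq q p" by blast
  qed blast
  then obtain n where n: "p \<in> el PP" "n \<in> el om" "pr t1 (pr (pr a emp) n) \<in> el p" "pr t0 (pr (pr b emp) n) \<in> el p"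
    by (auto simp: Q_def)
  have "n \<in> ev (xn (pr a emp))" "n \<in> ev (hn (pr b emp))"
    unfolding ev_xn ev_hn using G_up[OF p(1)] leq_t1[OF n(1,3)] leq_t0[OF n(1,4)] n(2) by blast+
  then show ?thesis using hn_xn by blast
qed

lemma j_img [simp]: "j x \<in> j ` S \<longleftrightarrow> x \<in> S" by (simp add: image_iff)

lemma j_bd: "N.bd (j ` S) \<longleftrightarrow> bd S"
  unfolding N.bd_def bd_def j_om by simp

lemma ev_om_image: assumes "N.el X \<subseteq> N.el N.om" shows "N.el X = j ` {n \<in> el om. j n \<in> N.el X}"
proof (intro equalityI subsetI)
  fix x assume x: "x \<in> N.el X"
  then obtain m where "m \<in> el om" "x = j m" using assms om_j by blast
  then show "x \<in> j ` {n \<in> el om. j n \<in> N.el X}" using x by blast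
qed blast

lemma family:
  assumes I: "DF (\<lambda>e. I (e 0))"
  obtains R where "\<And>b. b \<in> el A \<Longrightarrow> N.el (N.sec R (j b)) = j ` ev (xn (I b))"
proof -
  define DX where "DX = mk {z \<in> PR (el (cp A om)) (el PP). pr (sn (fs z)) (sn z) \<in> el (xn (I (fs (fs z))))}"
  have DX: "el DX = {z \<in> PR (el (cp A om)) (el PP). pr (sn (fs z)) (sn z) \<in> el (xn (I (fs (fs z))))}"
    unfolding DX_def by (rule el_mk, rule separation[OF small_PR[OF small_el[of "cp A om"] small_el[of PP]]])
      (auto, intro dfn liftF1[OF _ I])
  obtain R where R: "N.el R = j ` (el (cp A om) \<inter> ev DX)" by (rule set_of)
  have "N.el (N.sec R (j b)) = j ` ev (xn (I b))" if b: "b \<in> el A" for b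
  proof -
    have 1: "pr b n \<in> ev DX \<longleftrightarrow> n \<in> ev (xn (I b))" if "n \<in> el om" for n
      using that b G_P unfolding ev_def DX by auto
    have 2: "N.pr (j b) (j n) \<in> N.el R \<longleftrightarrow> n \<in> ev (xn (I b))" if "n \<in> el om" for n
      using that b 1[OF that] unfolding j_pr R by (auto simp: image_iff)
    show ?thesis
      unfolding N.el_sec j_om using 2 ev_xn by auto
  qed
  then show thesis by (rule that)
qed

text \<open>\<omega> is embedded in the index set of \<open>reg_w1\<close> by fixing
  \<open>emp\<close> as the component in \<open>w1\<close>; a function is extended so as to ignore
  that component.\<close>

lemma reg_om: assumes "\<forall>x\<in>el (cp om Om). app f x \<in> el th" shows "\<exists>b\<in>el th. \<forall>x\<in>el (cp om Om). app f x \<in> el b"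
proof -
  define F where "F z = app f (pr (sn (fs z)) (sn z))" for z
  have DF: "DF (\<lambda>e. F (e 0))" unfolding F_def by (intro dfn)
  have a: "app (lam (el (cp (cp w1 om) Om)) F) z = F z" if "z \<in> el (cp (cp w1 om) Om)" for z
    by (rule app_lam[OF small_el DF that])
  have "F z \<in> el th" if "z \<in> el (cp (cp w1 om) Om)" for z using that assms by (auto simp: F_def PR_def)
  then obtain b where b: "b \<in> el th" "\<forall>z\<in>el (cp (cp w1 om) Om). F z \<in> el b"
    using reg_w1[of "lam (el (cp (cp w1 om) Om)) F"] a by auto
  have "app f x \<in> el b" if x: "x \<in> el (cp om Om)" for x
  proof -
    obtain n y where xy: "x = pr n y" "n \<in> el om" "y \<in> el Om" using x by (auto simp: PR_def)
    then have "pr (pr emp n) y \<in> el (cp (cp w1 om) Om)" using w1(3) by simp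
    then have "F (pr (pr emp n) y) \<in> el b" using b(2) by blast
    then show ?thesis by (simp add: F_def xy(1))
  qed
  then show ?thesis using b(1) by blast
qed

lemma real_name:
  obtains Y g where "g \<in> el th" "\<And>n d. pr n d \<in> el Y \<Longrightarrow> d \<in> el PP \<and> d \<in> el (U g)"
    "ev Y = {n \<in> el om. j n \<in> N.el X}"
proof -
  obtain A where A: "\<And>y. y \<in> el om \<Longrightarrow> j y \<in> N.el X \<longleftrightarrow> y \<in> ev A" by (rule name_of[of om X]) blast
  obtain M g where "g \<in> el th" "\<forall>y d. pr y d \<in> el M \<longrightarrow> y \<in> el om \<and> d \<in> el PP \<and> d \<in> el (U g)"
    "el om \<inter> ev A = ev M"
  proof (rule ev_bounded[where A = om and N = A, OF reg_om])
    fix M g assume *: "g \<in> el th" "\<And>y d. pr y d \<in> el M \<Longrightarrow> y \<in> el om \<and> d \<in> el PP \<and> d \<in> el (U g)"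
      "el om \<inter> ev A = ev M"
    show thesis by (rule that[OF *(1) _ *(3)]) (use *(2) in blast)
  qed
  then show thesis using that[of g M] A by blast
qed

lemma evL_junk: assumes "Ord g" shows "el om \<subseteq> evL g' (junk g)"
proof -
  have "emp \<in> G" using G_ne G_up leq_emp G_P by blast
  then show ?thesis unfolding evL_def using PL_emp junk_pr[OF assms] by blast
qed

lemma evL_ev: assumes "Ord g" "k \<in> el (U g)" shows "evL g k = ev k"
  unfolding evL_def ev_def using PL_closed[OF assms] G_P by blast

text \<open>\<open>hit\<close> is used at two levels. At stage \<open>g\<close>, which lies above
  names for the given family and for \<open>Z\<close>, the earlier members are all of higher stage;
  so each new set meets \<open>Z\<close> infinitely often and is infinite. At a stage
  \<open>r\<close> containing all constraints of one index, the earlier members are low, and this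
  gives maximality.\<close>

lemma mad_perp:
  assumes f: "\<And>x. x \<in> el w1 \<Longrightarrow> N.el (N.app f (j x)) \<subseteq> N.el N.om"
    and Z: "N.el Z \<subseteq> N.el N.om" "\<not> N.bd (N.el Z)"
      "\<And>x. x \<in> el w1 \<Longrightarrow> N.bd (N.el (N.app f (j x)) \<inter> N.el Z)"
  obtains R where "\<And>b. b \<in> el th \<Longrightarrow> \<not> N.bd (N.el (N.sec R (j b)))"
    "\<And>x b. x \<in> el w1 \<Longrightarrow> b \<in> el th \<Longrightarrow> N.bd (N.el (N.app f (j x)) \<inter> N.el (N.sec R (j b)))"
    "\<And>b b'. b \<in> el th \<Longrightarrow> b' \<in> el th \<Longrightarrow> b \<noteq> b' \<Longrightarrow> N.bd (N.el (N.sec R (j b)) \<inter> N.el (N.sec R (j b')))"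
    "\<And>Y. N.el Y \<subseteq> N.el N.om \<Longrightarrow> \<not> N.bd (N.el Y) \<Longrightarrow>
      (\<And>x. x \<in> el w1 \<Longrightarrow> N.bd (N.el (N.app f (j x)) \<inter> N.el Y)) \<Longrightarrow>
      \<exists>b\<in>el th. \<not> N.bd (N.el (N.sec R (j b)) \<inter> N.el Y)"
proof -
  \<comment> \<open>The complements are named, since a constraint lists the conditions that put
    \<open>n\<close> outside the set to be avoided.\<close>
  define Rf where "Rf = N.mk {z \<in> N.el (j (cp w1 om)). N.sn z \<notin> N.el (N.app f (N.fs z))}"
  have Rf: "N.el Rf = {z \<in> N.el (j (cp w1 om)). N.sn z \<notin> N.el (N.app f (N.fs z))}"
    unfolding Rf_def by (rule N.el_mk, rule N.separation[OF N.small_el[of "j (cp w1 om)"]]) (blast, intro N.dfn)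
  obtain A where A: "\<And>y. y \<in> el (cp w1 om) \<Longrightarrow> j y \<in> N.el Rf \<longleftrightarrow> y \<in> ev A" by (rule name_of[of "cp w1 om" Rf]) blast
  obtain M gK where M: "gK \<in> el th" "\<forall>y d. pr y d \<in> el M \<longrightarrow> y \<in> el (cp w1 om) \<and> d \<in> el PP \<and> d \<in> el (U gK)"
    "el (cp w1 om) \<inter> ev A = ev M"
  proof (rule ev_bounded[where A = "cp w1 om" and N = A, OF reg_w1])
    fix M g assume *: "g \<in> el th" "\<And>y d. pr y d \<in> el M \<Longrightarrow> y \<in> el (cp w1 om) \<and> d \<in> el PP \<and> d \<in> el (U g)"
      "el (cp w1 om) \<inter> ev A = ev M"
    show thesis by (rule that[OF *(1) _ *(3)]) (use *(2) in blast)
  qed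
  define kk where "kk x = mk {z \<in> PR (el om) (el PP). pr (pr x (fs z)) (sn z) \<in> el M}" for x
  have kk: "el (kk x) = {z \<in> PR (el om) (el PP). pr (pr x (fs z)) (sn z) \<in> el M}" for x
    unfolding kk_def by (rule el_mk, rule separation[OF small_PR[OF small_el[of om] small_el[of PP]]]) (auto, intro dfn)
  have Dkk: "DF (\<lambda>e. kk (e 0))" unfolding kk_def by (intro dfn)
  have ev_kk: "ev (kk x) = {n \<in> el om. j n \<notin> N.el (N.app f (j x))}" if x: "x \<in> el w1" for x
  proof -
    have "n \<in> ev (kk x) \<longleftrightarrow> n \<in> el om \<and> pr x n \<in> ev M" for n
      using G_P unfolding ev_def kk by auto
    moreover have "pr x n \<in> ev M \<longleftrightarrow> j n \<notin> N.el (N.app f (j x))" if n: "n \<in> el om" for n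
    proof -
      have xn: "pr x n \<in> el (cp w1 om)" using x n by simp
      then have "pr x n \<in> ev M \<longleftrightarrow> j (pr x n) \<in> N.el Rf" using A M(3) by blast
      then show ?thesis using xn unfolding Rf by (auto simp: N_fs simp del: el_cp)
    qed
    ultimately show ?thesis by blast
  qed
  define KF where "KF = mk (kk ` el w1)"
  have KF: "el KF = kk ` el w1" unfolding KF_def by (intro el_mk small_image small_el Dkk)
  define s1 where "s1 = sc (sc gK)"
  have s1: "s1 \<in> el th" using M(1) lim_sc by (simp add: s1_def)
  have kU: "kk x \<in> el (U (sc s1))" for x
  proof (rule U_sub[OF s1])
    show "el (kk x) \<subseteq> el (U s1)"
    proof
      fix z assume "z \<in> el (kk x)"
      then obtain n d where z: "z = pr n d" "n \<in> el om" "pr (pr x n) d \<in> el M" unfolding kk by (auto simp: PR_def)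
      then show "z \<in> el (U s1)" unfolding s1_def z(1) using M(1,2) om_U by (intro pr_stage) blast+
    qed
  qed
  have KFU: "KF \<in> el (U (sc (sc s1)))" using kU KF by (intro U_sub lim_sc s1) auto
  obtain NZ gZ where NZ: "gZ \<in> el th" "\<And>n d. pr n d \<in> el NZ \<Longrightarrow> d \<in> el PP \<and> d \<in> el (U gZ)"
    "ev NZ = {n \<in> el om. j n \<in> N.el Z}" by (rule real_name[of Z]) blast
  \<comment> \<open>Above the stages of \<open>KF\<close> and of the name of \<open>Z\<close>; the
    constraint \<open>junk g\<close> then keeps every \<open>C KF g b\<close> out of stage
    \<open>g\<close>.\<close>
  obtain g where g: "g \<in> el th" "el (sc (sc s1)) \<subseteq> el g" "el gZ \<subseteq> el g"
    by (rule lim_max[OF lim_th lim_sc[OF lim_sc[OF s1]] NZ(1)])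
  note og = Ord_in_th[OF g(1)]
  have KFg: "KF \<in> el (U g)" using U_mono[OF lim_sc[OF lim_sc[OF s1]] g(1,2)] KFU by blast
  have kkg: "kk x \<in> el (U g)" if "x \<in> el w1" for x
    using KFg KF trans_U[OF og] that by (auto simp: trans_def)
  have KFth: "KF \<in> el (U th)" using KFg V_mono1[OF Ord_th g(1)] by blast
  define I where "I b = pr t0 (C KF g b)" for b
  have DI: "DF (\<lambda>e. I (e 0))" unfolding I_def by (intro dfn)
  have idx: "isidx (I b)" if "b \<in> el th" for b
    unfolding isidx_def I_def using t0_la C_U[OF KFth g(1) that] by blast
  have snI: "sn (I b) = C KF g b" for b by (simp add: I_def)
  have neqI: "I m \<noteq> I b" if "b \<in> el th" "m \<in> el b" for m b
    using C_neq[OF that(1) g(1) KFth that(2)] by (simp add: I_def)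
  have inC: "k \<in> el (C KF g b) \<longleftrightarrow> (\<exists>x\<in>el w1. k = kk x) \<or> k = junk g \<or> k = junk b \<or> (\<exists>m\<in>el b. k = hn (I m))"
    if "b \<in> el th" for k b
    unfolding el_C[OF Ord_in_th[OF that]] KF I_def by blast
  obtain R where R: "\<And>b. b \<in> el th \<Longrightarrow> N.el (N.sec R (j b)) = j ` ev (xn (I b))"
    by (rule family[OF DI, of th]) blast
  have jj: "j ` S \<inter> j ` T = j ` (S \<inter> T)" for S T by auto
  have xom: "ev (xn i) \<subseteq> el om" for i using ev_xn by blast
  have imf: "N.el (N.app f (j x)) = j ` {n \<in> el om. j n \<in> N.el (N.app f (j x))}" if "x \<in> el w1" for x
    by (rule ev_om_image[OF f[OF that]])
  have ad1: "bd (ev (xn (I b)) \<inter> {n \<in> el om. j n \<in> N.el (N.app f (j x))})" if "x \<in> el w1" "b \<in> el th" for x b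
  proof (rule bd_sub)
    show "bd (ev (xn (I b)) - ev (kk x))"
      by (rule promise_kept[OF idx[OF that(2)]]) (use inC[OF that(2), of "kk x"] that(1) snI in auto)
  qed (use ev_kk[OF that(1)] in blast)
  have ad2: "bd (ev (xn (I b)) \<inter> ev (xn (I m)))" if "b \<in> el th" "m \<in> el b" for b m
  proof (rule bd_sub)
    show "bd (ev (xn (I b)) - ev (hn (I m)))"
      by (rule promise_kept[OF idx[OF that(1)]]) (use inC[OF that(1), of "hn (I m)"] that(2) snI in auto)
  qed (use hn_xn in blast)
  have unb: "\<not> bd (ev (xn (I b)))" if b: "b \<in> el th" for b
  proof -
    have "\<not> bd (ev NZ \<inter> ev (xn (I b)))"
    proof (rule hit[OF g(1) idx[OF b]])
      show "sn (I b) \<notin> el (U g)" unfolding snI by (rule C_not_low[OF Ord_in_th[OF b] g(1)])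
      show "PL g d" if "pr n d \<in> el NZ" for n d
        using NZ(2)[OF that] U_mono[OF NZ(1) g(1,3)] by (intro PL_stage[OF og]) blast+
      show "\<not> bd (ev NZ)"
      proof
        assume "bd (ev NZ)"
        then have "N.bd (j ` ev NZ)" by (simp only: j_bd)
        then show False using Z(2) ev_om_image[OF Z(1)] NZ(3) by simp
      qed
      fix k assume "k \<in> el (sn (I b))"
      then consider x where "x \<in> el w1" "k = kk x" | g' where "Ord g'" "k = junk g'" | m where "m \<in> el b" "k = hn (I m)"
        unfolding snI using inC[OF b] og Ord_in_th[OF b] by blast
      then show "bd (ev NZ - evL g k) \<or> (\<exists>i. isidx i \<and> sn i \<notin> el (U g) \<and> i \<noteq> I b \<and> k = hn i)"
      proof cases
        case (1 x)
        have "N.bd (j ` ({n \<in> el om. j n \<in> N.el (N.app f (j x))} \<inter> ev NZ))"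
          unfolding jj[symmetric] NZ(3) imf[OF 1(1), symmetric] ev_om_image[OF Z(1), symmetric] by (rule Z(3)[OF 1(1)])
        then have "bd ({n \<in> el om. j n \<in> N.el (N.app f (j x))} \<inter> ev NZ)" by (simp only: j_bd)
        moreover have "ev NZ - evL g k \<subseteq> {n \<in> el om. j n \<in> N.el (N.app f (j x))} \<inter> ev NZ"
          unfolding 1(2) evL_ev[OF og kkg[OF 1(1)]] ev_kk[OF 1(1)] NZ(3) by blast
        ultimately show ?thesis using bd_sub by blast
      next
        case (2 g')
        have "ev NZ - evL g k = {}" using evL_junk[OF 2(1)] 2(2) NZ(3) by blast
        then have "bd (ev NZ - evL g k)" by (simp only: bd_empty)
        then show ?thesis ..
      next
        case (3 m)
        have m: "m \<in> el th" using Ord_trans[OF Ord_th b 3(1)] .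
        have "sn (I m) \<notin> el (U g)" unfolding snI by (rule C_not_low[OF Ord_in_th[OF m] g(1)])
        then show ?thesis using idx[OF m] neqI[OF b 3(1)] 3(2) by blast
      qed
    qed
    then show ?thesis using bd_sub by blast
  qed
  show thesis
  proof (rule that[of R])
    show "\<not> N.bd (N.el (N.sec R (j b)))" if "b \<in> el th" for b
      unfolding R[OF that] j_bd by (rule unb[OF that])
    show "N.bd (N.el (N.app f (j x)) \<inter> N.el (N.sec R (j b)))" if "x \<in> el w1" "b \<in> el th" for x b
      unfolding R[OF that(2)] by (subst imf[OF that(1)], unfold jj j_bd, subst Int_commute, rule ad1[OF that])
    show "N.bd (N.el (N.sec R (j b)) \<inter> N.el (N.sec R (j b')))" if b: "b \<in> el th" "b' \<in> el th" "b \<noteq> b'" for b b'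
      unfolding R[OF b(1)] R[OF b(2)] jj j_bd
      using Ord_linear[OF Ord_in_th[OF b(1)] Ord_in_th[OF b(2)]] b(3) ad2[OF b(1), of b'] ad2[OF b(2), of b]
      by (auto simp: Int_commute)
    fix Y assume Y: "N.el Y \<subseteq> N.el N.om" "\<not> N.bd (N.el Y)" "\<And>x. x \<in> el w1 \<Longrightarrow> N.bd (N.el (N.app f (j x)) \<inter> N.el Y)"
    obtain NY gY where NY: "gY \<in> el th" "\<And>n d. pr n d \<in> el NY \<Longrightarrow> d \<in> el PP \<and> d \<in> el (U gY)"
      "ev NY = {n \<in> el om. j n \<in> N.el Y}" by (rule real_name[of Y]) blast
    have imY: "N.el Y = j ` ev NY" unfolding NY(3) by (rule ev_om_image[OF Y(1)])
    show "\<exists>b\<in>el th. \<not> N.bd (N.el (N.sec R (j b)) \<inter> N.el Y)"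
    proof (rule ccontr)
      assume c: "\<not> ?thesis"
      have cb: "bd (ev NY \<inter> ev (xn (I b)))" if b: "b \<in> el th" for b
      proof -
        have "N.bd (N.el (N.sec R (j b)) \<inter> N.el Y)" using c b by blast
        then show ?thesis unfolding R[OF b] imY jj j_bd by (subst Int_commute)
      qed
      \<comment> \<open>The member with number \<open>gY\<close>, the stage of the name of
        \<open>Y\<close>, is the one that meets \<open>Y\<close>: by \<open>junk gY\<close> the
        stage \<open>r\<close> of its constraints exceeds \<open>gY\<close>, so \<open>Y\<close> has
        a name of stage \<open>r\<close> as well.\<close>
      obtain r where r: "r \<in> el th" "el (C KF g gY) \<subseteq> el (U r)" "C KF g gY \<notin> el (U r)" "gY \<in> el r"
        by (rule C_stage[OF NY(1) g(1) KFth])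
      note or = Ord_in_th[OF r(1)]
      have "\<not> bd (ev NY \<inter> ev (xn (I gY)))"
      proof (rule hit[OF r(1) idx[OF NY(1)]])
        show "sn (I gY) \<notin> el (U r)" unfolding snI by (rule r(3))
        show "PL r d" if "pr n d \<in> el NY" for n d
          using NY(2)[OF that] V_mono1[OF or r(4)] by (intro PL_stage[OF or]) blast+
        show "\<not> bd (ev NY)" using Y(2) unfolding imY j_bd .
        fix k assume k: "k \<in> el (sn (I gY))"
        then have kr: "k \<in> el (U r)" using r(2) snI by auto
        from k consider x where "x \<in> el w1" "k = kk x" | g' where "Ord g'" "k = junk g'" | m where "m \<in> el gY" "k = hn (I m)"
          unfolding snI using inC[OF NY(1)] og Ord_in_th[OF NY(1)] by blast
        then have "bd (ev NY - evL r k)"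
        proof cases
          case (1 x)
          have "N.bd (j ` ({n \<in> el om. j n \<in> N.el (N.app f (j x))} \<inter> ev NY))"
            unfolding jj[symmetric] imf[OF 1(1), symmetric] imY[symmetric] by (rule Y(3)[OF 1(1)])
          then have "bd ({n \<in> el om. j n \<in> N.el (N.app f (j x))} \<inter> ev NY)" by (simp only: j_bd)
          moreover have "ev NY - evL r k \<subseteq> {n \<in> el om. j n \<in> N.el (N.app f (j x))} \<inter> ev NY"
            unfolding evL_ev[OF or kr] unfolding 1(2) ev_kk[OF 1(1)] NY(3) by blast
          ultimately show ?thesis using bd_sub by blast
        next
          case (2 g')
          have "ev NY - evL r k = {}" using evL_junk[OF 2(1)] 2(2) NY(3) by blast
          then show ?thesis by (simp only: bd_empty)
        next
          case (3 m)
          have m: "m \<in> el th" using Ord_trans[OF Ord_th NY(1) 3(1)] .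
          \<comment> \<open>Each number is decided for the earlier set, so leaving its complement
            means belonging to it; by assumption \<open>Y\<close> does so only boundedly
            often.\<close>
          have "ev NY - evL r k \<subseteq> ev NY \<inter> ev (xn (I m))"
            unfolding evL_ev[OF or kr] unfolding 3(2) using hn_or_xn[OF idx[OF m]] NY(3) by blast
          then show ?thesis using bd_sub cb[OF m] by blast
        qed
        then show "bd (ev NY - evL r k) \<or> (\<exists>i. isidx i \<and> sn i \<notin> el (U r) \<and> i \<noteq> I gY \<and> k = hn i)" ..
      qed
      then show False using cb[OF NY(1)] by blast
    qed
  qed
qed


lemma om_th_sub: "el om \<subseteq> el th" using Ord_trans[OF Ord_th om_th] by blast

text \<open>\<open>w1\<close> is not covered by the product of \<omega> and \<open>Om\<close> in the
  ground model, hence is uncountable in the extension. So the first uncountable cardinal there is at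
  most the cardinality of \<open>w1\<close>, and \<open>w1\<close> can index every family in
  question.\<close>

lemma om_card_w1: assumes "N.card (j w1) \<kappa>" shows "N.om \<in> N.el \<kappa>"
proof (rule ccontr)
  have o: "N.Ord \<kappa>" "N.eqp (j w1) \<kappa>" using assms by (auto simp: N.card_def)
  assume "N.om \<notin> N.el \<kappa>"
  then have "N.el \<kappa> \<subseteq> N.el N.om" using N.Ord_not_mem[OF N.Ord_om o(1)] by blast
  then have "N.sj N.om (j w1)" using N.sj_trans[OF N.sj_sub N.eqp_sj[OF N.eqp_sym[OF o(2)]]] by blast
  then show False using no_sj[OF w1(2)] j_om by simp
qed

text \<open>The family is enumerated by \<open>w1\<close>, and the sections obtained from
  \<open>mad_perp\<close> form an infinite mad family of the size of \<theta> in the perp;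
  \<open>\<aa>\<^sup>+\<close> is a minimum, hence at most that size.\<close>

lemma apl_bound:
  assumes l: "N.aleph1 l" and \<nu>: "N.card (j th) \<nu>" and m: "N.apl l m" shows "N.el m \<subseteq> N.el \<nu>"
proof -
  obtain F n X where F: "\<And>x. x \<in> N.el F \<Longrightarrow> N.csub x N.om" "N.pad F" "N.card F n" "N.el n \<subseteq> N.el l"
    and X: "N.perp F X" "N.infmad X m" "\<And>k. N.infmad X k \<Longrightarrow> N.el m \<subseteq> N.el k"
    using m unfolding N.apl_def N.aplus_def by blast
  obtain \<kappa> where \<kappa>: "N.card (j w1) \<kappa>" using N.card_ex by blast
  have o\<kappa>: "N.Ord \<kappa>" "N.eqp (j w1) \<kappa>" using \<kappa> by (auto simp: N.card_def)
  have "N.om \<in> N.el \<kappa>" by (rule om_card_w1[OF \<kappa>])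
  then have "N.el n \<subseteq> N.el \<kappa>" using l F(4) N.card_card[OF \<kappa>] unfolding N.aleph1_def by blast
  then have "N.sj \<kappa> n" by (rule N.sj_sub)
  moreover have "N.sj (j w1) \<kappa>" by (rule N.eqp_sj[OF o\<kappa>(2)])
  moreover have "N.sj n F" using F(3) N.eqp_sj[OF N.eqp_sym] by (auto simp: N.card_def)
  ultimately have "N.sj (j w1) F" using N.sj_trans by blast
  then obtain f0 where f0: "N.el F \<subseteq> (\<lambda>x. N.app f0 x) ` N.el (j w1)" by (auto simp: N.sj_def)
  \<comment> \<open>The default \<open>emp\<close> makes every value a subset of \<omega>; being
    almost disjoint from everything, it does not change the perp.\<close>
  define f' where "f' x = (if N.app f0 x \<in> N.el F then N.app f0 x else N.emp)" for x
  have Df: "N.DF (\<lambda>e. f' (e 0))" unfolding f'_def by (intro N.dfn)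
  define f where "f = N.lam (N.el (j w1)) f'"
  have f: "N.app f (j x) = f' (j x)" if "x \<in> el w1" for x
    unfolding f_def by (rule N.app_lam[OF N.small_el Df]) (use that in simp)
  have f_cases: "N.app f (j x) \<in> N.el F \<or> N.app f (j x) = N.emp" if "x \<in> el w1" for x
    unfolding f[OF that] f'_def by simp
  have f_onto: "\<exists>x\<in>el w1. N.app f (j x) = y" if y: "y \<in> N.el F" for y
  proof -
    obtain x where "x \<in> el w1" "y = N.app f0 (j x)" using f0 y by auto
    then show ?thesis using f y unfolding f'_def by auto
  qed
  have Fom: "N.el y \<subseteq> N.el N.om" "\<not> N.bd (N.el y)" if "y \<in> N.el F" for y
    using F(1)[OF that] N.csub_bd by blast+
  have fom: "N.el (N.app f (j x)) \<subseteq> N.el N.om" if "x \<in> el w1" for x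
    using f_cases[OF that] Fom by auto
  have inX: "y \<in> N.el X \<longleftrightarrow> N.el y \<subseteq> N.el N.om \<and> \<not> N.bd (N.el y) \<and>
    (\<forall>x\<in>el w1. N.bd (N.el (N.app f (j x)) \<inter> N.el y))" for y
  proof -
    have "y \<in> N.el X \<longleftrightarrow> (N.el y \<subseteq> N.el N.om \<and> \<not> N.bd (N.el y)) \<and> (\<forall>x\<in>N.el F. N.ad x y)"
      using X(1) unfolding N.perp_def N.csub_bd by blast
    also have "\<dots> \<longleftrightarrow> (N.el y \<subseteq> N.el N.om \<and> \<not> N.bd (N.el y)) \<and> (\<forall>x\<in>el w1. N.bd (N.el (N.app f (j x)) \<inter> N.el y))"
    proof (intro conj_cong refl iffI ballI)
      fix x assume y: "N.el y \<subseteq> N.el N.om \<and> \<not> N.bd (N.el y)" and a: "\<forall>x\<in>N.el F. N.ad x y" and x: "x \<in> el w1"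
      show "N.bd (N.el (N.app f (j x)) \<inter> N.el y)"
        using f_cases[OF x]
      proof
        assume "N.app f (j x) \<in> N.el F"
        then show ?thesis using a N.ad_bd y by blast
      qed (simp add: N.bd_empty)
    next
      fix x assume y: "N.el y \<subseteq> N.el N.om \<and> \<not> N.bd (N.el y)" and x: "x \<in> N.el F"
        and a: "\<forall>x\<in>el w1. N.bd (N.el (N.app f (j x)) \<inter> N.el y)"
      obtain \<xi> where "\<xi> \<in> el w1" "N.app f (j \<xi>) = x" using f_onto[OF x] by blast
      then have "N.bd (N.el x \<inter> N.el y)" using a by blast
      then show "N.ad x y" using N.ad_bd y by blast
    qed
    finally show ?thesis by blast
  qed
  obtain F' where F': "N.madin F' X" "N.card F' m" "N.el N.om \<subseteq> N.el m"
    using X(2) by (auto simp: N.infmad_def)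
  have "N.eqp m F'" using F'(2) N.eqp_sym by (auto simp: N.card_def)
  then have "N.sj m F'" by (rule N.eqp_sj)
  \<comment> \<open>The existence of \<open>\<aa>\<^sup>+(F)\<close> provides an infinite mad family
    in the perp, so the perp has an element; this is where maximal families are excluded.\<close>
  obtain Z where Z: "Z \<in> N.el X"
  proof -
    have "N.el F' \<noteq> {}"
    proof
      assume e: "N.el F' = {}"
      have "N.eqp F' m" using F'(2) by (auto simp: N.card_def)
      then have "N.el m = {}" using e by (auto simp: N.eqp_def bij_betw_def)
      then show False using F'(3) N.emp_om by auto
    qed
    then show ?thesis using F'(1) that by (auto simp: N.madin_def)
  qed
  obtain R where R: "\<And>b. b \<in> el th \<Longrightarrow> \<not> N.bd (N.el (N.sec R (j b)))"
    "\<And>x b. x \<in> el w1 \<Longrightarrow> b \<in> el th \<Longrightarrow> N.bd (N.el (N.app f (j x)) \<inter> N.el (N.sec R (j b)))"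
    "\<And>b b'. b \<in> el th \<Longrightarrow> b' \<in> el th \<Longrightarrow> b \<noteq> b' \<Longrightarrow> N.bd (N.el (N.sec R (j b)) \<inter> N.el (N.sec R (j b')))"
    "\<And>Y. N.el Y \<subseteq> N.el N.om \<Longrightarrow> \<not> N.bd (N.el Y) \<Longrightarrow>
      (\<And>x. x \<in> el w1 \<Longrightarrow> N.bd (N.el (N.app f (j x)) \<inter> N.el Y)) \<Longrightarrow>
      \<exists>b\<in>el th. \<not> N.bd (N.el (N.sec R (j b)) \<inter> N.el Y)"
  proof (rule mad_perp[of f Z])
    show "N.el (N.app f (j x)) \<subseteq> N.el N.om" if "x \<in> el w1" for x using fom[OF that] .
    show "N.el Z \<subseteq> N.el N.om" "\<not> N.bd (N.el Z)" using Z inX by blast+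
    show "N.bd (N.el (N.app f (j x)) \<inter> N.el Z)" if "x \<in> el w1" for x using Z inX that by blast
    fix R assume "\<And>b. b \<in> el th \<Longrightarrow> \<not> N.bd (N.el (N.sec R (j b)))"
      "\<And>x b. x \<in> el w1 \<Longrightarrow> b \<in> el th \<Longrightarrow> N.bd (N.el (N.app f (j x)) \<inter> N.el (N.sec R (j b)))"
      "\<And>b b'. b \<in> el th \<Longrightarrow> b' \<in> el th \<Longrightarrow> b \<noteq> b' \<Longrightarrow> N.bd (N.el (N.sec R (j b)) \<inter> N.el (N.sec R (j b')))"
      "\<And>Y. N.el Y \<subseteq> N.el N.om \<Longrightarrow> \<not> N.bd (N.el Y) \<Longrightarrow>
        (\<And>x. x \<in> el w1 \<Longrightarrow> N.bd (N.el (N.app f (j x)) \<inter> N.el Y)) \<Longrightarrow>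
        \<exists>b\<in>el th. \<not> N.bd (N.el (N.sec R (j b)) \<inter> N.el Y)"
    note * = this
    show thesis by (rule that[OF *])
  qed
  define FF where "FF = N.mk (N.sec R ` N.el (j th))"
  have FF: "N.el FF = N.sec R ` N.el (j th)" unfolding FF_def by (intro N.el_mk N.small_image N.small_el N.dfn)
  have sub: "N.el (N.sec R b) \<subseteq> N.el N.om" for b by (auto simp: N.el_sec)
  have "N.madin FF X"
    unfolding N.madin_def
  proof (intro conjI notI)
    show "N.el FF \<subseteq> N.el X" unfolding FF using inX sub R(1,2) by auto
    show "N.pad FF" unfolding N.pad_def
    proof (intro ballI impI)
      fix x y assume "x \<in> N.el FF" "y \<in> N.el FF" "x \<noteq> y"
      then obtain b b' where "b \<in> el th" "b' \<in> el th" "x = N.sec R (j b)" "y = N.sec R (j b')" "b \<noteq> b'"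
        unfolding FF by auto
      then show "N.ad x y" using R(3) N.ad_bd sub by blast
    qed
    assume "\<exists>x\<in>N.el X. \<forall>y\<in>N.el FF. N.ad x y"
    then obtain Y where Y: "Y \<in> N.el X" "\<And>y. y \<in> N.el FF \<Longrightarrow> N.ad Y y" by blast
    have "\<exists>b\<in>el th. \<not> N.bd (N.el (N.sec R (j b)) \<inter> N.el Y)"
    proof (rule R(4))
      show "N.el Y \<subseteq> N.el N.om" "\<not> N.bd (N.el Y)" using Y(1) inX by blast+
      show "N.bd (N.el (N.app f (j x)) \<inter> N.el Y)" if "x \<in> el w1" for x using Y(1) inX that by blast
    qed
    then obtain b where b: "b \<in> el th" "\<not> N.bd (N.el (N.sec R (j b)) \<inter> N.el Y)" by blast
    have "N.ad Y (N.sec R (j b))" using Y(2) b(1) FF by simp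
    then have "N.bd (N.el Y \<inter> N.el (N.sec R (j b)))" using N.ad_bd sub by blast
    then show False using b(2) by (simp add: Int_commute)
  qed
  moreover have "N.card FF \<nu>"
  proof (rule N.card_eqp[OF \<nu>])
    have "inj_on (N.sec R) (N.el (j th))"
    proof (rule inj_onI)
      fix x y assume "x \<in> N.el (j th)" "y \<in> N.el (j th)" and e: "N.sec R x = N.sec R y"
      then obtain b b' where b: "b \<in> el th" "b' \<in> el th" "x = j b" "y = j b'" by auto
      have "b = b'"
      proof (rule ccontr)
        assume "b \<noteq> b'"
        then have "N.bd (N.el (N.sec R (j b)) \<inter> N.el (N.sec R (j b')))" using R(3) b by blast
        then show False using R(1)[OF b(1)] e b(3,4) by simp
      qed
      then show "x = y" using b by simp
    qed
    then have "bij_betw (N.sec R) (N.el (j th)) (N.el FF)" unfolding bij_betw_def FF by blast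
    then show "N.eqp (j th) FF" by (intro N.eqpI[of "N.sec R"] N.dfn)
  qed
  moreover have "N.el N.om \<subseteq> N.el \<nu>"
  proof -
    have o\<nu>: "N.Ord \<nu>" "N.eqp (j th) \<nu>" using \<nu> by (auto simp: N.card_def)
    have "\<nu> \<notin> N.el N.om"
    proof
      assume n: "\<nu> \<in> N.el N.om"
      have "N.el N.om \<subseteq> N.el (j th)" unfolding j_om using om_th_sub by auto
      then have "N.sj \<nu> N.om" using N.sj_trans[OF N.eqp_sj[OF N.eqp_sym[OF o\<nu>(2)]] N.sj_sub] by blast
      then show False using N.not_sj_om[OF n] by blast
    qed
    then show ?thesis using N.Ord_not_mem[OF o\<nu>(1) N.Ord_om] by blast
  qed
  ultimately have "N.infmad X \<nu>" unfolding N.infmad_def by blast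
  then show ?thesis by (rule X(3))
qed

text \<open>The supremum \<kappa> is at most the cardinality \<nu> of \<theta>. If it were not below
  the continuum, then \<theta> would cover the power set of \<omega> and thereby the \<lambda>
  distinct reals, against \<open>no_sj\<close>.\<close>

theorem extension_statement: "sat E' a_plus_aleph1_less_continuum e"
proof -
  obtain \<kappa>1 where \<kappa>1: "N.card (j w1) \<kappa>1" using N.card_ex by blast
  have o1: "N.Ord \<kappa>1" "N.eqp (j w1) \<kappa>1" using \<kappa>1 by (auto simp: N.card_def)
  have p1: "N.card \<kappa>1 \<kappa>1 \<and> N.om \<in> N.el \<kappa>1" using N.card_card[OF \<kappa>1] om_card_w1[OF \<kappa>1] by blast
  have "N.D (\<lambda>e. N.card (e 0) (e 0) \<and> N.om \<in> N.el (e 0))" by (intro N.dfn)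
  from N.Ord_least[OF this o1(1) p1] obtain l where
    l: "N.card l l \<and> N.om \<in> N.el l" "\<And>c. N.Ord c \<Longrightarrow> N.card c c \<and> N.om \<in> N.el c \<Longrightarrow> N.el l \<subseteq> N.el c" by metis
  have al: "N.aleph1 l" unfolding N.aleph1_def using l by (auto simp: N.card_def)
  obtain \<nu> where \<nu>: "N.card (j th) \<nu>" using N.card_ex by blast
  have o\<nu>: "N.Ord \<nu>" "N.eqp (j th) \<nu>" using \<nu> by (auto simp: N.card_def)
  have p\<nu>: "N.card \<nu> \<nu> \<and> (\<forall>m. N.apl l m \<longrightarrow> N.el m \<subseteq> N.el \<nu>)"
    using N.card_card[OF \<nu>] apl_bound[OF al \<nu>] by blast
  have "N.D (\<lambda>e. N.card (e 0) (e 0) \<and> (\<forall>m. N.apl l m \<longrightarrow> N.el m \<subseteq> N.el (e 0)))" by (intro N.dfn)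
  from N.Ord_least[OF this o\<nu>(1) p\<nu>] obtain \<kappa> where
    \<kappa>: "N.Ord \<kappa>" "N.card \<kappa> \<kappa> \<and> (\<forall>m. N.apl l m \<longrightarrow> N.el m \<subseteq> N.el \<kappa>)"
      "\<And>c. N.Ord c \<Longrightarrow> N.card c c \<and> (\<forall>m. N.apl l m \<longrightarrow> N.el m \<subseteq> N.el c) \<Longrightarrow> N.el \<kappa> \<subseteq> N.el c" by metis
  define p where "p = N.mk {x. N.el x \<subseteq> N.el N.om}"
  have p: "N.el p = {x. N.el x \<subseteq> N.el N.om}" unfolding p_def by (intro N.el_mk N.small_pow)
  obtain c where c: "N.card p c" using N.card_ex by blast
  have oc: "N.Ord c" "N.eqp p c" using c by (auto simp: N.card_def)
  have "\<kappa> \<in> N.el c"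
  proof (rule ccontr)
    assume "\<kappa> \<notin> N.el c"
    then have "N.el c \<subseteq> N.el \<kappa>" using N.Ord_not_mem \<kappa>(1) oc(1) by blast
    also have "\<dots> \<subseteq> N.el \<nu>" using \<kappa>(3) o\<nu>(1) p\<nu> by blast
    finally have "N.sj \<nu> c" by (rule N.sj_sub)
    then have "N.sj (j th) p"
      using N.eqp_sj[OF o\<nu>(2)] N.eqp_sj[OF N.eqp_sym[OF oc(2)]] N.sj_trans by blast
    moreover have "N.sj p (j la)"
    proof -
      have DI: "DF (\<lambda>e. pr (e 0) emp)" by (intro dfn)
      obtain R where R: "\<And>b. b \<in> el la \<Longrightarrow> N.el (N.sec R (j b)) = j ` ev (xn (pr b emp))"
        by (rule family[OF DI, of la]) blast
      show ?thesis
      proof (rule N.inj_sj[of "N.sec R"])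
        show "N.DF (\<lambda>e. N.sec R (e 0))" by (intro N.dfn)
        show "N.sec R ` N.el (j la) \<subseteq> N.el p" unfolding p by (auto simp: N.el_sec)
        show "inj_on (N.sec R) (N.el (j la))"
        proof (rule inj_onI)
          fix x y assume "x \<in> N.el (j la)" "y \<in> N.el (j la)" and e: "N.sec R x = N.sec R y"
          then obtain b b' where b: "b \<in> el la" "b' \<in> el la" "x = j b" "y = j b'" by auto
          have "j ` ev (xn (pr b emp)) = j ` ev (xn (pr b' emp))" using R b e by metis
          moreover have "inj j" by (rule injI) simp
          ultimately have "ev (xn (pr b emp)) = ev (xn (pr b' emp))" by (simp add: inj_image_eq_iff)
          then show "x = y" using xn_distinct[OF b(1,2)] b by blast
        qed
      qed
    qed
    ultimately show False using no_sj[OF la] N.sj_trans by blast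
  qed
  moreover have "(\<forall>x. x \<in> N.el p \<longleftrightarrow> N.el x \<subseteq> N.el N.om) \<and> N.card p c" using p c by simp
  moreover have "\<forall>v. N.card v v \<and> (\<forall>m. N.apl l m \<longrightarrow> N.el m \<subseteq> N.el v) \<longrightarrow> N.el \<kappa> \<subseteq> N.el v"
    using \<kappa>(3) by (auto simp: N.card_def)
  ultimately show ?thesis unfolding N.sat_statement using al \<kappa>(2) by blast
qed

end

section \<open>The parameters\<close>

context zfc begin

text \<open>Two subsets of \<open>W\<close> are coded as a disjoint union with the tags
  \<open>emp\<close> and \<open>sg emp\<close>, which stays inside \<open>W\<close>.\<close>

lemma sj_pow_pairs:
  assumes W: "\<And>x y. x \<in> el W \<Longrightarrow> y \<in> el W \<Longrightarrow> pr x y \<in> el W" and e: "emp \<in> el W" "sg emp \<in> el W"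
    and Q: "el Q = {x. el x \<subseteq> el W}"
  shows "sj Q (cp Q Q)"
proof (rule sjI)
  define half where "half t q = mk {z \<in> el W. pr t z \<in> el q}" for t q
  have half: "el (half t q) = {z \<in> el W. pr t z \<in> el q}" for t q
    unfolding half_def by (rule el_mk, rule separation[OF small_el[of W]]) (blast, intro dfn)
  have Dh: "DF s \<Longrightarrow> DF t \<Longrightarrow> DF (\<lambda>e. half (s e) (t e))" for s t
    by (rule liftF2; (assumption | (unfold half_def, intro dfn)))
  show "DF (\<lambda>e. pr (half emp (e 0)) (half (sg emp) (e 0)))" by (intro dfn Dh)
  show "el (cp Q Q) \<subseteq> (\<lambda>q. pr (half emp q) (half (sg emp) q)) ` el Q"
  proof
    fix z assume "z \<in> el (cp Q Q)"
    then obtain a b where z: "z = pr a b" "el a \<subseteq> el W" "el b \<subseteq> el W" by (auto simp: PR_def Q)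
    define q where "q = mk ((\<lambda>x. pr emp x) ` el a \<union> (\<lambda>x. pr (sg emp) x) ` el b)"
    have q: "el q = (\<lambda>x. pr emp x) ` el a \<union> (\<lambda>x. pr (sg emp) x) ` el b"
      unfolding q_def by (intro el_mk small_Un small_image small_el dfn)
    have ne: "sg emp \<noteq> emp" by (metis el_emp el_sg insert_not_empty)
    have "half emp q = a" "half (sg emp) q = b"
      using z ne by (intro ext; auto simp: half q)+
    moreover have "q \<in> el Q" using W e z(2,3) by (auto simp: Q q)
    ultimately show "z \<in> (\<lambda>q. pr (half emp q) (half (sg emp) q)) ` el Q" using z(1) by blast
  qed
qed

text \<open>\<open>th\<close> is the least ordinal that \<open>q\<close> does not cover, in other
  words its successor cardinal. A union of ordinals covered by \<open>q\<close>, over an index set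
  covered by \<open>q\<close>, is again covered because \<open>q\<close> covers its square.\<close>

lemma successor_card:
  assumes qq: "sj q (cp q q)" and om: "sj q om"
  obtains th where "lim th" "om \<in> el th" "\<And>a. a \<in> el th \<Longrightarrow> sj q a"
    "\<And>X f. sj q X \<Longrightarrow> \<forall>x\<in>el X. app f x \<in> el th \<Longrightarrow> \<exists>b\<in>el th. \<forall>x\<in>el X. app f x \<in> el b"
proof -
  obtain a where a: "Ord a" "\<not> sj q a" using hartogs by blast
  have "D (\<lambda>e. \<not> sj q (e 0))" by (intro dfn)
  from Ord_least[OF this a] obtain th where
    th: "Ord th" "\<not> sj q th" "\<And>c. Ord c \<Longrightarrow> \<not> sj q c \<Longrightarrow> el th \<subseteq> el c" by metis
  have in_th: "a \<in> el th \<longleftrightarrow> sj q a" if "Ord a" for a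
  proof
    assume "a \<in> el th"
    then show "sj q a" using th(3)[OF that] mem_irrefl by blast
  next
    assume "sj q a"
    then have "\<not> el th \<subseteq> el a" using th(2) sj_trans sj_sub by blast
    then show "a \<in> el th" using Ord_not_mem[OF that th(1)] by blast
  qed
  have sg: "sj q (sg a)" for a
  proof (rule sj_image[OF om])
    show "DF (\<lambda>e. a)" by (intro dfn)
    show "el (sg a) \<subseteq> (\<lambda>x. a) ` el om" using image_eqI[OF refl emp_om, of "\<lambda>x. a"] by simp
  qed
  have sc_th: "sc a \<in> el th" if a: "a \<in> el th" for a
  proof -
    have o: "Ord a" using Ord_mem[OF th(1) a] .
    have "sj q (sc a)"
    proof (rule sj_UN[OF qq om, of "\<lambda>n. if n = emp then sg a else a"])
      show "DF (\<lambda>e. if e 0 = emp then sg a else a)" by (intro dfn)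
      show "sj q (if n = emp then sg a else a)" for n using sg in_th[OF o] a by simp
      have "sc emp \<noteq> emp" by (metis el_emp el_sc insert_not_empty)
      then have "el (if sc emp = emp then sg a else a) = el a" by simp
      moreover have "el (if emp = emp then sg a else a) = {a}" by simp
      ultimately have "el (sc a) \<subseteq> (\<Union>n\<in>{emp, sc emp}. el (if n = emp then sg a else a))" by auto
      moreover have "{emp, sc emp} \<subseteq> el om" using emp_om sc_om[OF emp_om] by blast
      ultimately show "el (sc a) \<subseteq> (\<Union>n\<in>el om. el (if n = emp then sg a else a))" by blast
    qed
    then show ?thesis using in_th[OF Ord_sc[OF o]] by blast
  qed
  have "sj q emp" by (rule sj_sub) simp
  then have "lim th" unfolding lim_def using th(1) sc_th in_th[OF Ord_emp] by blast
  moreover have "\<exists>b\<in>el th. \<forall>x\<in>el X. app f x \<in> el b" if X: "sj q X" and f: "\<forall>x\<in>el X. app f x \<in> el th" for X f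
  proof -
    define S where "S = (\<lambda>x. app f x) ` el X"
    have S: "small S" unfolding S_def by (intro small_image small_el dfn)
    have oS: "Ord y" if "y \<in> S" for y using that f Ord_mem[OF th(1)] by (auto simp: S_def)
    define b where "b = mk (\<Union>(el ` S))"
    have b: "Ord b" "el b = \<Union>(el ` S)" unfolding b_def using Ord_UN[OF S oS] by blast+
    have "sj q b"
    proof (rule sj_UN[OF qq X, of "\<lambda>x. app f x"])
      show "DF (\<lambda>e. app f (e 0))" by (intro dfn)
      show "sj q (app f x)" if "x \<in> el X" for x
        using in_th[of "app f x"] f that Ord_mem[OF th(1)] by blast
      show "el b \<subseteq> (\<Union>x\<in>el X. el (app f x))" unfolding b by (auto simp: S_def)
    qed
    then have "b \<in> el th" using in_th[OF b(1)] by blast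
    \<comment> \<open>A value may equal the supremum \<open>b\<close>, so the strict bound is its
      successor.\<close>
    moreover have "app f x \<in> el (sc b)" if "x \<in> el X" for x
    proof -
      have "app f x \<in> S" using that by (simp add: S_def)
      then have "el (app f x) \<subseteq> el b" unfolding b by blast
      then show ?thesis using Ord_sub[OF oS[OF \<open>app f x \<in> S\<close>] b(1)] by auto
    qed
    ultimately show ?thesis using sc_th by blast
  qed
  moreover have "sj q a" if "a \<in> el th" for a using that in_th Ord_mem[OF th(1)] by blast
  ultimately show thesis using that[of th] in_th[OF Ord_om] om by blast
qed

lemma Ord_nonempty: "Ord a \<Longrightarrow> el a \<noteq> {} \<Longrightarrow> emp \<in> el a"
  using Ord_linear[OF _ Ord_emp, of a] by auto

end

text \<open>A name for \<open>w1\<close> many reals involves conditions indexed by \<open>A\<close>,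
  the product of \<open>w1\<close>, \<omega> and \<open>Om\<close>; \<theta> succeeds a size that
  covers \<open>A\<close> through singletons and absorbs its square by coding rather than by
  cardinal arithmetic. \<lambda> exceeds the product of \<theta> and \<open>Om\<close>, so that
  \<theta> cannot cover it in the extension.\<close>

lemma (in zfc) parameters:
  obtains th la w1 where "lim th" "Ord la" "el om \<subseteq> el la"
    "\<And>\<alpha> f. \<alpha> \<in> el th \<Longrightarrow> \<forall>x\<in>el \<alpha>. app f x \<in> el th \<Longrightarrow> \<exists>b\<in>el th. \<forall>x\<in>el \<alpha>. app f x \<in> el b"
    "\<And>f. \<forall>x\<in>el (cp (cp w1 om) Om). app f x \<in> el th \<Longrightarrow> \<exists>b\<in>el th. \<forall>x\<in>el (cp (cp w1 om) Om). app f x \<in> el b"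
    "om \<in> el th" "Ord w1" "\<not> sj (cp om Om) w1" "emp \<in> el w1" "\<not> sj (cp th Om) la"
proof -
  obtain w1 where w1: "Ord w1" "\<not> sj (cp om Om) w1" using hartogs by blast
  have "el w1 \<noteq> {}" using w1(2) sj_sub[of w1 "cp om Om"] by auto
  then have e1: "emp \<in> el w1" by (rule Ord_nonempty[OF w1(1)])
  define A where "A = cp (cp w1 om) Om"
  define W where "W = V A om"
  define Q where "Q = mk {x. el x \<subseteq> el W}"
  have Q: "el Q = {x. el x \<subseteq> el W}" unfolding Q_def by (intro el_mk small_pow)
  have eW: "emp \<in> el W" unfolding W_def by (rule V_intro[OF Ord_om emp_om]) simp
  then have sW: "sg emp \<in> el W" using V_lim_upr[OF lim_om, of emp A emp] unfolding W_def upr_def sg_def by simp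
  have QQ: "sj Q (cp Q Q)"
    by (rule sj_pow_pairs[OF _ eW sW Q]) (unfold W_def, rule V_lim_pr[OF lim_om])
  have QA: "sj Q A"
  proof (rule sjI[of "\<lambda>q. The1 (\<lambda>z. el q = {z})"])
    show "DF (\<lambda>e. The1 (\<lambda>z. el (e 0) = {z}))" by (intro dfn)
    show "el A \<subseteq> (\<lambda>q. The1 (\<lambda>z. el q = {z})) ` el Q"
    proof
      fix a assume a: "a \<in> el A"
      have "sg a \<in> el Q" unfolding Q W_def using V_base[OF Ord_om a] by simp
      moreover have "The1 (\<lambda>z. el (sg a) = {z}) = a" by (rule The1_eq) auto
      ultimately show "a \<in> (\<lambda>q. The1 (\<lambda>z. el q = {z})) ` el Q" by (intro image_eqI[of _ _ "sg a"]) auto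
    qed
  qed
  have "sj Q om"
  proof (rule sj_image[OF QA, of "\<lambda>z. sn (fs z)"])
    show "DF (\<lambda>e. sn (fs (e 0)))" by (intro dfn)
    show "el om \<subseteq> (\<lambda>z. sn (fs z)) ` el A"
    proof
      fix n assume n: "n \<in> el om"
      have "emp \<in> el Om" using om_Om emp_om by blast
      then show "n \<in> (\<lambda>z. sn (fs z)) ` el A" using n e1 unfolding A_def
        by (intro image_eqI[of _ _ "pr (pr emp n) emp"]) auto
    qed
  qed
  then obtain th where th: "lim th" "om \<in> el th" "\<And>a. a \<in> el th \<Longrightarrow> sj Q a"
    "\<And>X f. sj Q X \<Longrightarrow> \<forall>x\<in>el X. app f x \<in> el th \<Longrightarrow> \<exists>b\<in>el th. \<forall>x\<in>el X. app f x \<in> el b"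
    by (rule successor_card[OF QQ]) (rule that)
  obtain la where la: "Ord la" "\<not> sj (cp th Om) la" using hartogs by blast
  have oth: "Ord th" using th(1) by (simp add: lim_def)
  have "la \<notin> el om"
  proof
    assume "la \<in> el om"
    then have sub: "el la \<subseteq> el th" using om_trans Ord_trans[OF oth th(2)] by blast
    have "sj (cp th Om) la"
    proof (rule sjI[of fs])
      show "DF (\<lambda>e. fs (e 0))" by (intro dfn)
      show "el la \<subseteq> fs ` el (cp th Om)"
      proof
        fix x assume "x \<in> el la"
        moreover have "emp \<in> el Om" using om_Om emp_om by blast
        ultimately show "x \<in> fs ` el (cp th Om)" using sub by (intro image_eqI[of _ _ "pr x emp"]) auto
      qed
    qed
    then show False using la(2) by blast
  qed
  then have "el om \<subseteq> el la" using Ord_not_mem[OF la(1) Ord_om] by blast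
  then show thesis
    using that[OF th(1) la(1) _ th(4)[OF th(3)] th(4)[OF QA[unfolded A_def]] th(2) w1 e1 la(2)] by blast
qed

section \<open>The generic filter and the conclusion\<close>

context mad_poset begin

text \<open>Rasiowa-Sikorski: the universe of the model is \<open>nat\<close>, so letting step
  \<open>n\<close> try to enter the set \<open>el n\<close> treats every set of conditions of the
  model.\<close>

primrec descend where
  "descend 0 = emp"
| "descend (Suc n) = (if \<exists>r. leq r (descend n) \<and> r \<in> el n then SOME r. leq r (descend n) \<and> r \<in> el n else descend n)"

lemma descend_PP: "descend n \<in> el PP" and descend_leq: "leq (descend (Suc n)) (descend n)"
proof -
  have *: "leq (descend (Suc n)) (descend n)" if "descend n \<in> el PP" for n
    using leq_refl[OF that] by (auto intro: someI2_ex)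
  show "descend n \<in> el PP" for n
    by (induction n) (use emp_PP * leq_PP in \<open>simp, blast\<close>)
  then show "leq (descend (Suc n)) (descend n)" using * by blast
qed

lemma descend_mono: "m \<le> n \<Longrightarrow> leq (descend n) (descend m)"
proof (induction rule: dec_induct)
  case base
  then show ?case using leq_refl descend_PP by blast
next
  case (step n)
  then show ?case using leq_trans descend_leq by blast
qed

lemma generic_filter: "forcing E PP leq {p. \<exists>n. leq (descend n) p}" (is "forcing E PP leq ?G")
proof
  show "D (\<lambda>e. leq (e 0) (e (Suc 0)))" by (intro dfn)
  show "p \<in> el PP \<and> q \<in> el PP" if "leq p q" for p q using leq_PP that by blast
  show "leq p p" if "p \<in> el PP" for p using leq_refl that by blast
  show "leq p r" if "leq p q" "leq q r" for p q r using leq_trans that by blast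
  show "?G \<subseteq> el PP" using leq_PP by blast
  show "?G \<noteq> {}" using leq_refl[OF descend_PP] by blast
  show "q \<in> ?G" if "p \<in> ?G" "leq p q" for p q using leq_trans that by blast
  show "\<exists>r\<in>?G. leq r p \<and> leq r q" if pq: "p \<in> ?G" "q \<in> ?G" for p q
  proof -
    obtain m n where mn: "leq (descend m) p" "leq (descend n) q" using pq by blast
    have "leq (descend (max m n)) p" "leq (descend (max m n)) q"
      using leq_trans[OF descend_mono mn(1), of "max m n"] leq_trans[OF descend_mono mn(2), of "max m n"] by auto
    moreover have "descend (max m n) \<in> ?G" using leq_refl[OF descend_PP] by blast
    ultimately show ?thesis by blast
  qed
  show "(\<exists>p\<in>?G. p \<in> Q) \<or> (\<exists>p\<in>?G. \<forall>q. leq q p \<longrightarrow> q \<notin> Q)" if Q: "D (\<lambda>e. e 0 \<in> Q)" for Q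
  proof -
    \<comment> \<open>Only conditions matter, so the class \<open>Q\<close> may be replaced by its
      trace on \<open>PP\<close>; this is a set, hence itself the number of a step.\<close>
    define n where "n = mk {p \<in> el PP. p \<in> Q}"
    have n: "el n = {p \<in> el PP. p \<in> Q}"
      unfolding n_def by (rule el_mk, rule separation[OF small_el[of PP]]) (blast, intro dfn liftF1 lift1[OF _ Q])
    show ?thesis
    proof (cases "\<exists>r. leq r (descend n) \<and> r \<in> el n")
      case True
      then have "descend (Suc n) \<in> el n" by (auto intro: someI2_ex)
      then have "descend (Suc n) \<in> Q" using n by blast
      then show ?thesis using leq_refl[OF descend_PP] by blast
    next
      case False
      then have "\<forall>q. leq q (descend n) \<longrightarrow> q \<notin> Q" using n leq_PP by blast
      then show ?thesis using leq_refl[OF descend_PP] by blast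
    qed
  qed
qed

end

theorem theorem4p4:
  assumes "consistent ZFC"
  shows "consistent (insert a_plus_aleph1_less_continuum ZFC)"
proof -
  obtain E :: "nat \<Rightarrow> nat \<Rightarrow> bool" where E: "models E ZFC" by (rule ZFC_countable_model[OF assms])
  interpret zfc E using E by unfold_locales
  obtain th la w1 where par: "lim th" "Ord la" "el om \<subseteq> el la"
    "\<And>\<alpha> f. \<alpha> \<in> el th \<Longrightarrow> \<forall>x\<in>el \<alpha>. app f x \<in> el th \<Longrightarrow> \<exists>b\<in>el th. \<forall>x\<in>el \<alpha>. app f x \<in> el b"
    "\<And>f. \<forall>x\<in>el (cp (cp w1 om) Om). app f x \<in> el th \<Longrightarrow> \<exists>b\<in>el th. \<forall>x\<in>el (cp (cp w1 om) Om). app f x \<in> el b"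
    "om \<in> el th" "Ord w1" "\<not> sj (cp om Om) w1" "emp \<in> el w1" "\<not> sj (cp th Om) la"
    by (rule parameters) (rule that)
  interpret P: mad_poset E th la w1 using par by unfold_locales
  obtain G where "forcing E P.PP P.leq G" using P.generic_filter by blast
  then interpret F: forcing E P.PP P.leq G .
  have F_cong: "F.tmem x u \<longleftrightarrow> F.tmem y v" if "F.teq x y" "F.teq u v" for x y u v
    using F.tmem_cong F.teq_sym that by blast
  obtain h :: "nat \<Rightarrow> nat" and E' where h: "surj h" "\<And>x y. h x = h y \<longleftrightarrow> F.teq x y"
    "\<And>x y. E' (h x) (h y) \<longleftrightarrow> F.tmem x y"
    by (rule quotient_nat[where E = F.tmem, OF F.teq_equivp F_cong F.teq_infinite], assumption+) (rule that)
  interpret X: mad_ext E th la w1 G h E' using h by unfold_locales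
  have "models E' (insert a_plus_aleph1_less_continuum ZFC)"
    using X.extension_models X.extension_statement unfolding models_def by blast
  then show ?thesis by (rule models_consistent)
qed

end
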